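(* Let $m,n\ge 1$ be positive integers and fix $\alpha\in(0,1)$. Then there exist $\rho_n>0$, constants $a_n,b_n,d_n>0$ depending only on $n$, and a smooth curve $$(-\rho_n,\rho_n)\to(0,+\infty)\times\mathcal{P}^{2,\alpha}_{p,e}(\mathbb{R}^m),\qquad s\mapsto(\widetilde\mu^n_s,\widetilde h^n_s),$$ with $\widetilde\mu^n_s|_{s=0}=d_n$ and $$\widetilde h^n_s(x)=a_n\sqrt{\widetilde\mu^n_s}+s\,b_n\,\vartheta(x)+o(s)\qquad\text{as }s\to0\text{ uniformly on }\mathbb{R}^m,$$ where $\vartheta(x)=\cos(x_1)+\cdots+\cos(x_m)$, such that, with $\gamma_n(s):=n^2\pi^2/\widetilde\mu^n_s$, for every $s\in(-\rho_n,\rho_n)$ the overdetermined boundary value problem $$\begin{cases}\Delta\widetilde w^n_s+\widetilde\mu^n_s\,\widetilde w^n_s=0&\text{in }\Omega_{\widetilde h^n_s},\\ \widetilde w^n_s=0&\text{on }\partial\Omega_{\widetilde h^n_s},\\ \dfrac{\partial\widetilde w^n_s}{\partial\eta_s}=\pm\dfrac{1}{\sqrt{\gamma_n(s)}}&\text{on }\partial\Omega^{\pm}_{\widetilde h^n_s}\end{cases}$$ admits a classical solution $\widetilde w^n_s$ which is odd in $t$, even in each of $x_1,\dots,x_m$, $2\pi$-periodic in each of $x_1,\dots,x_m$, and invariant with respect to permutations of the variables $x_1,\dots,x_m$. Here $\eta_s$ is the unit outer normal vector field on $\partial\Omega_{\widetilde h^n_s}$. Moreover, $$\widetilde w^n_s\Bigl(\frac{t}{\widetilde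 h^n_s(x)},x\Bigr)=v_n(t)+s\Bigl(\sin\bigl(\tfrac{\pi t}{2}\bigr)-(-1)^n\,t\cos(n\pi t)\Bigr)\vartheta(x)+o(s)\qquad\text{as }s\to0$$ uniformly on $(-1,1)\times\mathbb{R}^m$, where $v_n(t)=\frac{(-1)^n}{n\pi}\sin(n\pi t)$.
   Context: $C^{2,\alpha}_{p,e}(\mathbb{R}^m)$ is the Banach space (with the $C^{2,\alpha}$ norm) of $C^{2,\alpha}$ functions on $\mathbb{R}^m$ that are $2\pi\mathbb{Z}^m$-periodic and even in each variable. $\mathcal{P}^{2,\alpha}_{p,e}(\mathbb{R}^m)$ is the set of strictly positive functions in $C^{2,\alpha}_{p,e}(\mathbb{R}^m)$ that are invariant under permutations of the coordinates; it is regarded as an open subset of the closed subspace of permutation-invariant functions. For $h\in\mathcal{P}^{2,\alpha}_{p,e}(\mathbb{R}^m)$, $$\Omega_h=\Bigl\{(t,x)\in\mathbb{R}\times\mathbb{R}^m:\ |t|<\tfrac1{h(x)}\Bigr\},\qquad \partial\Omega_h^{\pm}=\Bigl\{\bigl(\pm\tfrac1{h(x)},x\bigr):\ x\in\mathbb{R}^m\Bigr\}.$$ The boundary condition with $\pm$ means the value $+1/\sqrt{\gamma_n(s)}$ on $\partial\Omega^+$ and $-1/\sqrt{\gamma_n(s)}$ on $\partial\Omega^-$. *)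

theory Defs
  imports "HOL-Analysis.Analysis"
begin

text \<open>
  The constants $a_n$, $b_n$, $d_n$ of the theorem must not depend on the dimension $m$, so $m$ has
  to be quantified inside the formula and cannot be a type.  We therefore use the library's
  \<^term>\<open>Euclidean_space m\<close>, whose points are the sequences \<^typ>\<open>nat \<Rightarrow> real\<close> with $x_i = 0$ for
  $i \ge m$; coordinates are numbered from $0$ to $m - 1$.  Functions on $R^m$ are functions on
  \<^typ>\<open>nat \<Rightarrow> real\<close> whose values outside this carrier are irrelevant.

  A point $(t,x)$ of $R \times R^m$ is \<^term>\<open>case_nat t x\<close> in $R^{m+1}$: its coordinate $0$ is $t$
  and its coordinate $i + 1$ is $x_i$.
\<close>

abbreviation Rn :: "nat \<Rightarrow> (nat \<Rightarrow> real) set" where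
  "Rn m \<equiv> topspace (Euclidean_space m)"

definition enorm :: "nat \<Rightarrow> (nat \<Rightarrow> real) \<Rightarrow> real" where
  "enorm m x = L2_set x {..<m}"

definition cont_on :: "nat \<Rightarrow> (nat \<Rightarrow> real) set \<Rightarrow> ((nat \<Rightarrow> real) \<Rightarrow> real) \<Rightarrow> bool" where
  "cont_on m S f \<longleftrightarrow> continuous_map (subtopology (Euclidean_space m) S) euclideanreal f"

definition pd :: "nat \<Rightarrow> ((nat \<Rightarrow> real) \<Rightarrow> real) \<Rightarrow> (nat \<Rightarrow> real) \<Rightarrow> real" where
  "pd i f x = deriv (\<lambda>r. f (x(i := r))) (x i)"

text \<open>$C^k(S)$ for $S$ open in $R^m$: all partial derivatives of order at most $k$ exist and are
  continuous on $S$.  Existence is required separately, as \<^const>\<open>deriv\<close> is total.\<close>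

primrec Ck :: "nat \<Rightarrow> nat \<Rightarrow> (nat \<Rightarrow> real) set \<Rightarrow> ((nat \<Rightarrow> real) \<Rightarrow> real) \<Rightarrow> bool" where
  "Ck m 0 S f = cont_on m S f"
| "Ck m (Suc k) S f = (cont_on m S f \<and>
     (\<forall>i<m. (\<forall>x\<in>S. (\<lambda>r. f (x(i := r))) differentiable (at (x i))) \<and> Ck m k S (pd i f)))"

definition C1_closure :: "nat \<Rightarrow> (nat \<Rightarrow> real) set \<Rightarrow> ((nat \<Rightarrow> real) \<Rightarrow> real) \<Rightarrow> bool" where
  "C1_closure m S f \<longleftrightarrow> Ck m 1 S f \<and> cont_on m (Euclidean_space m closure_of S) f \<and>
     (\<forall>i<m. \<exists>g. cont_on m (Euclidean_space m closure_of S) g \<and> (\<forall>x\<in>S. g x = pd i f x))"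

definition laplacian :: "nat \<Rightarrow> ((nat \<Rightarrow> real) \<Rightarrow> real) \<Rightarrow> (nat \<Rightarrow> real) \<Rightarrow> real" where
  "laplacian m f x = (\<Sum>i<m. pd i (pd i f) x)"

definition holder_quotients :: "nat \<Rightarrow> real \<Rightarrow> ((nat \<Rightarrow> real) \<Rightarrow> real) \<Rightarrow> real set" where
  "holder_quotients m \<alpha> f =
     {\<bar>f x - f y\<bar> / enorm m (\<lambda>i. x i - y i) powr \<alpha> | x y. x \<in> Rn m \<and> y \<in> Rn m \<and> x \<noteq> y}"

definition periodic_even :: "nat \<Rightarrow> ((nat \<Rightarrow> real) \<Rightarrow> real) \<Rightarrow> bool" where
  "periodic_even m f \<longleftrightarrow> (\<forall>x\<in>Rn m. \<forall>i<m. f (x(i := x i + 2 * pi)) = f x \<and> f (x(i := - x i)) = f x)"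

definition perm_invariant :: "nat \<Rightarrow> ((nat \<Rightarrow> real) \<Rightarrow> real) \<Rightarrow> bool" where
  "perm_invariant m f \<longleftrightarrow> (\<forall>x\<in>Rn m. \<forall>\<pi>. \<pi> permutes {..<m} \<longrightarrow> f (x \<circ> \<pi>) = f x)"

text \<open>For periodic functions the suprema of $|f|$, $|Df|$, $|D^2f|$ are automatically finite, so
  only the Hoelder condition on the second derivatives has to be imposed.\<close>

definition C2a_pe :: "nat \<Rightarrow> real \<Rightarrow> ((nat \<Rightarrow> real) \<Rightarrow> real) set" where
  "C2a_pe m \<alpha> = {f. Ck m 2 (Rn m) f \<and>
     (\<forall>i<m. \<forall>j<m. bdd_above (holder_quotients m \<alpha> (pd i (pd j f)))) \<and> periodic_even m f}"

definition sup_norm :: "nat \<Rightarrow> ((nat \<Rightarrow> real) \<Rightarrow> real) \<Rightarrow> real" where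
  "sup_norm m f = (SUP x\<in>Rn m. \<bar>f x\<bar>)"

definition C2a_norm :: "nat \<Rightarrow> real \<Rightarrow> ((nat \<Rightarrow> real) \<Rightarrow> real) \<Rightarrow> real" where
  "C2a_norm m \<alpha> f = sup_norm m f + (\<Sum>i<m. sup_norm m (pd i f)) +
     (\<Sum>i<m. \<Sum>j<m. sup_norm m (pd i (pd j f)) + Sup (holder_quotients m \<alpha> (pd i (pd j f))))"

definition P2a_pe :: "nat \<Rightarrow> real \<Rightarrow> ((nat \<Rightarrow> real) \<Rightarrow> real) set" where
  "P2a_pe m \<alpha> = {f \<in> C2a_pe m \<alpha>. perm_invariant m f \<and> (\<forall>x\<in>Rn m. f x > 0)}"

text \<open>$s \mapsto (\mu_s, h_s)$ is $C^\infty$ on the open interval $I$ as a curve in the product of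
  $R$ with the Banach space of permutation-invariant functions of $C^{2,\alpha}_{p,e}$: $(M_k, H_k)$
  is the $k$-th derivative, difference quotients converging in the norm of the product.\<close>

definition smooth_curve ::
  "nat \<Rightarrow> real \<Rightarrow> real set \<Rightarrow> (real \<Rightarrow> real) \<Rightarrow> (real \<Rightarrow> (nat \<Rightarrow> real) \<Rightarrow> real) \<Rightarrow> bool" where
  "smooth_curve m \<alpha> I \<mu> h \<longleftrightarrow>
     (\<exists>(M :: nat \<Rightarrow> real \<Rightarrow> real) (H :: nat \<Rightarrow> real \<Rightarrow> (nat \<Rightarrow> real) \<Rightarrow> real). M 0 = \<mu> \<and> H 0 = h \<and>
       (\<forall>k. \<forall>s\<in>I. H k s \<in> C2a_pe m \<alpha> \<and> perm_invariant m (H k s) \<and>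
          (M k has_real_derivative M (Suc k) s) (at s) \<and>
          ((\<lambda>r. C2a_norm m \<alpha> (\<lambda>x. (H k r x - H k s x) / (r - s) - H (Suc k) s x)) \<longlongrightarrow> 0) (at s)))"

text \<open>$r_s(p) = o(s)$ as $s \to 0$, uniformly for $p \in S$.\<close>

definition unif_little_o :: "'a set \<Rightarrow> (real \<Rightarrow> 'a \<Rightarrow> real) \<Rightarrow> bool" where
  "unif_little_o S r \<longleftrightarrow> (\<forall>\<epsilon>>0. \<forall>\<^sub>F s in nhds 0. \<forall>p\<in>S. \<bar>r s p\<bar> \<le> \<epsilon> * \<bar>s\<bar>)"

definition Omega :: "nat \<Rightarrow> ((nat \<Rightarrow> real) \<Rightarrow> real) \<Rightarrow> (nat \<Rightarrow> real) set" where
  "Omega m h = {case_nat t x | t x. x \<in> Rn m \<and> \<bar>t\<bar> < 1 / h x}"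

definition bdry_plus :: "nat \<Rightarrow> ((nat \<Rightarrow> real) \<Rightarrow> real) \<Rightarrow> (nat \<Rightarrow> real) set" where
  "bdry_plus m h = {case_nat (1 / h x) x | x. x \<in> Rn m}"

definition bdry_minus :: "nat \<Rightarrow> ((nat \<Rightarrow> real) \<Rightarrow> real) \<Rightarrow> (nat \<Rightarrow> real) set" where
  "bdry_minus m h = {case_nat (- (1 / h x)) x | x. x \<in> Rn m}"

text \<open>$\eta$ is the unit outer normal to the boundary of $D$ at $p$: near $p$, $D = \{\varphi < 0\}$
  with $\varphi$ of class $C^1$, $\varphi(p) = 0$, and $\eta$ is $\nabla\varphi(p) \ne 0$ normalised.\<close>

definition unit_outer_normal ::
  "nat \<Rightarrow> (nat \<Rightarrow> real) set \<Rightarrow> (nat \<Rightarrow> real) \<Rightarrow> (nat \<Rightarrow> real) \<Rightarrow> bool" where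
  "unit_outer_normal N D p \<eta> \<longleftrightarrow> \<eta> \<in> Rn N \<and> enorm N \<eta> = 1 \<and>
     (\<exists>U \<phi>. openin (Euclidean_space N) U \<and> p \<in> U \<and> Ck N 1 U \<phi> \<and>
        D \<inter> U = {q \<in> U. \<phi> q < 0} \<and> \<phi> p = 0 \<and> (\<exists>c>0. \<forall>i<N. pd i \<phi> p = c * \<eta> i))"

text \<open>The derivative along $\eta$ at a boundary point is one-sided, from inside the domain.\<close>

definition has_normal_deriv ::
  "((nat \<Rightarrow> real) \<Rightarrow> real) \<Rightarrow> (nat \<Rightarrow> real) \<Rightarrow> (nat \<Rightarrow> real) \<Rightarrow> real \<Rightarrow> bool" where
  "has_normal_deriv w p \<eta> c \<longleftrightarrow>
     ((\<lambda>r. w (\<lambda>i. p i + r * \<eta> i)) has_real_derivative c) (at_left 0)"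

definition classical_solution ::
  "nat \<Rightarrow> ((nat \<Rightarrow> real) \<Rightarrow> real) \<Rightarrow> real \<Rightarrow> real \<Rightarrow> ((nat \<Rightarrow> real) \<Rightarrow> real) \<Rightarrow> bool" where
  "classical_solution m h \<mu> c w \<longleftrightarrow>
     Ck (Suc m) 2 (Omega m h) w \<and> C1_closure (Suc m) (Omega m h) w \<and>
     (\<forall>p\<in>Omega m h. laplacian (Suc m) w p + \<mu> * w p = 0) \<and>
     (\<forall>p\<in>bdry_plus m h \<union> bdry_minus m h. w p = 0) \<and>
     (\<exists>\<eta>. (\<forall>p\<in>bdry_plus m h \<union> bdry_minus m h. unit_outer_normal (Suc m) (Omega m h) p (\<eta> p)) \<and>
        (\<forall>p\<in>bdry_plus m h. has_normal_deriv w p (\<eta> p) c) \<and>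
        (\<forall>p\<in>bdry_minus m h. has_normal_deriv w p (\<eta> p) (- c)))"

definition solution_symmetries ::
  "nat \<Rightarrow> (nat \<Rightarrow> real) set \<Rightarrow> ((nat \<Rightarrow> real) \<Rightarrow> real) \<Rightarrow> bool" where
  "solution_symmetries m S w \<longleftrightarrow> (\<forall>t. \<forall>x\<in>Rn m. case_nat t x \<in> S \<longrightarrow>
     w (case_nat (- t) x) = - w (case_nat t x) \<and>
     (\<forall>i<m. w (case_nat t (x(i := - x i))) = w (case_nat t x)) \<and>
     (\<forall>i<m. w (case_nat t (x(i := x i + 2 * pi))) = w (case_nat t x)) \<and>
     (\<forall>\<pi>. \<pi> permutes {..<m} \<longrightarrow> w (case_nat t (x \<circ> \<pi>)) = w (case_nat t x)))"

definition theta :: "nat \<Rightarrow> (nat \<Rightarrow> real) \<Rightarrow> real" where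
  "theta m x = (\<Sum>i<m. cos (x i))"

definition v :: "nat \<Rightarrow> real \<Rightarrow> real" where
  "v n t = (-1) ^ n / (real n * pi) * sin (real n * pi * t)"

end

theory Submission
  imports Defs "HOL-Library.Poly_Mapping" "HOL-Library.Function_Algebras"
    "HOL-Computational_Algebra.Formal_Power_Series"
begin

text \<open>
  Write \<open>h = a M (1 + s \<eta>)\<close>, \<open>\<mu> = M\<^sup>2\<close> with \<open>a = 1 / (n \<pi>)\<close>, and straighten the domain by
  \<open>w (r, x) = W (r h x) x\<close>. Putting \<open>W = v\<^sub>n + s Y\<close> gives a quasilinear elliptic equation for \<open>Y\<close> on the strip
  \<open>|t| < 1\<close> with \<open>Y = 0\<close> and a second, nonlinear boundary condition at \<open>t = 1\<close>. All three unknowns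
  \<open>Y\<close>, \<open>\<eta>\<close>, \<open>M\<close> are sought as power series in \<open>s\<close> whose coefficients are trigonometric polynomials in \<open>x\<close>
  with coefficients depending continuously on \<open>t\<close>. In terms of \<open>z = Y + t v\<^sub>n' \<eta>\<close> the linear part decouples into
  one ODE \<open>z'' - \<omega> z = f\<close>, \<open>z' 1 = \<beta>\<close> for each frequency \<open>k\<close>, and \<open>\<eta> = z 1\<close>.
  At \<open>\<mu> = n\<^sup>2 / (n\<^sup>2 - 1/4)\<close> these are uniquely solvable by odd functions except for \<open>|k| = 1\<close>, where
  \<open>sin (\<pi> t / 2)\<close> solves the homogeneous problem; there the solvability condition determines the next
  coefficient of \<open>M\<close>. The solution gains two derivatives over \<open>f\<close> and one over \<open>\<beta>\<close>, so no derivative is lost.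
  In the recursion every unknown occurs with a factor \<open>s\<close>, so for small \<open>\<rho>\<close> the sums
  \<open>\<Sum>j\<le>J. \<rho> ^ j \<parallel>F\<^sub>j\<parallel>\<close> stay bounded by a constant independent of \<open>J\<close>. Hence the series converge together with
  three \<open>x\<close>-derivatives, and the curve is even analytic in \<open>s\<close>.
\<close>

section \<open>Bounded continuous functions as a normed algebra\<close>

text \<open>This is bifurcation from a simple eigenvalue, carried out by power series. For constant
  \<open>h\<close> the function \<open>v n\<close> solves the problem at every \<open>\<mu>\<close>;
  this free parameter pays for one solvability condition per order in \<open>s\<close>, and it can
  do so because \<open>ce n > 0\<close> (transversality). One condition suffices since sign flips
  and permutations of the coordinates act transitively on the frequencies with
  \<open>|k| = 1\<close>: within the symmetry class the kernel is spanned by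
  \<open>sin (\<pi> t / 2)\<close> times theta. Passing from \<open>Y\<close> to \<open>z\<close>
  undoes the straightening to first order, \<open>t v\<^sub>n' \<eta>\<close> being the effect of a
  dilation of the \<open>t\<close>-axis on \<open>v\<^sub>n\<close>; hence \<open>\<eta>\<close>
  leaves the equation and returns only as a boundary value. All norms are weighted l1 norms of
  Fourier coefficients, so that products and derivatives reduce to inequalities between
  coefficients; these bounds stand in for Schauder estimates. Three \<open>x\<close>-derivatives
  make the second derivatives of \<open>h\<close> Lipschitz, which serves all Hoelder exponents
  together. The Neumann condition is used in squared form, polynomial in the unknowns; its sign is
  restored at the end by smallness of \<open>s\<close>.\<close>

lemma bcontfun_times: "f \<in> bcontfun \<Longrightarrow> g \<in> bcontfun \<Longrightarrow> (\<lambda>x. f x * g x) \<in> bcontfun"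
  for f g :: "'a::topological_space \<Rightarrow> 'b::real_normed_algebra"
proof -
  assume "f \<in> bcontfun" "g \<in> bcontfun"
  then obtain a b where "\<And>x. norm (f x) \<le> a" "\<And>x. norm (g x) \<le> b"
    and c: "continuous_on UNIV f" "continuous_on UNIV g"
    by (auto simp: bcontfun_def bounded_iff)
  then have "norm (f x * g x) \<le> a * b" for x
    by (intro order_trans[OF norm_mult_ineq] mult_mono) (auto intro: order_trans[OF norm_ge_zero])
  then show ?thesis by (intro bcontfun_normI continuous_on_mult c)
qed

instantiation bcontfun :: (topological_space, real_normed_algebra_1) real_normed_algebra_1
begin

definition times_bcontfun :: "('a, 'b) bcontfun \<Rightarrow> ('a, 'b) bcontfun \<Rightarrow> ('a, 'b) bcontfun"
  where "times_bcontfun f g = Bcontfun (\<lambda>x. f x * g x)"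

definition one_bcontfun :: "('a, 'b) bcontfun"
  where "one_bcontfun = const_bcontfun 1"

lemma apply_bcontfun_times [simp]: "apply_bcontfun (f * g) x = f x * g x"
  for f g :: "('a, 'b) bcontfun"
  unfolding times_bcontfun_def
  using bcontfun_times[OF apply_bcontfun[of f] apply_bcontfun[of g]]
  by (simp add: Bcontfun_inverse)

lemma apply_bcontfun_one [simp]: "apply_bcontfun (1 :: ('a, 'b) bcontfun) x = 1"
  by (simp add: one_bcontfun_def)

instance
proof
  fix f g h :: "('a, 'b) bcontfun" and r :: real
  show "norm (f * g) \<le> norm f * norm g"
    by (rule norm_bound, unfold apply_bcontfun_times, rule order_trans[OF norm_mult_ineq])
      (intro mult_mono norm_bounded norm_ge_zero)
  show "norm (1 :: ('a, 'b) bcontfun) = 1"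
  proof (rule antisym)
    show "norm (1 :: ('a, 'b) bcontfun) \<le> 1" by (rule norm_bound) simp
    show "1 \<le> norm (1 :: ('a, 'b) bcontfun)"
      using norm_bounded[of "1 :: ('a, 'b) bcontfun" undefined] by simp
  qed
  show "(0 :: ('a, 'b) bcontfun) \<noteq> 1"
    by (metis apply_bcontfun_one zero_bcontfun.rep_eq zero_neq_one)
qed (rule bcontfun_eqI, simp add: mult.assoc distrib_left distrib_right)+

end

instance bcontfun :: (topological_space, "{real_normed_algebra_1, comm_ring_1}") comm_ring_1
proof
  fix f g h :: "('a, 'b) bcontfun"
  show "f * g = g * f" by (rule bcontfun_eqI) (simp add: mult.commute)
qed (simp_all add: distrib_right)

text \<open>A \<open>tpoly\<close> stands for \<open>\<Sum>k. f\<^sub>k t e\<^bsup>i k \<bullet> x\<^esup>\<close>, frequencies being integer sequences. All fields are even in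
  each \<open>x\<^sub>i\<close>, so real coefficients suffice. A function of \<open>t \<in> [-1, 1]\<close> is extended constantly to the real line
  in order to be an element of the Banach algebra of bounded continuous functions.\<close>

type_synonym freq = "nat \<Rightarrow> int"
type_synonym tfun = "(real, real) bcontfun"
type_synonym tpoly = "freq \<Rightarrow>\<^sub>0 tfun"
type_synonym tser = "tpoly fps"

definition clamp1 :: "real \<Rightarrow> real" where "clamp1 t = max (-1) (min 1 t)"

lemma clamp1_in: "clamp1 t \<in> {-1..1}" and clamp1_id: "t \<in> {-1..1} \<Longrightarrow> clamp1 t = t"
  by (auto simp: clamp1_def)

lemma continuous_on_clamp1 [continuous_intros]: "continuous_on S clamp1"
  unfolding clamp1_def by (intro continuous_intros)

definition bcf :: "(real \<Rightarrow> real) \<Rightarrow> tfun" where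
  "bcf f = Bcontfun (\<lambda>t. f (clamp1 t))"

lemma bcf_bcontfun:
  assumes "continuous_on {-1..1} f"
  shows "(\<lambda>t. f (clamp1 t)) \<in> (bcontfun :: (real \<Rightarrow> real) set)"
proof -
  have "continuous_on UNIV (\<lambda>t. f (clamp1 t))"
    by (rule continuous_on_compose2[OF assms]) (auto intro!: continuous_intros simp: clamp1_in[simplified])
  moreover have "bounded (f ` {-1..1})"
    by (intro compact_imp_bounded compact_continuous_image assms compact_Icc)
  then have "bounded (range (\<lambda>t. f (clamp1 t)))"
    by (rule bounded_subset) (use clamp1_in in auto)
  ultimately show ?thesis by (simp add: bcontfun_def)
qed

lemma apply_bcf: "continuous_on {-1..1} f \<Longrightarrow> apply_bcontfun (bcf f) t = f (clamp1 t)"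
  unfolding bcf_def by (simp add: Bcontfun_inverse bcf_bcontfun)

lemma apply_bcf_in: "continuous_on {-1..1} f \<Longrightarrow> t \<in> {-1..1} \<Longrightarrow> apply_bcontfun (bcf f) t = f t"
  by (simp add: apply_bcf clamp1_id)

lemma norm_bcf_le: "continuous_on {-1..1} f \<Longrightarrow> (\<And>t. t \<in> {-1..1} \<Longrightarrow> \<bar>f t\<bar> \<le> b) \<Longrightarrow> norm (bcf f) \<le> b"
  using clamp1_in by (intro norm_bound) (simp add: apply_bcf)

section \<open>Trigonometric polynomials\<close>

abbreviation cf :: "('a \<Rightarrow>\<^sub>0 'b::zero) \<Rightarrow> 'a \<Rightarrow> 'b" where "cf \<equiv> Poly_Mapping.lookup"
abbreviation supp :: "('a \<Rightarrow>\<^sub>0 'b::zero) \<Rightarrow> 'a set" where "supp \<equiv> Poly_Mapping.keys"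
abbreviation sng :: "'a \<Rightarrow> 'b \<Rightarrow> ('a \<Rightarrow>\<^sub>0 'b::zero)" where "sng \<equiv> Poly_Mapping.single"

lemma sum_sng: "f = (\<Sum>k\<in>supp f. sng k (cf f k))"
  by (rule poly_mapping_eqI) (auto simp: lookup_sum lookup_single when_def in_keys_iff)

text \<open>Bilinear statements about products are reduced to monomials through this form.\<close>

lemma times_eq_sum_sng:
  fixes f g :: "freq \<Rightarrow>\<^sub>0 'c::comm_ring_1"
  shows "f * g = (\<Sum>a\<in>supp f. \<Sum>b\<in>supp g. sng (a + b) (cf f a * cf g b))"
proof -
  have "f * g = (\<Sum>a\<in>supp f. sng a (cf f a)) * (\<Sum>b\<in>supp g. sng b (cf g b))"
    by (simp flip: sum_sng)
  then show ?thesis by (simp add: sum_product mult_single)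
qed

text \<open>The result has finite support when \<open>h k 0 0 = 0\<close>; this is the origin of the
  side condition of \<open>cf_pmap2\<close> and of the later proofs that zero data have the zero
  solution.\<close>

definition pmap2 :: "('k \<Rightarrow> 'a \<Rightarrow> 'b \<Rightarrow> 'c) \<Rightarrow> ('k \<Rightarrow>\<^sub>0 'a::zero) \<Rightarrow> ('k \<Rightarrow>\<^sub>0 'b::zero) \<Rightarrow> ('k \<Rightarrow>\<^sub>0 'c::zero)" where
  "pmap2 h f g = Abs_poly_mapping (\<lambda>k. h k (cf f k) (cf g k))"

lemma cf_pmap2:
  assumes "\<And>k. h k 0 0 = 0"
  shows "cf (pmap2 h f g) k = h k (cf f k) (cf g k)"
proof -
  have "{k. h k (cf f k) (cf g k) \<noteq> 0} \<subseteq> supp f \<union> supp g"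
    using assms by (auto simp: in_keys_iff)
  then have "finite {k. h k (cf f k) (cf g k) \<noteq> 0}"
    by (rule finite_subset) simp
  then show ?thesis by (simp add: pmap2_def)
qed

definition pmap :: "('k \<Rightarrow> 'a \<Rightarrow> 'c) \<Rightarrow> ('k \<Rightarrow>\<^sub>0 'a::zero) \<Rightarrow> ('k \<Rightarrow>\<^sub>0 'c::zero)" where
  "pmap h f = pmap2 (\<lambda>k a b. h k a) f f"

lemma cf_pmap: "(\<And>k. h k 0 = 0) \<Longrightarrow> cf (pmap h f) k = h k (cf f k)"
  unfolding pmap_def by (subst cf_pmap2) auto

section \<open>Weighted l1 norms of the coefficients\<close>

definition wt :: "nat \<Rightarrow> freq \<Rightarrow> real" where
  "wt m k = 1 + (\<Sum>i<m. \<bar>real_of_int (k i)\<bar>)"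

lemma wt_ge_1: "1 \<le> wt m k"
  by (simp add: wt_def sum_nonneg)

lemma wt_pos [simp]: "0 < wt m k" and wt_nonneg [simp]: "0 \<le> wt m k"
  using wt_ge_1[of m k] by linarith+

text \<open>From \<open>1 + a + b \<le> (1 + a) * (1 + b)\<close> for nonnegative \<open>a\<close>
  and \<open>b\<close>. Submultiplicativity of the weight is what turns every weighted norm into an
  algebra norm.\<close>

lemma wt_add: "wt m (k + l) \<le> wt m k * wt m l"
proof -
  have "wt m (k + l) \<le> 1 + ((\<Sum>i<m. \<bar>real_of_int (k i)\<bar>) + (\<Sum>i<m. \<bar>real_of_int (l i)\<bar>))"
    unfolding wt_def sum.distrib[symmetric] by (intro add_mono sum_mono) auto
  also have "\<dots> \<le> wt m k * wt m l"
    by (simp add: wt_def algebra_simps sum_nonneg)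
  finally show ?thesis .
qed

lemma abs_freq_le_wt: "i < m \<Longrightarrow> \<bar>real_of_int (k i)\<bar> \<le> wt m k"
proof -
  assume "i < m"
  then have "\<bar>real_of_int (k i)\<bar> \<le> (\<Sum>i<m. \<bar>real_of_int (k i)\<bar>)"
    by (intro member_le_sum) auto
  then show ?thesis by (simp add: wt_def)
qed

text \<open>The squared length \<open>|k|\<^sup>2\<close> as a natural number, so that the modes
  split exactly into the cases 0, 1 and at least 2.\<close>

definition sqn :: "nat \<Rightarrow> freq \<Rightarrow> nat" where
  "sqn m k = (\<Sum>i<m. nat \<bar>k i\<bar> ^ 2)"

lemma real_sqn: "real (sqn m k) = (\<Sum>i<m. real_of_int (k i) ^ 2)"
  by (simp add: sqn_def)

lemma sqn_le_wt: "real (sqn m k) \<le> wt m k ^ 2"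
proof -
  have "(\<Sum>i<m. real_of_int (k i) ^ 2) \<le> (\<Sum>i<m. \<bar>real_of_int (k i)\<bar> * wt m k)"
  proof (rule sum_mono)
    fix i assume "i \<in> {..<m}"
    then have "\<bar>real_of_int (k i)\<bar> * \<bar>real_of_int (k i)\<bar> \<le> \<bar>real_of_int (k i)\<bar> * wt m k"
      by (intro mult_left_mono abs_freq_le_wt) auto
    then show "real_of_int (k i) ^ 2 \<le> \<bar>real_of_int (k i)\<bar> * wt m k"
      by (simp add: power2_eq_square flip: abs_mult)
  qed
  also have "\<dots> = (wt m k - 1) * wt m k"
    by (simp add: wt_def sum_distrib_right)
  also have "\<dots> \<le> wt m k ^ 2"
    by (simp add: power2_eq_square mult_right_mono)
  finally show ?thesis by (simp add: real_sqn)
qed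

text \<open>The norm of a weighted Wiener algebra; \<open>p\<close> is the number of
  \<open>x\<close>-derivatives under control.\<close>

definition wnorm :: "nat \<Rightarrow> nat \<Rightarrow> (freq \<Rightarrow>\<^sub>0 'c::real_normed_vector) \<Rightarrow> real" where
  "wnorm m p f = (\<Sum>k\<in>supp f. wt m k ^ p * norm (cf f k))"

lemma wnorm_superset: "finite A \<Longrightarrow> supp f \<subseteq> A \<Longrightarrow> wnorm m p f = (\<Sum>k\<in>A. wt m k ^ p * norm (cf f k))"
  unfolding wnorm_def by (rule sum.mono_neutral_left) (auto simp: in_keys_iff)

lemma wnorm_nonneg [simp]: "0 \<le> wnorm m p f"
  unfolding wnorm_def by (intro sum_nonneg mult_nonneg_nonneg) auto

lemma wnorm_0 [simp]: "wnorm m p 0 = 0"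
  by (simp add: wnorm_def)

lemma wnorm_sng: "wnorm m p (sng k c) = wt m k ^ p * norm c"
  by (simp add: wnorm_def)

lemma wnorm_mono_pointwise:
  assumes "\<And>k. wt m k ^ p * norm (cf f k) \<le> c * (wt m k ^ q * norm (cf g k))"
  shows "wnorm m p f \<le> c * wnorm m q g"
proof -
  let ?A = "supp f \<union> supp g"
  have "wnorm m p f = (\<Sum>k\<in>?A. wt m k ^ p * norm (cf f k))" by (rule wnorm_superset) auto
  also have "\<dots> \<le> (\<Sum>k\<in>?A. c * (wt m k ^ q * norm (cf g k)))" by (intro sum_mono assms)
  also have "\<dots> = c * wnorm m q g" by (subst wnorm_superset[of ?A g]) (auto simp: sum_distrib_left)
  finally show ?thesis .
qed

lemma wnorm_mono_pointwise2:
  assumes "\<And>k. wt m k ^ p * norm (cf f k) \<le> c * (wt m k ^ q * norm (cf g k)) + d * (wt m k ^ r * norm (cf h k))"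
  shows "wnorm m p f \<le> c * wnorm m q g + d * wnorm m r h"
proof -
  let ?A = "supp f \<union> supp g \<union> supp h"
  have "wnorm m p f = (\<Sum>k\<in>?A. wt m k ^ p * norm (cf f k))" by (rule wnorm_superset) auto
  also have "\<dots> \<le> (\<Sum>k\<in>?A. c * (wt m k ^ q * norm (cf g k)) + d * (wt m k ^ r * norm (cf h k)))"
    by (intro sum_mono assms)
  also have "\<dots> = c * wnorm m q g + d * wnorm m r h"
    by (subst wnorm_superset[of ?A g], simp, blast, subst wnorm_superset[of ?A h])
      (auto simp: sum_distrib_left sum.distrib)
  finally show ?thesis .
qed

lemma wnorm_mono: "p \<le> q \<Longrightarrow> wnorm m p f \<le> wnorm m q f"
  using wnorm_mono_pointwise[of m p f 1 q f]
  by (simp add: mult_right_mono power_increasing wt_ge_1)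

lemma wnorm_add: "wnorm m p (f + g) \<le> wnorm m p f + wnorm m p g"
  using wnorm_mono_pointwise2[of m p "f + g" 1 p f 1 p g]
  by (simp add: lookup_add norm_triangle_ineq mult_left_mono flip: distrib_left)

lemma wnorm_minus [simp]: "wnorm m p (- f) = wnorm m p f"
  by (simp add: wnorm_def)

lemma wnorm_sum: "wnorm m p (\<Sum>i\<in>A. f i) \<le> (\<Sum>i\<in>A. wnorm m p (f i))"
  by (induction A rule: infinite_finite_induct) (auto intro: order_trans[OF wnorm_add])

text \<open>Young's inequality for the convolution of l1 sequences, the weight being distributed
  over the factors by \<open>wt_add\<close>.\<close>

lemma wnorm_mult:
  fixes f g :: "freq \<Rightarrow>\<^sub>0 'c::{real_normed_algebra_1, comm_ring_1}"
  shows "wnorm m p (f * g) \<le> wnorm m p f * wnorm m p g"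
proof -
  have "wnorm m p (f * g) \<le> (\<Sum>a\<in>supp f. \<Sum>b\<in>supp g. wnorm m p (sng (a + b) (cf f a * cf g b)))"
    unfolding times_eq_sum_sng by (intro order_trans[OF wnorm_sum] sum_mono wnorm_sum)
  also have "\<dots> \<le> (\<Sum>a\<in>supp f. \<Sum>b\<in>supp g. (wt m a ^ p * norm (cf f a)) * (wt m b ^ p * norm (cf g b)))"
  proof (intro sum_mono)
    fix a b
    have "wt m (a + b) ^ p * norm (cf f a * cf g b)
        \<le> (wt m a * wt m b) ^ p * (norm (cf f a) * norm (cf g b))"
      by (intro mult_mono power_mono wt_add norm_mult_ineq) auto
    then show "wnorm m p (sng (a + b) (cf f a * cf g b)) \<le> (wt m a ^ p * norm (cf f a)) * (wt m b ^ p * norm (cf g b))"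
      by (simp add: wnorm_sng power_mult_distrib mult_ac)
  qed
  also have "\<dots> = wnorm m p f * wnorm m p g" by (simp add: wnorm_def sum_product)
  finally show ?thesis .
qed

text \<open>\<open>Dop i\<close> is \<open>-i \<partial>\<^sub>i\<close>; hence \<open>Eop\<close> is minus the Laplacian and \<open>Gop\<close> minus the product of the gradients.
  \<open>aop\<close> is the trace at \<open>t = 1\<close>.\<close>

definition Dop :: "nat \<Rightarrow> tpoly \<Rightarrow> tpoly" where
  "Dop i = pmap (\<lambda>k c. real_of_int (k i) *\<^sub>R c)"

lemma cf_Dop [simp]: "cf (Dop i f) k = real_of_int (k i) *\<^sub>R cf f k"
  by (simp add: Dop_def cf_pmap)

definition Eop :: "nat \<Rightarrow> tpoly \<Rightarrow> tpoly" where
  "Eop m = pmap (\<lambda>k c. real (sqn m k) *\<^sub>R c)"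

lemma cf_Eop [simp]: "cf (Eop m f) k = real (sqn m k) *\<^sub>R cf f k"
  by (simp add: Eop_def cf_pmap)

definition Gop :: "nat \<Rightarrow> tpoly \<Rightarrow> tpoly \<Rightarrow> tpoly" where
  "Gop m f g = (\<Sum>i<m. Dop i f * Dop i g)"

definition aop :: "tpoly \<Rightarrow> tpoly" where
  "aop = pmap (\<lambda>k c. const_bcontfun (apply_bcontfun c 1))"

lemma cf_aop [simp]: "cf (aop f) k = const_bcontfun (apply_bcontfun (cf f k) 1)"
  by (simp add: aop_def cf_pmap)

lemma wnorm_Dop: "i < m \<Longrightarrow> wnorm m p (Dop i f) \<le> wnorm m (Suc p) f"
  by (rule order_trans[OF wnorm_mono_pointwise[of m p "Dop i f" 1 "Suc p" f]])
    (auto simp: mult_ac intro!: mult_right_mono abs_freq_le_wt)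

lemma wnorm_Eop: "wnorm m p (Eop m f) \<le> wnorm m (Suc (Suc p)) f"
proof -
  have "wt m k ^ p * (real (sqn m k) * norm (cf f k)) \<le> wt m k ^ p * (wt m k ^ 2 * norm (cf f k))" for k
    by (intro mult_left_mono mult_right_mono sqn_le_wt) auto
  then show ?thesis
    using wnorm_mono_pointwise[of m p "Eop m f" 1 "Suc (Suc p)" f] by (simp add: power2_eq_square mult_ac)
qed

lemma wnorm_aop: "wnorm m p (aop f) \<le> wnorm m p f"
proof -
  have "norm (cf (aop f) k) \<le> norm (cf f k)" for k
    using norm_bounded[of "cf f k" 1] by (intro norm_bound) simp
  then show ?thesis
    using wnorm_mono_pointwise[of m p "aop f" 1 p f] by (simp add: mult_left_mono)
qed

subsection \<open>Symmetries\<close>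

text \<open>The sign \<open>\<sigma>\<close> is the parity in \<open>t\<close>.\<close>

definition psym :: "nat \<Rightarrow> real \<Rightarrow> tpoly \<Rightarrow> bool" where
  "psym m \<sigma> f \<longleftrightarrow>
     (\<forall>k. (\<exists>i\<ge>m. k i \<noteq> 0) \<longrightarrow> cf f k = 0) \<and>
     (\<forall>k. \<forall>i<m. cf f (k(i := - k i)) = cf f k) \<and>
     (\<forall>k \<pi>. \<pi> permutes {..<m} \<longrightarrow> cf f (k \<circ> \<pi>) = cf f k) \<and>
     (\<forall>k t. apply_bcontfun (cf f k) (- t) = \<sigma> * apply_bcontfun (cf f k) t)"

lemma psym_0 [simp]: "psym m \<sigma> 0"
  by (simp add: psym_def)

lemma psym_add: "psym m \<sigma> f \<Longrightarrow> psym m \<sigma> g \<Longrightarrow> psym m \<sigma> (f + g)"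
  by (auto simp: psym_def lookup_add distrib_left)

lemma psym_minus: "psym m \<sigma> f \<Longrightarrow> psym m \<sigma> (- f)"
  by (auto simp: psym_def)

lemma psym_diff: "psym m \<sigma> f \<Longrightarrow> psym m \<sigma> g \<Longrightarrow> psym m \<sigma> (f - g)"
  using psym_add[of m \<sigma> f "- g"] psym_minus by auto

lemma psym_sum: "(\<And>i. i \<in> A \<Longrightarrow> psym m \<sigma> (f i)) \<Longrightarrow> psym m \<sigma> (\<Sum>i\<in>A. f i)"
  by (induction A rule: infinite_finite_induct) (auto intro: psym_add)

lemma psym_sng_0: "(\<And>t. apply_bcontfun c (- t) = \<sigma> * apply_bcontfun c t) \<Longrightarrow> psym m \<sigma> (sng 0 c)"
proof -
  assume c: "\<And>t. apply_bcontfun c (- t) = \<sigma> * apply_bcontfun c t"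
  have 1: "k \<circ> \<pi> = 0 \<longleftrightarrow> k = 0" if "\<pi> permutes {..<m}" for k :: freq and \<pi>
    using permutes_surj[OF that] by (auto simp: fun_eq_iff) (metis surjD)
  have 2: "k(i := - k i) = 0 \<longleftrightarrow> k = 0" for k :: freq and i
    by (auto simp: fun_eq_iff)
  show ?thesis
    using c by (auto simp: psym_def lookup_single when_def 1 2 eq_commute[of 0])
qed

section \<open>Convolution of coefficients and the symmetry of products\<close>

text \<open>A bilinear weight \<open>\<beta>\<close> is included so that the plain product
  (\<open>\<beta> = 1\<close>) and the gradient product (\<open>\<beta> a b\<close> the dot product
  of \<open>a\<close> and \<open>b\<close>) share one symmetry proof.\<close>

definition wconv :: "(freq \<Rightarrow> freq \<Rightarrow> real) \<Rightarrow> tpoly \<Rightarrow> tpoly \<Rightarrow> freq \<Rightarrow> tfun" where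
  "wconv \<beta> f g k = (\<Sum>a\<in>supp f. \<Sum>b\<in>supp g. (if a + b = k then \<beta> a b *\<^sub>R (cf f a * cf g b) else 0))"

lemma cf_times: "cf (f * g) k = wconv (\<lambda>_ _. 1) f g k"
  unfolding wconv_def times_eq_sum_sng by (simp add: lookup_sum lookup_single when_def cong: if_cong)

lemma wconv_superset:
  assumes "finite A" "supp f \<subseteq> A" "finite B" "supp g \<subseteq> B"
  shows "wconv \<beta> f g k = (\<Sum>a\<in>A. \<Sum>b\<in>B. (if a + b = k then \<beta> a b *\<^sub>R (cf f a * cf g b) else 0))"
proof -
  have "wconv \<beta> f g k = (\<Sum>a\<in>supp f. \<Sum>b\<in>B. (if a + b = k then \<beta> a b *\<^sub>R (cf f a * cf g b) else 0))"
    unfolding wconv_def using assms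
    by (intro sum.cong refl sum.mono_neutral_left) (auto simp: in_keys_iff)
  also have "\<dots> = (\<Sum>a\<in>A. \<Sum>b\<in>B. (if a + b = k then \<beta> a b *\<^sub>R (cf f a * cf g b) else 0))"
    using assms by (intro sum.mono_neutral_left) (auto simp: in_keys_iff intro!: sum.neutral)
  finally show ?thesis .
qed

text \<open>A single product \<open>Dop i f * Dop i g\<close> distinguishes a coordinate and is not
  permutation invariant. The sum over \<open>i\<close> is, and the dot product as weight makes this
  visible.\<close>

lemma cf_Gop: "cf (Gop m f g) k = wconv (\<lambda>a b. \<Sum>i<m. real_of_int (a i) * real_of_int (b i)) f g k"
proof -
  have "cf (Dop i f * Dop i g) k = wconv (\<lambda>a b. real_of_int (a i) * real_of_int (b i)) f g k" for i
  proof -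
    have "supp (Dop i f) \<subseteq> supp f" "supp (Dop i g) \<subseteq> supp g" by (auto simp: in_keys_iff)
    then show ?thesis
      unfolding cf_times
      by (subst wconv_superset[of "supp f" _ "supp g"], simp, simp, simp, simp, subst wconv_def)
        (intro sum.cong refl, auto)
  qed
  then have "cf (Gop m f g) k = (\<Sum>i<m. wconv (\<lambda>a b. real_of_int (a i) * real_of_int (b i)) f g k)"
    by (simp add: Gop_def lookup_sum)
  also have "\<dots> = (\<Sum>a\<in>supp f. \<Sum>b\<in>supp g. \<Sum>i<m. (if a + b = k then (real_of_int (a i) * real_of_int (b i)) *\<^sub>R (cf f a * cf g b) else 0))"
    unfolding wconv_def by (subst sum.swap) (intro sum.cong refl sum.swap)
  also have "\<dots> = wconv (\<lambda>a b. \<Sum>i<m. real_of_int (a i) * real_of_int (b i)) f g k"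
    unfolding wconv_def by (intro sum.cong refl) (auto simp: scaleR_sum_left)
  finally show ?thesis .
qed

text \<open>An additive bijection of the frequencies that fixes the coefficients of both factors
  maps their supports onto themselves, so it merely reorders the double sum.\<close>

lemma wconv_reindex:
  assumes bij: "bij \<tau>" and add: "\<And>a b. \<tau> (a + b) = \<tau> a + \<tau> b"
    and \<beta>: "\<And>a b. \<beta> (\<tau> a) (\<tau> b) = \<beta> a b"
    and f: "\<And>a. cf f (\<tau> a) = cf f a" and g: "\<And>a. cf g (\<tau> a) = cf g a"
  shows "wconv \<beta> f g (\<tau> k) = wconv \<beta> f g k"
proof -
  have inj: "inj \<tau>" using bij by (rule bij_is_inj)
  have img: "\<tau> ` supp h = supp h" if h: "\<And>a. cf h (\<tau> a) = cf h a" for h :: tpoly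
  proof
    show "\<tau> ` supp h \<subseteq> supp h" using h by (auto simp: in_keys_iff)
    show "supp h \<subseteq> \<tau> ` supp h"
    proof
      fix a assume "a \<in> supp h"
      obtain b where "a = \<tau> b" using bij_is_surj[OF bij] by blast
      then show "a \<in> \<tau> ` supp h" using h[of b] \<open>a \<in> supp h\<close> by (auto simp: in_keys_iff)
    qed
  qed
  have "wconv \<beta> f g (\<tau> k) = (\<Sum>a\<in>\<tau> ` supp f. \<Sum>b\<in>\<tau> ` supp g. (if a + b = \<tau> k then \<beta> a b *\<^sub>R (cf f a * cf g b) else 0))"
    unfolding wconv_def img[OF f] img[OF g] ..
  also have "\<dots> = wconv \<beta> f g k"
    unfolding wconv_def
    by (simp add: sum.reindex inj_on_subset[OF inj] f g \<beta> add[symmetric] inj_eq[OF inj] cong: if_cong)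
  finally show ?thesis .
qed

lemma bij_flip: "bij (\<lambda>k::freq. k(i := - k i))"
  by (rule involuntory_imp_bij) auto

lemma bij_comp_permutes:
  assumes "\<pi> permutes S" shows "bij (\<lambda>k::freq. k \<circ> \<pi>)"
proof (rule bijI')
  fix k l :: freq
  show "k \<circ> \<pi> = l \<circ> \<pi> \<longleftrightarrow> k = l"
    using permutes_surj[OF assms] by (metis surj_fun_eq)
  show "\<exists>x. k = x \<circ> \<pi>"
    by (rule exI[of _ "k \<circ> inv \<pi>"]) (simp add: comp_assoc permutes_inv_o[OF assms])
qed

lemma psym_wconv:
  assumes f: "psym m \<sigma> f" and g: "psym m \<tau> g"
    and h: "\<And>k. cf h k = wconv \<beta> f g k"
    and \<beta>1: "\<And>a b i. \<beta> (a(i := - a i)) (b(i := - b i)) = \<beta> a b"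
    and \<beta>2: "\<And>a b \<pi>. \<pi> permutes {..<m} \<Longrightarrow> \<beta> (a \<circ> \<pi>) (b \<circ> \<pi>) = \<beta> a b"
  shows "psym m (\<sigma> * \<tau>) h"
  unfolding psym_def h
proof (intro conjI allI impI)
  fix k :: freq assume "\<exists>i\<ge>m. k i \<noteq> 0"
  then obtain i where i: "i \<ge> m" "k i \<noteq> 0" by blast
  show "wconv \<beta> f g k = 0"
    unfolding wconv_def
  proof (intro sum.neutral ballI)
    fix a b assume "a \<in> supp f" "b \<in> supp g"
    then have "a i = 0" "b i = 0" using f g i by (auto simp: psym_def in_keys_iff)
    then show "(if a + b = k then \<beta> a b *\<^sub>R (cf f a * cf g b) else 0) = 0" using i by auto
  qed
next
  fix k i assume "i < m"
  then show "wconv \<beta> f g (k(i := - k i)) = wconv \<beta> f g k"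
    using f g by (intro wconv_reindex[OF bij_flip] \<beta>1) (auto simp: psym_def)
next
  fix k \<pi> assume \<pi>: "\<pi> permutes {..<m}"
  then show "wconv \<beta> f g (k \<circ> \<pi>) = wconv \<beta> f g k"
    using f g by (intro wconv_reindex[OF bij_comp_permutes[OF \<pi>]] \<beta>2) (auto simp: psym_def)
next
  fix k t
  have app: "apply_bcontfun (wconv \<beta> f g k) t = (\<Sum>a\<in>supp f. \<Sum>b\<in>supp g.
     (if a + b = k then \<beta> a b * (apply_bcontfun (cf f a) t * apply_bcontfun (cf g b) t) else 0))" for t
  proof -
    have s: "apply_bcontfun (\<Sum>a\<in>A. u a) t = (\<Sum>a\<in>A. apply_bcontfun (u a) t)" for A and u :: "freq \<Rightarrow> tfun"
      by (induction A rule: infinite_finite_induct) auto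
    show ?thesis unfolding wconv_def s by (intro sum.cong refl) auto
  qed
  have "apply_bcontfun (cf f a) (- t) = \<sigma> * apply_bcontfun (cf f a) t"
    "apply_bcontfun (cf g a) (- t) = \<tau> * apply_bcontfun (cf g a) t" for a
    using f g by (auto simp: psym_def)
  then show "apply_bcontfun (wconv \<beta> f g k) (- t) = \<sigma> * \<tau> * apply_bcontfun (wconv \<beta> f g k) t"
    unfolding app sum_distrib_left by (intro sum.cong refl) (auto simp: mult_ac)
qed

lemma psym_mult: "psym m \<sigma> f \<Longrightarrow> psym m \<tau> g \<Longrightarrow> psym m (\<sigma> * \<tau>) (f * g)"
  by (rule psym_wconv[OF _ _ cf_times]) simp_all

lemma psym_Gop: "psym m \<sigma> f \<Longrightarrow> psym m \<tau> g \<Longrightarrow> psym m (\<sigma> * \<tau>) (Gop m f g)"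
proof (rule psym_wconv[OF _ _ cf_Gop])
  fix a b :: freq and \<pi> assume "\<pi> permutes {..<m}"
  then show "(\<Sum>i<m. real_of_int ((a \<circ> \<pi>) i) * real_of_int ((b \<circ> \<pi>) i)) = (\<Sum>i<m. real_of_int (a i) * real_of_int (b i))"
    using sum.permute[of \<pi> "{..<m}" "\<lambda>i. real_of_int (a i) * real_of_int (b i)"] by (simp add: o_def)
qed (auto intro!: sum.cong)

lemma sqn_flip [simp]: "sqn m (k(i := - k i)) = sqn m k"
  by (auto simp: sqn_def intro!: sum.cong)

lemma sqn_permutes: "\<pi> permutes {..<m} \<Longrightarrow> sqn m (k \<circ> \<pi>) = sqn m k"
  using sum.permute[of \<pi> "{..<m}" "\<lambda>i. nat \<bar>k i\<bar> ^ 2"] by (simp add: sqn_def o_def)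

lemma psym_Eop: "psym m \<sigma> f \<Longrightarrow> psym m \<sigma> (Eop m f)"
  by (auto simp: psym_def sqn_permutes)

lemma psym_aop: "psym m \<sigma> f \<Longrightarrow> psym m 1 (aop f)"
  by (auto simp: psym_def intro!: bcontfun_eqI)

section \<open>Power series and tame operators\<close>

unbundle no vec_syntax and fps_syntax

definition fmap :: "('a \<Rightarrow> 'b) \<Rightarrow> 'a fps \<Rightarrow> 'b fps" where
  "fmap h F = Abs_fps (\<lambda>j. h (F $ j))"

lemma fmap_nth [simp]: "fmap h F $ j = h (F $ j)"
  by (simp add: fmap_def)

definition cst :: "tfun \<Rightarrow> tser" where "cst c = fps_const (sng 0 c)"

definition GS :: "nat \<Rightarrow> tser \<Rightarrow> tser \<Rightarrow> tser" where
  "GS m F G = (\<Sum>i<m. fmap (Dop i) F * fmap (Dop i) G)"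

lemma GS_nth: "GS m F G $ j = (\<Sum>i=0..j. Gop m (F $ i) (G $ (j - i)))"
  unfolding GS_def Gop_def fps_sum_nth fps_mult_nth fmap_nth by (rule sum.swap)

text \<open>Truncated at order \<open>J\<close> because convergence is not known beforehand; a bound
  uniform in \<open>J\<close> is what the majorant argument has to deliver.\<close>

definition jet_norm :: "nat \<Rightarrow> nat \<Rightarrow> real \<Rightarrow> nat \<Rightarrow> (freq \<Rightarrow>\<^sub>0 'c::real_normed_vector) fps \<Rightarrow> real" where
  "jet_norm m p \<rho> J F = (\<Sum>j\<le>J. \<rho> ^ j * wnorm m p (F $ j))"

lemma jet_norm_nonneg [simp]: "0 \<le> \<rho> \<Longrightarrow> 0 \<le> jet_norm m p \<rho> J F"
  unfolding jet_norm_def by (intro sum_nonneg) auto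

lemma jet_norm_mono: "0 \<le> \<rho> \<Longrightarrow> p \<le> q \<Longrightarrow> jet_norm m p \<rho> J F \<le> jet_norm m q \<rho> J F"
  unfolding jet_norm_def by (intro sum_mono mult_left_mono wnorm_mono) auto

lemma jet_norm_add: "0 \<le> \<rho> \<Longrightarrow> jet_norm m p \<rho> J (F + G) \<le> jet_norm m p \<rho> J F + jet_norm m p \<rho> J G"
  unfolding jet_norm_def sum.distrib[symmetric] distrib_left[symmetric]
  by (intro sum_mono mult_left_mono) (auto simp: wnorm_add)

lemma jet_norm_minus [simp]: "jet_norm m p \<rho> J (- F) = jet_norm m p \<rho> J F"
  for F :: "(freq \<Rightarrow>\<^sub>0 'c::real_normed_vector) fps"
  by (simp add: jet_norm_def)

lemma jet_norm_diff: "0 \<le> \<rho> \<Longrightarrow> jet_norm m p \<rho> J (F - G) \<le> jet_norm m p \<rho> J F + jet_norm m p \<rho> J G"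
  for F :: "(freq \<Rightarrow>\<^sub>0 'c::real_normed_vector) fps"
  using jet_norm_add[of \<rho> m p J F "- G"] by simp

text \<open>The index pairs of the truncated Cauchy product form a triangle inside the square
  \<open>{..J} \<times> {..J}\<close>, and all terms are nonnegative.\<close>

lemma jet_norm_mult:
  fixes F G :: tser
  assumes "0 \<le> \<rho>"
  shows "jet_norm m p \<rho> J (F * G) \<le> jet_norm m p \<rho> J F * jet_norm m p \<rho> J G"
proof -
  let ?f = "\<lambda>j. \<rho> ^ j * wnorm m p (F $ j)" and ?g = "\<lambda>j. \<rho> ^ j * wnorm m p (G $ j)"
  have "jet_norm m p \<rho> J (F * G) \<le> (\<Sum>j\<le>J. \<Sum>i\<le>j. ?f i * ?g (j - i))"
    unfolding jet_norm_def
  proof (rule sum_mono)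
    fix j
    have "wnorm m p ((F * G) $ j) \<le> (\<Sum>i=0..j. wnorm m p (F $ i) * wnorm m p (G $ (j - i)))"
      unfolding fps_mult_nth by (intro order_trans[OF wnorm_sum] sum_mono wnorm_mult)
    then have "\<rho> ^ j * wnorm m p ((F * G) $ j) \<le> \<rho> ^ j * (\<Sum>i=0..j. wnorm m p (F $ i) * wnorm m p (G $ (j - i)))"
      using assms by (intro mult_left_mono) auto
    also have "\<dots> = (\<Sum>i\<le>j. ?f i * ?g (j - i))"
      unfolding sum_distrib_left
      by (rule sum.cong) (auto simp: mult_ac simp flip: power_add)
    finally show "\<rho> ^ j * wnorm m p ((F * G) $ j) \<le> (\<Sum>i\<le>j. ?f i * ?g (j - i))" .
  qed
  also have "\<dots> = (\<Sum>(i, j)\<in>{(i, j). i + j \<le> J}. ?f i * ?g j)"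
    by (rule sum.triangle_reindex_eq[symmetric])
  also have "\<dots> \<le> (\<Sum>(i, j)\<in>{..J} \<times> {..J}. ?f i * ?g j)"
    using assms by (intro sum_mono2) auto
  also have "\<dots> = jet_norm m p \<rho> J F * jet_norm m p \<rho> J G"
    by (simp add: jet_norm_def sum_product sum.cartesian_product)
  finally show ?thesis .
qed

lemma jet_norm_sum: "0 \<le> \<rho> \<Longrightarrow> jet_norm m p \<rho> J (\<Sum>i\<in>A. F i) \<le> (\<Sum>i\<in>A. jet_norm m p \<rho> J (F i))"
proof (induction A rule: infinite_finite_induct)
  case (insert x A)
  then show ?case using jet_norm_add[of \<rho> m p J "F x" "sum F A"] by simp
qed (auto simp: jet_norm_def)

lemma jet_norm_fmap_le:
  assumes "0 \<le> \<rho>" "\<And>f. wnorm m p (h f) \<le> C * wnorm m q f"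
  shows "jet_norm m p \<rho> J (fmap h F) \<le> C * jet_norm m q \<rho> J F"
proof -
  have "\<rho> ^ j * wnorm m p (h (F $ j)) \<le> C * (\<rho> ^ j * wnorm m q (F $ j))" for j
    using mult_left_mono[OF assms(2)[of "F $ j"], of "\<rho> ^ j"] assms(1) by (simp add: mult_ac)
  then show ?thesis unfolding jet_norm_def sum_distrib_left by (auto intro!: sum_mono)
qed

lemma jet_norm_fps_const: "jet_norm m p \<rho> J (fps_const c) = wnorm m p c"
proof -
  have "jet_norm m p \<rho> J (fps_const c) = (\<Sum>j\<le>J. if j = 0 then wnorm m p c else 0)"
    unfolding jet_norm_def by (intro sum.cong) auto
  then show ?thesis by simp
qed

text \<open>The source of all smallness: a factor \<open>s\<close> buys a factor
  \<open>\<rho>\<close> and at the same time one more order.\<close>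

lemma jet_norm_X_mult:
  fixes F :: tser
  assumes "0 \<le> \<rho>"
  shows "jet_norm m p \<rho> (Suc J) (fps_X * F) = \<rho> * jet_norm m p \<rho> J F"
  unfolding jet_norm_def sum_distrib_left
  by (subst sum.atMost_Suc_shift) (simp add: mult_ac)

lemma jet_norm_X_mult_0: "jet_norm m p \<rho> 0 (fps_X * F :: tser) = 0"
  by (simp add: jet_norm_def)

section \<open>Causal operators on series and their closure rules\<close>

text \<open>Only orders strictly below \<open>J\<close> count, so \<open>agree 0\<close> is vacuous
  and can start an induction; \<open>jet_norm\<close>, in contrast, includes order
  \<open>J\<close>.\<close>

definition agree :: "nat \<Rightarrow> 'a fps \<Rightarrow> 'a fps \<Rightarrow> bool" where
  "agree J F G \<longleftrightarrow> (\<forall>i<J. F $ i = G $ i)"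

definition sym_upto :: "nat \<Rightarrow> real \<Rightarrow> nat \<Rightarrow> tser \<Rightarrow> bool" where
  "sym_upto m \<sigma> J F \<longleftrightarrow> (\<forall>i<J. psym m \<sigma> (F $ i))"

lemma agree_X_mult: "agree J F G \<Longrightarrow> agree (Suc J) (fps_X * F) (fps_X * (G :: tser))"
  by (auto simp: agree_def)

lemma sym_upto_X_mult: "sym_upto m \<sigma> J F \<Longrightarrow> sym_upto m \<sigma> (Suc J) (fps_X * F)"
  by (auto simp: sym_upto_def less_Suc_eq_0_disj)

text \<open>The components of the unknown are \<open>Y\<close>, \<open>Y'\<close>, \<open>Y''\<close>, \<open>\<eta>\<close> and \<open>M\<close>; \<open>cord\<close> is the number of \<open>x\<close>-derivatives that are
  controlled, \<open>cpar\<close> the parity in \<open>t\<close>. Treating the \<open>t\<close>-derivatives as separate unknowns avoids differentiating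
  the coefficients.\<close>

datatype comp = CY | CY1 | CY2 | Eta | Mu

primrec cord :: "comp \<Rightarrow> nat" where
  "cord CY = 3" | "cord CY1 = 2" | "cord CY2 = 1" | "cord Eta = 3" | "cord Mu = 3"

primrec cpar :: "comp \<Rightarrow> real" where
  "cpar CY = -1" | "cpar CY1 = 1" | "cpar CY2 = -1" | "cpar Eta = 1" | "cpar Mu = 1"

definition jets_bounded :: "nat \<Rightarrow> real \<Rightarrow> nat \<Rightarrow> real \<Rightarrow> (comp \<Rightarrow> tser) \<Rightarrow> bool" where
  "jets_bounded m \<rho> J R x \<longleftrightarrow> (\<forall>c. jet_norm m (cord c) \<rho> J (x c) \<le> R)"

text \<open>Three properties inherited together by sums and products: boundedness on bounded sets
  with a constant independent of \<open>J\<close> and of \<open>\<rho> \<le> 1\<close>, causality in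
  \<open>s\<close>, and preservation of the symmetries. No smallness of \<open>C\<close> is asked
  for; it will come from the factors \<open>s\<close> alone.\<close>

definition tame :: "nat \<Rightarrow> nat \<Rightarrow> real \<Rightarrow> ((comp \<Rightarrow> tser) \<Rightarrow> tser) \<Rightarrow> bool" where
  "tame m p \<sigma> f \<longleftrightarrow>
     (\<forall>R. \<exists>C\<ge>0. \<forall>\<rho>\<in>{0..1}. \<forall>J x. jets_bounded m \<rho> J R x \<longrightarrow> jet_norm m p \<rho> J (f x) \<le> C) \<and>
     (\<forall>J x y. (\<forall>c. agree J (x c) (y c)) \<longrightarrow> agree J (f x) (f y)) \<and>
     (\<forall>J x. (\<forall>c. sym_upto m (cpar c) J (x c)) \<longrightarrow> sym_upto m \<sigma> J (f x))"

lemma tame_bound: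
  assumes "tame m p \<sigma> f"
  obtains C where "C \<ge> 0" "\<And>\<rho> J x. 0 \<le> \<rho> \<Longrightarrow> \<rho> \<le> 1 \<Longrightarrow> jets_bounded m \<rho> J R x \<Longrightarrow> jet_norm m p \<rho> J (f x) \<le> C"
  using assms unfolding tame_def by (metis atLeastAtMost_iff)

lemma tame_agree: "tame m p \<sigma> f \<Longrightarrow> (\<And>c. agree J (x c) (y c)) \<Longrightarrow> agree J (f x) (f y)"
  by (simp add: tame_def)

lemma tame_sym_upto: "tame m p \<sigma> f \<Longrightarrow> (\<And>c. sym_upto m (cpar c) J (x c)) \<Longrightarrow> sym_upto m \<sigma> J (f x)"
  by (simp add: tame_def)

lemma tame_comp: "p \<le> cord c \<Longrightarrow> \<sigma> = cpar c \<Longrightarrow> tame m p \<sigma> (\<lambda>x. x c)"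
  unfolding tame_def jets_bounded_def
proof (intro conjI allI impI, goal_cases)
  case (1 R)
  then show ?case
    by (intro exI[of _ "max 0 R"]) (auto intro: order_trans[OF jet_norm_mono] simp: le_max_iff_disj)
qed auto

lemma tame_const:
  assumes "psym m \<sigma> f"
  shows "tame m p \<sigma> (\<lambda>x. fps_const f)"
  unfolding tame_def
proof (intro conjI allI impI, goal_cases)
  case (1 R)
  then show ?case by (intro exI[of _ "wnorm m p f"]) (auto simp: jet_norm_fps_const)
qed (use assms in \<open>auto simp: agree_def sym_upto_def\<close>)

lemma tame_cst:
  assumes "\<And>t. apply_bcontfun c (- t) = \<sigma> * apply_bcontfun c t"
  shows "tame m p \<sigma> (\<lambda>x. cst c)"
  unfolding cst_def by (intro tame_const psym_sng_0 assms)

lemma tame_X: "tame m p 1 (\<lambda>x. fps_X)"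
  unfolding tame_def
proof (intro conjI allI impI, goal_cases)
  case (1 R)
  have "jet_norm m p \<rho> J (fps_X :: tser) \<le> wnorm m p (1 :: tpoly)" if "0 \<le> \<rho>" "\<rho> \<le> 1" for \<rho> J
  proof -
    have "jet_norm m p \<rho> J (fps_X :: tser) = (\<Sum>j\<le>J. if j = 1 then \<rho> * wnorm m p (1 :: tpoly) else 0)"
      unfolding jet_norm_def by (intro sum.cong) auto
    then show ?thesis using that by (auto simp: mult_left_le_one_le)
  qed
  then show ?case by (intro exI[of _ "wnorm m p (1::tpoly)"]) auto
next
  case (3 J x)
  have "psym m 1 (sng 0 (1::tfun))" by (rule psym_sng_0) simp
  then show ?case by (auto simp: sym_upto_def simp flip: single_one)
qed (auto simp: agree_def)

lemma tame_binary:
  assumes f: "tame m p \<sigma> f" and g: "tame m q \<tau> g"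
    and bd: "\<And>\<rho> J F G. 0 \<le> \<rho> \<Longrightarrow> jet_norm m r \<rho> J (h F G) \<le> b (jet_norm m p \<rho> J F) (jet_norm m q \<rho> J G)"
    and mono: "\<And>x y x' y'. 0 \<le> x \<Longrightarrow> x \<le> x' \<Longrightarrow> 0 \<le> y \<Longrightarrow> y \<le> y' \<Longrightarrow> b x y \<le> b x' (y'::real)"
    and ag: "\<And>J F F' G G'. agree J F F' \<Longrightarrow> agree J G G' \<Longrightarrow> agree J (h F G) (h F' G')"
    and sy: "\<And>J F G. sym_upto m \<sigma> J F \<Longrightarrow> sym_upto m \<tau> J G \<Longrightarrow> sym_upto m \<upsilon> J (h F G)"
  shows "tame m r \<upsilon> (\<lambda>x. h (f x) (g x))"
  unfolding tame_def
proof (intro conjI allI impI)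
  fix R
  obtain C where C: "C \<ge> 0" "\<And>\<rho> J x. 0 \<le> \<rho> \<Longrightarrow> \<rho> \<le> 1 \<Longrightarrow> jets_bounded m \<rho> J R x \<Longrightarrow> jet_norm m p \<rho> J (f x) \<le> C"
    by (rule tame_bound[OF f, of R]) blast
  obtain D where D: "D \<ge> 0" "\<And>\<rho> J x. 0 \<le> \<rho> \<Longrightarrow> \<rho> \<le> 1 \<Longrightarrow> jets_bounded m \<rho> J R x \<Longrightarrow> jet_norm m q \<rho> J (g x) \<le> D"
    by (rule tame_bound[OF g, of R]) blast
  have "jet_norm m r \<rho> J (h (f x) (g x)) \<le> b C D" if "0 \<le> \<rho>" "\<rho> \<le> 1" "jets_bounded m \<rho> J R x" for \<rho> J x
    using that by (intro order_trans[OF bd mono] C D) auto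
  then show "\<exists>C\<ge>0. \<forall>\<rho>\<in>{0..1}. \<forall>J x. jets_bounded m \<rho> J R x \<longrightarrow> jet_norm m r \<rho> J (h (f x) (g x)) \<le> C"
    by (intro exI[of _ "max 0 (b C D)"]) (auto simp: le_max_iff_disj)
qed (use tame_agree[OF f] tame_agree[OF g] tame_sym_upto[OF f] tame_sym_upto[OF g] in \<open>auto intro!: ag sy\<close>)

lemma tame_add: "tame m p \<sigma> f \<Longrightarrow> tame m p \<sigma> g \<Longrightarrow> tame m p \<sigma> (\<lambda>x. f x + g x)"
  by (rule tame_binary[where b = "(+)"]) (auto simp: jet_norm_add agree_def sym_upto_def psym_add)

lemma tame_diff: "tame m p \<sigma> f \<Longrightarrow> tame m p \<sigma> g \<Longrightarrow> tame m p \<sigma> (\<lambda>x. f x - g x)"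
  by (rule tame_binary[where b = "(+)"]) (auto simp: jet_norm_diff agree_def sym_upto_def psym_diff)

lemma tame_mult: "tame m p \<sigma> f \<Longrightarrow> tame m p \<tau> g \<Longrightarrow> \<upsilon> = \<sigma> * \<tau> \<Longrightarrow> tame m p \<upsilon> (\<lambda>x. f x * g x)"
proof (rule tame_binary[where b = times], assumption, assumption)
  fix J F G assume "sym_upto m \<sigma> J F" "sym_upto m \<tau> J G" "\<upsilon> = \<sigma> * \<tau>"
  then show "sym_upto m \<upsilon> J (F * G)"
    by (auto simp: sym_upto_def fps_mult_nth intro!: psym_sum psym_mult)
qed (auto simp: jet_norm_mult mult_mono agree_def fps_mult_nth intro!: sum.cong)

lemma jet_norm_GS:
  assumes "0 \<le> \<rho>"
  shows "jet_norm m p \<rho> J (GS m F G) \<le> real m * (jet_norm m (Suc p) \<rho> J F * jet_norm m (Suc p) \<rho> J G)"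
proof -
  have *: "jet_norm m p \<rho> J (fmap (Dop i) F) \<le> jet_norm m (Suc p) \<rho> J F" if "i < m" for i F
    using jet_norm_fmap_le[OF assms, of m p "Dop i" 1 "Suc p"] wnorm_Dop[OF that] by simp
  have "jet_norm m p \<rho> J (GS m F G) \<le> (\<Sum>i<m. jet_norm m (Suc p) \<rho> J F * jet_norm m (Suc p) \<rho> J G)"
    unfolding GS_def using assms
    by (intro order_trans[OF jet_norm_sum] sum_mono order_trans[OF jet_norm_mult] mult_mono *) auto
  then show ?thesis by simp
qed

lemma tame_GS: "tame m (Suc p) \<sigma> f \<Longrightarrow> tame m (Suc p) \<tau> g \<Longrightarrow> \<upsilon> = \<sigma> * \<tau> \<Longrightarrow> tame m p \<upsilon> (\<lambda>x. GS m (f x) (g x))"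
proof (rule tame_binary[where b = "\<lambda>x y. real m * (x * y)"], assumption, assumption)
  fix J F G assume "sym_upto m \<sigma> J F" "sym_upto m \<tau> J G" "\<upsilon> = \<sigma> * \<tau>"
  then show "sym_upto m \<upsilon> J (GS m F G)"
    by (auto simp: sym_upto_def GS_nth intro!: psym_sum psym_Gop)
qed (auto simp: jet_norm_GS agree_def GS_nth intro!: mult_left_mono mult_mono sum.cong)

lemma tame_unary:
  assumes f: "tame m p \<sigma> f"
    and bd: "\<And>g. wnorm m q (h g) \<le> wnorm m p g"
    and sy: "\<And>g. psym m \<sigma> g \<Longrightarrow> psym m \<tau> (h g)"
  shows "tame m q \<tau> (\<lambda>x. fmap h (f x))"
proof (rule tame_binary[OF f f, where b = "\<lambda>x y. x" and h = "\<lambda>F G. fmap h F"])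
  fix \<rho> J F and G :: tser assume "0 \<le> (\<rho>::real)"
  then show "jet_norm m q \<rho> J (fmap h F) \<le> jet_norm m p \<rho> J F"
    using jet_norm_fmap_le[of \<rho> m q h 1 p J F] bd by simp
qed (use sy in \<open>auto simp: agree_def sym_upto_def\<close>)

lemma tame_E: "tame m (Suc (Suc p)) \<sigma> f \<Longrightarrow> tame m p \<sigma> (\<lambda>x. fmap (Eop m) (f x))"
  by (erule tame_unary) (auto simp: wnorm_Eop psym_Eop)

lemma tame_aop: "tame m p \<sigma> f \<Longrightarrow> tame m p 1 (\<lambda>x. fmap aop (f x))"
  by (erule tame_unary) (auto simp: wnorm_aop psym_aop)

text \<open>Each application of \<open>\<Phi>\<close> settles one further coefficient for good. The
  \<open>j\<close>-th coefficient of the fixed point is therefore read off iterate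
  \<open>Suc j\<close>, starting from zero.\<close>

lemma causal_fixpoint:
  fixes \<Phi> :: "('i \<Rightarrow> 'a::zero fps) \<Rightarrow> 'i \<Rightarrow> 'a fps"
  assumes "\<And>J x y. (\<And>c. agree J (x c) (y c)) \<Longrightarrow> (\<And>c. agree (Suc J) (\<Phi> x c) (\<Phi> y c))"
  shows "\<exists>x. \<Phi> x = x"
proof -
  define X where "X p = (\<Phi> ^^ p) (\<lambda>_. Abs_fps (\<lambda>_. 0))" for p
  have step: "agree p (X p c) (X (Suc p) c)" for p c
  proof (induction p arbitrary: c)
    case (Suc p)
    show ?case using assms[OF Suc] by (simp add: X_def)
  qed (simp add: agree_def)
  have later: "agree p (X p c) (X (p + q) c)" for p q c
  proof (induction q)
    case (Suc q)
    then show ?case using step[of "p + q" c] by (auto simp: agree_def)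
  qed (simp add: agree_def)
  define L where "L c = Abs_fps (\<lambda>j. X (Suc j) c $ j)" for c
  have L: "agree p (L c) (X p c)" for p c
    unfolding agree_def
  proof (intro allI impI)
    fix i assume "i < p"
    then show "L c $ i = X p c $ i"
      using later[of "Suc i" c "p - Suc i"] by (auto simp: L_def agree_def)
  qed
  have "\<Phi> L c $ j = L c $ j" for c j
    using assms[of j L "X j" c, OF L] L[of "Suc j" c] by (auto simp: agree_def X_def)
  then show ?thesis by (intro exI[of _ L] ext fps_ext)
qed

section \<open>The boundary value problem for one frequency\<close>

lemma abs_mult_le: "\<bar>u\<bar> \<le> c \<Longrightarrow> \<bar>w\<bar> \<le> d \<Longrightarrow> \<bar>u * w\<bar> \<le> c * d"
  for u w c d :: real
  unfolding abs_mult by (rule mult_mono) auto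

definition prim :: "(real \<Rightarrow> real) \<Rightarrow> real \<Rightarrow> real" where
  "prim g t = integral {-1..t} g"

lemma prim_deriv [derivative_intros]:
  assumes "continuous_on {-1..1} g" "t \<in> {-1..1}"
  shows "(prim g has_real_derivative g t) (at t within {-1..1})"
  unfolding prim_def [abs_def] using assms by (intro integral_has_real_derivative)

lemma prim_minus_one [simp]: "prim g (-1) = 0"
  by (simp add: prim_def)

lemma prim_diff:
  assumes "continuous_on {-1..1} g" "-1 \<le> a" "a \<le> b" "b \<le> 1"
  shows "prim g b - prim g a = integral {a..b} g"
proof -
  have "g integrable_on {-1..b}"
    using assms by (intro integrable_continuous_interval continuous_on_subset[OF assms(1)]) auto
  from Henstock_Kurzweil_Integration.integral_combine[of "-1" a b g, OF _ _ this] show ?thesis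
    using assms by (simp add: prim_def)
qed

text \<open>\<open>G\<close> is an explicit antiderivative of a majorant of \<open>g\<close>.
  Keeping the exponential majorant instead of its maximum is what yields the powers of
  \<open>r\<close> in \<open>green_bounds\<close>.\<close>

lemma prim_diff_bound:
  assumes g: "continuous_on {-1..1} g" and "-1 \<le> a" "a \<le> b" "b \<le> 1"
    and G: "\<And>t. t \<in> {-1..1} \<Longrightarrow> (G has_real_derivative G' t) (at t)"
    and G': "continuous_on {-1..1} G'"
    and bd: "\<And>t. t \<in> {-1..1} \<Longrightarrow> \<bar>g t\<bar> \<le> G' t"
  shows "\<bar>prim g b - prim g a\<bar> \<le> G b - G a"
proof -
  have "(G' has_integral (G b - G a)) {a..b}"
    using assms by (intro fundamental_theorem_of_calculus)
      (auto simp flip: has_real_derivative_iff_has_vector_derivative intro: has_field_derivative_at_within)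
  moreover have "norm (integral {a..b} g) \<le> integral {a..b} G'"
    using assms by (intro integral_norm_bound_integral integrable_continuous_interval
        continuous_on_subset[OF g] continuous_on_subset[OF G']) auto
  ultimately show ?thesis using prim_diff[OF assms(1-4)] by (simp add: integral_unique)
qed

lemma prim_diff_bound_const:
  assumes g: "continuous_on {-1..1} g" and "a \<in> {-1..1}" "b \<in> {-1..1}"
    and bd: "\<And>t. t \<in> {-1..1} \<Longrightarrow> \<bar>g t\<bar> \<le> F"
  shows "\<bar>prim g b - prim g a\<bar> \<le> 2 * F"
proof -
  have *: "\<bar>prim g b - prim g a\<bar> \<le> 2 * F" if "a \<le> b" "a \<in> {-1..1}" "b \<in> {-1..1}" for a b
  proof -
    have "\<bar>prim g b - prim g a\<bar> \<le> F * b - F * a"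
      using that bd g by (intro prim_diff_bound[where G' = "\<lambda>_. F"]) (auto intro!: derivative_eq_intros)
    also have "\<dots> = F * (b - a)" by (simp add: algebra_simps)
    also have "\<dots> \<le> F * 2" using that bd[of 0] by (intro mult_left_mono) auto
    finally show ?thesis by simp
  qed
  show ?thesis
    using *[of a b] *[of b a] assms by (cases "a \<le> b") (auto simp: abs_minus_commute)
qed

text \<open>Reflection turns an integral from the left end into one up to the right end; it thereby
  exchanges the two integrals in \<open>green\<close>.\<close>

lemma prim_reflect:
  assumes g: "continuous_on {-1..1} g" and h: "\<And>s. s \<in> {-1..1} \<Longrightarrow> h s = - g (- s)" and "t \<in> {-1..1}"
  shows "prim g (- t) = - (prim h 1 - prim h t)"
proof -
  have ch: "continuous_on {-1..1} h"
  proof -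
    have "continuous_on {-1..1} (\<lambda>s. - g (- s))"
      by (intro continuous_intros continuous_on_compose2[OF g]) auto
    then show ?thesis using h by (subst continuous_on_cong[OF refl h]) auto
  qed
  have "prim g (- t) = integral {-1..-t} (\<lambda>s. - h (- s))"
    unfolding prim_def using h assms(3) by (intro Henstock_Kurzweil_Integration.integral_cong) auto
  also have "\<dots> = - integral {t..1} h"
    using integral_reflect_real[of 1 t h] by simp
  finally show ?thesis using prim_diff[OF ch, of t 1] assms(3) by simp
qed

subsection \<open>Exponential modes\<close>

text \<open>Given by Green's function for the Neumann problem \<open>z'' - r\<^sup>2 z = f\<close>, \<open>z' (-1) = z' 1 = \<beta>\<close>, so that the solution is odd for odd \<open>f\<close>.\<close>

definition green :: "real \<Rightarrow> (real \<Rightarrow> real) \<Rightarrow> real \<Rightarrow> real \<Rightarrow> real" where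
  "green r f \<beta> t = \<beta> * sinh (r * t) / (r * cosh r) -
     (cosh (r * (1 - t)) * prim (\<lambda>s. cosh (r * (1 + s)) * f s) t +
      cosh (r * (1 + t)) * (prim (\<lambda>s. cosh (r * (1 - s)) * f s) 1 - prim (\<lambda>s. cosh (r * (1 - s)) * f s) t))
       / (r * sinh (2 * r))"

definition green' :: "real \<Rightarrow> (real \<Rightarrow> real) \<Rightarrow> real \<Rightarrow> real \<Rightarrow> real" where
  "green' r f \<beta> t = \<beta> * cosh (r * t) / cosh r -
     (- sinh (r * (1 - t)) * prim (\<lambda>s. cosh (r * (1 + s)) * f s) t +
      sinh (r * (1 + t)) * (prim (\<lambda>s. cosh (r * (1 - s)) * f s) 1 - prim (\<lambda>s. cosh (r * (1 - s)) * f s) t))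
       / sinh (2 * r)"

context
  fixes r :: real and f :: "real \<Rightarrow> real" and \<beta> :: real
  assumes r: "r > 0" and f: "continuous_on {-1..1} f"
begin

lemma green_cont:
  "continuous_on {-1..1} (\<lambda>s. cosh (r * (1 + s)) * f s)"
  "continuous_on {-1..1} (\<lambda>s. cosh (r * (1 - s)) * f s)"
  by (intro continuous_intros f)+

text \<open>Up to the factor \<open>r\<close> this is the Wronskian of
  \<open>cosh (r * (1 - t))\<close> and \<open>cosh (r * (1 + t))\<close>, the solutions satisfying
  the Neumann condition at one end each; hence it does not depend on \<open>t\<close>.\<close>

lemma sinh_2r: "sinh (2 * r) = sinh (r * (1 - t)) * cosh (r * (1 + t)) + cosh (r * (1 - t)) * sinh (r * (1 + t))"
  using sinh_add[of "r * (1 - t)" "r * (1 + t)"] by (simp add: algebra_simps)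

lemma green_deriv:
  assumes t: "t \<in> {-1..1}"
  shows "(green r f \<beta> has_real_derivative green' r f \<beta> t) (at t within {-1..1})"
proof -
  have "sinh (2 * r) \<noteq> 0" "cosh r \<noteq> 0" using r by (auto simp: sinh_zero_iff)
  then show ?thesis
    unfolding green_def [abs_def] green'_def
    using r by (auto intro!: derivative_eq_intros prim_deriv green_cont t)
      (simp add: field_simps)
qed

lemma green'_deriv:
  assumes t: "t \<in> {-1..1}"
  shows "(green' r f \<beta> has_real_derivative (r\<^sup>2 * green r f \<beta> t + f t)) (at t within {-1..1})"
proof -
  let ?A = "prim (\<lambda>s. cosh (r * (1 + s)) * f s) t"
  let ?B = "prim (\<lambda>s. cosh (r * (1 - s)) * f s) 1 - prim (\<lambda>s. cosh (r * (1 - s)) * f s) t"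
  let ?D = "\<beta> * (r * sinh (r * t)) / cosh r -
     (r * cosh (r * (1 - t)) * ?A - sinh (r * (1 - t)) * (cosh (r * (1 + t)) * f t)
      + r * cosh (r * (1 + t)) * ?B - sinh (r * (1 + t)) * (cosh (r * (1 - t)) * f t)) / sinh (2 * r)"
  have nz: "sinh (2 * r) \<noteq> 0" "cosh r \<noteq> 0" using r by (auto simp: sinh_zero_iff)
  have "(green' r f \<beta> has_real_derivative ?D) (at t within {-1..1})"
    unfolding green'_def [abs_def]
    using nz by (auto intro!: derivative_eq_intros prim_deriv green_cont t) (simp add: algebra_simps)
  moreover have "?D = r\<^sup>2 * green r f \<beta> t + f t"
  proof -
    \<comment> \<open>The terms from differentiating the limits of integration add up to
      \<open>f t\<close> times the Wronskian, which cancels the denominator.\<close>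
    have "f t = (sinh (r * (1 - t)) * cosh (r * (1 + t)) + cosh (r * (1 - t)) * sinh (r * (1 + t))) * f t / sinh (2 * r)"
      using nz by (simp flip: sinh_2r)
    then show ?thesis
      unfolding green_def using nz r by (simp add: field_simps power2_eq_square)
  qed
  ultimately show ?thesis by simp
qed

lemma green'_1: "green' r f \<beta> 1 = \<beta>"
  by (simp add: green'_def)

text \<open>The kernel has constant sign, so \<open>f\<close> may be replaced by the constant
  \<open>F\<close>; the integrals are then explicit and add up to the Wronskian
  \<open>sinh (2 * r)\<close>. The solution gains \<open>r\<^sup>2\<close> over \<open>f\<close> and
  \<open>r\<close> over \<open>\<beta>\<close>.\<close>

lemma green_bounds:
  assumes F: "\<And>s. s \<in> {-1..1} \<Longrightarrow> \<bar>f s\<bar> \<le> F" and t: "t \<in> {-1..1}"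
  shows "\<bar>green r f \<beta> t\<bar> \<le> \<bar>\<beta>\<bar> / r + F / r\<^sup>2" "\<bar>green' r f \<beta> t\<bar> \<le> \<bar>\<beta>\<bar> + 2 * F / r"
proof -
  let ?A = "prim (\<lambda>s. cosh (r * (1 + s)) * f s) t"
  let ?B = "prim (\<lambda>s. cosh (r * (1 - s)) * f s) 1 - prim (\<lambda>s. cosh (r * (1 - s)) * f s) t"
  let ?a = "r * (1 - t)" and ?b = "r * (1 + t)"
  have F0: "F \<ge> 0" using F[of 0] by auto
  have ab: "?a \<ge> 0" "?b \<ge> 0" using r t by auto
  have S: "sinh (2 * r) > 0" using r by simp
  have sum: "sinh (2 * r) = sinh ?a * cosh ?b + cosh ?a * sinh ?b" by (rule sinh_2r)
  have "\<bar>?A - prim (\<lambda>s. cosh (r * (1 + s)) * f s) (-1)\<bar> \<le> sinh ?b / r * F - sinh (r * (1 + -1)) / r * F"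
    using r t by (intro prim_diff_bound[where G' = "\<lambda>s. cosh (r * (1 + s)) * F"] green_cont)
      (auto intro!: derivative_eq_intros continuous_intros mult_left_mono F simp: abs_mult)
  then have A: "\<bar>?A\<bar> \<le> sinh ?b / r * F" by simp
  have "\<bar>?B\<bar> \<le> (- sinh (r * (1 - 1)) / r * F) - (- sinh ?a / r * F)"
    using r t by (intro prim_diff_bound[where G' = "\<lambda>s. cosh (r * (1 - s)) * F"] green_cont)
      (auto intro!: derivative_eq_intros continuous_intros mult_left_mono F simp: abs_mult)
  then have B: "\<bar>?B\<bar> \<le> sinh ?a / r * F" by simp
  have "\<bar>cosh ?a * ?A + cosh ?b * ?B\<bar> \<le> cosh ?a * (sinh ?b / r * F) + cosh ?b * (sinh ?a / r * F)"
    using A B by (intro order_trans[OF abs_triangle_ineq] add_mono abs_mult_le) auto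
  also have "\<dots> = sinh (2 * r) * (F / r)" unfolding sum by (simp add: algebra_simps add_divide_distrib)
  finally have 1: "\<bar>(cosh ?a * ?A + cosh ?b * ?B) / (r * sinh (2 * r))\<bar> \<le> F / r\<^sup>2"
    using r S by (simp add: abs_mult divide_simps power2_eq_square mult_ac)
  have "\<bar>sinh (r * t)\<bar> \<le> cosh r"
  proof -
    have "\<bar>sinh (r * t)\<bar> = sinh (r * \<bar>t\<bar>)" by (cases "t \<ge> 0") (use r in \<open>auto simp: mult_nonneg_nonpos\<close>)
    also have "\<dots> \<le> sinh r" using r t by (auto simp: mult_left_le)
    also have "\<dots> \<le> cosh r" using sinh_less_cosh_real[of r] by linarith
    finally show ?thesis .
  qed
  then have 2: "\<bar>\<beta> * sinh (r * t) / (r * cosh r)\<bar> \<le> \<bar>\<beta>\<bar> / r"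
    using r by (simp add: abs_mult divide_simps mult_left_mono)
  show "\<bar>green r f \<beta> t\<bar> \<le> \<bar>\<beta>\<bar> / r + F / r\<^sup>2"
    unfolding green_def using 1 2 by linarith
  have "\<bar>- sinh ?a * ?A + sinh ?b * ?B\<bar> \<le> sinh ?a * (sinh ?b / r * F) + sinh ?b * (sinh ?a / r * F)"
    using A B ab by (intro order_trans[OF abs_triangle_ineq] add_mono abs_mult_le) auto
  also have "\<dots> = 2 * (sinh ?a * sinh ?b) * (F / r)" by (simp add: field_simps)
  also have "\<dots> \<le> 2 * sinh (2 * r) * (F / r)"
  proof (intro mult_right_mono mult_left_mono)
    have "sinh ?a * sinh ?b \<le> sinh ?a * cosh ?b"
      using ab sinh_less_cosh_real[of ?b] by (intro mult_left_mono) auto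
    also have "\<dots> \<le> sinh (2 * r)" using sum ab by simp
    finally show "sinh ?a * sinh ?b \<le> sinh (2 * r)" .
  qed (use F0 r in auto)
  finally have 3: "\<bar>(- sinh ?a * ?A + sinh ?b * ?B) / sinh (2 * r)\<bar> \<le> 2 * F / r"
    using r S by (simp add: divide_simps mult_ac)
  have "cosh (r * t) \<le> cosh r"
  proof -
    have "cosh (r * t) = cosh (r * \<bar>t\<bar>)" by (cases "t \<ge> 0") auto
    also have "\<dots> \<le> cosh r" using r t by (subst cosh_real_nonneg_le_iff) (auto simp: mult_left_le)
    finally show ?thesis .
  qed
  then have 4: "\<bar>\<beta> * cosh (r * t) / cosh r\<bar> \<le> \<bar>\<beta>\<bar>"
    by (simp add: abs_mult divide_simps mult_left_mono)
  show "\<bar>green' r f \<beta> t\<bar> \<le> \<bar>\<beta>\<bar> + 2 * F / r"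
    unfolding green'_def using 3 4 by linarith
qed

lemma green_odd:
  assumes odd: "\<And>s. f (- s) = - f s" and t: "t \<in> {-1..1}"
  shows "green r f \<beta> (- t) = - green r f \<beta> t" "green' r f \<beta> (- t) = green' r f \<beta> t"
proof -
  let ?a = "\<lambda>s. cosh (r * (1 + s)) * f s" and ?b = "\<lambda>s. cosh (r * (1 - s)) * f s"
  have A: "prim ?a (- t) = - (prim ?b 1 - prim ?b t)"
    using t odd by (intro prim_reflect green_cont) auto
  have "prim ?a (- (- t)) = - (prim ?b 1 - prim ?b (- t))"
    using t odd by (intro prim_reflect green_cont) auto
  then have B: "prim ?b 1 - prim ?b (- t) = - prim ?a t" by simp
  have e: "r * (1 - - t) = r * (1 + t)" "r * (1 + - t) = r * (1 - t)" "r * - t = - (r * t)" by simp_all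
  have alg: "\<beta> * (- w) / c - (a * (- P) + b * (- Q)) / d = - (\<beta> * w / c - (b * Q + a * P) / d)"
    "u - (- a * (- P) + b * (- Q)) / d = u - (- b * Q + a * P) / d" for u c w a b P Q d :: real
    by (simp_all add: diff_divide_distrib add_divide_distrib)
  show "green r f \<beta> (- t) = - green r f \<beta> t"
    unfolding green_def A B e sinh_minus by (rule alg)
  show "green' r f \<beta> (- t) = green' r f \<beta> t"
    unfolding green'_def A B e cosh_minus by (rule alg)
qed

end

subsection \<open>Oscillatory modes\<close>

text \<open>The solution of \<open>z'' + q\<^sup>2 z = f\<close> with \<open>z 0 = 0\<close> and free parameter \<open>A\<close>.\<close>

definition volt :: "real \<Rightarrow> (real \<Rightarrow> real) \<Rightarrow> real \<Rightarrow> real \<Rightarrow> real" where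
  "volt q f A t = (sin (q * t) * (prim (\<lambda>s. cos (q * s) * f s) t - prim (\<lambda>s. cos (q * s) * f s) 0) -
     cos (q * t) * (prim (\<lambda>s. sin (q * s) * f s) t - prim (\<lambda>s. sin (q * s) * f s) 0)) / q + A * sin (q * t)"

definition volt' :: "real \<Rightarrow> (real \<Rightarrow> real) \<Rightarrow> real \<Rightarrow> real \<Rightarrow> real" where
  "volt' q f A t = cos (q * t) * (prim (\<lambda>s. cos (q * s) * f s) t - prim (\<lambda>s. cos (q * s) * f s) 0) +
     sin (q * t) * (prim (\<lambda>s. sin (q * s) * f s) t - prim (\<lambda>s. sin (q * s) * f s) 0) + A * q * cos (q * t)"

context
  fixes q :: real and f :: "real \<Rightarrow> real" and A :: real
  assumes q: "q > 0" and f: "continuous_on {-1..1} f"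
begin

lemma volt_cont:
  "continuous_on {-1..1} (\<lambda>s. cos (q * s) * f s)"
  "continuous_on {-1..1} (\<lambda>s. sin (q * s) * f s)"
  by (intro continuous_intros f)+

lemma volt_deriv:
  assumes t: "t \<in> {-1..1}"
  shows "(volt q f A has_real_derivative volt' q f A t) (at t within {-1..1})"
  unfolding volt_def [abs_def] volt'_def
  using q by (auto intro!: derivative_eq_intros prim_deriv volt_cont t) (simp_all add: field_simps)

lemma volt'_deriv:
  assumes t: "t \<in> {-1..1}"
  shows "(volt' q f A has_real_derivative (- q\<^sup>2 * volt q f A t + f t)) (at t within {-1..1})"
proof -
  let ?C = "prim (\<lambda>s. cos (q * s) * f s) t - prim (\<lambda>s. cos (q * s) * f s) 0"
  let ?S = "prim (\<lambda>s. sin (q * s) * f s) t - prim (\<lambda>s. sin (q * s) * f s) 0"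
  have "(volt' q f A has_real_derivative
      (- q * sin (q * t) * ?C + cos (q * t) * (cos (q * t) * f t) + q * cos (q * t) * ?S
        + sin (q * t) * (sin (q * t) * f t) - A * q * (q * sin (q * t)))) (at t within {-1..1})"
    unfolding volt'_def [abs_def]
    by (auto intro!: derivative_eq_intros prim_deriv volt_cont t)
  moreover have "cos (q * t) * (cos (q * t) * f t) + sin (q * t) * (sin (q * t) * f t) = f t"
    using sin_cos_squared_add[of "q * t"] by (metis distrib_right mult.assoc mult_1 power2_eq_square add.commute)
  moreover have "- q\<^sup>2 * ((x * C - y * S) / q + A * x) = - q * x * C + q * y * S - A * q * (q * x)" for x y C S
    using q by (simp add: field_simps power2_eq_square)
  then have "- q\<^sup>2 * volt q f A t = - q * sin (q * t) * ?C + q * cos (q * t) * ?S - A * q * (q * sin (q * t))"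
    unfolding volt_def .
  ultimately show ?thesis
    by (auto elim!: DERIV_cong)
qed

lemma volt_bounds:
  assumes F: "\<And>s. s \<in> {-1..1} \<Longrightarrow> \<bar>f s\<bar> \<le> F" and t: "t \<in> {-1..1}"
  shows "\<bar>volt q f A t\<bar> \<le> 4 * F / q + \<bar>A\<bar>" "\<bar>volt' q f A t\<bar> \<le> 4 * F + \<bar>A\<bar> * q"
proof -
  let ?C = "prim (\<lambda>s. cos (q * s) * f s) t - prim (\<lambda>s. cos (q * s) * f s) 0"
  let ?S = "prim (\<lambda>s. sin (q * s) * f s) t - prim (\<lambda>s. sin (q * s) * f s) 0"
  have F0: "F \<ge> 0" using F[of 0] by auto
  have *: "\<bar>u * w\<bar> \<le> c" if "\<bar>u\<bar> \<le> 1" "\<bar>w\<bar> \<le> c" for u w c :: real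
    using mult_mono[OF that] that by (simp add: abs_mult)
  have C: "\<bar>?C\<bar> \<le> 2 * F" and S: "\<bar>?S\<bar> \<le> 2 * F"
    using t F by (auto intro!: prim_diff_bound_const volt_cont *)
  have "\<bar>sin (q * t) * ?C\<bar> \<le> 2 * F" "\<bar>cos (q * t) * ?S\<bar> \<le> 2 * F" "\<bar>A * sin (q * t)\<bar> \<le> \<bar>A\<bar>"
    "\<bar>cos (q * t) * ?C\<bar> \<le> 2 * F" "\<bar>sin (q * t) * ?S\<bar> \<le> 2 * F" "\<bar>A * q * cos (q * t)\<bar> \<le> \<bar>A\<bar> * q"
    using *[OF _ C] *[OF _ S] q by (simp_all add: abs_mult mult_left_le)
  note b = this
  have "\<bar>(sin (q * t) * ?C - cos (q * t) * ?S) / q\<bar> \<le> 4 * F / q"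
    using b(1,2) q by (simp add: divide_right_mono)
  then show "\<bar>volt q f A t\<bar> \<le> 4 * F / q + \<bar>A\<bar>" unfolding volt_def using b(3) by linarith
  show "\<bar>volt' q f A t\<bar> \<le> 4 * F + \<bar>A\<bar> * q" unfolding volt'_def using b(4-6) by linarith
qed

lemma volt_odd:
  assumes odd: "\<And>s. f (- s) = - f s" and t: "t \<in> {-1..1}"
  shows "volt q f A (- t) = - volt q f A t" "volt' q f A (- t) = volt' q f A t"
proof -
  let ?c = "\<lambda>s. cos (q * s) * f s" and ?s = "\<lambda>s. sin (q * s) * f s"
  have C: "prim ?c (- t) - prim ?c 0 = prim ?c t - prim ?c 0"
  proof -
    have "prim ?c (- t) = - (prim ?c 1 - prim ?c t)" if "t \<in> {-1..1}" for t
      using that odd by (intro prim_reflect volt_cont) auto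
    from this[of t] this[of 0] t show ?thesis by simp
  qed
  have S: "prim ?s (- t) - prim ?s 0 = - (prim ?s t - prim ?s 0)"
  proof -
    have *: "prim ?s (- t) = - (prim (\<lambda>s. - ?s s) 1 - prim (\<lambda>s. - ?s s) t)" if "t \<in> {-1..1}" for t
      using that odd by (intro prim_reflect volt_cont) auto
    have "prim (\<lambda>s. - ?s s) u = - prim ?s u" for u
      unfolding prim_def by simp
    with *[of t] *[of 0] t show ?thesis by simp
  qed
  have e: "q * - t = - (q * t)" by simp
  have alg: "(- a * P - b * - Q) / d + A * (- a) = - ((a * P - b * Q) / d + A * a)"
    "b * P + - a * - Q + c = b * P + a * Q + c" for a b c P Q d :: real
    by (simp_all add: diff_divide_distrib add_divide_distrib)
  show "volt q f A (- t) = - volt q f A t"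
    unfolding volt_def C S e sin_minus cos_minus by (rule alg)
  show "volt' q f A (- t) = volt' q f A t"
    unfolding volt'_def C S e sin_minus cos_minus by (rule alg)
qed

end

text \<open>The value \<open>mu0\<close> is chosen such that \<open>om n 1 = - (\<pi> / 2)\<^sup>2\<close>, i.e. \<open>sin (\<pi> t / 2)\<close> is a solution of the homogeneous
  problem for \<open>|k|\<^sup>2 = 1\<close>. In that case \<open>mode_sol\<close> satisfies the boundary condition only if \<open>resonance f = \<beta>\<close>.\<close>

definition lam :: "nat \<Rightarrow> real" where "lam n = 1 / (real n * pi)\<^sup>2"
definition mu0 :: "nat \<Rightarrow> real" where "mu0 n = (real n)\<^sup>2 / ((real n)\<^sup>2 - 1 / 4)"
definition om :: "nat \<Rightarrow> nat \<Rightarrow> real" where "om n \<kappa> = (real \<kappa> - mu0 n) / (lam n * mu0 n)"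

definition mode_sol :: "nat \<Rightarrow> nat \<Rightarrow> tfun \<Rightarrow> real \<Rightarrow> real \<Rightarrow> real" where
  "mode_sol n \<kappa> f \<beta> = (if \<kappa> = 0 then volt (real n * pi) f ((\<beta> - volt' (real n * pi) f 0 1) / (real n * pi * cos (real n * pi)))
     else if \<kappa> = 1 then volt (pi / 2) f 0 else green (sqrt (om n \<kappa>)) f \<beta>)"

definition mode_sol' :: "nat \<Rightarrow> nat \<Rightarrow> tfun \<Rightarrow> real \<Rightarrow> real \<Rightarrow> real" where
  "mode_sol' n \<kappa> f \<beta> = (if \<kappa> = 0 then volt' (real n * pi) f ((\<beta> - volt' (real n * pi) f 0 1) / (real n * pi * cos (real n * pi)))
     else if \<kappa> = 1 then volt' (pi / 2) f 0 else green' (sqrt (om n \<kappa>)) f \<beta>)"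

text \<open>Equals \<open>volt' (pi / 2) f 0 1\<close>: at \<open>t = 1\<close> the cosine factor
  vanishes and only the pairing of \<open>f\<close> with the kernel function remains. The integral
  starts at 0 because \<open>volt\<close> does.\<close>

definition resonance :: "tfun \<Rightarrow> real" where
  "resonance f = prim (\<lambda>s. sin (pi / 2 * s) * f s) 1 - prim (\<lambda>s. sin (pi / 2 * s) * f s) 0"

context
  fixes n :: nat
  assumes n: "n \<ge> 1"
begin

lemma npi_ge: "real n * pi \<ge> 3"
  using n pi_gt3 mult_mono[of 1 "real n" 3 pi] by auto

lemma n_sq: "(real n)\<^sup>2 \<ge> 1"
  using n by simp

lemma lam_pos: "lam n > 0"
  using n by (simp add: lam_def)

lemma mu0_pos: "mu0 n > 0"
  unfolding mu0_def using n_sq by (intro divide_pos_pos) linarith+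

lemma om_eq: "om n \<kappa> = (real \<kappa> * (1 - 1 / (4 * (real n)\<^sup>2)) - 1) * (real n * pi)\<^sup>2"
proof -
  have "1 / mu0 n = 1 - 1 / (4 * (real n)\<^sup>2)"
    unfolding mu0_def using n_sq n by (simp add: diff_divide_distrib)
  then have "om n \<kappa> = (real \<kappa> * (1 - 1 / (4 * (real n)\<^sup>2)) - 1) / lam n"
    unfolding om_def using mu0_pos lam_pos
    by (simp only: flip: \<open>1 / mu0 n = _\<close>) (simp add: diff_divide_distrib mult.commute)
  then show ?thesis by (simp add: lam_def)
qed

lemma om_0: "om n 0 = - (real n * pi)\<^sup>2"
  by (simp add: om_eq)

lemma om_1: "om n 1 = - (pi / 2)\<^sup>2"
  using n by (simp add: om_eq power_mult_distrib power_divide)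

text \<open>As \<open>n \<ge> 1\<close>, the factor of \<open>\<kappa>\<close> in
  \<open>om_eq\<close> is at least 3/4, and \<open>3 * \<kappa> / 4 - 1\<close> dominates
  \<open>(1 + \<kappa>) / 6\<close> from \<open>\<kappa> = 2\<close> on, with equality there. Linear
  growth in \<open>\<kappa>\<close> is the ellipticity behind the gain of two derivatives.\<close>

lemma om_ge: assumes "\<kappa> \<ge> 2" shows "om n \<kappa> \<ge> (1 + real \<kappa>) / 6"
proof -
  have "(1 + real \<kappa>) / 6 \<le> real \<kappa> * (3 / 4) - 1" using assms by simp
  also have "real \<kappa> * (3 / 4) \<le> real \<kappa> * (1 - 1 / (4 * (real n)\<^sup>2))"
    using n_sq by (intro mult_left_mono) (auto simp: divide_simps)
  finally have *: "(1 + real \<kappa>) / 6 \<le> real \<kappa> * (1 - 1 / (4 * (real n)\<^sup>2)) - 1" by simp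
  also have "\<dots> * 1 \<le> om n \<kappa>"
    unfolding om_eq
  proof (rule mult_left_mono)
    show "1 \<le> (real n * pi)\<^sup>2" using npi_ge by simp
    show "0 \<le> real \<kappa> * (1 - 1 / (4 * (real n)\<^sup>2)) - 1" using * by (rule order_trans[rotated]) simp
  qed
  finally show ?thesis by simp
qed

lemma om_le: "om n \<kappa> \<le> (1 + real \<kappa>) * (real n * pi)\<^sup>2"
  unfolding om_eq
proof (rule mult_right_mono)
  have "real \<kappa> * (1 - 1 / (4 * (real n)\<^sup>2)) \<le> real \<kappa> * 1" by (intro mult_left_mono) auto
  then show "real \<kappa> * (1 - 1 / (4 * (real n)\<^sup>2)) - 1 \<le> 1 + real \<kappa>" by simp
qed simp

lemma om_pos: "\<kappa> \<ge> 2 \<Longrightarrow> om n \<kappa> > 0"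
  using om_ge[of \<kappa>] by (rule less_le_trans[rotated]) auto

lemma npi_pos: "real n * pi > 0"
  using npi_ge by linarith

lemma cos_npi_nz: "cos (real n * pi) \<noteq> 0"
  by (simp add: cos_npi)

lemma mode_sol_deriv:
  assumes t: "t \<in> {-1..1}"
  shows "(mode_sol n \<kappa> f \<beta> has_real_derivative mode_sol' n \<kappa> f \<beta> t) (at t within {-1..1})"
    and "(mode_sol' n \<kappa> f \<beta> has_real_derivative (om n \<kappa> * mode_sol n \<kappa> f \<beta> t + f t)) (at t within {-1..1})"
proof -
  consider "\<kappa> = 0" | "\<kappa> = 1" | "\<kappa> \<ge> 2" by linarith
  then have "(mode_sol n \<kappa> f \<beta> has_real_derivative mode_sol' n \<kappa> f \<beta> t) (at t within {-1..1}) \<and>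
    (mode_sol' n \<kappa> f \<beta> has_real_derivative (om n \<kappa> * mode_sol n \<kappa> f \<beta> t + f t)) (at t within {-1..1})"
  proof cases
    case 1
    then show ?thesis
      using volt_deriv[OF npi_pos _ t] volt'_deriv[OF npi_pos _ t] by (simp add: mode_sol_def mode_sol'_def om_0)
  next
    case 2
    then show ?thesis
      using volt_deriv[OF _ _ t, of "pi / 2"] volt'_deriv[OF _ _ t, of "pi / 2"] om_1 by (simp add: mode_sol_def mode_sol'_def)
  next
    case 3
    then show ?thesis
      using green_deriv[OF _ _ t, of "sqrt (om n \<kappa>)"] green'_deriv[OF _ _ t, of "sqrt (om n \<kappa>)"] om_pos[of \<kappa>]
      by (simp add: mode_sol_def mode_sol'_def)
  qed
  then show "(mode_sol n \<kappa> f \<beta> has_real_derivative mode_sol' n \<kappa> f \<beta> t) (at t within {-1..1})"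
    and "(mode_sol' n \<kappa> f \<beta> has_real_derivative (om n \<kappa> * mode_sol n \<kappa> f \<beta> t + f t)) (at t within {-1..1})" by auto
qed

lemma mode_sol_cont: "continuous_on {-1..1} (mode_sol n \<kappa> f \<beta>)" "continuous_on {-1..1} (mode_sol' n \<kappa> f \<beta>)"
  by (rule DERIV_continuous_on, erule mode_sol_deriv)+

lemma mode_sol'_1:
  assumes "\<kappa> = 1 \<Longrightarrow> resonance f = \<beta>"
  shows "mode_sol' n \<kappa> f \<beta> 1 = \<beta>"
proof -
  consider "\<kappa> = 0" | "\<kappa> = 1" | "\<kappa> \<ge> 2" by linarith
  then show ?thesis
  proof cases
    case 1
    \<comment> \<open>The slope in \<open>A\<close> is the end derivative of
      \<open>sin (n \<pi> t)\<close>, which is nonzero; so \<open>A\<close> can be adjusted to any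
      boundary value.\<close>
    have "volt' (real n * pi) f A 1 = volt' (real n * pi) f 0 1 + A * (real n * pi * cos (real n * pi))" for A
      by (simp add: volt'_def)
    from this[of "(\<beta> - volt' (real n * pi) f 0 1) / (real n * pi * cos (real n * pi))"] show ?thesis
      using 1 npi_pos cos_npi_nz n by (simp add: mode_sol'_def del: cos_npi cos_npi2)
  next
    case 2
    then show ?thesis using assms by (simp add: mode_sol'_def volt'_def resonance_def)
  next
    case 3
    then show ?thesis using om_pos[of \<kappa>] by (simp add: mode_sol'_def green'_1)
  qed
qed

lemma mode_sol_odd:
  assumes odd: "\<And>s. apply_bcontfun f (- s) = - apply_bcontfun f s" and t: "t \<in> {-1..1}"
  shows "mode_sol n \<kappa> f \<beta> (- t) = - mode_sol n \<kappa> f \<beta> t" "mode_sol' n \<kappa> f \<beta> (- t) = mode_sol' n \<kappa> f \<beta> t"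
proof -
  have f: "continuous_on {-1..1} (apply_bcontfun f)" by simp
  show "mode_sol n \<kappa> f \<beta> (- t) = - mode_sol n \<kappa> f \<beta> t" "mode_sol' n \<kappa> f \<beta> (- t) = mode_sol' n \<kappa> f \<beta> t"
    using volt_odd[OF npi_pos f, OF odd t] volt_odd[OF _ f, of "pi / 2", OF _ odd t]
      green_odd[OF _ f, of "sqrt (om n \<kappa>)", OF _ odd t] om_pos[of \<kappa>]
    by (auto simp: mode_sol_def mode_sol'_def)
qed

text \<open>\<open>w\<close> is comparable to the frequency weight, so this is the gain of two
  derivatives over \<open>f\<close> and one over \<open>\<beta>\<close>, with constants uniform in
  \<open>\<kappa>\<close>. Modes 0 and 1 are crude estimates of oscillating integrals; the rest is
  \<open>green_bounds\<close> with \<open>r\<close> of the size of \<open>w\<close>.\<close>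

lemma mode_sol_bounds:
  fixes \<kappa> :: nat
  assumes t: "t \<in> {-1..1}"
  defines "w \<equiv> sqrt (1 + real \<kappa>)" and "N \<equiv> real n * pi"
  shows "w\<^sup>2 * \<bar>mode_sol n \<kappa> f \<beta> t\<bar> \<le> 8 * norm f + 3 * (w * \<bar>\<beta>\<bar>)"
    and "w * \<bar>mode_sol' n \<kappa> f \<beta> t\<bar> \<le> 8 * norm f + 3 * (w * \<bar>\<beta>\<bar>)"
proof -
  let ?F = "norm f"
  have F: "\<bar>f s\<bar> \<le> ?F" for s using norm_bounded[of f s] by simp
  have cf: "continuous_on {-1..1} f" by simp
  have w1: "w \<ge> 1" and w2: "w\<^sup>2 = 1 + real \<kappa>" by (auto simp: w_def)
  have N3: "N \<ge> 3" unfolding N_def by (rule npi_ge)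
  consider "\<kappa> = 0" | "\<kappa> = 1" | "\<kappa> \<ge> 2" by linarith
  then have "w\<^sup>2 * \<bar>mode_sol n \<kappa> f \<beta> t\<bar> \<le> 8 * ?F + 3 * (w * \<bar>\<beta>\<bar>) \<and> w * \<bar>mode_sol' n \<kappa> f \<beta> t\<bar> \<le> 8 * ?F + 3 * (w * \<bar>\<beta>\<bar>)"
  proof cases
    case 1
    let ?A = "(\<beta> - volt' N f 0 1) / (N * cos N)"
    have "\<bar>cos N\<bar> = 1" by (simp add: N_def cos_npi)
    have "\<bar>volt' N f 0 1\<bar> \<le> 4 * ?F"
      using volt_bounds(2)[OF _ cf F, of N 1 0] N3 by simp
    then have "\<bar>\<beta> - volt' N f 0 1\<bar> \<le> \<bar>\<beta>\<bar> + 4 * ?F" by linarith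
    then have A: "\<bar>?A\<bar> * N \<le> \<bar>\<beta>\<bar> + 4 * ?F"
      using N3 \<open>\<bar>cos N\<bar> = 1\<close> by (simp add: abs_mult)
    have "\<bar>?A\<bar> * 1 \<le> \<bar>?A\<bar> * N" using N3 by (intro mult_left_mono) auto
    then have A1: "\<bar>?A\<bar> \<le> \<bar>\<beta>\<bar> + 4 * ?F" using A by simp
    have "4 * ?F / N \<le> 4 * ?F" using N3 by (simp add: divide_simps) (simp add: mult_le_cancel_left1)
    then have "\<bar>volt N f ?A t\<bar> \<le> 8 * ?F + \<bar>\<beta>\<bar>" "\<bar>volt' N f ?A t\<bar> \<le> 8 * ?F + \<bar>\<beta>\<bar>"
      using volt_bounds[OF _ cf F t, of N ?A] N3 A A1 by auto
    then show ?thesis using 1 by (auto simp: mode_sol_def mode_sol'_def w_def N_def)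
  next
    case 2
    have "4 * ?F / (pi / 2) \<le> 4 * ?F" using pi_gt3 by (simp add: divide_simps mult_right_mono)
    then have b: "\<bar>volt (pi / 2) f 0 t\<bar> \<le> 4 * ?F" "\<bar>volt' (pi / 2) f 0 t\<bar> \<le> 4 * ?F"
      using volt_bounds[OF _ cf F t, of "pi / 2" 0] by auto
    have w: "w \<le> 2" using 2 by (simp add: w_def sqrt2_less_2 less_imp_le)
    have "w * \<bar>volt' (pi / 2) f 0 t\<bar> \<le> 2 * (4 * ?F)" using b w w1 by (intro mult_mono) auto
    moreover have "w\<^sup>2 * \<bar>volt (pi / 2) f 0 t\<bar> \<le> 2 * (4 * ?F)"
      unfolding w2 2 using b by (intro mult_mono) auto
    moreover have "0 \<le> 3 * (w * \<bar>\<beta>\<bar>)" using w1 by simp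
    ultimately show ?thesis using 2 by (auto simp: mode_sol_def mode_sol'_def)
  next
    case 3
    define r where "r = sqrt (om n \<kappa>)"
    have r2: "r\<^sup>2 = om n \<kappa>" and r0: "r > 0" using om_pos[OF 3] by (auto simp: r_def)
    have ge: "w\<^sup>2 \<le> 6 * r\<^sup>2" using om_ge[OF 3] unfolding w2 r2 by simp
    note ge
    also have "6 * r\<^sup>2 \<le> (3 * r)\<^sup>2" by (simp add: power_mult_distrib)
    finally have "w\<^sup>2 \<le> (3 * r)\<^sup>2" .
    then have wr: "w \<le> 3 * r" using r0 by (rule_tac power2_le_imp_le) auto
    have g: "\<bar>green r f \<beta> t\<bar> \<le> \<bar>\<beta>\<bar> / r + ?F / r\<^sup>2" "\<bar>green' r f \<beta> t\<bar> \<le> \<bar>\<beta>\<bar> + 2 * ?F / r"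
      by (rule green_bounds[OF r0 cf F t])+
    have "w\<^sup>2 * \<bar>green r f \<beta> t\<bar> \<le> w\<^sup>2 * (\<bar>\<beta>\<bar> / r + ?F / r\<^sup>2)" using g by (intro mult_left_mono) auto
    also have "\<dots> = (w * \<bar>\<beta>\<bar>) * (w / r) + ?F * (w\<^sup>2 / r\<^sup>2)" by (simp add: power2_eq_square field_simps)
    also have "\<dots> \<le> (w * \<bar>\<beta>\<bar>) * 3 + ?F * 6"
      using wr ge r0 w1 by (intro add_mono mult_left_mono) (auto simp: divide_simps)
    finally have 1: "w\<^sup>2 * \<bar>green r f \<beta> t\<bar> \<le> 8 * ?F + 3 * (w * \<bar>\<beta>\<bar>)" using norm_ge_zero[of f] by linarith
    have "w * \<bar>green' r f \<beta> t\<bar> \<le> w * (\<bar>\<beta>\<bar> + 2 * ?F / r)" using g w1 by (intro mult_left_mono) auto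
    also have "\<dots> = (w * \<bar>\<beta>\<bar>) * 1 + 2 * ?F * (w / r)" by (simp add: field_simps)
    also have "\<dots> \<le> (w * \<bar>\<beta>\<bar>) * 3 + 2 * ?F * 3"
      using wr r0 w1 by (intro add_mono mult_left_mono) (auto simp: divide_simps)
    finally have 2: "w * \<bar>green' r f \<beta> t\<bar> \<le> 8 * ?F + 3 * (w * \<bar>\<beta>\<bar>)" using norm_ge_zero[of f] by linarith
    show ?thesis using 1 2 3 by (simp add: mode_sol_def mode_sol'_def r_def)
  qed
  then show "w\<^sup>2 * \<bar>mode_sol n \<kappa> f \<beta> t\<bar> \<le> 8 * norm f + 3 * (w * \<bar>\<beta>\<bar>)"
    and "w * \<bar>mode_sol' n \<kappa> f \<beta> t\<bar> \<le> 8 * norm f + 3 * (w * \<bar>\<beta>\<bar>)" by auto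
qed

lemma om_mode_sol_bound:
  assumes t: "t \<in> {-1..1}"
  shows "\<bar>om n \<kappa>\<bar> * \<bar>mode_sol n \<kappa> f \<beta> t\<bar> \<le> (real n * pi)\<^sup>2 * (8 * norm f + 3 * (sqrt (1 + real \<kappa>) * \<bar>\<beta>\<bar>))"
proof -
  have "\<bar>om n \<kappa>\<bar> \<le> (real n * pi)\<^sup>2 * (sqrt (1 + real \<kappa>))\<^sup>2"
  proof -
    have "- om n \<kappa> \<le> (1 + real \<kappa>) * (real n * pi)\<^sup>2"
    proof -
      have "0 \<le> real \<kappa> * (1 - 1 / (4 * (real n)\<^sup>2))" using n_sq by (intro mult_nonneg_nonneg) (auto simp: divide_simps)
      then have "- (real \<kappa> * (1 - 1 / (4 * (real n)\<^sup>2)) - 1) \<le> 1 + real \<kappa>" by simp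
      then show ?thesis
        unfolding om_eq minus_mult_left by (intro mult_right_mono) simp_all
    qed
    then show ?thesis using om_le[of \<kappa>] by (simp add: abs_le_iff mult.commute)
  qed
  then have "\<bar>om n \<kappa>\<bar> * \<bar>mode_sol n \<kappa> f \<beta> t\<bar> \<le> (real n * pi)\<^sup>2 * (sqrt (1 + real \<kappa>))\<^sup>2 * \<bar>mode_sol n \<kappa> f \<beta> t\<bar>"
    by (intro mult_right_mono) auto
  also have "\<dots> \<le> (real n * pi)\<^sup>2 * (8 * norm f + 3 * (sqrt (1 + real \<kappa>) * \<bar>\<beta>\<bar>))"
    unfolding mult.assoc by (intro mult_left_mono mode_sol_bounds t) simp
  finally show ?thesis .
qed

end

section \<open>The linearised problem\<close>

lemma cf_sng_0_times: "cf (sng 0 c * f) k = c * cf f k" for f :: tpoly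
  unfolding cf_times
  by (subst wconv_superset[of "{0}" _ "supp f"]) (auto simp: in_keys_iff cong: if_cong)

lemma cst_times_nth [simp]: "(cst c * F) $ j = sng 0 c * F $ j"
  by (simp add: cst_def)

lemma cst_add: "cst (c + d) = cst c + cst d"
  and cst_minus: "cst (- c) = - cst c"
  and cst_diff: "cst (c - d) = cst c - cst d"
  and cst_mult: "cst (c * d) = cst c * cst d"
  and cst_0 [simp]: "cst 0 = 0"
  and cst_1 [simp]: "cst 1 = 1"
  by (simp_all add: cst_def single_add single_uminus single_diff mult_single)

lemma wt_0 [simp]: "wt m 0 = 1"
  by (simp add: wt_def)

lemma fmap_E_cst_times: "fmap (Eop m) (cst c * F) = cst c * fmap (Eop m) F"
  by (intro fps_ext poly_mapping_eqI) (simp add: cf_sng_0_times)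

lemma Eop_add: "Eop m (f + g) = Eop m f + Eop m g"
  and Eop_diff: "Eop m (f - g) = Eop m f - Eop m g"
  by (rule poly_mapping_eqI, simp add: lookup_add lookup_minus scaleR_add_right scaleR_diff_right)+

lemma fmap_E_add: "fmap (Eop m) (F + G) = fmap (Eop m) F + fmap (Eop m) G"
  and fmap_E_diff: "fmap (Eop m) (F - G) = fmap (Eop m) F - fmap (Eop m) G"
  by (rule fps_ext, simp add: Eop_add Eop_diff)+

lemma fmap_E_X_times: "fmap (Eop m) (fps_X * F) = fps_X * fmap (Eop m) F"
proof -
  have "Eop m 0 = 0" by (rule poly_mapping_eqI) simp
  then show ?thesis by (intro fps_ext) simp
qed

lemma aop_add: "aop (f + g) = aop f + aop g"
  and aop_diff: "aop (f - g) = aop f - aop g"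
  and aop_0: "aop 0 = 0"
  by (rule poly_mapping_eqI, rule bcontfun_eqI, simp add: lookup_add lookup_minus)+

lemma aop_sng_0_times: "aop (sng 0 c * f) = sng 0 (const_bcontfun (apply_bcontfun c 1)) * aop f"
  by (rule poly_mapping_eqI, rule bcontfun_eqI) (simp add: cf_sng_0_times)

lemma fmap_aop_add: "fmap aop (F + G) = fmap aop F + fmap aop G"
  and fmap_aop_diff: "fmap aop (F - G) = fmap aop F - fmap aop G"
  and fmap_aop_X_times: "fmap aop (fps_X * F) = fps_X * fmap aop F"
  and fmap_aop_cst_times: "fmap aop (cst c * F) = cst (const_bcontfun (apply_bcontfun c 1)) * fmap aop F"
  by (rule fps_ext, simp add: aop_add aop_diff aop_0 aop_sng_0_times)+

lemma const_bcontfun_eq_of_real: "const_bcontfun r = (of_real r :: tfun)"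
  by (rule bcontfun_eqI) (simp add: of_real_def)

lemma apply_bcontfun_of_real [simp]: "apply_bcontfun (of_real r :: tfun) t = r"
  by (simp add: of_real_def)

lemma of_real_times_tfun: "of_real r * (f :: tfun) = r *\<^sub>R f"
  by (simp add: of_real_def)

definition fmap2 :: "('a \<Rightarrow> 'b \<Rightarrow> 'c) \<Rightarrow> 'a fps \<Rightarrow> 'b fps \<Rightarrow> 'c fps" where
  "fmap2 h F G = Abs_fps (\<lambda>j. h (F $ j) (G $ j))"

lemma fmap2_nth [simp]: "fmap2 h F G $ j = h (F $ j) (G $ j)"
  by (simp add: fmap2_def)

lemma tame_fmap2:
  assumes f: "tame m p \<sigma> f" and g: "tame m q \<tau> g"
    and bd: "\<And>f g. wnorm m r (h f g) \<le> C * wnorm m p f + D * wnorm m q g" and CD: "0 \<le> C" "0 \<le> D"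
    and sy: "\<And>f g. psym m \<sigma> f \<Longrightarrow> psym m \<tau> g \<Longrightarrow> psym m \<upsilon> (h f g)"
  shows "tame m r \<upsilon> (\<lambda>x. fmap2 h (f x) (g x))"
proof (rule tame_binary[OF f g, where b = "\<lambda>x y. C * x + D * y"])
  fix \<rho> :: real and J F G assume \<rho>: "0 \<le> \<rho>"
  have "\<rho> ^ j * wnorm m r (h (F $ j) (G $ j)) \<le> C * (\<rho> ^ j * wnorm m p (F $ j)) + D * (\<rho> ^ j * wnorm m q (G $ j))" for j
    using mult_left_mono[OF bd[of "F $ j" "G $ j"], of "\<rho> ^ j"] \<rho> by (simp add: algebra_simps)
  then show "jet_norm m r \<rho> J (fmap2 h F G) \<le> C * jet_norm m p \<rho> J F + D * jet_norm m q \<rho> J G"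
    unfolding jet_norm_def sum_distrib_left sum.distrib[symmetric] by (auto intro!: sum_mono)
qed (use sy CD in \<open>auto simp: agree_def sym_upto_def intro!: add_mono mult_left_mono\<close>)

text \<open>The l1 weight is convenient for products, the Euclidean one arises from the differential
  equation; this and \<open>sqrt_le_wt\<close> make them equivalent.\<close>

lemma wt_le_sqrt: "wt m k \<le> (1 + real m) * sqrt (1 + real (sqn m k))"
proof -
  have "\<bar>real_of_int (k i)\<bar> \<le> sqrt (1 + real (sqn m k))" if "i < m" for i
  proof -
    have "real_of_int (k i) ^ 2 \<le> real (sqn m k)"
      unfolding real_sqn using that by (intro member_le_sum) auto
    then show ?thesis by (intro real_le_rsqrt) simp
  qed
  then have "(\<Sum>i<m. \<bar>real_of_int (k i)\<bar>) \<le> (\<Sum>i<m. sqrt (1 + real (sqn m k)))"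
    by (intro sum_mono) auto
  moreover have "1 \<le> sqrt (1 + real (sqn m k))" by simp
  ultimately have "1 + (\<Sum>i<m. \<bar>real_of_int (k i)\<bar>) \<le> sqrt (1 + real (sqn m k)) + real m * sqrt (1 + real (sqn m k))"
    by (intro add_mono) simp_all
  then show ?thesis by (simp add: wt_def algebra_simps)
qed

lemma sqrt_le_wt: "sqrt (1 + real (sqn m k)) \<le> 2 * wt m k"
proof (rule real_le_lsqrt)
  have "1 \<le> wt m k ^ 2" using wt_ge_1[of m k] by simp
  then show "1 + real (sqn m k) \<le> (2 * wt m k)\<^sup>2" using sqn_le_wt[of m k] by (simp add: power_mult_distrib)
qed simp

section \<open>The solution operators, one frequency at a time\<close>

definition tS0 :: "nat \<Rightarrow> nat \<Rightarrow> tfun \<Rightarrow> real \<Rightarrow> tfun" where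
  "tS0 n \<kappa> f \<beta> = bcf (mode_sol n \<kappa> f \<beta>)"
definition tS1 :: "nat \<Rightarrow> nat \<Rightarrow> tfun \<Rightarrow> real \<Rightarrow> tfun" where
  "tS1 n \<kappa> f \<beta> = bcf (mode_sol' n \<kappa> f \<beta>)"
text \<open>The second derivative is defined through the differential equation;
  \<open>tS_deriv\<close> shows that it is the derivative of \<open>tS1\<close>.\<close>

definition tS2 :: "nat \<Rightarrow> nat \<Rightarrow> tfun \<Rightarrow> real \<Rightarrow> tfun" where
  "tS2 n \<kappa> f \<beta> = om n \<kappa> *\<^sub>R tS0 n \<kappa> f \<beta> + f"

lemma clamp1_minus: "clamp1 (- t) = - clamp1 t"
  by (auto simp: clamp1_def)

lemma has_deriv_bcf:
  assumes "(g has_real_derivative D) (at t within {-1..1})" "continuous_on {-1..1} g" "t \<in> {-1..1}"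
  shows "(apply_bcontfun (bcf g) has_real_derivative D) (at t within {-1..1})"
  by (rule has_field_derivative_transform_within[OF assms(1) zero_less_one]) (use assms in \<open>auto simp: apply_bcf_in\<close>)

context
  fixes n :: nat
  assumes n: "n \<ge> 1"
begin

lemma tS_bounds:
  shows "(sqrt (1 + real \<kappa>))\<^sup>2 * norm (tS0 n \<kappa> f \<beta>) \<le> 8 * norm f + 3 * (sqrt (1 + real \<kappa>) * \<bar>\<beta>\<bar>)"
    and "sqrt (1 + real \<kappa>) * norm (tS1 n \<kappa> f \<beta>) \<le> 8 * norm f + 3 * (sqrt (1 + real \<kappa>) * \<bar>\<beta>\<bar>)"
    and "norm (tS2 n \<kappa> f \<beta>) \<le> (real n * pi)\<^sup>2 * (8 * norm f + 3 * (sqrt (1 + real \<kappa>) * \<bar>\<beta>\<bar>)) + norm f"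
proof -
  let ?w = "sqrt (1 + real \<kappa>)" and ?b = "8 * norm f + 3 * (sqrt (1 + real \<kappa>) * \<bar>\<beta>\<bar>)"
  have w: "?w > 0" by (simp add: add_pos_nonneg)
  have "norm (tS0 n \<kappa> f \<beta>) \<le> ?b / ?w\<^sup>2"
    unfolding tS0_def using mode_sol_bounds(1)[OF n, of _ \<kappa> f \<beta>] w
    by (intro norm_bcf_le mode_sol_cont[OF n]) (simp add: pos_le_divide_eq mult.commute)
  then show "?w\<^sup>2 * norm (tS0 n \<kappa> f \<beta>) \<le> ?b"
    using w by (simp add: pos_le_divide_eq mult.commute)
  have "norm (tS1 n \<kappa> f \<beta>) \<le> ?b / ?w"
    unfolding tS1_def using mode_sol_bounds(2)[OF n, of _ \<kappa> f \<beta>] w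
    by (intro norm_bcf_le mode_sol_cont[OF n]) (simp add: pos_le_divide_eq mult.commute)
  then show "?w * norm (tS1 n \<kappa> f \<beta>) \<le> ?b"
    using w by (simp add: pos_le_divide_eq mult.commute)
  have "norm (om n \<kappa> *\<^sub>R tS0 n \<kappa> f \<beta>) \<le> (real n * pi)\<^sup>2 * ?b"
  proof (rule norm_bound)
    fix t
    show "norm (apply_bcontfun (om n \<kappa> *\<^sub>R tS0 n \<kappa> f \<beta>) t) \<le> (real n * pi)\<^sup>2 * ?b"
      using om_mode_sol_bound[OF n clamp1_in, of \<kappa> f \<beta> t]
      by (simp add: tS0_def apply_bcf mode_sol_cont[OF n] abs_mult)
  qed
  then show "norm (tS2 n \<kappa> f \<beta>) \<le> (real n * pi)\<^sup>2 * ?b + norm f"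
    unfolding tS2_def by (intro order_trans[OF norm_triangle_ineq]) simp
qed

text \<open>Uniqueness follows from the estimates with zero right-hand sides. It guarantees finite
  support when the operators act coefficientwise.\<close>

lemma tS_0 [simp]: "tS0 n \<kappa> 0 0 = 0" "tS1 n \<kappa> 0 0 = 0" "tS2 n \<kappa> 0 0 = 0"
proof -
  have w: "sqrt (1 + real \<kappa>) > 0" by (simp add: add_pos_nonneg)
  have "(sqrt (1 + real \<kappa>))\<^sup>2 * norm (tS0 n \<kappa> 0 0) \<le> 0" using tS_bounds(1)[of \<kappa> 0 0] by simp
  then show 0: "tS0 n \<kappa> 0 0 = 0" using w by (simp add: mult_le_0_iff)
  have "sqrt (1 + real \<kappa>) * norm (tS1 n \<kappa> 0 0) \<le> 0" using tS_bounds(2)[of \<kappa> 0 0] by simp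
  then show "tS1 n \<kappa> 0 0 = 0" using w by (simp add: mult_le_0_iff)
  show "tS2 n \<kappa> 0 0 = 0" by (simp add: tS2_def 0)
qed

lemma tS_parity:
  assumes "\<And>t. apply_bcontfun f (- t) = - apply_bcontfun f t"
  shows "apply_bcontfun (tS0 n \<kappa> f \<beta>) (- t) = - apply_bcontfun (tS0 n \<kappa> f \<beta>) t"
    and "apply_bcontfun (tS1 n \<kappa> f \<beta>) (- t) = apply_bcontfun (tS1 n \<kappa> f \<beta>) t"
    and "apply_bcontfun (tS2 n \<kappa> f \<beta>) (- t) = - apply_bcontfun (tS2 n \<kappa> f \<beta>) t"
proof -
  show 0: "apply_bcontfun (tS0 n \<kappa> f \<beta>) (- t) = - apply_bcontfun (tS0 n \<kappa> f \<beta>) t"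
    and "apply_bcontfun (tS1 n \<kappa> f \<beta>) (- t) = apply_bcontfun (tS1 n \<kappa> f \<beta>) t"
    by (simp_all add: tS0_def tS1_def apply_bcf mode_sol_cont[OF n] clamp1_minus mode_sol_odd[OF n assms clamp1_in])
  show "apply_bcontfun (tS2 n \<kappa> f \<beta>) (- t) = - apply_bcontfun (tS2 n \<kappa> f \<beta>) t"
    by (simp add: tS2_def 0 assms)
qed

lemma tS_deriv:
  assumes t: "t \<in> {-1..1}"
  shows "(apply_bcontfun (tS0 n \<kappa> f \<beta>) has_real_derivative apply_bcontfun (tS1 n \<kappa> f \<beta>) t) (at t within {-1..1})"
    and "(apply_bcontfun (tS1 n \<kappa> f \<beta>) has_real_derivative apply_bcontfun (tS2 n \<kappa> f \<beta>) t) (at t within {-1..1})"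
  using has_deriv_bcf[OF mode_sol_deriv(1)[OF n t] mode_sol_cont(1)[OF n] t, of \<kappa> f \<beta>]
    has_deriv_bcf[OF mode_sol_deriv(2)[OF n t] mode_sol_cont(2)[OF n] t, of \<kappa> f \<beta>] t
  by (simp_all add: tS0_def tS1_def tS2_def apply_bcf_in mode_sol_cont[OF n])

lemma tS1_1: "(\<kappa> = 1 \<Longrightarrow> resonance f = \<beta>) \<Longrightarrow> apply_bcontfun (tS1 n \<kappa> f \<beta>) 1 = \<beta>"
  by (simp add: tS1_def apply_bcf_in mode_sol_cont[OF n] mode_sol'_1[OF n])

end

text \<open>The boundary datum is stored as a trigonometric polynomial like everything else; only
  its value at \<open>t = 1\<close> enters.\<close>

definition LS :: "(nat \<Rightarrow> tfun \<Rightarrow> real \<Rightarrow> tfun) \<Rightarrow> nat \<Rightarrow> tpoly \<Rightarrow> tpoly \<Rightarrow> tpoly" where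
  "LS S m = pmap2 (\<lambda>k f b. S (sqn m k) f (apply_bcontfun b 1))"

lemma cf_LS: "(\<And>\<kappa>. S \<kappa> 0 0 = 0) \<Longrightarrow> cf (LS S m f g) k = S (sqn m k) (cf f k) (apply_bcontfun (cf g k) 1)"
  unfolding LS_def by (subst cf_pmap2) auto

lemma psym_LS:
  assumes S: "\<And>\<kappa>. S \<kappa> 0 0 = 0"
    and par: "\<And>\<kappa> f \<beta> t. (\<And>t. apply_bcontfun f (- t) = \<sigma> * apply_bcontfun f t) \<Longrightarrow>
      apply_bcontfun (S \<kappa> f \<beta>) (- t) = \<upsilon> * apply_bcontfun (S \<kappa> f \<beta>) t"
    and f: "psym m \<sigma> f" and g: "psym m \<tau> g"
  shows "psym m \<upsilon> (LS S m f g)"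
  using f g by (auto simp: psym_def cf_LS S sqn_permutes intro!: par)

lemma wnorm_LS0:
  assumes n: "n \<ge> 1"
  shows "wnorm m (Suc (Suc p)) (LS (tS0 n) m f g) \<le> (8 * (1 + real m)\<^sup>2) * wnorm m p f + (6 * (1 + real m)\<^sup>2) * wnorm m (Suc p) g"
proof (rule wnorm_mono_pointwise2)
  fix k
  let ?w = "sqrt (1 + real (sqn m k))" and ?b = "apply_bcontfun (cf g k) 1"
  have b: "\<bar>?b\<bar> \<le> norm (cf g k)" using norm_bounded[of "cf g k" 1] by simp
  have "wt m k ^ 2 * norm (tS0 n (sqn m k) (cf f k) ?b) \<le> ((1 + real m) * ?w)\<^sup>2 * norm (tS0 n (sqn m k) (cf f k) ?b)"
    by (intro mult_right_mono power_mono wt_le_sqrt) auto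
  also have "\<dots> \<le> (1 + real m)\<^sup>2 * (8 * norm (cf f k) + 3 * (?w * \<bar>?b\<bar>))"
    unfolding power_mult_distrib mult.assoc by (intro mult_left_mono tS_bounds[OF n]) simp
  also have "\<dots> \<le> (1 + real m)\<^sup>2 * (8 * norm (cf f k) + 3 * ((2 * wt m k) * norm (cf g k)))"
    by (intro mult_left_mono add_left_mono mult_mono b sqrt_le_wt) auto
  finally have "wt m k ^ p * (wt m k ^ 2 * norm (tS0 n (sqn m k) (cf f k) ?b)) \<le>
    wt m k ^ p * ((1 + real m)\<^sup>2 * (8 * norm (cf f k) + 3 * ((2 * wt m k) * norm (cf g k))))"
    by (intro mult_left_mono) auto
  then show "wt m k ^ Suc (Suc p) * norm (cf (LS (tS0 n) m f g) k) \<le>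
      8 * (1 + real m)\<^sup>2 * (wt m k ^ p * norm (cf f k)) + 6 * (1 + real m)\<^sup>2 * (wt m k ^ Suc p * norm (cf g k))"
    by (simp add: cf_LS tS_0[OF n] algebra_simps power2_eq_square)
qed

lemma wnorm_LS1:
  assumes n: "n \<ge> 1"
  shows "wnorm m (Suc p) (LS (tS1 n) m f g) \<le> (8 * (1 + real m)) * wnorm m p f + (6 * (1 + real m)) * wnorm m (Suc p) g"
proof (rule wnorm_mono_pointwise2)
  fix k
  let ?w = "sqrt (1 + real (sqn m k))" and ?b = "apply_bcontfun (cf g k) 1"
  have b: "\<bar>?b\<bar> \<le> norm (cf g k)" using norm_bounded[of "cf g k" 1] by simp
  have "wt m k * norm (tS1 n (sqn m k) (cf f k) ?b) \<le> ((1 + real m) * ?w) * norm (tS1 n (sqn m k) (cf f k) ?b)"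
    by (intro mult_right_mono wt_le_sqrt) auto
  also have "\<dots> \<le> (1 + real m) * (8 * norm (cf f k) + 3 * (?w * \<bar>?b\<bar>))"
    unfolding mult.assoc by (intro mult_left_mono tS_bounds[OF n]) simp
  also have "\<dots> \<le> (1 + real m) * (8 * norm (cf f k) + 3 * ((2 * wt m k) * norm (cf g k)))"
    by (intro mult_left_mono add_left_mono mult_mono b sqrt_le_wt) auto
  finally have "wt m k ^ p * (wt m k * norm (tS1 n (sqn m k) (cf f k) ?b)) \<le>
    wt m k ^ p * ((1 + real m) * (8 * norm (cf f k) + 3 * ((2 * wt m k) * norm (cf g k))))"
    by (intro mult_left_mono) auto
  then show "wt m k ^ Suc p * norm (cf (LS (tS1 n) m f g) k) \<le>
      8 * (1 + real m) * (wt m k ^ p * norm (cf f k)) + 6 * (1 + real m) * (wt m k ^ Suc p * norm (cf g k))"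
    by (simp add: cf_LS tS_0[OF n] algebra_simps)
qed

lemma wnorm_LS2:
  assumes n: "n \<ge> 1"
  shows "wnorm m p (LS (tS2 n) m f g) \<le> (8 * (real n * pi)\<^sup>2 + 1) * wnorm m p f + (6 * (real n * pi)\<^sup>2) * wnorm m (Suc p) g"
proof (rule wnorm_mono_pointwise2)
  fix k
  let ?w = "sqrt (1 + real (sqn m k))" and ?b = "apply_bcontfun (cf g k) 1"
  have b: "\<bar>?b\<bar> \<le> norm (cf g k)" using norm_bounded[of "cf g k" 1] by simp
  have "norm (tS2 n (sqn m k) (cf f k) ?b) \<le> (real n * pi)\<^sup>2 * (8 * norm (cf f k) + 3 * (?w * \<bar>?b\<bar>)) + norm (cf f k)"
    by (rule tS_bounds[OF n])
  also have "\<dots> \<le> (real n * pi)\<^sup>2 * (8 * norm (cf f k) + 3 * ((2 * wt m k) * norm (cf g k))) + norm (cf f k)"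
    by (intro mult_left_mono add_left_mono add_right_mono mult_mono b sqrt_le_wt) auto
  finally have "wt m k ^ p * norm (tS2 n (sqn m k) (cf f k) ?b) \<le>
    wt m k ^ p * ((real n * pi)\<^sup>2 * (8 * norm (cf f k) + 3 * ((2 * wt m k) * norm (cf g k))) + norm (cf f k))"
    by (intro mult_left_mono) auto
  then show "wt m k ^ p * norm (cf (LS (tS2 n) m f g) k) \<le>
      (8 * (real n * pi)\<^sup>2 + 1) * (wt m k ^ p * norm (cf f k)) + 6 * (real n * pi)\<^sup>2 * (wt m k ^ Suc p * norm (cf g k))"
    by (simp add: cf_LS tS_0[OF n] algebra_simps)
qed

definition M0 :: "nat \<Rightarrow> real" where "M0 n = sqrt (mu0 n)"
text \<open>What remains of \<open>Tphi\<close> under \<open>lam n\<close> times the second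
  derivative plus the identity, see \<open>lam_pi\<close>; thus the effect of a variation of
  \<open>\<mu>\<close> on the kernel function.\<close>

definition eps0 :: "nat \<Rightarrow> real" where "eps0 n = 1 / mu0 n"

section \<open>The explicit functions of t\<close>

definition Tid :: tfun where "Tid = bcf (\<lambda>t. t)"
definition Tv :: "nat \<Rightarrow> tfun" where "Tv n = bcf (v n)"
definition Tv1 :: "nat \<Rightarrow> tfun" where "Tv1 n = bcf (\<lambda>t. (-1) ^ n * cos (real n * pi * t))"
definition Tphi :: tfun where "Tphi = bcf (\<lambda>t. sin (pi / 2 * t))"
definition Tphi1 :: tfun where "Tphi1 = bcf (\<lambda>t. pi / 2 * cos (pi / 2 * t))"

lemma T_cont:
  "continuous_on {-1..1} (\<lambda>t::real. t)" "continuous_on {-1..1} (v n)"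
  "continuous_on {-1..1} (\<lambda>t. (-1) ^ n * cos (real n * pi * t))"
  "continuous_on {-1..1} (\<lambda>t. sin (pi / 2 * t))" "continuous_on {-1..1} (\<lambda>t. pi / 2 * cos (pi / 2 * t))"
  unfolding v_def [abs_def] by (intro continuous_intros)+

lemma apply_T:
  "apply_bcontfun Tid t = clamp1 t"
  "apply_bcontfun (Tv n) t = v n (clamp1 t)"
  "apply_bcontfun (Tv1 n) t = (-1) ^ n * cos (real n * pi * clamp1 t)"
  "apply_bcontfun Tphi t = sin (pi / 2 * clamp1 t)"
  "apply_bcontfun Tphi1 t = pi / 2 * cos (pi / 2 * clamp1 t)"
  unfolding Tid_def Tv_def Tv1_def Tphi_def Tphi1_def by (rule apply_bcf[OF T_cont(1)] apply_bcf[OF T_cont(2)] apply_bcf[OF T_cont(3)] apply_bcf[OF T_cont(4)] apply_bcf[OF T_cont(5)])+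

lemma clamp1_1 [simp]: "clamp1 1 = 1"
  by (simp add: clamp1_def)

lemma apply_T_1:
  "apply_bcontfun Tid 1 = 1" "apply_bcontfun (Tv n) 1 = 0" "apply_bcontfun (Tv1 n) 1 = 1"
  "apply_bcontfun Tphi 1 = 1" "apply_bcontfun Tphi1 1 = 0"
  by (simp_all add: apply_T v_def cos_npi flip: power_add)

lemma T_parity:
  "apply_bcontfun Tid (- t) = - apply_bcontfun Tid t"
  "apply_bcontfun (Tv n) (- t) = - apply_bcontfun (Tv n) t"
  "apply_bcontfun (Tv1 n) (- t) = apply_bcontfun (Tv1 n) t"
  "apply_bcontfun Tphi (- t) = - apply_bcontfun Tphi t"
  "apply_bcontfun Tphi1 (- t) = apply_bcontfun Tphi1 t"
  by (simp_all add: apply_T clamp1_minus v_def)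

lemma T_deriv:
  assumes t: "t \<in> {-1..1}" and n: "n \<ge> 1"
  shows "(apply_bcontfun Tid has_real_derivative 1) (at t within {-1..1})"
    "(apply_bcontfun (Tv n) has_real_derivative apply_bcontfun (Tv1 n) t) (at t within {-1..1})"
    "(apply_bcontfun (Tv1 n) has_real_derivative - apply_bcontfun (Tv n) t / lam n) (at t within {-1..1})"
    "(apply_bcontfun Tphi has_real_derivative apply_bcontfun Tphi1 t) (at t within {-1..1})"
    "(apply_bcontfun Tphi1 has_real_derivative - (pi / 2)\<^sup>2 * apply_bcontfun Tphi t) (at t within {-1..1})"
proof -
  have d: "((\<lambda>t. t) has_real_derivative 1) (at t within {-1..1})"
    "(v n has_real_derivative (-1) ^ n * cos (real n * pi * t)) (at t within {-1..1})"
    "((\<lambda>t. (-1) ^ n * cos (real n * pi * t)) has_real_derivative - (v n t * (real n * pi)\<^sup>2)) (at t within {-1..1})"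
    "((\<lambda>t. sin (pi / 2 * t)) has_real_derivative pi / 2 * cos (pi / 2 * t)) (at t within {-1..1})"
    "((\<lambda>t. pi / 2 * cos (pi / 2 * t)) has_real_derivative - (pi / 2)\<^sup>2 * sin (pi / 2 * t)) (at t within {-1..1})"
    unfolding v_def [abs_def] using n
    by (auto intro!: derivative_eq_intros simp: power2_eq_square field_simps)
  note * = has_deriv_bcf[OF d(1) T_cont(1) t] has_deriv_bcf[OF d(2) T_cont(2) t] has_deriv_bcf[OF d(3) T_cont(3) t]
     has_deriv_bcf[OF d(4) T_cont(4) t] has_deriv_bcf[OF d(5) T_cont(5) t]
  show "(apply_bcontfun Tid has_real_derivative 1) (at t within {-1..1})"
    "(apply_bcontfun (Tv n) has_real_derivative apply_bcontfun (Tv1 n) t) (at t within {-1..1})"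
    "(apply_bcontfun (Tv1 n) has_real_derivative - apply_bcontfun (Tv n) t / lam n) (at t within {-1..1})"
    "(apply_bcontfun Tphi has_real_derivative apply_bcontfun Tphi1 t) (at t within {-1..1})"
    "(apply_bcontfun Tphi1 has_real_derivative - (pi / 2)\<^sup>2 * apply_bcontfun Tphi t) (at t within {-1..1})"
    using *[folded Tid_def Tv_def Tv1_def Tphi_def Tphi1_def] t by (simp_all add: apply_T clamp1_id lam_def)
qed

section \<open>The frequencies of length one, and the solvability functional\<close>

definition unit :: "nat \<Rightarrow> freq" where "unit i = (\<lambda>j. if j = i then 1 else 0)"

definition theta_poly :: "nat \<Rightarrow> tpoly" where
  "theta_poly m = (\<Sum>i<m. sng (unit i) (of_real (1 / 2)) + sng (- unit i) (of_real (1 / 2)))"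

definition theta_coeff :: "nat \<Rightarrow> freq \<Rightarrow> real" where
  "theta_coeff i k = (if k = unit i then 1 / 2 else 0) + (if k = - unit i then 1 / 2 else 0)"

lemma cf_theta_poly: "cf (theta_poly m) k = of_real (\<Sum>i<m. theta_coeff i k)"
  unfolding theta_poly_def lookup_sum of_real_sum
  by (intro sum.cong refl) (auto simp: lookup_add lookup_single when_def theta_coeff_def)

lemma theta_coeff_flip: "theta_coeff j (k(i := - k i)) = theta_coeff j k"
proof -
  have 1: "k(i := - k i) = l \<longleftrightarrow> k = l(i := - l i)" for k l :: freq
    by (auto simp: fun_eq_iff)
  have 2: "(unit j)(i := - unit j i) = (if i = j then - unit j else unit j)"
    "(- unit j)(i := - (- unit j) i) = (if i = j then unit j else - unit j)"
    by (auto simp: unit_def fun_eq_iff)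
  show ?thesis unfolding theta_coeff_def 1 2 by auto
qed

lemma theta_coeff_perm: "\<pi> permutes S \<Longrightarrow> theta_coeff j (k \<circ> \<pi>) = theta_coeff (\<pi> j) k"
proof -
  assume \<pi>: "\<pi> permutes S"
  have "k \<circ> \<pi> = unit j \<longleftrightarrow> k = unit (\<pi> j)" "k \<circ> \<pi> = - unit j \<longleftrightarrow> k = - unit (\<pi> j)"
  proof -
    have 1: "k \<circ> \<pi> = l \<circ> \<pi> \<longleftrightarrow> k = l" for l
      using permutes_surj[OF \<pi>] by (metis surj_fun_eq)
    have 2: "unit j = unit (\<pi> j) \<circ> \<pi>" "- unit j = (- unit (\<pi> j)) \<circ> \<pi>"
      using permutes_inj[OF \<pi>] by (auto simp: unit_def fun_eq_iff inj_eq)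
    show "k \<circ> \<pi> = unit j \<longleftrightarrow> k = unit (\<pi> j)" by (subst 2(1)) (rule 1)
    show "k \<circ> \<pi> = - unit j \<longleftrightarrow> k = - unit (\<pi> j)" by (subst 2(2)) (rule 1)
  qed
  then show ?thesis by (simp add: theta_coeff_def)
qed

lemma psym_theta_poly: "psym m 1 (theta_poly m)"
  unfolding psym_def cf_theta_poly
proof (intro conjI allI impI)
  fix k :: freq assume "\<exists>i\<ge>m. k i \<noteq> 0"
  then have "theta_coeff i k = 0" if "i < m" for i
    using that by (auto simp: theta_coeff_def unit_def)
  then show "of_real (\<Sum>i<m. theta_coeff i k) = (0 :: tfun)" by simp
next
  fix k :: freq and \<pi> assume "\<pi> permutes {..<m}"
  then have "(\<Sum>i<m. theta_coeff i (k \<circ> \<pi>)) = (\<Sum>i<m. theta_coeff i k)"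
    using sum.permute[of \<pi> "{..<m}" "\<lambda>i. theta_coeff i k"] by (simp add: theta_coeff_perm)
  then show "of_real (\<Sum>i<m. theta_coeff i (k \<circ> \<pi>)) = (of_real (\<Sum>i<m. theta_coeff i k) :: tfun)" by simp
qed (simp_all add: theta_coeff_flip flip: of_real_sum)

lemma sqn_unit: "i < m \<Longrightarrow> sqn m (unit i) = 1" "i < m \<Longrightarrow> sqn m (- unit i) = 1"
proof -
  assume i: "i < m"
  have "nat \<bar>unit i j\<bar> ^ 2 = (if j = i then 1 else 0)" "nat \<bar>(- unit i) j\<bar> ^ 2 = (if j = i then 1 else 0)" for j
    by (auto simp: unit_def)
  then show "sqn m (unit i) = 1" "sqn m (- unit i) = 1"
    using i by (simp_all add: sqn_def)
qed

lemma Eop_theta_poly: "Eop m (theta_poly m) = theta_poly m"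
proof (rule poly_mapping_eqI)
  fix k
  have "(\<Sum>i<m. theta_coeff i k) = 0" if "sqn m k \<noteq> 1"
    using that sqn_unit by (intro sum.neutral ballI) (auto simp: theta_coeff_def)
  then show "cf (Eop m (theta_poly m)) k = cf (theta_poly m) k"
    unfolding cf_Eop cf_theta_poly by (cases "sqn m k = 1") auto
qed

lemma sqn_1_cases:
  assumes "sqn m k = 1" "\<And>i. i \<ge> m \<Longrightarrow> k i = 0"
  obtains i where "i < m" "k = unit i \<or> k = - unit i"
proof -
  have "\<exists>i<m. k i \<noteq> 0"
    using assms(1) by (rule_tac ccontr) (simp add: sqn_def)
  then obtain i where i: "i < m" "k i \<noteq> 0" by blast
  have "(\<Sum>j<m. nat \<bar>k j\<bar> ^ 2) = nat \<bar>k i\<bar> ^ 2 + (\<Sum>j\<in>{..<m} - {i}. nat \<bar>k j\<bar> ^ 2)"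
    using i by (intro sum.remove) auto
  then have s: "nat \<bar>k i\<bar> ^ 2 + (\<Sum>j\<in>{..<m} - {i}. nat \<bar>k j\<bar> ^ 2) = 1"
    using assms(1) by (simp add: sqn_def)
  moreover have "nat \<bar>k i\<bar> ^ 2 \<ge> 1" using i by simp
  ultimately have a: "nat \<bar>k i\<bar> ^ 2 = 1" "(\<Sum>j\<in>{..<m} - {i}. nat \<bar>k j\<bar> ^ 2) = 0" by linarith+
  have "k j = 0" if "j \<noteq> i" for j
    using a(2) assms(2)[of j] that by (cases "j < m") auto
  moreover have "k i = 1 \<or> k i = -1" using a(1) by (auto simp: power2_eq_square)
  ultimately have "k = unit i \<or> k = - unit i" by (auto simp: unit_def fun_eq_iff)
  then show ?thesis using i that by blast
qed

text \<open>This makes the kernel one-dimensional: a frequency of length one is some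
  \<open>unit i\<close> or its negative, a sign flip removes the sign, and a transposition moves
  \<open>i\<close> to 0.\<close>

lemma psym_cf_unit:
  assumes f: "psym m \<sigma> f" and "sqn m k = 1" "\<And>i. i \<ge> m \<Longrightarrow> k i = 0"
  shows "cf f k = cf f (unit 0)"
proof -
  obtain i where i: "i < m" "k = unit i \<or> k = - unit i" using sqn_1_cases[OF assms(2,3)] by blast
  have "cf f ((unit i)(i := - unit i i)) = cf f (unit i)" using f i by (simp add: psym_def)
  moreover have "(unit i)(i := - unit i i) = - unit i" by (auto simp: unit_def fun_eq_iff)
  ultimately have "cf f k = cf f (unit i)" using i by auto
  moreover have "Transposition.transpose 0 i permutes {..<m}" using i by (intro permutes_swap_id) auto
  then have "cf f (unit 0 \<circ> Transposition.transpose 0 i) = cf f (unit 0)" using f by (simp add: psym_def)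
  moreover have "unit 0 \<circ> Transposition.transpose 0 i = unit i" by (auto simp: unit_def fun_eq_iff Transposition.transpose_def)
  ultimately show ?thesis by simp
qed

lemma cf_theta_poly_unit: assumes "m \<ge> 1" shows "cf (theta_poly m) (unit 0) = of_real (1 / 2)"
proof -
  have "theta_coeff i (unit 0) = (if i = 0 then 1 / 2 else 0)" for i
    by (auto simp: theta_coeff_def unit_def fun_eq_iff)
  then show ?thesis using assms unfolding cf_theta_poly by simp
qed

lemma resonance_eq_integral: "resonance f = integral {0..1} (\<lambda>s. sin (pi / 2 * s) * apply_bcontfun f s)"
  unfolding resonance_def by (intro prim_diff continuous_intros) auto

lemma resonance_int: "(\<lambda>s. sin (pi / 2 * s) * apply_bcontfun f s) integrable_on {0..1}"
  by (intro integrable_continuous_interval continuous_intros) auto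

lemma resonance_diff: "resonance (f - g) = resonance f - resonance g"
  using Henstock_Kurzweil_Integration.integral_diff[OF resonance_int[of f] resonance_int[of g]]
  by (simp add: resonance_eq_integral algebra_simps)

lemma resonance_scaleR: "resonance (c *\<^sub>R f) = c * resonance f"
  unfolding resonance_eq_integral
  by (subst integral_mult_right[symmetric]) (simp add: mult_ac)

lemma resonance_0 [simp]: "resonance 0 = 0"
  by (simp add: resonance_eq_integral)

lemma resonance_bound: "\<bar>resonance f\<bar> \<le> 2 * norm f"
  unfolding resonance_def
proof (intro prim_diff_bound_const continuous_intros)
  fix t
  have "\<bar>sin (pi / 2 * t) * apply_bcontfun f t\<bar> \<le> 1 * norm f"
    using norm_bounded[of f t] by (intro abs_mult_le) auto
  then show "\<bar>sin (pi / 2 * t) * apply_bcontfun f t\<bar> \<le> norm f" by simp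
qed auto

lemma resonance_Tphi: "resonance Tphi = 1 / 2"
proof -
  have "((\<lambda>s. sin (pi / 2 * s) * sin (pi / 2 * s)) has_integral
     (1 / 2 - sin (pi * 1) / (2 * pi)) - (0 / 2 - sin (pi * 0) / (2 * pi))) {0..1}"
  proof (rule fundamental_theorem_of_calculus)
    fix x :: real
    have "cos (pi * x) = 1 - 2 * (sin (pi / 2 * x))\<^sup>2"
      using cos_double_sin[of "pi / 2 * x"] by simp
    then have "1 / 2 - cos (pi * x) * pi / (2 * pi) = sin (pi / 2 * x) * sin (pi / 2 * x)"
      by (simp add: power2_eq_square diff_divide_distrib)
    moreover have "((\<lambda>x. x / 2 - sin (pi * x) / (2 * pi)) has_real_derivative 1 / 2 - cos (pi * x) * pi / (2 * pi)) (at x within {0..1})"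
      by (auto intro!: derivative_eq_intros)
    ultimately have "((\<lambda>x. x / 2 - sin (pi * x) / (2 * pi)) has_real_derivative sin (pi / 2 * x) * sin (pi / 2 * x)) (at x within {0..1})"
      by simp
    then show "((\<lambda>x. x / 2 - sin (pi * x) / (2 * pi)) has_vector_derivative sin (pi / 2 * x) * sin (pi / 2 * x)) (at x within {0..1})"
      by (simp add: has_real_derivative_iff_has_vector_derivative)
  qed simp
  then have "integral {0..1} (\<lambda>s. sin (pi / 2 * s) * sin (pi / 2 * s)) = 1 / 2"
    by (simp add: integral_unique)
  moreover have "integral {0..1} (\<lambda>s. sin (pi / 2 * s) * apply_bcontfun Tphi s) = integral {0..1} (\<lambda>s. sin (pi / 2 * s) * sin (pi / 2 * s))"
    by (intro Henstock_Kurzweil_Integration.integral_cong) (simp add: apply_T clamp1_id)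
  ultimately show ?thesis by (simp add: resonance_eq_integral)
qed

abbreviation rc :: "real \<Rightarrow> tser" where "rc r \<equiv> cst (of_real r)"

text \<open>\<open>SolE\<close> is the correction of \<open>M\<close>: its coefficients are fixed by the solvability condition at \<open>|k| = 1\<close>.\<close>

definition ce :: "nat \<Rightarrow> real" where "ce n = 2 * M0 n * eps0 n / (lam n * mu0 n)"

text \<open>At \<open>unit 0\<close> theta has the coefficient 1/2, and \<open>Tphi\<close> has
  \<open>resonance\<close> 1/2. A unit of correction therefore lowers the resonance of the
  right-hand side by \<open>ce n / 4\<close>, whence the factor 4.\<close>

definition efun :: "nat \<Rightarrow> tpoly \<Rightarrow> tpoly \<Rightarrow> real" where
  "efun n f g = 4 / ce n * (resonance (cf f (unit 0)) / (lam n * mu0 n) - apply_bcontfun (cf g (unit 0)) 1)"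

definition SolE :: "nat \<Rightarrow> tser \<Rightarrow> tser \<Rightarrow> tser" where
  "SolE n = fmap2 (\<lambda>f g. sng 0 (of_real (efun n f g)))"

definition TH :: "nat \<Rightarrow> tser" where "TH m = fps_const (theta_poly m)"

text \<open>The linearised equation contains \<open>2 * M0 n * eps0 n\<close> times
  \<open>Tphi\<close>, theta and the correction of \<open>M\<close>. This term is moved to the right
  and everything is divided by \<open>lam n * mu0 n\<close>, the coefficient of the second
  derivative.\<close>

definition SolF :: "nat \<Rightarrow> nat \<Rightarrow> tser \<Rightarrow> tser \<Rightarrow> tser" where
  "SolF n m N B = rc (1 / (lam n * mu0 n)) * N - cst (of_real (ce n) * Tphi) * SolE n N B * TH m"

definition SolZ :: "(nat \<Rightarrow> tfun \<Rightarrow> real \<Rightarrow> tfun) \<Rightarrow> nat \<Rightarrow> nat \<Rightarrow> tser \<Rightarrow> tser \<Rightarrow> tser" where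
  "SolZ S n m N B = fmap2 (LS S m) (SolF n m N B) B"

definition SolQ :: "nat \<Rightarrow> nat \<Rightarrow> tser \<Rightarrow> tser \<Rightarrow> tser" where
  "SolQ n m N B = fmap aop (SolZ (tS0 n) n m N B)"

text \<open>\<open>SolZ\<close> computes \<open>z\<close> and its derivatives, and \<open>SolQ\<close> is \<open>z 1\<close>; then \<open>Y = z - t v\<^sub>n' SolQ\<close> vanishes at \<open>t = 1\<close>.\<close>

primrec Sol :: "nat \<Rightarrow> nat \<Rightarrow> tser \<Rightarrow> tser \<Rightarrow> comp \<Rightarrow> tser" where
  "Sol n m N B CY = SolZ (tS0 n) n m N B - cst Tid * cst (Tv1 n) * SolQ n m N B"
| "Sol n m N B CY1 = SolZ (tS1 n) n m N B - (cst (Tv1 n) - rc (1 / lam n) * cst Tid * cst (Tv n)) * SolQ n m N B"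
| "Sol n m N B CY2 = SolZ (tS2 n) n m N B + rc (1 / lam n) * (cst (Tv n) + cst (Tv n) + cst Tid * cst (Tv1 n)) * SolQ n m N B"
| "Sol n m N B Eta = SolQ n m N B"
| "Sol n m N B Mu = SolE n N B"

text \<open>The kernel element: \<open>z\<close> is \<open>Tphi\<close> times theta,
  \<open>\<eta>\<close> is theta, and \<open>Y\<close> results by subtracting
  \<open>t v\<^sub>n' \<eta>\<close>. The next two lines are its derivatives in \<open>t\<close>,
  simplified by \<open>v\<^sub>n'' = - v\<^sub>n / lam n\<close>. Taking theta with factor 1 fixes
  the parameter \<open>s\<close>.\<close>

primrec base :: "nat \<Rightarrow> nat \<Rightarrow> comp \<Rightarrow> tser" where
  "base n m CY = (cst Tphi - cst Tid * cst (Tv1 n)) * TH m"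
| "base n m CY1 = (cst Tphi1 - (cst (Tv1 n) - rc (1 / lam n) * cst Tid * cst (Tv n))) * TH m"
| "base n m CY2 = (rc (- ((pi / 2)\<^sup>2)) * cst Tphi + rc (1 / lam n) * (cst (Tv n) + cst (Tv n) + cst Tid * cst (Tv1 n))) * TH m"
| "base n m Eta = TH m"
| "base n m Mu = rc (M0 n)"

section \<open>The nonlinear terms\<close>

definition kap :: "tser \<Rightarrow> tser" where
  "kap \<eta> = \<eta> + \<eta> + fps_X * (\<eta> * \<eta>)"

text \<open>With \<open>(1 + s \<eta>)\<^sup>2 = 1 + s kap\<close>, the operators \<open>Kop\<close> and \<open>Kbop\<close> collect the terms of higher order in \<open>s\<close> of the
  straightened equation and of the boundary condition
  \<open>W\<^sub>t\<^sup>2 (\<lambda> \<mu> (1 + s \<eta>)\<^sup>4 + s\<^sup>2 |\<nabla>\<eta>|\<^sup>2) = \<lambda> \<mu> (1 + s \<eta>)\<^sup>2\<close> at \<open>t = 1\<close>, where \<open>\<lambda> = lam n\<close>. \<open>Pop\<close> and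
  \<open>Pbop\<close> come from replacing \<open>\<mu>\<close> by \<open>mu0\<close> in the linear part.\<close>

definition Kop :: "nat \<Rightarrow> nat \<Rightarrow> (comp \<Rightarrow> tser) \<Rightarrow> tser" where
  "Kop n m x = x Mu * x Mu * ((kap (x Eta) + kap (x Eta) + fps_X * (kap (x Eta) * kap (x Eta))) * (rc (lam n) * x CY2))
     - kap (x Eta) * fmap (Eop m) (x CY) + x Mu * x Mu * (kap (x Eta) * x CY)
     - x Mu * x Mu * ((x Eta * x Eta + kap (x Eta) * kap (x Eta)) * cst (Tv n))
     - cst Tid * (fmap (Eop m) (x Eta) * (x CY1 + x Eta * cst (Tv1 n) + fps_X * (x Eta * x CY1)))
     - cst Tid * GS m (kap (x Eta)) (x CY1)
     - cst Tid * cst Tid * (GS m (x Eta) (x Eta) * (fps_X * x CY2 - rc (1 / lam n) * cst (Tv n)))"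

definition Kbop :: "nat \<Rightarrow> nat \<Rightarrow> (comp \<Rightarrow> tser) \<Rightarrow> tser" where
  "Kbop n m x = rc (lam n) * (x Mu * x Mu) * (x CY1 * x CY1
       + (x CY1 + x CY1 + fps_X * (x CY1 * x CY1)) * (kap (x Eta) + kap (x Eta) + fps_X * (kap (x Eta) * kap (x Eta)))
       + x Eta * x Eta + kap (x Eta) * kap (x Eta))
     - (1 + fps_X * x CY1) * (1 + fps_X * x CY1) * GS m (x Eta) (x Eta)"

text \<open>For \<open>M = M0 n + s * e\<close> one has
  \<open>M\<^sup>2 = mu0 n + s * Emu n e\<close>.\<close>

definition Emu :: "nat \<Rightarrow> tser \<Rightarrow> tser" where
  "Emu n e = rc (2 * M0 n) * e + fps_X * (e * e)"

definition Pop :: "nat \<Rightarrow> nat \<Rightarrow> (comp \<Rightarrow> tser) \<Rightarrow> tser" where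
  "Pop n m x = rc (eps0 n) * cst Tphi * TH m * (x Mu * x Mu)
     + Emu n (x Mu) * (rc (lam n) * x CY2 + x CY - (x Eta * cst (Tv n) + x Eta * cst (Tv n)))"

definition Pbop :: "nat \<Rightarrow> nat \<Rightarrow> (comp \<Rightarrow> tser) \<Rightarrow> tser" where
  "Pbop n m x = rc (2 * lam n) * (Emu n (x Mu) * (x CY1 + x Eta))"

text \<open>The unknown of the fixed point equation is the remainder after the explicit leading terms.\<close>

definition hat :: "nat \<Rightarrow> nat \<Rightarrow> (comp \<Rightarrow> tser) \<Rightarrow> comp \<Rightarrow> tser" where
  "hat n m x c = base n m c + fps_X * x c"

definition RN :: "nat \<Rightarrow> nat \<Rightarrow> (comp \<Rightarrow> tser) \<Rightarrow> tser" where
  "RN n m x = - (fps_X * Pop n m x + Kop n m (hat n m x))"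

text \<open>The linear part of the boundary condition is \<open>2 * lam n * mu0 n\<close> times
  \<open>Y' + \<eta>\<close>, that is, times \<open>z'\<close> at \<open>t = 1\<close>; dividing by
  it gives the Neumann datum.\<close>

definition RB :: "nat \<Rightarrow> nat \<Rightarrow> (comp \<Rightarrow> tser) \<Rightarrow> tser" where
  "RB n m x = rc (- 1 / (2 * lam n * mu0 n)) * fmap aop (fps_X * Pbop n m x + Kbop n m (hat n m x))"

definition Phi :: "nat \<Rightarrow> nat \<Rightarrow> (comp \<Rightarrow> tser) \<Rightarrow> comp \<Rightarrow> tser" where
  "Phi n m x = Sol n m (RN n m x) (RB n m x)"

section \<open>Orders and parities of the nonlinear terms\<close>

lemma tame_rc: "tame m p 1 (\<lambda>x. rc r)"
  by (rule tame_cst) simp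

lemma tame_1: "tame m p 1 (\<lambda>x. 1)"
  using tame_rc[of m p 1] by simp

lemma tame_T:
  "tame m p (-1) (\<lambda>x. cst Tid)" "tame m p (-1) (\<lambda>x. cst (Tv n))" "tame m p 1 (\<lambda>x. cst (Tv1 n))"
  "tame m p (-1) (\<lambda>x. cst Tphi)" "tame m p 1 (\<lambda>x. cst Tphi1)"
  by (intro tame_cst, simp add: T_parity)+

lemma tame_TH: "tame m p 1 (\<lambda>x. TH m)"
  unfolding TH_def by (intro tame_const psym_theta_poly)

lemmas tame_intros = tame_add tame_diff tame_mult tame_GS tame_E tame_aop tame_rc tame_1 tame_T tame_TH tame_X tame_comp

lemma tame_kap: "tame m p 1 f \<Longrightarrow> tame m p 1 (\<lambda>x. kap (f x))"
  unfolding kap_def by ((rule tame_intros | assumption | rule refl | (simp; fail))+)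

lemma tame_Emu: "tame m p 1 f \<Longrightarrow> tame m p 1 (\<lambda>x. Emu n (f x))"
  unfolding Emu_def by ((rule tame_intros | assumption | rule refl | (simp; fail))+)

text \<open>The loss matches the gain: two derivatives of \<open>Y\<close> and \<open>\<eta>\<close>
  (order 3), one of \<open>Y'\<close> (order 2) and none of \<open>Y''\<close> (order 1) all leave
  order 1, and the solution operators return order 3, 2, 1 from a right-hand side of order 1 and a
  boundary datum of order 2.\<close>

lemma tame_Kop: "tame m 1 (-1) (Kop n m)"
  unfolding Kop_def by ((rule tame_intros tame_kap | rule refl | (simp; fail))+)

lemma tame_Kbop: "tame m 2 1 (Kbop n m)"
  unfolding Kbop_def by ((rule tame_intros tame_kap | rule refl | (simp; fail))+)

lemma tame_Pop: "tame m 1 (-1) (Pop n m)"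
  unfolding Pop_def by ((rule tame_intros tame_Emu | rule refl | (simp; fail))+)

lemma tame_Pbop: "tame m 2 1 (Pbop n m)"
  unfolding Pbop_def by ((rule tame_intros tame_Emu | rule refl | (simp; fail))+)

lemma tame_base: "tame m p (cpar c) (\<lambda>x. base n m c)"
  by (cases c; simp only: base.simps cpar.simps; ((rule tame_intros | rule refl | (simp; fail))+))

section \<open>Majorant argument\<close>

lemma norm_cf_le_wnorm: "norm (cf f k) \<le> wnorm m p f"
proof (cases "cf f k = 0")
  case False
  have "1 * norm (cf f k) \<le> wt m k ^ p * norm (cf f k)"
    by (intro mult_right_mono one_le_power wt_ge_1) auto
  also have "\<dots> \<le> wnorm m p f"
    unfolding wnorm_def using False by (intro member_le_sum) (auto simp: in_keys_iff)
  finally show ?thesis by simp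
qed simp

context
  fixes n m :: nat
  assumes n: "n \<ge> 1" and m: "m \<ge> 1"
begin

lemma M0_pos: "M0 n > 0" and M0_sq: "M0 n * M0 n = mu0 n" and eps0_pos: "eps0 n > 0" and eps0_mu0: "eps0 n * mu0 n = 1"
  using mu0_pos[OF n] by (simp_all add: M0_def eps0_def)

lemma ce_pos: "ce n > 0"
  unfolding ce_def using M0_pos eps0_pos mu0_pos[OF n] lam_pos[OF n] by simp

lemma efun_bound: "\<bar>efun n f g\<bar> \<le> 4 / ce n * (2 / (lam n * mu0 n)) * wnorm m 1 f + 4 / ce n * wnorm m 2 g"
proof -
  have "\<bar>resonance (cf f (unit 0))\<bar> \<le> 2 * wnorm m 1 f"
    using resonance_bound[of "cf f (unit 0)"] norm_cf_le_wnorm[of f "unit 0" m 1] by linarith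
  then have 1: "\<bar>resonance (cf f (unit 0)) / (lam n * mu0 n)\<bar> \<le> 2 / (lam n * mu0 n) * wnorm m 1 f"
    using mu0_pos[OF n] lam_pos[OF n] by (simp add: divide_simps abs_mult)
  have 2: "\<bar>apply_bcontfun (cf g (unit 0)) 1\<bar> \<le> wnorm m 2 g"
    using norm_bounded[of "cf g (unit 0)" 1] norm_cf_le_wnorm[of g "unit 0" m 2] by simp
  have "\<bar>efun n f g\<bar> = 4 / ce n * \<bar>resonance (cf f (unit 0)) / (lam n * mu0 n) - apply_bcontfun (cf g (unit 0)) 1\<bar>"
    unfolding efun_def abs_mult using ce_pos by simp
  also have "\<dots> \<le> 4 / ce n * (2 / (lam n * mu0 n) * wnorm m 1 f + wnorm m 2 g)"
    using ce_pos by (intro mult_left_mono order_trans[OF abs_triangle_ineq4 add_mono[OF 1 2]]) auto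
  finally show ?thesis by (simp add: algebra_simps)
qed

lemma tame_SolE:
  assumes "tame m 1 (-1) N" "tame m 2 1 B"
  shows "tame m p 1 (\<lambda>x. SolE n (N x) (B x))"
  unfolding SolE_def
proof (rule tame_fmap2[OF assms])
  fix f g :: tpoly
  show "wnorm m p (sng 0 (of_real (efun n f g) :: tfun)) \<le> 4 / ce n * (2 / (lam n * mu0 n)) * wnorm m 1 f + 4 / ce n * wnorm m 2 g"
    using efun_bound by (simp add: wnorm_sng)
  show "psym m 1 (sng 0 (of_real (efun n f g) :: tfun))"
    by (rule psym_sng_0) simp
qed (use ce_pos mu0_pos[OF n] lam_pos[OF n] in auto)

lemma tame_SolF:
  assumes "tame m 1 (-1) N" "tame m 2 1 B"
  shows "tame m 1 (-1) (\<lambda>x. SolF n m (N x) (B x))"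
  unfolding SolF_def cst_mult
  by ((rule assms tame_SolE[OF assms] tame_intros | rule refl | (simp; fail))+)

lemma tame_SolZ:
  assumes "tame m 1 (-1) N" "tame m 2 1 B"
  shows "tame m 3 (-1) (\<lambda>x. SolZ (tS0 n) n m (N x) (B x))"
    and "tame m 2 1 (\<lambda>x. SolZ (tS1 n) n m (N x) (B x))"
    and "tame m 1 (-1) (\<lambda>x. SolZ (tS2 n) n m (N x) (B x))"
proof -
  note F = tame_SolF[OF assms]
  have s: "Suc 1 = 2" "Suc 2 = 3" by simp_all
  show "tame m 3 (-1) (\<lambda>x. SolZ (tS0 n) n m (N x) (B x))"
    unfolding SolZ_def
    by (rule tame_fmap2[OF F assms(2) wnorm_LS0[OF n, of m 1, unfolded s]])
      (auto intro!: psym_LS[where \<sigma> = "-1" and \<tau> = 1] simp: tS_parity[OF n] tS_0[OF n])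
  show "tame m 2 1 (\<lambda>x. SolZ (tS1 n) n m (N x) (B x))"
    unfolding SolZ_def
    by (rule tame_fmap2[OF F assms(2) wnorm_LS1[OF n, of m 1, unfolded s]])
      (auto intro!: psym_LS[where \<sigma> = "-1" and \<tau> = 1] simp: tS_parity[OF n] tS_0[OF n])
  show "tame m 1 (-1) (\<lambda>x. SolZ (tS2 n) n m (N x) (B x))"
    unfolding SolZ_def
    by (rule tame_fmap2[OF F assms(2) wnorm_LS2[OF n, of m 1, unfolded s]])
      (auto intro!: psym_LS[where \<sigma> = "-1" and \<tau> = 1] simp: tS_parity[OF n] tS_0[OF n])
qed

lemma tame_le: "tame m q \<sigma> f \<Longrightarrow> p \<le> q \<Longrightarrow> tame m p \<sigma> f"
  by (rule tame_binary[of m q \<sigma> f q \<sigma> f p "\<lambda>F G. F" "\<lambda>x y. x"]) (auto intro: jet_norm_mono)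

lemma tame_SolQ:
  assumes "tame m 1 (-1) N" "tame m 2 1 B" "p \<le> 3"
  shows "tame m p 1 (\<lambda>x. SolQ n m (N x) (B x))"
  unfolding SolQ_def by (rule tame_aop[OF tame_le[OF tame_SolZ(1)[OF assms(1,2)] assms(3)]])

lemma tame_Sol:
  assumes "tame m 1 (-1) N" "tame m 2 1 B"
  shows "tame m (cord c) (cpar c) (\<lambda>x. Sol n m (N x) (B x) c)"
  by (cases c; simp only: Sol.simps cpar.simps cord.simps;
      ((rule tame_SolZ[OF assms] tame_SolQ[OF assms] tame_SolE[OF assms] tame_intros | rule refl | (simp; fail))+))

lemma jet_norm_zero [simp]: "jet_norm m p \<rho> J 0 = 0"
  by (simp add: jet_norm_def)

lemma ex_uniform_comp:
  assumes "\<And>c. \<exists>C::real. P c C" "\<And>c C D. P c C \<Longrightarrow> C \<le> D \<Longrightarrow> P c D"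
  shows "\<exists>C\<ge>0. \<forall>c::comp. P c C"
proof -
  obtain C where C: "\<And>c. P c (C c)" using assms(1) by metis
  have "C c \<le> \<bar>C CY\<bar> + \<bar>C CY1\<bar> + \<bar>C CY2\<bar> + \<bar>C Eta\<bar> + \<bar>C Mu\<bar>" for c
    by (cases c) auto
  then have "P c (\<bar>C CY\<bar> + \<bar>C CY1\<bar> + \<bar>C CY2\<bar> + \<bar>C Eta\<bar> + \<bar>C Mu\<bar>)" for c
    using assms(2)[OF C[of c]] by blast
  then show ?thesis by (intro exI[of _ "\<bar>C CY\<bar> + \<bar>C CY1\<bar> + \<bar>C CY2\<bar> + \<bar>C Eta\<bar> + \<bar>C Mu\<bar>"]) auto
qed

lemma base_bound: "\<exists>C\<ge>0. \<forall>c. \<forall>\<rho>\<in>{0..1}. \<forall>J. jet_norm m (cord c) \<rho> J (base n m c) \<le> C"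
proof (rule ex_uniform_comp)
  fix c
  obtain C where "C \<ge> 0" and C: "\<And>\<rho> J x. 0 \<le> \<rho> \<Longrightarrow> \<rho> \<le> 1 \<Longrightarrow> jets_bounded m \<rho> J 0 x \<Longrightarrow> jet_norm m (cord c) \<rho> J (base n m c) \<le> C"
    by (rule tame_bound[OF tame_base[of m "cord c" c n], of 0]) blast
  have i: "jets_bounded m \<rho> J 0 (\<lambda>_. 0)" for \<rho> J by (simp add: jets_bounded_def)
  then show "\<exists>C. \<forall>\<rho>\<in>{0..1}. \<forall>J. jet_norm m (cord c) \<rho> J (base n m c) \<le> C"
    by (intro exI[of _ C] ballI allI) (rule C[OF _ _ i], auto)
next
  fix c C D
  assume "\<forall>\<rho>\<in>{0..1}. \<forall>J. jet_norm m (cord c) \<rho> J (base n m c) \<le> C" "C \<le> D"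
  then show "\<forall>\<rho>\<in>{0..1}. \<forall>J. jet_norm m (cord c) \<rho> J (base n m c) \<le> D"
    by (meson order_trans)
qed

text \<open>Tameness concerns operators on the five-component unknown. To apply it to arbitrary
  data, \<open>N\<close> and \<open>B\<close> are put into the slots \<open>CY2\<close> and
  \<open>CY1\<close>, whose orders 1 and 2 and whose parities are the right ones.\<close>

lemma Sol_bound:
  "\<exists>C\<ge>0. \<forall>c. \<forall>\<rho>\<in>{0..1}. \<forall>J N B. jet_norm m 1 \<rho> J N \<le> R \<longrightarrow> jet_norm m 2 \<rho> J B \<le> R \<longrightarrow> jet_norm m (cord c) \<rho> J (Sol n m N B c) \<le> C"
proof (rule ex_uniform_comp)
  fix c
  have op: "tame m (cord c) (cpar c) (\<lambda>x. Sol n m (x CY2) (x CY1) c)"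
    by (rule tame_Sol) (simp_all add: tame_comp)
  obtain C where "C \<ge> 0" and C: "\<And>\<rho> J x. 0 \<le> \<rho> \<Longrightarrow> \<rho> \<le> 1 \<Longrightarrow>
      jets_bounded m \<rho> J (max R 0) x \<Longrightarrow> jet_norm m (cord c) \<rho> J (Sol n m (x CY2) (x CY1) c) \<le> C"
    by (rule tame_bound[OF op, of "max R 0"]) blast
  have "jet_norm m (cord c) \<rho> J (Sol n m N B c) \<le> C"
    if "0 \<le> \<rho>" "\<rho> \<le> 1" "jet_norm m 1 \<rho> J N \<le> R" "jet_norm m 2 \<rho> J B \<le> R" for \<rho> J N B
  proof -
    define x where "x d = (if d = CY2 then N else if d = CY1 then B else 0)" for d
    have "jets_bounded m \<rho> J (max R 0) x"
      unfolding jets_bounded_def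
    proof
      fix d show "jet_norm m (cord d) \<rho> J (x d) \<le> max R 0" using that by (cases d) (auto simp: x_def)
    qed
    from C[OF that(1,2) this] show ?thesis by (simp add: x_def)
  qed
  then show "\<exists>C. \<forall>\<rho>\<in>{0..1}. \<forall>J N B. jet_norm m 1 \<rho> J N \<le> R \<longrightarrow> jet_norm m 2 \<rho> J B \<le> R \<longrightarrow> jet_norm m (cord c) \<rho> J (Sol n m N B c) \<le> C"
    by (intro exI[of _ C] ballI allI impI) simp
next
  fix c C D
  assume "\<forall>\<rho>\<in>{0..1}. \<forall>J N B. jet_norm m 1 \<rho> J N \<le> R \<longrightarrow> jet_norm m 2 \<rho> J B \<le> R \<longrightarrow> jet_norm m (cord c) \<rho> J (Sol n m N B c) \<le> C"
    "C \<le> D"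
  then show "\<forall>\<rho>\<in>{0..1}. \<forall>J N B. jet_norm m 1 \<rho> J N \<le> R \<longrightarrow> jet_norm m 2 \<rho> J B \<le> R \<longrightarrow> jet_norm m (cord c) \<rho> J (Sol n m N B c) \<le> D"
    by (meson order_trans)
qed

lemma jet_norm_rc_times: "0 \<le> \<rho> \<Longrightarrow> jet_norm m p \<rho> J (rc r * F) \<le> \<bar>r\<bar> * jet_norm m p \<rho> J F"
  by (rule order_trans[OF jet_norm_mult]) (simp_all add: cst_def jet_norm_fps_const wnorm_sng)

lemma jet_norm_aop: "0 \<le> \<rho> \<Longrightarrow> jet_norm m p \<rho> J (fmap aop F) \<le> jet_norm m p \<rho> J F"
  using jet_norm_fmap_le[of \<rho> m p aop 1 p J F] wnorm_aop by simp

text \<open>The order of the choices avoids circularity. As long as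
  \<open>\<rho> * R \<le> 1\<close>, the argument \<open>hat n m x\<close> is bounded by
  \<open>Cb + 1\<close> whatever \<open>R\<close> is; so \<open>R\<close> is determined by
  \<open>Cb\<close> alone, and \<open>\<rho>\<close> is chosen last.\<close>

lemma Phi_bounded:
  "\<exists>R \<rho>. 0 < \<rho> \<and> \<rho> \<le> 1 \<and> (\<forall>x. jets_bounded m \<rho> 0 R (Phi n m x)) \<and>
     (\<forall>J x. jets_bounded m \<rho> J R x \<longrightarrow> jets_bounded m \<rho> (Suc J) R (Phi n m x))"
proof -
  obtain Cb where Cb: "Cb \<ge> 0" "\<And>c \<rho> J. 0 \<le> \<rho> \<Longrightarrow> \<rho> \<le> 1 \<Longrightarrow> jet_norm m (cord c) \<rho> J (base n m c) \<le> Cb"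
    using base_bound by auto
  obtain CK where CK: "CK \<ge> 0" "\<And>\<rho> J x. 0 \<le> \<rho> \<Longrightarrow> \<rho> \<le> 1 \<Longrightarrow> jets_bounded m \<rho> J (Cb + 1) x \<Longrightarrow> jet_norm m 1 \<rho> J (Kop n m x) \<le> CK"
    by (rule tame_bound[OF tame_Kop, of m "Cb + 1" n]) blast
  obtain CL where CL: "CL \<ge> 0" "\<And>\<rho> J x. 0 \<le> \<rho> \<Longrightarrow> \<rho> \<le> 1 \<Longrightarrow> jets_bounded m \<rho> J (Cb + 1) x \<Longrightarrow> jet_norm m 2 \<rho> J (Kbop n m x) \<le> CL"
    by (rule tame_bound[OF tame_Kbop, of m "Cb + 1" n]) blast
  define r where "r = \<bar>- 1 / (2 * lam n * mu0 n)\<bar>"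
  define R0 where "R0 = max (CK + 1) (r * (CL + 1))"
  obtain R where R: "R \<ge> 0" "\<And>c \<rho> J N B. 0 \<le> \<rho> \<Longrightarrow> \<rho> \<le> 1 \<Longrightarrow> jet_norm m 1 \<rho> J N \<le> R0 \<Longrightarrow>
      jet_norm m 2 \<rho> J B \<le> R0 \<Longrightarrow> jet_norm m (cord c) \<rho> J (Sol n m N B c) \<le> R"
    using Sol_bound[of R0] by auto
  obtain CP where CP: "CP \<ge> 0" "\<And>\<rho> J x. 0 \<le> \<rho> \<Longrightarrow> \<rho> \<le> 1 \<Longrightarrow> jets_bounded m \<rho> J R x \<Longrightarrow> jet_norm m 1 \<rho> J (Pop n m x) \<le> CP"
    by (rule tame_bound[OF tame_Pop, of m R n]) blast
  obtain CQ where CQ: "CQ \<ge> 0" "\<And>\<rho> J x. 0 \<le> \<rho> \<Longrightarrow> \<rho> \<le> 1 \<Longrightarrow> jets_bounded m \<rho> J R x \<Longrightarrow> jet_norm m 2 \<rho> J (Pbop n m x) \<le> CQ"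
    by (rule tame_bound[OF tame_Pbop, of m R n]) blast
  \<comment> \<open>Small enough that each of \<open>R\<close>, \<open>CP\<close> and
    \<open>CQ\<close> is brought below 1 by one factor \<open>s\<close>.\<close>
  define \<rho> where "\<rho> = 1 / (1 + R + CP + CQ)"
  have \<rho>: "0 < \<rho>" "\<rho> \<le> 1" "\<rho> * R \<le> 1" "\<rho> * CP \<le> 1" "\<rho> * CQ \<le> 1"
    using R(1) CP(1) CQ(1) by (auto simp: \<rho>_def divide_simps)
  have main: "jets_bounded m \<rho> J R (Phi n m x)"
    if h: "\<And>c. jet_norm m (cord c) \<rho> J (fps_X * x c) \<le> 1"
      and P: "jet_norm m 1 \<rho> J (fps_X * Pop n m x) \<le> 1" and Q: "jet_norm m 2 \<rho> J (fps_X * Pbop n m x) \<le> 1" for J x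
  proof -
    have hb: "jets_bounded m \<rho> J (Cb + 1) (hat n m x)"
      unfolding jets_bounded_def hat_def
    proof
      fix c show "jet_norm m (cord c) \<rho> J (base n m c + fps_X * x c) \<le> Cb + 1"
        using jet_norm_add[of \<rho> m "cord c" J "base n m c" "fps_X * x c"] Cb(2)[of \<rho> c J] h[of c] \<rho> by linarith
    qed
    have N: "jet_norm m 1 \<rho> J (RN n m x) \<le> R0"
    proof -
      have "jet_norm m 1 \<rho> J (RN n m x) \<le> jet_norm m 1 \<rho> J (fps_X * Pop n m x) + jet_norm m 1 \<rho> J (Kop n m (hat n m x))"
        unfolding RN_def jet_norm_minus using \<rho> by (intro jet_norm_add) simp
      also have "\<dots> \<le> 1 + CK" using P CK(2)[OF _ _ hb] \<rho> by (intro add_mono) auto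
      finally show ?thesis by (simp add: R0_def)
    qed
    have B: "jet_norm m 2 \<rho> J (RB n m x) \<le> R0"
    proof -
      have "jet_norm m 2 \<rho> J (RB n m x) \<le> r * jet_norm m 2 \<rho> J (fmap aop (fps_X * Pbop n m x + Kbop n m (hat n m x)))"
        unfolding RB_def r_def using \<rho> by (intro jet_norm_rc_times) simp
      also have "\<dots> \<le> r * (jet_norm m 2 \<rho> J (fps_X * Pbop n m x) + jet_norm m 2 \<rho> J (Kbop n m (hat n m x)))"
        using \<rho> by (intro mult_left_mono order_trans[OF jet_norm_aop jet_norm_add]) (auto simp: r_def)
      also have "\<dots> \<le> r * (1 + CL)"
        using Q CL(2)[OF _ _ hb] \<rho> by (intro mult_left_mono add_mono) (auto simp: r_def)
      finally show ?thesis by (simp add: R0_def add.commute)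
    qed
    show ?thesis unfolding jets_bounded_def Phi_def using R(2)[OF _ _ N B] \<rho> by auto
  qed
  \<comment> \<open>At order 0 the terms with a factor \<open>s\<close> vanish, so the induction
    starts without any assumption on \<open>x\<close>.\<close>
  have "jets_bounded m \<rho> 0 R (Phi n m x)" for x
    by (rule main) (auto simp: jet_norm_X_mult_0)
  moreover have "jets_bounded m \<rho> (Suc J) R (Phi n m x)" if x: "jets_bounded m \<rho> J R x" for J x
  proof (rule main)
    fix c
    have "\<rho> * jet_norm m (cord c) \<rho> J (x c) \<le> \<rho> * R" using x \<rho> by (intro mult_left_mono) (auto simp: jets_bounded_def)
    then show "jet_norm m (cord c) \<rho> (Suc J) (fps_X * x c) \<le> 1" using \<rho> by (subst jet_norm_X_mult) linarith+
  next
    have "\<rho> * jet_norm m 1 \<rho> J (Pop n m x) \<le> \<rho> * CP" using CP(2)[OF _ _ x] \<rho> by (intro mult_left_mono) auto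
    then show "jet_norm m 1 \<rho> (Suc J) (fps_X * Pop n m x) \<le> 1" using \<rho> by (subst jet_norm_X_mult) linarith+
  next
    have "\<rho> * jet_norm m 2 \<rho> J (Pbop n m x) \<le> \<rho> * CQ" using CQ(2)[OF _ _ x] \<rho> by (intro mult_left_mono) auto
    then show "jet_norm m 2 \<rho> (Suc J) (fps_X * Pbop n m x) \<le> 1" using \<rho> by (subst jet_norm_X_mult) linarith+
  qed
  ultimately show ?thesis using \<rho> by blast
qed

lemma agree_refl: "agree J F F" by (simp add: agree_def)

lemma agree_add: "agree J F F' \<Longrightarrow> agree J G G' \<Longrightarrow> agree J (F + G) (F' + G')" for F G :: tser
  by (simp add: agree_def)

lemma sym_upto_add: "sym_upto m \<sigma> J F \<Longrightarrow> sym_upto m \<sigma> J G \<Longrightarrow> sym_upto m \<sigma> J (F + G)" for F G :: tser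
  by (simp add: sym_upto_def psym_add)

lemma agree_minus: "agree J F G \<Longrightarrow> agree J (- F) (- G)" for F G :: tser
  by (simp add: agree_def)

lemma sym_upto_minus: "sym_upto m \<sigma> J F \<Longrightarrow> sym_upto m \<sigma> J (- F)"
  by (simp add: sym_upto_def psym_minus)

lemma tame_SolN: "tame m (cord c) (cpar c) (\<lambda>x. Sol n m (x CY2) (x CY1) c)"
  by (rule tame_Sol) (simp_all add: tame_comp)

lemma Sol_agree: "agree J N N' \<Longrightarrow> agree J B B' \<Longrightarrow> agree J (Sol n m N B c) (Sol n m N' B' c)"
  using tame_agree[OF tame_SolN, of J "\<lambda>d. if d = CY2 then N else if d = CY1 then B else 0"
      "\<lambda>d. if d = CY2 then N' else if d = CY1 then B' else 0" c] by (simp add: agree_refl)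

lemma Sol_sym_upto: "sym_upto m (-1) J N \<Longrightarrow> sym_upto m 1 J B \<Longrightarrow> sym_upto m (cpar c) J (Sol n m N B c)"
proof -
  assume "sym_upto m (-1) J N" "sym_upto m 1 J B"
  then have "sym_upto m (cpar d) J (if d = CY2 then N else if d = CY1 then B else 0)" for d
    by (cases d) (auto simp: sym_upto_def)
  from tame_sym_upto[OF tame_SolN, of J "\<lambda>d. if d = CY2 then N else if d = CY1 then B else 0", OF this]
  show ?thesis by simp
qed

lemma RN_RB_agree:
  assumes "\<And>c. agree J (x c) (y c)"
  shows "agree (Suc J) (RN n m x) (RN n m y)" "agree (Suc J) (RB n m x) (RB n m y)"
proof -
  have h: "agree (Suc J) (hat n m x c) (hat n m y c)" for c
    unfolding hat_def by (intro agree_add agree_refl agree_X_mult assms)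
  have "agree (Suc J) (fps_X * Pop n m x + Kop n m (hat n m x)) (fps_X * Pop n m y + Kop n m (hat n m y))"
    by (intro agree_add agree_X_mult tame_agree[OF tame_Pop] tame_agree[OF tame_Kop] assms h)
  then show "agree (Suc J) (RN n m x) (RN n m y)" unfolding RN_def by (rule agree_minus)
  have "agree (Suc J) (fps_X * Pbop n m x + Kbop n m (hat n m x)) (fps_X * Pbop n m y + Kbop n m (hat n m y))"
    by (intro agree_add agree_X_mult tame_agree[OF tame_Pbop] tame_agree[OF tame_Kbop] assms h)
  then show "agree (Suc J) (RB n m x) (RB n m y)" by (simp add: RB_def agree_def)
qed

lemma RN_RB_sym_upto:
  assumes "\<And>c. sym_upto m (cpar c) J (x c)"
  shows "sym_upto m (-1) (Suc J) (RN n m x)" "sym_upto m 1 (Suc J) (RB n m x)" "\<And>c. sym_upto m (cpar c) (Suc J) (hat n m x c)"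
proof -
  have b: "sym_upto m (cpar c) J (base n m c)" for c J
    by (rule tame_sym_upto[OF tame_base[of m 0 c n], of J "\<lambda>_. 0"]) (simp add: sym_upto_def)
  show h: "sym_upto m (cpar c) (Suc J) (hat n m x c)" for c
    unfolding hat_def by (intro sym_upto_add b sym_upto_X_mult assms)
  have "sym_upto m (-1) (Suc J) (fps_X * Pop n m x + Kop n m (hat n m x))"
    by (intro sym_upto_add sym_upto_X_mult tame_sym_upto[OF tame_Pop] tame_sym_upto[OF tame_Kop] assms h)
  then show "sym_upto m (-1) (Suc J) (RN n m x)" unfolding RN_def by (rule sym_upto_minus)
  have *: "sym_upto m 1 (Suc J) (fps_X * Pbop n m x + Kbop n m (hat n m x))"
    by (intro sym_upto_add sym_upto_X_mult tame_sym_upto[OF tame_Pbop] tame_sym_upto[OF tame_Kbop] assms h)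
  show "sym_upto m 1 (Suc J) (RB n m x)"
    unfolding RB_def sym_upto_def cst_times_nth fmap_nth
  proof (intro allI impI)
    fix i assume "i < Suc J"
    then have "psym m 1 (aop ((fps_X * Pbop n m x + Kbop n m (hat n m x)) $ i))"
      using *[unfolded sym_upto_def] by (intro psym_aop) blast
    moreover have "psym m 1 (sng 0 (of_real (- 1 / (2 * lam n * mu0 n)) :: tfun))"
      by (rule psym_sng_0) simp
    ultimately show "psym m 1 (sng 0 (of_real (- 1 / (2 * lam n * mu0 n))) * aop ((fps_X * Pbop n m x + Kbop n m (hat n m x)) $ i))"
      using psym_mult[of m 1 _ 1] by force
  qed
qed

lemma formal_fixpoint:
  "\<exists>x \<rho> R. 0 < \<rho> \<and> \<rho> \<le> 1 \<and> Phi n m x = x \<and> (\<forall>J. jets_bounded m \<rho> J R x) \<and> (\<forall>c J. sym_upto m (cpar c) J (x c))"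
proof -
  have "\<exists>x. Phi n m x = x"
    by (rule causal_fixpoint) (auto simp: Phi_def intro!: Sol_agree RN_RB_agree)
  then obtain x where x: "Phi n m x = x" by blast
  obtain R \<rho> where R: "0 < \<rho>" "\<rho> \<le> 1" "\<And>x. jets_bounded m \<rho> 0 R (Phi n m x)"
    "\<And>J x. jets_bounded m \<rho> J R x \<Longrightarrow> jets_bounded m \<rho> (Suc J) R (Phi n m x)"
    using Phi_bounded by blast
  \<comment> \<open>Since \<open>x\<close> is its own image, the one-order gain in
    \<open>Phi_bounded\<close> propagates the same bound \<open>R\<close> to all orders.\<close>
  have "jets_bounded m \<rho> J R x" for J
    by (induction J) (use R(3)[of x] R(4)[of _ x] x in auto)
  moreover have "sym_upto m (cpar c) J (x c)" for c J
  proof (induction J arbitrary: c)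
    case (Suc J)
    have "sym_upto m (cpar c) (Suc J) (Phi n m x c)"
      unfolding Phi_def by (intro Sol_sym_upto RN_RB_sym_upto Suc)
    then show ?case by (simp add: x)
  qed (simp add: sym_upto_def)
  ultimately show ?thesis using R x by blast
qed

end

section \<open>The formal solution\<close>

lemma apply_bcontfun_sum: "apply_bcontfun (\<Sum>a\<in>A. u a) t = (\<Sum>a\<in>A. apply_bcontfun (u a) t)"
  for u :: "'a \<Rightarrow> tfun"
  by (induction A rule: infinite_finite_induct) auto

lemma apply_if_0: "apply_bcontfun (if P then c else 0) t = (if P then apply_bcontfun c t else 0)" for c :: tfun
  by simp

lemma aop_times: "aop (f * g) = aop f * aop g"
proof (rule poly_mapping_eqI)
  fix k
  have "supp (aop f) \<subseteq> supp f" "supp (aop g) \<subseteq> supp g" by (auto simp: in_keys_iff)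
  then have *: "cf (aop f * aop g) k = (\<Sum>a\<in>supp f. \<Sum>b\<in>supp g. (if a + b = k then 1 *\<^sub>R (cf (aop f) a * cf (aop g) b) else 0))"
    unfolding cf_times by (intro wconv_superset) auto
  show "cf (aop (f * g)) k = cf (aop f * aop g) k"
    unfolding cf_aop * by (rule bcontfun_eqI)
      (simp add: cf_times wconv_def apply_bcontfun_sum apply_if_0 cong: if_cong)
qed

lemma aop_sum: "aop (\<Sum>i\<in>A. f i) = (\<Sum>i\<in>A. aop (f i))"
  by (induction A rule: infinite_finite_induct) (auto simp: aop_0 aop_add)

lemma fmap_aop_times: "fmap aop (F * G) = fmap aop F * fmap aop G"
  by (rule fps_ext) (simp add: fps_mult_nth aop_sum aop_times)

lemma aop_sng_0: "aop (sng 0 c) = sng 0 (const_bcontfun (apply_bcontfun c 1))"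
  by (rule poly_mapping_eqI) (simp add: lookup_single when_def)

lemma fmap_aop_cst: "fmap aop (cst c) = cst (const_bcontfun (apply_bcontfun c 1))"
  by (rule fps_ext) (simp add: cst_def aop_sng_0 aop_0)

lemma fmap_aop_rc [simp]: "fmap aop (rc r) = rc r"
  by (simp add: fmap_aop_cst const_bcontfun_eq_of_real)

lemma fmap_aop_T [simp]:
  "fmap aop (cst Tid) = 1" "fmap aop (cst (Tv n)) = 0" "fmap aop (cst (Tv1 n)) = 1"
  "fmap aop (cst Tphi) = 1" "fmap aop (cst Tphi1) = 0"
  by (simp_all add: fmap_aop_cst apply_T_1 const_bcontfun_eq_of_real)

lemma aop_aop: "aop (aop f) = aop f"
  by (rule poly_mapping_eqI) simp

lemma fmap_aop_idem [simp]: "fmap aop (fmap aop F) = fmap aop F"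
  by (rule fps_ext) (simp add: aop_aop)

lemma fmap_aop_TH [simp]: "fmap aop (TH m) = TH m"
proof -
  have "aop (theta_poly m) = theta_poly m"
    by (rule poly_mapping_eqI) (simp add: cf_theta_poly const_bcontfun_eq_of_real flip: of_real_sum)
  then show ?thesis unfolding TH_def by (intro fps_ext) (simp add: aop_0)
qed

lemma fmap_aop_SolE [simp]: "fmap aop (SolE n N B) = SolE n N B"
  by (rule fps_ext) (simp add: SolE_def aop_sng_0 const_bcontfun_eq_of_real)

lemma fmap_aop_X [simp]: "fmap aop fps_X = fps_X"
  using fmap_aop_X_times[of 1] fmap_aop_rc[of 1] by simp

lemma fmap_E_TH [simp]: "fmap (Eop m) (TH m) = TH m"
proof -
  have "Eop m 0 = 0" by (rule poly_mapping_eqI) simp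
  then show ?thesis unfolding TH_def by (intro fps_ext) (simp add: Eop_theta_poly)
qed

lemma cf_SolF:
  "cf (SolF n m N B $ j) k = (1 / (lam n * mu0 n)) *\<^sub>R cf (N $ j) k
     - (ce n * efun n (N $ j) (B $ j) * (\<Sum>i<m. theta_coeff i k)) *\<^sub>R Tphi"
  unfolding SolF_def TH_def
  by (rule bcontfun_eqI)
    (simp add: mult.assoc lookup_minus cf_sng_0_times cf_theta_poly SolE_def of_real_times_tfun flip: of_real_sum)

text \<open>At order zero in \<open>X\<close> only \<open>(ep * (M * M) - 1) * (\<phi> * th)\<close>
  survives, which vanishes because \<open>\<phi> * th\<close> is in the kernel at
  \<open>mu0\<close>. The rest is \<open>X\<close> times the linearised equation \<open>I\<close>.
  Here \<open>q\<close> and \<open>e\<close> are the remainders of \<open>\<eta>\<close> and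
  \<open>M\<close>, \<open>w2\<close> is \<open>lam n\<close> times \<open>z''\<close>, and
  \<open>Ez\<close>, \<open>Eq\<close> are images under \<open>Eop\<close>.\<close>

lemma pde_identity:
  fixes X M ep th e q v v1 t \<phi> z w2 Ez Eq K P Em :: "'a::comm_ring_1"
  assumes I: "M * M * w2 - Ez + M * M * z + (M * ep + M * ep) * \<phi> * e * th = - (X * P + K)"
    and P: "P = ep * \<phi> * th * (e * e) + Em * (w2 + (v + v + t * v1) * q + (z - t * v1 * q) - (q * v + q * v))"
    and Em: "Em = (M + M) * e + X * (e * e)" and ep: "ep * (M * M) = 1"
  shows "(M + X * e) * (M + X * e) * ((- (1 - ep) * \<phi> + (v + v + t * v1)) * th + X * (w2 + (v + v + t * v1) * q))
     - ((\<phi> - t * v1) * th + X * (Ez - t * v1 * Eq))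
     + (M + X * e) * (M + X * e) * ((\<phi> - t * v1) * th + X * (z - t * v1 * q))
     - (M + X * e) * (M + X * e) * ((th + X * q) + (th + X * q)) * v
     - t * v1 * (th + X * Eq) + X * K = 0" (is "?L = 0")
proof -
  have "?L = X * ((M * M * w2 - Ez + M * M * z + (M * ep + M * ep) * \<phi> * e * th) + (X * P + K))
    + (ep * (M * M) - 1) * (\<phi> * th)"
    unfolding P Em by (simp add: algebra_simps)
  then show ?thesis unfolding I ep by simp
qed

context
  fixes n m :: nat
  assumes n: "n \<ge> 1" and m: "m \<ge> 1"
begin

text \<open>Coefficientwise this is the equation of \<open>tS2\<close>:
  \<open>lam n * mu0 n * om n \<kappa>\<close> equals \<open>\<kappa> - mu0 n\<close>, and
  \<open>lam n * mu0 n * ce n\<close> is the factor of the correction term.\<close>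

lemma SolZ_ode:
  "rc (mu0 n) * (rc (lam n) * SolZ (tS2 n) n m N B) - fmap (Eop m) (SolZ (tS0 n) n m N B)
     + rc (mu0 n) * SolZ (tS0 n) n m N B + rc (2 * M0 n * eps0 n) * cst Tphi * SolE n N B * TH m = N"
proof (intro fps_ext poly_mapping_eqI bcontfun_eqI)
  fix j k t
  define z where "z = apply_bcontfun (cf (SolZ (tS0 n) n m N B $ j) k) t"
  define f where "f = apply_bcontfun (cf (SolF n m N B $ j) k) t"
  define E where "E = efun n (N $ j) (B $ j) * (\<Sum>i<m. theta_coeff i k) * apply_bcontfun Tphi t"
  have 2: "apply_bcontfun (cf (SolZ (tS2 n) n m N B $ j) k) t = om n (sqn m k) * z + f"
    by (simp add: z_def f_def SolZ_def cf_LS tS_0[OF n] tS2_def)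
  have f: "f = 1 / (lam n * mu0 n) * apply_bcontfun (cf (N $ j) k) t - ce n * E"
    unfolding f_def E_def cf_SolF by simp
  have "apply_bcontfun (cf ((rc (mu0 n) * (rc (lam n) * SolZ (tS2 n) n m N B) - fmap (Eop m) (SolZ (tS0 n) n m N B)
     + rc (mu0 n) * SolZ (tS0 n) n m N B + rc (2 * M0 n * eps0 n) * cst Tphi * SolE n N B * TH m) $ j) k) t
     = mu0 n * (lam n * (om n (sqn m k) * z + f)) - real (sqn m k) * z + mu0 n * z + 2 * M0 n * eps0 n * E"
    unfolding TH_def
    by (simp add: mult.assoc lookup_minus lookup_add cf_sng_0_times cf_theta_poly of_real_times_tfun 2 z_def[symmetric]
        E_def SolE_def del: of_real_mult flip: of_real_sum)
  also have "\<dots> = apply_bcontfun (cf (N $ j) k) t"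
    using mu0_pos[OF n] lam_pos[OF n] unfolding f om_def ce_def by (simp add: field_simps)
  finally show "apply_bcontfun (cf ((rc (mu0 n) * (rc (lam n) * SolZ (tS2 n) n m N B) - fmap (Eop m) (SolZ (tS0 n) n m N B)
     + rc (mu0 n) * SolZ (tS0 n) n m N B + rc (2 * M0 n * eps0 n) * cst Tphi * SolE n N B * TH m) $ j) k) t
     = apply_bcontfun (cf (N $ j) k) t" .
qed

text \<open>Only \<open>|k| = 1\<close> is in doubt. There the symmetry reduces every frequency to
  \<open>unit 0\<close>, for which \<open>efun\<close> was made; frequencies with entries at or
  beyond position \<open>m\<close> have zero data.\<close>

lemma SolZ_neumann:
  assumes N: "\<And>j. psym m (-1) (N $ j)" and B: "\<And>j. psym m 1 (B $ j)"
  shows "fmap aop (SolZ (tS1 n) n m N B) = fmap aop B"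
proof (intro fps_ext poly_mapping_eqI)
  fix j k
  let ?e = "efun n (N $ j) (B $ j)"
  have "resonance (cf (SolF n m N B $ j) k) = apply_bcontfun (cf (B $ j) k) 1" if k: "sqn m k = 1"
  proof (cases "\<exists>i\<ge>m. k i \<noteq> 0")
    case True
    then have "cf (N $ j) k = 0" "cf (B $ j) k = 0" "cf (theta_poly m) k = 0"
      using N B psym_theta_poly[of m] by (auto simp: psym_def)
    moreover from this have "(\<Sum>i<m. theta_coeff i k) = 0" by (simp only: cf_theta_poly of_real_eq_0_iff)
    ultimately show ?thesis by (simp add: cf_SolF)
  next
    case False
    then have s: "cf f k = cf f (unit 0)" if "psym m \<sigma> f" for f \<sigma>
      using psym_cf_unit[OF that k] by blast
    have "(of_real (\<Sum>i<m. theta_coeff i k) :: tfun) = of_real (1 / 2)"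
      using s[OF psym_theta_poly] cf_theta_poly_unit[OF m] by (simp add: cf_theta_poly)
    then have t: "(\<Sum>i<m. theta_coeff i k) = 1 / 2" by (simp only: of_real_eq_iff)
    have "ce n * ?e * (1 / 2) * (1 / 2) = resonance (cf (N $ j) (unit 0)) / (lam n * mu0 n) - apply_bcontfun (cf (B $ j) (unit 0)) 1"
      unfolding efun_def using ce_pos[OF n m] by simp
    then show ?thesis
      by (simp add: cf_SolF t s[OF N] s[OF B] resonance_diff resonance_scaleR resonance_Tphi field_simps)
  qed
  then have "apply_bcontfun (tS1 n (sqn m k) (cf (SolF n m N B $ j) k) (apply_bcontfun (cf (B $ j) k) 1)) 1
      = apply_bcontfun (cf (B $ j) k) 1"
    by (intro tS1_1[OF n]) auto
  then show "cf (fmap aop (SolZ (tS1 n) n m N B) $ j) k = cf (fmap aop B $ j) k"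
    by (simp add: SolZ_def cf_LS tS_0[OF n])
qed

lemma rc_lam: "rc (lam n) * rc (1 / lam n) = 1"
  using lam_pos[OF n] by (simp flip: cst_mult of_real_mult)

lemma rc_add: "rc (a + b) = rc a + rc b" and rc_mult: "rc (a * b) = rc a * rc b"
  and rc_minus: "rc (- a) = - rc a" and rc_diff: "rc (a - b) = rc a - rc b"
  by (simp_all flip: cst_add cst_mult cst_minus cst_diff of_real_add of_real_mult of_real_minus of_real_diff)

text \<open>Both sides equal \<open>1 / (4 * n\<^sup>2)\<close>.\<close>

lemma lam_pi: "lam n * (pi / 2)\<^sup>2 = 1 - eps0 n"
proof -
  have "(real n)\<^sup>2 - 1 / 4 > 0" using n_sq[OF n] by linarith
  moreover have "(real n)\<^sup>2 \<noteq> 0" using n by simp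
  ultimately show ?thesis by (simp add: lam_def eps0_def mu0_def field_simps power2_eq_square)
qed

text \<open>At a fixed point the linear operator applied to \<open>x\<close> cancels the right-hand
  sides \<open>RN\<close> and \<open>RB\<close>, which leaves the full nonlinear system for
  \<open>H\<close>. The equation and the Neumann condition appear with one factor \<open>s\<close>
  divided out; the last statement is the Dirichlet condition.\<close>

lemma Phi_equations:
  assumes x: "Phi n m x = x" and sy: "\<And>c J. sym_upto m (cpar c) J (x c)"
  defines "H \<equiv> hat n m x"
  shows "H Mu * H Mu * (rc (lam n) * H CY2) - fmap (Eop m) (H CY) + H Mu * H Mu * H CY
       - H Mu * H Mu * (H Eta + H Eta) * cst (Tv n) - cst Tid * cst (Tv1 n) * fmap (Eop m) (H Eta)
       + fps_X * Kop n m H = 0" (is ?A)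
    and "fmap aop (rc (lam n) * (H Mu * H Mu) * ((H CY1 + H Eta) + (H CY1 + H Eta)) + fps_X * Kbop n m H) = 0" (is ?B)
    and "fmap aop (H CY) = 0" (is ?C)
proof -
  define N where "N = RN n m x"
  define B where "B = RB n m x"
  have xs: "x c = Sol n m N B c" for c
    using fun_cong[OF x, of c] by (simp add: Phi_def N_def B_def)
  define z where "z = SolZ (tS0 n) n m N B"
  define z1 where "z1 = SolZ (tS1 n) n m N B"
  define w2 where "w2 = rc (lam n) * SolZ (tS2 n) n m N B"
  define q where "q = SolQ n m N B"
  define e where "e = SolE n N B"
  define X :: tser where "X = fps_X"
  define t where "t = cst Tid"
  define u where "u = cst (Tv n)"
  define u1 where "u1 = cst (Tv1 n)"
  define \<phi> where "\<phi> = cst Tphi"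
  define M where "M = rc (M0 n)"
  define ep where "ep = rc (eps0 n)"
  define l where "l = rc (lam n)"
  define il where "il = rc (1 / lam n)"
  define K where "K = Kop n m H"
  have lil: "l * il = 1" by (simp add: l_def il_def rc_lam)
  have lil': "l * (il * F) = F" for F using lil by (metis mult.assoc mult_1)
  have MM: "M * M = rc (mu0 n)" using M0_sq[OF n m] by (simp add: M_def flip: rc_mult)
  have eM: "ep * (M * M) = 1" unfolding MM using eps0_mu0[OF n m] by (simp add: ep_def flip: rc_mult)
  have xc: "x CY = z - t * u1 * q" "x CY1 = z1 - (u1 - il * t * u) * q" "x Eta = q" "x Mu = e"
    by (simp_all add: xs z_def z1_def q_def e_def t_def u_def u1_def il_def)
  have "x CY2 = SolZ (tS2 n) n m N B + il * ((u + u + t * u1) * q)"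
    unfolding xs Sol.simps t_def u_def u1_def il_def q_def by (simp only: mult.assoc)
  then have x2: "l * x CY2 = w2 + (u + u + t * u1) * q"
    unfolding w2_def l_def[symmetric] by (simp only: distrib_left[of l] lil')
  have lpi: "l * rc (- ((pi / 2)\<^sup>2)) = - (1 - ep)"
  proof -
    have "l * rc (- ((pi / 2)\<^sup>2)) = rc (lam n * - ((pi / 2)\<^sup>2))" by (simp only: l_def rc_mult)
    also have "\<dots> = rc (- (1 - eps0 n))" by (simp only: mult_minus_right lam_pi)
    finally show ?thesis by (simp only: rc_minus rc_diff ep_def of_real_1 cst_1)
  qed
  have b2: "l * base n m CY2 = (- (1 - ep) * \<phi> + (u + u + t * u1)) * TH m"
  proof -
    have "l * base n m CY2 = (l * rc (- ((pi / 2)\<^sup>2)) * \<phi> + l * (il * (u + u + t * u1))) * TH m"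
      unfolding base.simps \<phi>_def t_def u_def u1_def il_def
      by (simp only: mult.assoc[symmetric] distrib_left[of l])
    then show ?thesis unfolding lpi lil' .
  qed
  have H2: "l * H CY2 = (- (1 - ep) * \<phi> + (u + u + t * u1)) * TH m + X * (w2 + (u + u + t * u1) * q)"
    unfolding H_def hat_def X_def[symmetric] distrib_left b2 x2[symmetric] by (simp add: mult_ac)
  have H0: "H CY = (\<phi> - t * u1) * TH m + X * (z - t * u1 * q)"
    and H3: "H Eta = TH m + X * q" and H4: "H Mu = M + X * e"
    by (simp_all add: H_def hat_def xc \<phi>_def t_def u1_def X_def M_def)
  have EH0: "fmap (Eop m) (H CY) = (\<phi> - t * u1) * TH m + X * (fmap (Eop m) z - t * u1 * fmap (Eop m) q)"
    unfolding H0 X_def \<phi>_def t_def u1_def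
    by (simp add: fmap_E_add fmap_E_diff fmap_E_X_times fmap_E_cst_times left_diff_distrib mult.assoc)
  have EH3: "fmap (Eop m) (H Eta) = TH m + X * fmap (Eop m) q"
    unfolding H3 X_def by (simp add: fmap_E_add fmap_E_X_times)
  have I: "M * M * w2 - fmap (Eop m) z + M * M * z + (M * ep + M * ep) * \<phi> * e * TH m = - (X * Pop n m x + K)"
  proof -
    have "rc (2 * M0 n * eps0 n) = rc (M0 n * eps0 n + M0 n * eps0 n)" by (rule arg_cong[where f = rc]) simp
    then have "rc (2 * M0 n * eps0 n) = M * ep + M * ep"
      by (simp only: M_def ep_def rc_mult rc_add)
    then show ?thesis
      using SolZ_ode[of N B] by (simp add: MM w2_def z_def e_def \<phi>_def N_def RN_def X_def K_def H_def)
  qed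
  have Em: "Emu n e = (M + M) * e + X * (e * e)"
  proof -
    have "rc (2 * M0 n) = rc (M0 n + M0 n)" by (rule arg_cong[where f = rc]) simp
    then show ?thesis by (simp only: Emu_def M_def X_def rc_add)
  qed
  have P: "Pop n m x = ep * \<phi> * TH m * (e * e) + Emu n e * (w2 + (u + u + t * u1) * q + (z - t * u1 * q) - (q * u + q * u))"
    unfolding Pop_def l_def[symmetric] x2 xc ep_def \<phi>_def u_def by simp
  show ?A
    unfolding l_def[symmetric] u_def[symmetric] u1_def[symmetric] t_def[symmetric] K_def[symmetric] X_def[symmetric]
      H2 EH0[unfolded H0] H0 EH3[unfolded H3] H3 H4
    by (rule pde_identity[OF I P Em eM])
  have sy': "psym m (-1) (N $ j)" "psym m 1 (B $ j)" for j
    using RN_RB_sym_upto(1)[where J = j and x = x, OF n m sy] RN_RB_sym_upto(2)[where J = j and x = x, OF n m sy]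
    by (auto simp: N_def B_def sym_upto_def)
  have z1: "fmap aop z1 = fmap aop B" unfolding z1_def by (rule SolZ_neumann[OF sy'])
  define kb where "kb = fmap aop (Kbop n m H)"
  define em where "em = Emu n e"
  have aq: "fmap aop q = q" by (simp add: q_def SolQ_def)
  have ae: "fmap aop e = e" by (simp add: e_def)
  have aem: "fmap aop em = em" unfolding em_def Emu_def by (simp only: fmap_aop_add fmap_aop_times fmap_aop_rc fmap_aop_X ae)
  \<comment> \<open>At \<open>t = 1\<close> one has \<open>v\<^sub>n = 0\<close> and
    \<open>v\<^sub>n' = 1\<close>, so \<open>Y' + \<eta>\<close> is exactly the Neumann trace of
    \<open>z\<close>.\<close>
  have y1q: "fmap aop (x CY1 + x Eta) = fmap aop z1"
    by (simp add: xc fmap_aop_add fmap_aop_diff fmap_aop_times aq t_def u_def u1_def il_def)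
  have pb: "fmap aop (Pbop n m x) = (l + l) * (em * fmap aop z1)"
  proof -
    have "rc (2 * lam n) = rc (lam n + lam n)" by (rule arg_cong[where f = rc]) simp
    then have "rc (2 * lam n) = l + l" by (simp only: l_def rc_add)
    moreover have al: "fmap aop (l + l) = l + l" by (simp only: fmap_aop_add l_def fmap_aop_rc)
    ultimately show ?thesis unfolding Pbop_def by (simp only: fmap_aop_times fmap_aop_rc y1q xc(4) em_def[symmetric] aem al)
  qed
  have z1': "(l + l) * (M * M) * fmap aop z1 = - (X * ((l + l) * (em * fmap aop z1)) + kb)"
  proof -
    have a: "(l + l) * (M * M) = rc (2 * lam n * mu0 n)"
      unfolding MM l_def rc_add[symmetric] rc_mult[symmetric] by (rule arg_cong[where f = rc]) simp
    have b: "rc (2 * lam n * mu0 n) * rc (- 1 / (2 * lam n * mu0 n)) = - 1"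
    proof -
      have "2 * lam n * mu0 n * (- 1 / (2 * lam n * mu0 n)) = - 1"
        using lam_pos[OF n] mu0_pos[OF n] by simp
      then show ?thesis by (simp only: rc_mult[symmetric] rc_minus of_real_1 cst_1)
    qed
    have c: "fmap aop B = rc (- 1 / (2 * lam n * mu0 n)) * (X * ((l + l) * (em * fmap aop z1)) + kb)"
      unfolding B_def RB_def H_def[symmetric] pb[symmetric] kb_def X_def
      by (simp only: fmap_aop_times fmap_aop_rc fmap_aop_idem fmap_aop_add fmap_aop_X)
    have "(l + l) * (M * M) * fmap aop B
        = (rc (2 * lam n * mu0 n) * rc (- 1 / (2 * lam n * mu0 n))) * (X * ((l + l) * (em * fmap aop z1)) + kb)"
      unfolding a c by (simp only: mult.assoc)
    then show ?thesis unfolding b z1 by simp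
  qed
  \<comment> \<open>The base part satisfies the linear boundary condition, so a factor
    \<open>X\<close> splits off.\<close>
  have HH: "fmap aop (H CY1 + H Eta) = X * fmap aop z1"
  proof -
    have "fmap aop (H CY1 + H Eta) = fmap aop (base n m CY1 + base n m Eta) + X * fmap aop (x CY1 + x Eta)"
      unfolding H_def hat_def X_def by (simp add: fmap_aop_add fmap_aop_times distrib_left)
    also have "fmap aop (base n m CY1 + base n m Eta) = 0"
      by (simp add: fmap_aop_add fmap_aop_diff fmap_aop_times)
    finally show ?thesis unfolding y1q by simp
  qed
  have "fmap aop (rc (lam n) * (H Mu * H Mu) * ((H CY1 + H Eta) + (H CY1 + H Eta)) + fps_X * Kbop n m H)
      = l * (fmap aop (H Mu) * fmap aop (H Mu)) * (fmap aop (H CY1 + H Eta) + fmap aop (H CY1 + H Eta)) + X * kb"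
    by (simp only: fmap_aop_add fmap_aop_times fmap_aop_rc fmap_aop_X l_def X_def kb_def)
  also have "fmap aop (H Mu) = M + X * e"
    unfolding H4 M_def X_def by (simp add: fmap_aop_add fmap_aop_times ae)
  also have "l * ((M + X * e) * (M + X * e)) * (fmap aop (H CY1 + H Eta) + fmap aop (H CY1 + H Eta)) + X * kb
      = X * ((l + l) * (M * M) * fmap aop z1 + X * ((l + l) * (em * fmap aop z1)) + kb)"
    unfolding HH em_def Em by (simp add: algebra_simps)
  also have "\<dots> = 0" unfolding z1' by simp
  finally show ?B .
  show ?C
    unfolding H0 by (simp add: fmap_aop_add fmap_aop_diff fmap_aop_times aq \<phi>_def t_def u1_def X_def)
      (simp add: q_def SolQ_def z_def)
qed

end

lemma apply_times_abs: "apply_bcontfun (f * g) = (\<lambda>t. apply_bcontfun f t * apply_bcontfun g t)" for f g :: tfun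
  by (rule ext) simp

lemma apply_numeral: "apply_bcontfun (numeral k :: tfun) t = numeral k"
  using apply_bcontfun_of_real[of "numeral k" t] by (simp del: apply_bcontfun_of_real)

section \<open>The components CY1 and CY2 as actual derivatives in t\<close>

text \<open>Restricted to \<open>[-1, 1]\<close>, one-sided at the ends, because the coefficient
  functions are continued by constants and may have a kink there.\<close>

definition t_deriv :: "(tser \<Rightarrow> tser \<Rightarrow> bool)" where
  "t_deriv F G \<longleftrightarrow> (\<forall>j k. \<forall>t\<in>{-1..1}.
     (apply_bcontfun (cf (F $ j) k) has_real_derivative apply_bcontfun (cf (G $ j) k) t) (at t within {-1..1}))"

lemma t_deriv_add: "t_deriv F G \<Longrightarrow> t_deriv F' G' \<Longrightarrow> t_deriv (F + F') (G + G')"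
  unfolding t_deriv_def by (auto simp: lookup_add intro!: DERIV_add)

lemma t_deriv_diff: "t_deriv F G \<Longrightarrow> t_deriv F' G' \<Longrightarrow> t_deriv (F - F') (G - G')"
  unfolding t_deriv_def by (auto simp: lookup_minus intro!: DERIV_diff)

lemma t_deriv_X_times: "t_deriv F G \<Longrightarrow> t_deriv (fps_X * F) (fps_X * G)"
  unfolding t_deriv_def by auto

text \<open>The second factor has to be free of \<open>t\<close>; this holds for theta and for the
  trace \<open>SolQ\<close>.\<close>

lemma t_deriv_cst_times:
  assumes "\<And>t. t \<in> {-1..1} \<Longrightarrow> (apply_bcontfun c has_real_derivative apply_bcontfun d t) (at t within {-1..1})"
    and "\<And>j k. \<exists>r. cf (F $ j) k = of_real r"
  shows "t_deriv (cst c * F) (cst d * F)"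
  unfolding t_deriv_def
proof (intro allI ballI)
  fix j k and t :: real assume t: "t \<in> {-1..1}"
  obtain r where r: "cf (F $ j) k = of_real r" using assms(2) by blast
  show "(apply_bcontfun (cf ((cst c * F) $ j) k) has_real_derivative apply_bcontfun (cf ((cst d * F) $ j) k) t) (at t within {-1..1})"
    using DERIV_cmult_right[OF assms(1)[OF t], of r] by (simp add: cf_sng_0_times r apply_times_abs)
qed

context
  fixes n m :: nat
  assumes n: "n \<ge> 1" and m: "m \<ge> 1"
begin

lemma t_deriv_SolZ: "t_deriv (SolZ (tS0 n) n m N B) (SolZ (tS1 n) n m N B)" "t_deriv (SolZ (tS1 n) n m N B) (SolZ (tS2 n) n m N B)"
  unfolding t_deriv_def SolZ_def by (simp_all add: cf_LS tS_0[OF n] tS_deriv[OF n])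

lemma T_deriv2:
  assumes t: "t \<in> {-1..1}"
  shows "(apply_bcontfun (Tid * Tv1 n) has_real_derivative
      apply_bcontfun (Tv1 n - of_real (1 / lam n) * Tid * Tv n) t) (at t within {-1..1})"
    and "(apply_bcontfun (Tv1 n - of_real (1 / lam n) * Tid * Tv n) has_real_derivative
      apply_bcontfun (- (of_real (1 / lam n) * (Tv n + Tv n + Tid * Tv1 n))) t) (at t within {-1..1})"
    and "(apply_bcontfun Tphi1 has_real_derivative apply_bcontfun (of_real (- ((pi / 2)\<^sup>2)) * Tphi) t) (at t within {-1..1})"
proof -
  note d = T_deriv[OF t n]
  have id: "apply_bcontfun Tid t = t" using t by (simp add: apply_T clamp1_id)
  have "((\<lambda>t. apply_bcontfun Tid t * apply_bcontfun (Tv1 n) t) has_real_derivative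
      apply_bcontfun (Tv1 n) t - 1 / lam n * t * apply_bcontfun (Tv n) t) (at t within {-1..1})"
    by (rule derivative_eq_intros d refl)+ (simp add: id)
  then show "(apply_bcontfun (Tid * Tv1 n) has_real_derivative
      apply_bcontfun (Tv1 n - of_real (1 / lam n) * Tid * Tv n) t) (at t within {-1..1})"
    by (simp add: id apply_times_abs)
  have "((\<lambda>t. apply_bcontfun (Tv1 n) t - 1 / lam n * apply_bcontfun Tid t * apply_bcontfun (Tv n) t) has_real_derivative
      - (1 / lam n * (apply_bcontfun (Tv n) t + apply_bcontfun (Tv n) t + t * apply_bcontfun (Tv1 n) t))) (at t within {-1..1})"
    by (rule derivative_eq_intros d refl)+ (simp add: id algebra_simps)
  then show "(apply_bcontfun (Tv1 n - of_real (1 / lam n) * Tid * Tv n) has_real_derivative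
      apply_bcontfun (- (of_real (1 / lam n) * (Tv n + Tv n + Tid * Tv1 n))) t) (at t within {-1..1})"
    by (simp add: id apply_times_abs apply_numeral)
  show "(apply_bcontfun Tphi1 has_real_derivative apply_bcontfun (of_real (- ((pi / 2)\<^sup>2)) * Tphi) t) (at t within {-1..1})"
    using d by (simp del: of_real_minus)
qed

lemma SolQ_const: "\<exists>r. cf (SolQ n m N B $ j) k = of_real r"
  by (simp add: SolQ_def const_bcontfun_eq_of_real)

lemma TH_const: "\<exists>r. cf (TH m $ j) k = of_real r"
  by (cases "j = 0") (auto simp: TH_def cf_theta_poly simp flip: of_real_sum)

lemma t_deriv_Sol: "t_deriv (Sol n m N B CY) (Sol n m N B CY1)" "t_deriv (Sol n m N B CY1) (Sol n m N B CY2)"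
proof -
  have a: "t_deriv (cst (Tid * Tv1 n) * SolQ n m N B) (cst (Tv1 n - of_real (1 / lam n) * Tid * Tv n) * SolQ n m N B)"
    by (rule t_deriv_cst_times[OF T_deriv2(1) SolQ_const])
  have b: "t_deriv (cst (Tv1 n - of_real (1 / lam n) * Tid * Tv n) * SolQ n m N B)
     (cst (- (of_real (1 / lam n) * (Tv n + Tv n + Tid * Tv1 n))) * SolQ n m N B)"
    by (rule t_deriv_cst_times[OF T_deriv2(2) SolQ_const])
  show "t_deriv (Sol n m N B CY) (Sol n m N B CY1)"
    using t_deriv_diff[OF t_deriv_SolZ(1)[of N B] a] by (simp only: Sol.simps cst_mult cst_diff)
  show "t_deriv (Sol n m N B CY1) (Sol n m N B CY2)"
    using t_deriv_diff[OF t_deriv_SolZ(2)[of N B] b]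
    by (simp only: Sol.simps cst_mult cst_diff cst_add cst_minus mult_minus_left diff_minus_eq_add)
qed

lemma t_deriv_base: "t_deriv (base n m CY) (base n m CY1)" "t_deriv (base n m CY1) (base n m CY2)"
proof -
  have a: "t_deriv (cst (Tid * Tv1 n) * TH m) (cst (Tv1 n - of_real (1 / lam n) * Tid * Tv n) * TH m)"
    by (rule t_deriv_cst_times[OF T_deriv2(1) TH_const])
  have b: "t_deriv (cst (Tv1 n - of_real (1 / lam n) * Tid * Tv n) * TH m)
     (cst (- (of_real (1 / lam n) * (Tv n + Tv n + Tid * Tv1 n))) * TH m)"
    by (rule t_deriv_cst_times[OF T_deriv2(2) TH_const])
  have c: "t_deriv (cst Tphi * TH m) (cst Tphi1 * TH m)"
    by (rule t_deriv_cst_times[OF T_deriv(4) TH_const]) (use n in auto)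
  have d: "t_deriv (cst Tphi1 * TH m) (cst (of_real (- ((pi / 2)\<^sup>2)) * Tphi) * TH m)"
    by (rule t_deriv_cst_times[OF T_deriv2(3) TH_const])
  show "t_deriv (base n m CY) (base n m CY1)"
    using t_deriv_diff[OF c a] by (simp only: base.simps cst_mult cst_diff left_diff_distrib)
  show "t_deriv (base n m CY1) (base n m CY2)"
    using t_deriv_diff[OF d b]
    by (simp only: base.simps cst_mult cst_diff cst_add cst_minus mult_minus_left diff_minus_eq_add left_diff_distrib distrib_right)
qed

lemma hat_const:
  assumes "\<And>j k. \<exists>r. cf (x c $ j) k = of_real r" "\<And>j k. \<exists>r. cf (base n m c $ j) k = of_real r"
  shows "\<exists>r. cf (hat n m x c $ j) k = of_real r"
proof -
  obtain a where a: "cf (base n m c $ j) k = of_real a" using assms(2) by blast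
  show ?thesis
  proof (cases j)
    case 0
    then show ?thesis using a by (auto simp: hat_def)
  next
    case (Suc i)
    obtain b where "cf (x c $ i) k = of_real b" using assms(1) by blast
    then show ?thesis using a Suc by (auto simp: hat_def lookup_add simp flip: of_real_add)
  qed
qed

text \<open>Interface between the formal and the analytic part. The last two facts say that
  \<open>M\<close> is a number and \<open>\<eta>\<close> a function of \<open>x\<close> alone at
  each order, so that they really describe a parameter and a domain.\<close>

lemma formal_solution:
  obtains H \<rho> R where "0 < \<rho>" "\<rho> \<le> 1"
    and "H Mu * H Mu * (rc (lam n) * H CY2) - fmap (Eop m) (H CY) + H Mu * H Mu * H CY
       - H Mu * H Mu * (H Eta + H Eta) * cst (Tv n) - cst Tid * cst (Tv1 n) * fmap (Eop m) (H Eta)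
       + fps_X * Kop n m H = 0"
    and "fmap aop (rc (lam n) * (H Mu * H Mu) * ((H CY1 + H Eta) + (H CY1 + H Eta)) + fps_X * Kbop n m H) = 0"
    and "fmap aop (H CY) = 0"
    and "\<And>c j. psym m (cpar c) (H c $ j)"
    and "\<And>J. jets_bounded m \<rho> J R H"
    and "\<And>c. H c $ 0 = base n m c $ 0"
    and "t_deriv (H CY) (H CY1)" "t_deriv (H CY1) (H CY2)"
    and "\<And>j. \<exists>r. H Mu $ j = sng 0 (of_real r)"
    and "\<And>j k. \<exists>r. cf (H Eta $ j) k = of_real r"
proof -
  obtain x \<rho> R where \<rho>: "0 < \<rho>" "\<rho> \<le> 1" and x: "Phi n m x = x" and b: "\<And>J. jets_bounded m \<rho> J R x"
    and sy: "\<And>c J. sym_upto m (cpar c) J (x c)"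
    using formal_fixpoint[OF n m] by blast
  define H where "H = hat n m x"
  have xs: "x c = Sol n m (RN n m x) (RB n m x) c" for c
    using fun_cong[OF x, of c] by (simp add: Phi_def)
  obtain Cb where Cb: "Cb \<ge> 0" "\<And>c \<rho> J. 0 \<le> \<rho> \<Longrightarrow> \<rho> \<le> 1 \<Longrightarrow> jet_norm m (cord c) \<rho> J (base n m c) \<le> Cb"
    using base_bound[OF n m] by auto
  have R0: "R \<ge> 0" using b[of 0] \<rho> jet_norm_nonneg[of \<rho> m "cord CY" 0 "x CY"] unfolding jets_bounded_def by (meson less_imp_le order_trans)
  have jets_bounded: "jets_bounded m \<rho> J (Cb + R) H" for J
    unfolding jets_bounded_def H_def hat_def
  proof
    fix c
    have "jet_norm m (cord c) \<rho> J (fps_X * x c) \<le> R"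
    proof (cases J)
      case 0
      then show ?thesis using R0 by (simp add: jet_norm_X_mult_0)
    next
      case (Suc i)
      have "\<rho> * jet_norm m (cord c) \<rho> i (x c) \<le> 1 * R"
        using \<rho> b[of i] by (intro mult_mono) (auto simp: jets_bounded_def)
      then show ?thesis using \<rho> Suc by (simp add: jet_norm_X_mult)
    qed
    then show "jet_norm m (cord c) \<rho> J (base n m c + fps_X * x c) \<le> Cb + R"
      using Cb(2)[of \<rho> c J] \<rho> jet_norm_add[of \<rho> m "cord c" J "base n m c" "fps_X * x c"] by linarith
  qed
  have psym: "psym m (cpar c) (H c $ j)" for c j
    using RN_RB_sym_upto(3)[where J = j and x = x and c = c, OF n m sy] by (simp add: sym_upto_def H_def)
  have Mu: "\<exists>r. H Mu $ j = sng 0 (of_real r)" for j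
  proof (cases j)
    case 0
    then show ?thesis by (auto simp: H_def hat_def cst_def)
  next
    case (Suc i)
    then show ?thesis unfolding H_def hat_def xs[of Mu] by (auto simp: cst_def SolE_def)
  qed
  have Eta: "\<exists>r. cf (H Eta $ j) k = of_real r" for j k
    unfolding H_def by (rule hat_const) (auto simp: xs[of Eta] intro: SolQ_const TH_const)
  have T: "t_deriv (H CY) (H CY1)" "t_deriv (H CY1) (H CY2)"
    unfolding H_def hat_def xs[of CY] xs[of CY1] xs[of CY2]
    by (intro t_deriv_add t_deriv_X_times t_deriv_base t_deriv_Sol)+
  show ?thesis
    by (rule that[of \<rho> H, OF \<rho> Phi_equations[OF n m x sy, folded H_def] psym jets_bounded _ T Mu Eta])
      (simp add: H_def hat_def)
qed

end

section \<open>Evaluation of trigonometric polynomials and of the series\<close>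

definition dotp :: "nat \<Rightarrow> freq \<Rightarrow> (nat \<Rightarrow> real) \<Rightarrow> real" where
  "dotp m k x = (\<Sum>i<m. real_of_int (k i) * x i)"

text \<open>With \<open>cos\<close> and \<open>sin\<close> for \<open>g\<close> these are the real
  and imaginary part of the complex trigonometric sum, carried along separately.\<close>

definition trig_eval :: "(real \<Rightarrow> real) \<Rightarrow> nat \<Rightarrow> tpoly \<Rightarrow> real \<Rightarrow> (nat \<Rightarrow> real) \<Rightarrow> real" where
  "trig_eval g m f t x = (\<Sum>k\<in>supp f. apply_bcontfun (cf f k) t * g (dotp m k x))"

abbreviation cos_poly :: "nat \<Rightarrow> tpoly \<Rightarrow> real \<Rightarrow> (nat \<Rightarrow> real) \<Rightarrow> real" where "cos_poly \<equiv> trig_eval cos"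
abbreviation sin_poly :: "nat \<Rightarrow> tpoly \<Rightarrow> real \<Rightarrow> (nat \<Rightarrow> real) \<Rightarrow> real" where "sin_poly \<equiv> trig_eval sin"

lemma trig_eval_superset:
  "finite A \<Longrightarrow> supp f \<subseteq> A \<Longrightarrow> trig_eval g m f t x = (\<Sum>k\<in>A. apply_bcontfun (cf f k) t * g (dotp m k x))"
  unfolding trig_eval_def by (rule sum.mono_neutral_left) (auto simp: in_keys_iff)

lemma trig_eval_0 [simp]: "trig_eval g m 0 t x = 0"
  by (simp add: trig_eval_def)

lemma trig_eval_add: "trig_eval g m (f + h) t x = trig_eval g m f t x + trig_eval g m h t x"
proof -
  let ?A = "supp f \<union> supp h \<union> supp (f + h)"
  have "trig_eval g m u t x = (\<Sum>k\<in>?A. apply_bcontfun (cf u k) t * g (dotp m k x))" if "u \<in> {f, h, f + h}" for u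
    using that by (intro trig_eval_superset) auto
  then show ?thesis by (simp add: lookup_add distrib_right sum.distrib)
qed

lemma trig_eval_minus: "trig_eval g m (- f) t x = - trig_eval g m f t x"
  using trig_eval_add[of g m f "- f" t x] by simp

lemma trig_eval_diff: "trig_eval g m (f - h) t x = trig_eval g m f t x - trig_eval g m h t x"
  using trig_eval_add[of g m f "- h" t x] by (simp add: trig_eval_minus)

lemma trig_eval_sum: "trig_eval g m (\<Sum>i\<in>A. f i) t x = (\<Sum>i\<in>A. trig_eval g m (f i) t x)"
  by (induction A rule: infinite_finite_induct) (auto simp: trig_eval_add)

lemma trig_eval_sng: "trig_eval g m (sng k c) t x = apply_bcontfun c t * g (dotp m k x)"
  by (simp add: trig_eval_def)

lemma dotp_add: "dotp m (a + b) x = dotp m a x + dotp m b x"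
  by (simp add: dotp_def algebra_simps sum.distrib)

lemma dotp_0 [simp]: "dotp m 0 x = 0"
  by (simp add: dotp_def)

lemma trig_eval_times_aux:
  "trig_eval g m (f * h) t x = (\<Sum>a\<in>supp f. \<Sum>b\<in>supp h. apply_bcontfun (cf f a) t * apply_bcontfun (cf h b) t * g (dotp m a x + dotp m b x))"
  by (simp add: times_eq_sum_sng trig_eval_sum trig_eval_sng dotp_add)

lemma cos_poly_times: "cos_poly m (f * h) t x = cos_poly m f t x * cos_poly m h t x - sin_poly m f t x * sin_poly m h t x"
  unfolding trig_eval_times_aux unfolding trig_eval_def
  by (simp add: cos_add sum_product right_diff_distrib sum_subtractf mult_ac)

lemma sin_poly_times: "sin_poly m (f * h) t x = sin_poly m f t x * cos_poly m h t x + cos_poly m f t x * sin_poly m h t x"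
  unfolding trig_eval_times_aux unfolding trig_eval_def
  by (simp add: sin_add sum_product distrib_left sum.distrib mult_ac)

lemma trig_eval_bound:
  assumes "\<And>r. \<bar>g r\<bar> \<le> 1"
  shows "\<bar>trig_eval g m f t x\<bar> \<le> wnorm m p f"
proof -
  have "\<bar>trig_eval g m f t x\<bar> \<le> (\<Sum>k\<in>supp f. \<bar>apply_bcontfun (cf f k) t * g (dotp m k x)\<bar>)"
    unfolding trig_eval_def by (rule sum_abs)
  also have "\<dots> \<le> (\<Sum>k\<in>supp f. wt m k ^ p * norm (cf f k))"
  proof (rule sum_mono)
    fix k
    have "\<bar>apply_bcontfun (cf f k) t * g (dotp m k x)\<bar> \<le> norm (cf f k) * 1"
      using norm_bounded[of "cf f k" t] assms by (intro abs_mult_le) auto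
    also have "\<dots> \<le> wt m k ^ p * norm (cf f k)"
      using mult_right_mono[of 1 "wt m k ^ p" "norm (cf f k)"] one_le_power[OF wt_ge_1] by simp
    finally show "\<bar>apply_bcontfun (cf f k) t * g (dotp m k x)\<bar> \<le> wt m k ^ p * norm (cf f k)" .
  qed
  finally show ?thesis by (simp add: wnorm_def)
qed

lemma trig_eval_aop: "trig_eval g m (aop f) t x = trig_eval g m f 1 x"
  by (subst trig_eval_superset[of "supp f"]) (auto simp: in_keys_iff trig_eval_def)

lemma continuous_on_dotp [continuous_intros]:
  "continuous_on S f \<Longrightarrow> continuous_on S (\<lambda>y. dotp m k (f y))"
proof -
  assume f: "continuous_on S f"
  have "continuous_on S (\<lambda>y. f y i)" for i
    using f by (rule continuous_on_product_then_coordinatewise)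
  then show ?thesis unfolding dotp_def by (intro continuous_intros)
qed

lemma continuous_on_trig_eval:
  assumes "continuous_on UNIV g"
  shows "continuous_on UNIV (\<lambda>(t, x). trig_eval g m f t x)"
  unfolding trig_eval_def split_beta
  by (intro continuous_intros continuous_on_compose2[OF assms] continuous_on_compose2[OF continuous_on_apply_bcontfun[of UNIV]]) auto

lemma trig_eval_Dop: "trig_eval g m (Dop i f) t x = (\<Sum>k\<in>supp f. real_of_int (k i) * (apply_bcontfun (cf f k) t * g (dotp m k x)))"
  by (subst trig_eval_superset[of "supp f"]) (auto simp: in_keys_iff mult_ac)

lemma dotp_line: "dotp m k (\<lambda>i. x i + r * \<xi> i) = dotp m k x + r * dotp m k \<xi>"
  by (simp add: dotp_def sum_distrib_left algebra_simps sum.distrib)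

lemma dotp_sum_eq: "(\<Sum>i<m. \<xi> i * trig_eval g m (Dop i f) t x) = (\<Sum>k\<in>supp f. dotp m k \<xi> * (apply_bcontfun (cf f k) t * g (dotp m k x)))"
  unfolding trig_eval_Dop dotp_def sum_distrib_left sum_distrib_right
  by (subst sum.swap) (simp add: mult_ac)

lemma cos_poly_deriv_line:
  "((\<lambda>r. cos_poly m f t (\<lambda>i. x i + r * \<xi> i)) has_real_derivative
     - (\<Sum>i<m. \<xi> i * sin_poly m (Dop i f) t (\<lambda>i. x i + r * \<xi> i))) (at r within S)"
  unfolding dotp_sum_eq unfolding trig_eval_def dotp_line
  by (auto intro!: derivative_eq_intros simp: sum_negf[symmetric] mult_ac)

lemma sin_poly_deriv_line:
  "((\<lambda>r. sin_poly m f t (\<lambda>i. x i + r * \<xi> i)) has_real_derivative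
     (\<Sum>i<m. \<xi> i * cos_poly m (Dop i f) t (\<lambda>i. x i + r * \<xi> i))) (at r within S)"
  unfolding dotp_sum_eq unfolding trig_eval_def dotp_line
  by (auto intro!: derivative_eq_intros simp: mult_ac)

lemma Eop_eq_sum: "Eop m f = (\<Sum>i<m. Dop i (Dop i f))"
  by (rule poly_mapping_eqI) (simp add: lookup_sum real_sqn power2_eq_square flip: scaleR_sum_left)

lemma Dop_add: "Dop i (f + g) = Dop i f + Dop i g"
  and Dop_diff: "Dop i (f - g) = Dop i f - Dop i g"
  by (rule poly_mapping_eqI, simp add: lookup_add lookup_minus scaleR_add_right scaleR_diff_right)+

lemma Dop_sum: "Dop i (\<Sum>a\<in>A. f a) = (\<Sum>a\<in>A. Dop i (f a))"
proof -
  have "Dop i 0 = 0" by (rule poly_mapping_eqI) simp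
  then show ?thesis by (induction A rule: infinite_finite_induct) (auto simp: Dop_add)
qed

lemma Dop_sng: "Dop i (sng k c) = sng k (real_of_int (k i) *\<^sub>R c)"
  by (rule poly_mapping_eqI) (simp add: lookup_single when_def)

lemma Dop_times: "Dop i (f * g) = Dop i f * g + f * Dop i g"
proof -
  have "Dop i (sng a c * sng b d) = Dop i (sng a c) * sng b d + sng a c * Dop i (sng b d)" for a b c d
    by (simp add: Dop_sng mult_single scaleR_add_left flip: single_add)
  then have "Dop i ((\<Sum>a\<in>supp f. sng a (cf f a)) * (\<Sum>b\<in>supp g. sng b (cf g b)))
    = Dop i (\<Sum>a\<in>supp f. sng a (cf f a)) * (\<Sum>b\<in>supp g. sng b (cf g b))
      + (\<Sum>a\<in>supp f. sng a (cf f a)) * Dop i (\<Sum>b\<in>supp g. sng b (cf g b))"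
    by (simp add: sum_product Dop_sum sum.distrib)
  then show ?thesis by (simp flip: sum_sng)
qed

text \<open>The coordinates below \<open>m\<close> are flipped one after another; a frequency with a
  nonzero entry further on has coefficient zero, and so does its negative.\<close>

lemma psym_cf_uminus:
  assumes f: "psym m \<sigma> f" shows "cf f (- k) = cf f k"
proof (cases "\<exists>i\<ge>m. k i \<noteq> 0")
  case True
  then have "\<exists>i\<ge>m. (- k) i \<noteq> 0" by auto
  then show ?thesis using True f unfolding psym_def by metis
next
  case False
  have flip: "cf f (h(i := - h i)) = cf f h" if "i < m" for h i
    using f that by (auto simp: psym_def)
  have *: "l \<le> m \<Longrightarrow> cf f (\<lambda>i. if i < l then - k i else k i) = cf f k" for l
  proof (induction l)
    case (Suc l)
    let ?k = "\<lambda>i. if i < l then - k i else k i"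
    have "cf f (?k(l := - ?k l)) = cf f ?k" using Suc.prems by (intro flip) simp
    moreover have "?k(l := - ?k l) = (\<lambda>i. if i < Suc l then - k i else k i)" by (auto simp: fun_eq_iff less_Suc_eq)
    ultimately show ?case using Suc by simp
  qed simp
  have "(\<lambda>i. if i < m then - k i else k i) = - k" using False by (auto simp: fun_eq_iff not_less)
  then show ?thesis using *[of m] by simp
qed

section \<open>Parity in x and the symmetries of the evaluated functions\<close>

text \<open>Parity under \<open>x\<close> to \<open>-x\<close>: the fields have sign 1 and their
  first derivatives -1, so of the two parts of \<open>trig_eval\<close> one always vanishes.\<close>

definition par_poly :: "real \<Rightarrow> tpoly \<Rightarrow> bool" where
  "par_poly \<sigma> f \<longleftrightarrow> (\<forall>k. cf f (- k) = \<sigma> *\<^sub>R cf f k)"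

lemma psym_par_poly: "psym m \<sigma> f \<Longrightarrow> par_poly 1 f"
  by (simp add: par_poly_def psym_cf_uminus)

lemma par_poly_Dop: "par_poly \<sigma> f \<Longrightarrow> par_poly (- \<sigma>) (Dop i f)"
  by (simp add: par_poly_def)

lemma trig_eval_reindex_uminus:
  assumes "par_poly \<sigma> f" "\<sigma> \<noteq> 0"
  shows "trig_eval g m f t x = (\<Sum>k\<in>supp f. \<sigma> * (apply_bcontfun (cf f k) t * g (- dotp m k x)))"
proof -
  have "uminus ` supp f = supp f"
  proof -
    have "uminus ` supp f \<subseteq> supp f" using assms by (auto simp: par_poly_def in_keys_iff)
    moreover from this have "uminus ` uminus ` supp f \<subseteq> uminus ` supp f" by (rule image_mono)
    ultimately show ?thesis by (simp add: image_image)
  qed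
  then have "trig_eval g m f t x = (\<Sum>k\<in>uminus ` supp f. apply_bcontfun (cf f k) t * g (dotp m k x))"
    by (simp add: trig_eval_def)
  also have "\<dots> = (\<Sum>k\<in>supp f. apply_bcontfun (cf f (- k)) t * g (dotp m (- k) x))"
    by (rule sum.reindex_cong[where l = uminus]) auto
  finally show ?thesis using assms by (simp add: par_poly_def dotp_def sum_negf mult_ac)
qed

lemma sin_poly_even: "par_poly 1 f \<Longrightarrow> sin_poly m f t x = 0"
  using trig_eval_reindex_uminus[of 1 f sin m t x] by (simp add: trig_eval_def sum_negf)

lemma cos_poly_odd: "par_poly (-1) f \<Longrightarrow> cos_poly m f t x = 0"
  using trig_eval_reindex_uminus[of "-1" f cos m t x] by (simp add: trig_eval_def sum_negf)

lemma trig_eval_reindex: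
  assumes "\<And>k. cf f (\<tau> k) = cf f k" "bij \<tau>" "\<And>k. dotp m (\<tau> k) x = dotp m k y"
  shows "trig_eval g m f t x = trig_eval g m f t y"
proof -
  have "\<tau> ` supp f = supp f"
  proof
    show "\<tau> ` supp f \<subseteq> supp f" using assms by (auto simp: in_keys_iff)
    show "supp f \<subseteq> \<tau> ` supp f"
    proof
      fix a assume a: "a \<in> supp f"
      obtain b where "a = \<tau> b" using bij_is_surj[OF assms(2)] by blast
      then show "a \<in> \<tau> ` supp f" using a assms(1)[of b] by (auto simp: in_keys_iff)
    qed
  qed
  then have "trig_eval g m f t x = (\<Sum>k\<in>\<tau> ` supp f. apply_bcontfun (cf f k) t * g (dotp m k x))"
    by (simp add: trig_eval_def)
  also have "\<dots> = (\<Sum>k\<in>supp f. apply_bcontfun (cf f (\<tau> k)) t * g (dotp m (\<tau> k) x))"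
    by (rule sum.reindex_cong[where l = \<tau>]) (auto intro: inj_on_subset[OF bij_is_inj[OF assms(2)]])
  finally show ?thesis by (simp add: assms trig_eval_def)
qed

lemma trig_eval_flip: "psym m \<sigma> f \<Longrightarrow> i < m \<Longrightarrow> trig_eval g m f t (x(i := - x i)) = trig_eval g m f t x"
  by (rule trig_eval_reindex[OF _ bij_flip[of i]]) (auto simp: psym_def dotp_def intro!: sum.cong)

lemma trig_eval_perm:
  assumes "psym m \<sigma> f" "\<pi> permutes {..<m}"
  shows "trig_eval g m f t (x \<circ> \<pi>) = trig_eval g m f t x"
proof (rule trig_eval_reindex[OF _ bij_comp_permutes[OF assms(2)]])
  show "cf f (k \<circ> \<pi>) = cf f k" for k using assms by (auto simp: psym_def)
  show "dotp m (k \<circ> \<pi>) (x \<circ> \<pi>) = dotp m k x" for k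
    using sum.permute[OF assms(2), of "\<lambda>i. real_of_int (k i) * x i"] by (simp add: dotp_def o_def)
qed

lemma trig_eval_shift:
  assumes "i < m" "\<And>r j. g (r + of_int j * (2 * pi)) = g r"
  shows "trig_eval g m f t (x(i := x i + 2 * pi)) = trig_eval g m f t x"
proof -
  have "dotp m k (x(i := x i + 2 * pi)) = dotp m k x + of_int (k i) * (2 * pi)" for k
  proof -
    have "(\<Sum>j\<in>{..<m} - {i}. real_of_int (k j) * (x(i := x i + 2 * pi)) j) = (\<Sum>j\<in>{..<m} - {i}. real_of_int (k j) * x j)"
      by (intro sum.cong) auto
    then show ?thesis
      using assms(1) unfolding dotp_def by (simp add: sum.remove[of "{..<m}" i] distrib_left)
  qed
  then show ?thesis unfolding trig_eval_def by (simp add: assms(2))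
qed

lemma trig_eval_parity: "psym m \<sigma> f \<Longrightarrow> trig_eval g m f (- t) x = \<sigma> * trig_eval g m f t x"
  by (simp add: trig_eval_def psym_def sum_distrib_left mult_ac)

no_syntax
  "_Sum_any" :: "pttrn \<Rightarrow> 'a \<Rightarrow> 'a::comm_monoid_add"    (\<open>(\<open>indent=2 notation=\<open>binder \<Sum>\<close>\<close>\<Sum>_. _)\<close> [0, 10] 10)

section \<open>Absolute convergence in s and evaluation of the series\<close>

definition conv_at :: "nat \<Rightarrow> nat \<Rightarrow> real \<Rightarrow> tser \<Rightarrow> bool" where
  "conv_at m p s F \<longleftrightarrow> summable (\<lambda>j. \<bar>s\<bar> ^ j * wnorm m p (F $ j))"

lemma sum_power_wnorm_le_jet_norm:
  assumes "\<bar>s\<bar> \<le> \<rho>"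
  shows "(\<Sum>j<n. \<bar>s\<bar> ^ j * wnorm m p (F $ j)) \<le> jet_norm m p \<rho> n F"
proof -
  have "(\<Sum>j<n. \<bar>s\<bar> ^ j * wnorm m p (F $ j)) \<le> (\<Sum>j<n. \<rho> ^ j * wnorm m p (F $ j))"
    using assms by (intro sum_mono mult_right_mono power_mono) auto
  also have "\<dots> \<le> jet_norm m p \<rho> n F"
    unfolding jet_norm_def using order_trans[OF abs_ge_zero assms] by (intro sum_mono2) auto
  finally show ?thesis .
qed

lemma conv_at_jet_norm:
  assumes "\<And>J. jet_norm m p \<rho> J F \<le> R" "\<bar>s\<bar> \<le> \<rho>"
  shows "conv_at m p s F"
  unfolding conv_at_def
proof (rule summableI_nonneg_bounded[where x = R])
  fix n
  show "(\<Sum>j<n. \<bar>s\<bar> ^ j * wnorm m p (F $ j)) \<le> R"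
    using sum_power_wnorm_le_jet_norm[OF assms(2)] assms(1) by (rule order_trans)
qed auto

lemma conv_at_jet_norm_bound:
  assumes "conv_at m p s F"
  shows "jet_norm m p \<bar>s\<bar> J F \<le> (\<Sum>j. \<bar>s\<bar> ^ j * wnorm m p (F $ j))"
  unfolding jet_norm_def lessThan_Suc_atMost[symmetric]
  by (rule sum_le_suminf) (use assms in \<open>auto simp: conv_at_def\<close>)

lemma conv_at_bounded: "conv_at m p s F \<Longrightarrow> \<exists>R. \<forall>J. jet_norm m p \<bar>s\<bar> J F \<le> R"
  using conv_at_jet_norm_bound by blast

text \<open>Carries each inequality between truncated norms over to convergent series: bounded
  partial sums with nonnegative terms converge.\<close>

lemma conv_at_binary:
  assumes "conv_at m p s F" "conv_at m q s G"
    and "\<And>J. jet_norm m r \<bar>s\<bar> J H \<le> b (jet_norm m p \<bar>s\<bar> J F) (jet_norm m q \<bar>s\<bar> J G)"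
    and mono: "\<And>x y x' y'. 0 \<le> x \<Longrightarrow> x \<le> x' \<Longrightarrow> 0 \<le> y \<Longrightarrow> y \<le> y' \<Longrightarrow> b x y \<le> b x' (y'::real)"
  shows "conv_at m r s H"
proof -
  obtain R where R: "\<And>J. jet_norm m p \<bar>s\<bar> J F \<le> R" using conv_at_bounded[OF assms(1)] by blast
  obtain S where S: "\<And>J. jet_norm m q \<bar>s\<bar> J G \<le> S" using conv_at_bounded[OF assms(2)] by blast
  have "jet_norm m r \<bar>s\<bar> J H \<le> b R S" for J
    by (intro order_trans[OF assms(3) mono] R S) auto
  then show ?thesis by (intro conv_at_jet_norm[where \<rho> = "\<bar>s\<bar>"]) auto
qed

lemma conv_at_add: "conv_at m p s F \<Longrightarrow> conv_at m p s G \<Longrightarrow> conv_at m p s (F + G)"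
  by (erule conv_at_binary[where b = "(+)"], assumption) (auto simp: jet_norm_add)

lemma conv_at_diff: "conv_at m p s F \<Longrightarrow> conv_at m p s G \<Longrightarrow> conv_at m p s (F - G)"
  by (erule conv_at_binary[where b = "(+)"], assumption) (auto simp: jet_norm_diff)

lemma conv_at_times: "conv_at m p s F \<Longrightarrow> conv_at m p s G \<Longrightarrow> conv_at m p s (F * G)"
  by (erule conv_at_binary[where b = times], assumption) (auto simp: jet_norm_mult mult_mono)

lemma conv_at_le: "conv_at m p s F \<Longrightarrow> q \<le> p \<Longrightarrow> conv_at m q s F"
  by (rule conv_at_binary[where b = "\<lambda>x y. x"], assumption, assumption) (auto simp: jet_norm_mono)

lemma conv_at_D: "conv_at m (Suc p) s F \<Longrightarrow> i < m \<Longrightarrow> conv_at m p s (fmap (Dop i) F)"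
  by (rule conv_at_binary[where b = "\<lambda>x y. x"], assumption, assumption)
    (use jet_norm_fmap_le[of "\<bar>s\<bar>" m p "Dop i" 1 "Suc p" _ F] wnorm_Dop[of i m p] in auto)

lemma conv_at_E: "conv_at m (Suc (Suc p)) s F \<Longrightarrow> conv_at m p s (fmap (Eop m) F)"
  by (rule conv_at_binary[where b = "\<lambda>x y. x"], assumption, assumption)
    (use jet_norm_fmap_le[of "\<bar>s\<bar>" m p "Eop m" 1 "Suc (Suc p)" _ F] wnorm_Eop[of m p] in auto)

lemma conv_at_const [simp]: "conv_at m p s (fps_const f)"
  by (rule conv_at_jet_norm[where \<rho> = "\<bar>s\<bar>"]) (auto simp: jet_norm_fps_const)

lemma conv_at_cst [simp]: "conv_at m p s (cst c)"
  by (simp add: cst_def)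

lemma conv_at_1 [simp]: "conv_at m p s 1"
  using conv_at_cst[of m p s 1] by simp

lemma conv_at_X [simp]: "conv_at m p s fps_X"
proof -
  have "jet_norm m p \<bar>s\<bar> J (fps_X :: tser) \<le> \<bar>s\<bar> * wnorm m p (1::tpoly)" for J
  proof -
    have "jet_norm m p \<bar>s\<bar> J (fps_X :: tser) = (\<Sum>j\<le>J. if j = 1 then \<bar>s\<bar> * wnorm m p (1 :: tpoly) else 0)"
      unfolding jet_norm_def by (intro sum.cong) auto
    then show ?thesis by auto
  qed
  then show ?thesis by (intro conv_at_jet_norm[where \<rho> = "\<bar>s\<bar>"]) auto
qed

lemma conv_at_GS: "conv_at m (Suc p) s F \<Longrightarrow> conv_at m (Suc p) s G \<Longrightarrow> conv_at m p s (GS m F G)"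
  by (erule conv_at_binary[where b = "\<lambda>x y. real m * (x * y)"], assumption)
    (auto simp: jet_norm_GS intro!: mult_left_mono mult_mono)

definition ser_eval :: "(real \<Rightarrow> real) \<Rightarrow> nat \<Rightarrow> tser \<Rightarrow> real \<Rightarrow> real \<Rightarrow> (nat \<Rightarrow> real) \<Rightarrow> real" where
  "ser_eval g m F s t x = (\<Sum>j. s ^ j * trig_eval g m (F $ j) t x)"

abbreviation cos_ser :: "nat \<Rightarrow> tser \<Rightarrow> real \<Rightarrow> real \<Rightarrow> (nat \<Rightarrow> real) \<Rightarrow> real" where "cos_ser \<equiv> ser_eval cos"
abbreviation sin_ser :: "nat \<Rightarrow> tser \<Rightarrow> real \<Rightarrow> real \<Rightarrow> (nat \<Rightarrow> real) \<Rightarrow> real" where "sin_ser \<equiv> ser_eval sin"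

lemma ser_eval_term_bound:
  assumes "\<And>r. \<bar>g r\<bar> \<le> 1"
  shows "norm (s ^ j * trig_eval g m (F $ j) t x) \<le> \<bar>s\<bar> ^ j * wnorm m p (F $ j)"
  using trig_eval_bound[OF assms] by (simp add: abs_mult power_abs mult_left_mono)

lemma ser_eval_summable_abs:
  assumes "\<And>r. \<bar>g r\<bar> \<le> 1" "conv_at m p s F"
  shows "summable (\<lambda>j. norm (s ^ j * trig_eval g m (F $ j) t x))"
  by (rule summable_comparison_test'[where g = "\<lambda>j. \<bar>s\<bar> ^ j * wnorm m p (F $ j)" and N = 0])
    (use ser_eval_term_bound[OF assms(1)] assms(2) in \<open>auto simp: conv_at_def\<close>)

lemma ser_eval_summable:
  assumes "\<And>r. \<bar>g r\<bar> \<le> 1" "conv_at m p s F"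
  shows "summable (\<lambda>j. s ^ j * trig_eval g m (F $ j) t x)"
  by (rule summable_norm_cancel[OF ser_eval_summable_abs[OF assms]])

lemma ser_eval_bound:
  assumes "\<And>r. \<bar>g r\<bar> \<le> 1" "conv_at m p s F"
  shows "\<bar>ser_eval g m F s t x\<bar> \<le> (\<Sum>j. \<bar>s\<bar> ^ j * wnorm m p (F $ j))"
proof -
  have "norm (\<Sum>j. s ^ j * trig_eval g m (F $ j) t x) \<le> (\<Sum>j. norm (s ^ j * trig_eval g m (F $ j) t x))"
    by (rule summable_norm[OF ser_eval_summable_abs[OF assms]])
  also have "\<dots> \<le> (\<Sum>j. \<bar>s\<bar> ^ j * wnorm m p (F $ j))"
    using assms(2) by (intro suminf_le ser_eval_term_bound[OF assms(1)] ser_eval_summable_abs[OF assms]) (simp add: conv_at_def)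
  finally show ?thesis by (simp add: ser_eval_def)
qed

lemma cs_le_1: "\<bar>cos (r::real)\<bar> \<le> 1" "\<bar>sin (r::real)\<bar> \<le> 1"
  by auto

lemma ser_eval_add:
  assumes "\<And>r. \<bar>g r\<bar> \<le> 1" "conv_at m p s F" "conv_at m q s G"
  shows "ser_eval g m (F + G) s t x = ser_eval g m F s t x + ser_eval g m G s t x"
  unfolding ser_eval_def
  by (subst suminf_add[OF ser_eval_summable[OF assms(1,2)] ser_eval_summable[OF assms(1,3)]]) (simp add: trig_eval_add distrib_left)

lemma ser_eval_diff:
  assumes "\<And>r. \<bar>g r\<bar> \<le> 1" "conv_at m p s F" "conv_at m q s G"
  shows "ser_eval g m (F - G) s t x = ser_eval g m F s t x - ser_eval g m G s t x"
  unfolding ser_eval_def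
  by (subst suminf_diff[OF ser_eval_summable[OF assms(1,2)] ser_eval_summable[OF assms(1,3)]]) (simp add: trig_eval_diff right_diff_distrib)

lemma ser_eval_sum:
  assumes "\<And>r. \<bar>g r\<bar> \<le> 1" "\<And>i. i \<in> A \<Longrightarrow> conv_at m p s (F i)"
  shows "ser_eval g m (\<Sum>i\<in>A. F i) s t x = (\<Sum>i\<in>A. ser_eval g m (F i) s t x)"
proof -
  have "(\<Sum>j. \<Sum>i\<in>A. s ^ j * trig_eval g m (F i $ j) t x) = (\<Sum>i\<in>A. \<Sum>j. s ^ j * trig_eval g m (F i $ j) t x)"
    by (rule suminf_sum) (rule ser_eval_summable[OF assms(1) assms(2)])
  then show ?thesis unfolding ser_eval_def by (simp add: fps_sum_nth trig_eval_sum sum_distrib_left)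
qed

lemma ser_eval_fps_const: "ser_eval g m (fps_const f) s t x = trig_eval g m f t x"
proof -
  have "(\<lambda>j. s ^ j * trig_eval g m (fps_const f $ j) t x) sums (s ^ 0 * trig_eval g m (fps_const f $ 0) t x)"
    using sums_finite[of "{0}" "\<lambda>j. s ^ j * trig_eval g m (fps_const f $ j) t x"] by auto
  then show ?thesis by (simp add: ser_eval_def sums_iff)
qed

lemma cos_ser_cst [simp]: "cos_ser m (cst c) s t x = apply_bcontfun c t" and sin_ser_cst [simp]: "sin_ser m (cst c) s t x = 0"
  by (simp_all add: cst_def ser_eval_fps_const trig_eval_sng)

lemma cos_ser_1 [simp]: "cos_ser m 1 s t x = 1"
  using cos_ser_cst[of m 1 s t x] by simp

lemma Cauchy_ser_eval:
  assumes g: "\<And>r. \<bar>g r\<bar> \<le> 1" "\<And>r. \<bar>h r\<bar> \<le> 1" and F: "conv_at m p s F" and G: "conv_at m q s G"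
  shows "(\<lambda>j. s ^ j * (\<Sum>i=0..j. trig_eval g m (F $ i) t x * trig_eval h m (G $ (j - i)) t x)) sums (ser_eval g m F s t x * ser_eval h m G s t x)"
proof -
  have "(\<lambda>j. \<Sum>i\<le>j. (s ^ i * trig_eval g m (F $ i) t x) * (s ^ (j - i) * trig_eval h m (G $ (j - i)) t x)) sums (ser_eval g m F s t x * ser_eval h m G s t x)"
    unfolding ser_eval_def by (intro Cauchy_product_sums ser_eval_summable_abs[OF g(1) F] ser_eval_summable_abs[OF g(2) G])
  moreover have "(\<Sum>i\<le>j. (s ^ i * trig_eval g m (F $ i) t x) * (s ^ (j - i) * trig_eval h m (G $ (j - i)) t x))
     = s ^ j * (\<Sum>i=0..j. trig_eval g m (F $ i) t x * trig_eval h m (G $ (j - i)) t x)" for j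
    unfolding sum_distrib_left
    by (rule sum.cong) (auto simp: mult_ac simp flip: power_add)
  ultimately show ?thesis by simp
qed

lemma cos_ser_times:
  assumes F: "conv_at m p s F" and G: "conv_at m q s G"
  shows "cos_ser m (F * G) s t x = cos_ser m F s t x * cos_ser m G s t x - sin_ser m F s t x * sin_ser m G s t x"
proof -
  have "(\<lambda>j. s ^ j * (\<Sum>i=0..j. cos_poly m (F $ i) t x * cos_poly m (G $ (j - i)) t x)
      - s ^ j * (\<Sum>i=0..j. sin_poly m (F $ i) t x * sin_poly m (G $ (j - i)) t x)) sums
      (cos_ser m F s t x * cos_ser m G s t x - sin_ser m F s t x * sin_ser m G s t x)"
    by (intro sums_diff Cauchy_ser_eval[OF _ _ F G] cs_le_1)
  then show ?thesis
    unfolding ser_eval_def[of cos m "F * G"]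
    by (simp add: sums_iff fps_mult_nth trig_eval_sum cos_poly_times sum_subtractf right_diff_distrib)
qed

lemma sin_ser_times:
  assumes F: "conv_at m p s F" and G: "conv_at m q s G"
  shows "sin_ser m (F * G) s t x = sin_ser m F s t x * cos_ser m G s t x + cos_ser m F s t x * sin_ser m G s t x"
proof -
  have "(\<lambda>j. s ^ j * (\<Sum>i=0..j. sin_poly m (F $ i) t x * cos_poly m (G $ (j - i)) t x)
      + s ^ j * (\<Sum>i=0..j. cos_poly m (F $ i) t x * sin_poly m (G $ (j - i)) t x)) sums
      (sin_ser m F s t x * cos_ser m G s t x + cos_ser m F s t x * sin_ser m G s t x)"
    by (intro sums_add Cauchy_ser_eval[OF _ _ F G] cs_le_1)
  then show ?thesis
    unfolding ser_eval_def[of sin m "F * G"]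
    by (simp add: sums_iff fps_mult_nth trig_eval_sum sin_poly_times sum.distrib distrib_left)
qed

lemma cos_ser_X [simp]: "cos_ser m fps_X s t x = s" and sin_ser_X [simp]: "sin_ser m fps_X s t x = 0"
proof -
  have *: "(\<lambda>j. s ^ j * trig_eval g m (fps_X $ j) t x) sums (s * trig_eval g m 1 t x)" for g
    using sums_finite[of "{1}" "\<lambda>j. s ^ j * trig_eval g m (fps_X $ j) t x"] by auto
  have "cos_poly m 1 t x = 1" "sin_poly m 1 t x = 0"
    using trig_eval_sng[of cos m 0 1 t x] trig_eval_sng[of sin m 0 1 t x] by simp_all
  then show "cos_ser m fps_X s t x = s" "sin_ser m fps_X s t x = 0"
    using *[of cos] *[of sin] by (simp_all add: ser_eval_def sums_iff)
qed

definition par_ser :: "real \<Rightarrow> tser \<Rightarrow> bool" where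
  "par_ser \<sigma> F \<longleftrightarrow> (\<forall>j. par_poly \<sigma> (F $ j))"

lemma sin_ser_par_ser [simp]: "par_ser 1 F \<Longrightarrow> sin_ser m F s t x = 0"
  by (simp add: ser_eval_def par_ser_def sin_poly_even)

lemma cos_ser_par_ser [simp]: "par_ser (-1) F \<Longrightarrow> cos_ser m F s t x = 0"
  by (simp add: ser_eval_def par_ser_def cos_poly_odd)

lemma par_ser_D: "par_ser 1 F \<Longrightarrow> par_ser (-1) (fmap (Dop i) F)" "par_ser (-1) F \<Longrightarrow> par_ser 1 (fmap (Dop i) F)"
  using par_poly_Dop[of 1] par_poly_Dop[of "-1"] by (auto simp: par_ser_def)

lemma par_poly_add: "par_poly \<sigma> f \<Longrightarrow> par_poly \<sigma> g \<Longrightarrow> par_poly \<sigma> (f + g)"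
  by (simp add: par_poly_def lookup_add scaleR_add_right)

lemma ser_eval_aop: "ser_eval g m (fmap aop F) s t x = ser_eval g m F s 1 x"
  by (simp add: ser_eval_def trig_eval_aop)

lemma ser_eval_E:
  assumes "\<And>r. \<bar>g r\<bar> \<le> 1" "conv_at m (Suc (Suc p)) s F"
  shows "ser_eval g m (fmap (Eop m) F) s t x = (\<Sum>i<m. ser_eval g m (fmap (Dop i) (fmap (Dop i) F)) s t x)"
proof -
  have "fmap (Eop m) F = (\<Sum>i<m. fmap (Dop i) (fmap (Dop i) F))"
    by (rule fps_ext) (simp add: fps_sum_nth Eop_eq_sum)
  moreover have "conv_at m p s (fmap (Dop i) (fmap (Dop i) F))" if "i \<in> {..<m}" for i
    using that assms(2) by (intro conv_at_D) auto
  ultimately show ?thesis using ser_eval_sum[OF assms(1), of "{..<m}" m p s] by simp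
qed

text \<open>The factors \<open>Dop i F\<close> are odd, so only sine parts survive, and the addition
  theorem of the cosine supplies the minus sign.\<close>

lemma cos_ser_GS:
  assumes "conv_at m (Suc p) s F" "conv_at m (Suc p) s G" "par_ser 1 F" "par_ser 1 G"
  shows "cos_ser m (GS m F G) s t x = - (\<Sum>i<m. sin_ser m (fmap (Dop i) F) s t x * sin_ser m (fmap (Dop i) G) s t x)"
proof -
  have "cos_ser m (GS m F G) s t x = (\<Sum>i<m. cos_ser m (fmap (Dop i) F * fmap (Dop i) G) s t x)"
    unfolding GS_def by (rule ser_eval_sum[OF cs_le_1(1) conv_at_times]) (use assms in \<open>auto intro: conv_at_D\<close>)
  also have "\<dots> = (\<Sum>i<m. - (sin_ser m (fmap (Dop i) F) s t x * sin_ser m (fmap (Dop i) G) s t x))"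
  proof (intro sum.cong refl)
    fix i assume "i \<in> {..<m}"
    then have "conv_at m p s (fmap (Dop i) F)" "conv_at m p s (fmap (Dop i) G)" using assms by (auto intro: conv_at_D)
    from cos_ser_times[OF this] show "cos_ser m (fmap (Dop i) F * fmap (Dop i) G) s t x
       = - (sin_ser m (fmap (Dop i) F) s t x * sin_ser m (fmap (Dop i) G) s t x)"
      using assms by (simp add: par_ser_D)
  qed
  finally show ?thesis by (simp add: sum_negf)
qed

lemma fmap_D_times: "fmap (Dop i) (F * G) = fmap (Dop i) F * G + F * fmap (Dop i) G"
  by (rule fps_ext) (simp add: fps_mult_nth Dop_sum Dop_times sum.distrib)

lemma fmap_D_add: "fmap (Dop i) (F + G) = fmap (Dop i) F + fmap (Dop i) G"
  by (rule fps_ext) (simp add: Dop_add)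

section \<open>Continuity and termwise differentiation in x and t\<close>

lemma ser_eval_uniform:
  assumes "\<And>r. \<bar>g r\<bar> \<le> 1" "conv_at m p s F"
  shows "uniform_limit S (\<lambda>n (t, x). \<Sum>j<n. s ^ j * trig_eval g m (F $ j) t x) (\<lambda>(t, x). ser_eval g m F s t x) sequentially"
  unfolding ser_eval_def split_beta
  by (rule Weierstrass_m_test[where M = "\<lambda>j. \<bar>s\<bar> ^ j * wnorm m p (F $ j)"])
    (use ser_eval_term_bound[OF assms(1)] assms(2) in \<open>auto simp: conv_at_def\<close>)

lemma continuous_on_ser_eval:
  assumes "\<And>r. \<bar>g r\<bar> \<le> 1" "continuous_on UNIV g" "conv_at m p s F"
  shows "continuous_on UNIV (\<lambda>(t, x). ser_eval g m F s t x)"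
proof (rule uniform_limit_theorem[OF _ ser_eval_uniform[OF assms(1,3)]])
  have "continuous_on UNIV (\<lambda>(t, x). \<Sum>j<n. s ^ j * trig_eval g m (F $ j) t x)" for n
    using continuous_on_trig_eval[OF assms(2)] unfolding split_beta by (intro continuous_intros) auto
  then show "\<forall>\<^sub>F n in sequentially. continuous_on UNIV (\<lambda>(t, x). \<Sum>j<n. s ^ j * trig_eval g m (F $ j) t x)"
    by simp
qed simp

text \<open>The differentiated series has a majorant independent of the point on the line, at the
  price of one order; \<open>c\<close> covers the signs of the cosine and sine cases.\<close>

lemma ser_eval_deriv_line_aux:
  assumes g: "\<And>r. \<bar>g r\<bar> \<le> 1" "\<And>r. \<bar>g' r\<bar> \<le> 1" and F: "conv_at m 1 s F"
    and d: "\<And>j r. ((\<lambda>r. trig_eval g m (F $ j) t (\<lambda>i. x i + r * \<xi> i)) has_real_derivative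
      c * (\<Sum>i<m. \<xi> i * trig_eval g' m (Dop i (F $ j)) t (\<lambda>i. x i + r * \<xi> i))) (at r)"
  shows "((\<lambda>r. ser_eval g m F s t (\<lambda>i. x i + r * \<xi> i)) has_real_derivative
      c * (\<Sum>i<m. \<xi> i * ser_eval g' m (fmap (Dop i) F) s t (\<lambda>i. x i + r * \<xi> i))) (at r)"
proof -
  let ?f' = "\<lambda>j r. s ^ j * (c * (\<Sum>i<m. \<xi> i * trig_eval g' m (Dop i (F $ j)) t (\<lambda>i. x i + r * \<xi> i)))"
  have D: "conv_at m 0 s (fmap (Dop i) F)" if "i < m" for i using F that by (auto intro!: conv_at_D)
  have sums: "(\<lambda>j. ?f' j r) sums (c * (\<Sum>i<m. \<xi> i * ser_eval g' m (fmap (Dop i) F) s t (\<lambda>i. x i + r * \<xi> i)))" for r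
  proof -
    have "(\<lambda>j. c * (\<Sum>i<m. \<xi> i * (s ^ j * trig_eval g' m (fmap (Dop i) F $ j) t (\<lambda>i. x i + r * \<xi> i)))) sums
       (c * (\<Sum>i<m. \<xi> i * ser_eval g' m (fmap (Dop i) F) s t (\<lambda>i. x i + r * \<xi> i)))"
      unfolding ser_eval_def by (intro sums_mult sums_sum summable_sums ser_eval_summable[OF g(2) D]) auto
    then show ?thesis by (simp add: sum_distrib_left mult_ac)
  qed
  have A: "((\<lambda>r. s ^ j * trig_eval g m (F $ j) t (\<lambda>i. x i + r * \<xi> i)) has_real_derivative ?f' j r) (at r within UNIV)" for j r
    by (intro DERIV_cmult d)
  have B: "uniformly_convergent_on UNIV (\<lambda>n r. \<Sum>j<n. ?f' j r)"
    proof (rule Weierstrass_m_test'[where M = "\<lambda>j. \<bar>c\<bar> * (\<Sum>i<m. \<bar>\<xi> i\<bar> * (\<bar>s\<bar> ^ j * wnorm m 0 (fmap (Dop i) F $ j)))"])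
      fix j r
      have "\<bar>?f' j r\<bar> = \<bar>c\<bar> * \<bar>\<Sum>i<m. \<xi> i * (s ^ j * trig_eval g' m (fmap (Dop i) F $ j) t (\<lambda>i. x i + r * \<xi> i))\<bar>"
        by (simp add: abs_mult sum_distrib_left mult_ac flip: abs_mult)
      also have "\<dots> \<le> \<bar>c\<bar> * (\<Sum>i<m. \<bar>\<xi> i * (s ^ j * trig_eval g' m (fmap (Dop i) F $ j) t (\<lambda>i. x i + r * \<xi> i))\<bar>)"
        by (intro mult_left_mono sum_abs) simp
      also have "\<dots> \<le> \<bar>c\<bar> * (\<Sum>i<m. \<bar>\<xi> i\<bar> * (\<bar>s\<bar> ^ j * wnorm m 0 (fmap (Dop i) F $ j)))"
      proof (intro mult_left_mono sum_mono)
        fix i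
        show "\<bar>\<xi> i * (s ^ j * trig_eval g' m (fmap (Dop i) F $ j) t (\<lambda>i. x i + r * \<xi> i))\<bar> \<le> \<bar>\<xi> i\<bar> * (\<bar>s\<bar> ^ j * wnorm m 0 (fmap (Dop i) F $ j))"
          unfolding abs_mult[of "\<xi> i"] using ser_eval_term_bound[where g = g' and p = 0 and F = "fmap (Dop i) F", OF g(2)]
          by (intro mult_left_mono) auto
      qed simp
      finally show "norm (?f' j r) \<le> \<bar>c\<bar> * (\<Sum>i<m. \<bar>\<xi> i\<bar> * (\<bar>s\<bar> ^ j * wnorm m 0 (fmap (Dop i) F $ j)))" by simp
    next
      show "summable (\<lambda>j. \<bar>c\<bar> * (\<Sum>i<m. \<bar>\<xi> i\<bar> * (\<bar>s\<bar> ^ j * wnorm m 0 (fmap (Dop i) F $ j))))"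
        using D unfolding conv_at_def by (intro summable_mult summable_sum) auto
    qed
  have C: "summable (\<lambda>j. s ^ j * trig_eval g m (F $ j) t (\<lambda>i. x i + 0 * \<xi> i))"
    by (rule ser_eval_summable[OF g(1) F])
  have "((\<lambda>r. \<Sum>j. s ^ j * trig_eval g m (F $ j) t (\<lambda>i. x i + r * \<xi> i)) has_real_derivative (\<Sum>j. ?f' j r)) (at r)"
    by (rule has_field_derivative_series'(2)[OF convex_UNIV A B UNIV_I C]) simp
  then show ?thesis using sums[of r] by (simp add: sums_iff ser_eval_def[of g m F])
qed

lemma cos_ser_deriv_line:
  assumes "conv_at m 1 s F"
  shows "((\<lambda>r. cos_ser m F s t (\<lambda>i. x i + r * \<xi> i)) has_real_derivative
      - (\<Sum>i<m. \<xi> i * sin_ser m (fmap (Dop i) F) s t (\<lambda>i. x i + r * \<xi> i))) (at r)"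
  using ser_eval_deriv_line_aux[where c = "-1" and g = cos and g' = sin, OF _ _ assms] cos_poly_deriv_line by simp

lemma sin_ser_deriv_line:
  assumes "conv_at m 1 s F"
  shows "((\<lambda>r. sin_ser m F s t (\<lambda>i. x i + r * \<xi> i)) has_real_derivative
      (\<Sum>i<m. \<xi> i * cos_ser m (fmap (Dop i) F) s t (\<lambda>i. x i + r * \<xi> i))) (at r)"
  using ser_eval_deriv_line_aux[where c = 1 and g = sin and g' = cos, OF _ _ assms] sin_poly_deriv_line by simp

lemma ser_eval_deriv_t:
  assumes g: "\<And>r. \<bar>g r\<bar> \<le> 1" and F: "conv_at m 0 s F" and G: "conv_at m 0 s G" and T: "t_deriv F G" and t: "t \<in> {-1..1}"
  shows "((\<lambda>t. ser_eval g m F s t x) has_real_derivative ser_eval g m G s t x) (at t within {-1..1})"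
proof -
  have d: "((\<lambda>t. s ^ j * trig_eval g m (F $ j) t x) has_real_derivative s ^ j * trig_eval g m (G $ j) t x) (at t within {-1..1})"
    if "t \<in> {-1..1}" for j t
  proof -
    let ?A = "supp (F $ j) \<union> supp (G $ j)"
    have "trig_eval g m (h $ j) t x = (\<Sum>k\<in>?A. apply_bcontfun (cf (h $ j) k) t * g (dotp m k x))" if "h \<in> {F, G}" for h t
      using that by (intro trig_eval_superset) auto
    moreover have "((\<lambda>t. \<Sum>k\<in>?A. apply_bcontfun (cf (F $ j) k) t * g (dotp m k x)) has_real_derivative
       (\<Sum>k\<in>?A. apply_bcontfun (cf (G $ j) k) t * g (dotp m k x))) (at t within {-1..1})"
      using T that unfolding t_deriv_def by (intro DERIV_sum DERIV_cmult_right) auto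
    ultimately show ?thesis by (intro DERIV_cmult) simp
  qed
  have "\<exists>h. \<forall>t\<in>{-1..1}. (\<lambda>j. s ^ j * trig_eval g m (F $ j) t x) sums h t \<and>
      (h has_real_derivative ser_eval g m G s t x) (at t within {-1..1})"
  proof (rule has_field_derivative_series[OF _ d])
    have "uniform_limit {-1..1} (\<lambda>n t. \<Sum>j<n. s ^ j * trig_eval g m (G $ j) t x) (\<lambda>t. \<Sum>j. s ^ j * trig_eval g m (G $ j) t x) sequentially"
      by (rule Weierstrass_m_test[where M = "\<lambda>j. \<bar>s\<bar> ^ j * wnorm m 0 (G $ j)"])
        (use ser_eval_term_bound[OF g] G in \<open>auto simp: conv_at_def\<close>)
    then show "uniform_limit {-1..1} (\<lambda>n t. \<Sum>j<n. s ^ j * trig_eval g m (G $ j) t x) (\<lambda>t. ser_eval g m G s t x) sequentially"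
      by (simp add: ser_eval_def)
    show "summable (\<lambda>j. s ^ j * trig_eval g m (F $ j) 0 x)" by (rule ser_eval_summable[OF g F])
  qed auto
  then obtain h where h: "\<And>t. t \<in> {-1..1} \<Longrightarrow> (\<lambda>j. s ^ j * trig_eval g m (F $ j) t x) sums h t"
    "\<And>t. t \<in> {-1..1} \<Longrightarrow> (h has_real_derivative ser_eval g m G s t x) (at t within {-1..1})" by blast
  then have "h t = ser_eval g m F s t x" if "t \<in> {-1..1}" for t
    using that by (auto simp: sums_iff ser_eval_def)
  then show ?thesis
    using h(2)[OF t] t by (auto intro: has_field_derivative_transform_within[OF _ zero_less_one])
qed

lemma cos_ser_flip: "(\<And>j. psym m \<sigma> (F $ j)) \<Longrightarrow> i < m \<Longrightarrow> ser_eval g m F s t (x(i := - x i)) = ser_eval g m F s t x"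
  by (simp add: ser_eval_def trig_eval_flip[of m \<sigma>])

lemma cos_ser_perm: "(\<And>j. psym m \<sigma> (F $ j)) \<Longrightarrow> \<pi> permutes {..<m} \<Longrightarrow> ser_eval g m F s t (x \<circ> \<pi>) = ser_eval g m F s t x"
  by (simp add: ser_eval_def trig_eval_perm[of m \<sigma>])

lemma cos_shift: "cos (r + of_int j * (2 * pi)) = cos (r::real)"
  using cos.plus_of_int[of r j] by simp

lemma cos_ser_shift: "i < m \<Longrightarrow> cos_ser m F s t (x(i := x i + 2 * pi)) = cos_ser m F s t x"
  unfolding ser_eval_def by (subst trig_eval_shift[OF _ cos_shift]) auto

lemma cos_ser_parity:
  assumes "\<And>j. psym m \<sigma> (F $ j)" "\<And>r. \<bar>g r\<bar> \<le> 1" "conv_at m p s F"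
  shows "ser_eval g m F s (- t) x = \<sigma> * ser_eval g m F s t x"
  unfolding ser_eval_def suminf_mult[OF ser_eval_summable[OF assms(2,3)], symmetric]
  by (simp add: trig_eval_parity[OF assms(1)] mult_ac)

text \<open>Splitting \<open>F\<close> into its constant term plus \<open>s * G\<close>, the shift
  of the coefficients multiplies the bound by \<open>1 / \<rho>\<close>. All remainders of the
  theorem come from here.\<close>

lemma ser_eval_tail:
  assumes g: "\<And>r. \<bar>g r\<bar> \<le> 1" and R: "\<And>J. jet_norm m p \<rho> J F \<le> R" and s: "\<bar>s\<bar> \<le> \<rho>" "0 < \<rho>"
  shows "\<bar>ser_eval g m F s t x - trig_eval g m (F $ 0) t x\<bar> \<le> \<bar>s\<bar> * (R / \<rho>)"
proof -
  define G where "G = fps_shift 1 F"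
  have F: "F = fps_const (F $ 0) + fps_X * G"
    by (rule fps_ext) (auto simp: G_def)
  have "jet_norm m p \<rho> J G \<le> R / \<rho>" for J
  proof -
    have "\<rho> * jet_norm m p \<rho> J G \<le> jet_norm m p \<rho> (Suc J) F"
      unfolding jet_norm_def sum.atMost_Suc_shift sum_distrib_left by (simp add: G_def mult_ac)
    then show ?thesis using R[of "Suc J"] s(2) by (simp add: pos_le_divide_eq mult.commute)
  qed
  note G = this
  have smG: "conv_at m p s G" by (rule conv_at_jet_norm[OF G s(1)])
  have "(\<lambda>j. s ^ j * trig_eval g m (F $ j) t x) sums (s * ser_eval g m G s t x + trig_eval g m (F $ 0) t x)"
  proof -
    have "(\<lambda>j. s * (s ^ j * trig_eval g m (G $ j) t x)) sums (s * ser_eval g m G s t x)"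
      unfolding ser_eval_def by (intro sums_mult summable_sums ser_eval_summable[OF g smG])
    then have "(\<lambda>j. s ^ Suc j * trig_eval g m (F $ Suc j) t x) sums (s * ser_eval g m G s t x)"
      by (simp add: G_def mult_ac)
    from sums_Suc[OF this] show ?thesis by simp
  qed
  then have e: "ser_eval g m F s t x - trig_eval g m (F $ 0) t x = s * ser_eval g m G s t x"
    by (simp add: ser_eval_def sums_iff)
  have "\<bar>ser_eval g m G s t x\<bar> \<le> (\<Sum>j. \<bar>s\<bar> ^ j * wnorm m p (G $ j))"
    by (rule ser_eval_bound[OF g smG])
  also have "\<dots> \<le> R / \<rho>"
  proof (rule suminf_le_const)
    show "summable (\<lambda>j. \<bar>s\<bar> ^ j * wnorm m p (G $ j))" using smG by (simp add: conv_at_def)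
    fix n
    show "(\<Sum>j<n. \<bar>s\<bar> ^ j * wnorm m p (G $ j)) \<le> R / \<rho>"
      using sum_power_wnorm_le_jet_norm[OF s(1)] G by (rule order_trans)
  qed
  finally show ?thesis unfolding e abs_mult by (intro mult_left_mono) auto
qed

section \<open>Differentiation on \<open>R\<^sup>m\<close>\<close>

lemma has_real_derivative_split:
  assumes "(f has_real_derivative D) (at_left x)" "(f has_real_derivative D) (at_right x)"
  shows "(f has_real_derivative D) (at x)"
  using assms unfolding has_field_derivative_iff by (rule filterlim_split_at)

text \<open>Continuation by the tangent line: at the two ends the one-sided derivatives agree,
  elsewhere a single formula is valid nearby.\<close>

lemma clamp_extension_deriv:
  assumes d: "\<And>t. t \<in> {-1..1} \<Longrightarrow> (f has_real_derivative g t) (at t within {-1..1})"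
  shows "((\<lambda>t. f (clamp1 t) + (t - clamp1 t) * g (clamp1 t)) has_real_derivative g (clamp1 t)) (at t)"
proof -
  let ?F = "\<lambda>t. f (clamp1 t) + (t - clamp1 t) * g (clamp1 t)"
  have mid: "(?F has_real_derivative g t) (at t within {-1..1})" if "t \<in> {-1..1}" for t
    by (rule has_field_derivative_transform_within[OF d[OF that] zero_less_one that]) (simp add: clamp1_id)
  have up: "(?F has_real_derivative g 1) (at t within {1..})" if "t \<ge> 1" for t
  proof (rule has_field_derivative_transform_within[OF _ zero_less_one])
    show "((\<lambda>t. f 1 + (t - 1) * g 1) has_real_derivative g 1) (at t within {1..})"
      by (auto intro!: derivative_eq_intros)
  qed (use that in \<open>auto simp: clamp1_def\<close>)
  have lo: "(?F has_real_derivative g (-1)) (at t within {..-1})" if "t \<le> -1" for t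
  proof (rule has_field_derivative_transform_within[OF _ zero_less_one])
    show "((\<lambda>t. f (-1) + (t + 1) * g (-1)) has_real_derivative g (-1)) (at t within {..-1})"
      by (auto intro!: derivative_eq_intros)
  qed (use that in \<open>auto simp: clamp1_def\<close>)
  consider "t < -1" | "t = -1" | "-1 < t" "t < 1" | "t = 1" | "t > 1" by linarith
  then show ?thesis
  proof cases
    case 1
    have "(?F has_real_derivative g (-1)) (at t within {..<-1})"
      by (rule DERIV_subset[OF lo]) (use 1 in auto)
    then show ?thesis using 1 by (simp add: at_within_open[of t "{..<-1}"] clamp1_def)
  next
    case 2
    have "(?F has_real_derivative g (-1)) (at_left (-1))" by (rule DERIV_subset[OF lo]) auto
    moreover have "(?F has_real_derivative g (-1)) (at_right (-1))"
      using mid[of "-1"] at_within_Icc_at_right[of "-1::real" "1::real"] by simp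
    ultimately show ?thesis using 2 by (auto intro!: has_real_derivative_split simp: clamp1_def)
  next
    case 3
    have "(?F has_real_derivative g t) (at t within {-1<..<1})"
      by (rule DERIV_subset[OF mid]) (use 3 in auto)
    then show ?thesis using 3 by (simp add: at_within_open[of t "{-1<..<1}"] clamp1_id)
  next
    case 4
    have "(?F has_real_derivative g 1) (at_right 1)" by (rule DERIV_subset[OF up]) auto
    moreover have "(?F has_real_derivative g 1) (at_left 1)"
      using mid[of 1] at_within_Icc_at_left[of "-1::real" "1::real"] by simp
    ultimately show ?thesis using 4 by (auto intro!: has_real_derivative_split simp: clamp1_def)
  next
    case 5
    have "(?F has_real_derivative g 1) (at t within {1<..})"
      by (rule DERIV_subset[OF up]) (use 5 in auto)
    then show ?thesis using 5 by (simp add: at_within_open[of t "{1<..}"] clamp1_def)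
  qed
qed

text \<open>The hypotheses are asymmetric on purpose: the derivative in the first variable is
  required at one point only, the one in the second everywhere and continuous. So \<open>Wt\<close>,
  which is differentiated in \<open>t\<close> only inside the strip, is covered.\<close>

lemma chain_two_variables:
  fixes F :: "real \<Rightarrow> real \<Rightarrow> real"
  assumes a: "((\<lambda>x. F x (\<beta> r)) has_real_derivative Fa) (at (\<alpha> r))"
    and b: "\<And>x y. ((\<lambda>y. F x y) has_real_derivative Fb x y) (at y)"
    and c: "continuous_on UNIV (\<lambda>(x, y). Fb x y)"
    and \<alpha>: "(\<alpha> has_real_derivative \<alpha>') (at r)" and \<beta>: "(\<beta> has_real_derivative \<beta>') (at r)"
  shows "((\<lambda>r. F (\<alpha> r) (\<beta> r)) has_real_derivative (Fa * \<alpha>' + Fb (\<alpha> r) (\<beta> r) * \<beta>')) (at r)"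
proof -
  have "((\<lambda>(x, y). F x y) has_derivative (\<lambda>(h, k). h * Fa + blinfun_apply (blinfun_scaleR_left (Fb (\<alpha> r) (\<beta> r))) k))
      (at (\<alpha> r, \<beta> r) within UNIV \<times> UNIV)"
  proof (rule has_derivative_partialsI[where fy = "\<lambda>x y. blinfun_scaleR_left (Fb x y)"])
    show "((\<lambda>x. F x (\<beta> r)) has_derivative (\<lambda>h. h * Fa)) (at (\<alpha> r) within UNIV)"
      using a by (simp add: has_field_derivative_def mult_commute_abs)
    show "((\<lambda>y. F x y) has_derivative blinfun_apply (blinfun_scaleR_left (Fb x y))) (at y within UNIV)" for x y
      using b[of x y] by (simp add: has_field_derivative_def mult_commute_abs)
    have "isCont (\<lambda>(x, y). Fb x y) (\<alpha> r, \<beta> r)"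
      using c by (simp add: continuous_on_eq_continuous_at)
    then have "((\<lambda>p. Fb (fst p) (snd p)) \<longlongrightarrow> Fb (\<alpha> r) (\<beta> r)) (at (\<alpha> r, \<beta> r))"
      by (simp add: isCont_def case_prod_unfold)
    then have "((\<lambda>p. blinfun_scaleR_left (Fb (fst p) (snd p)) :: real \<Rightarrow>\<^sub>L real) \<longlongrightarrow> blinfun_scaleR_left (Fb (\<alpha> r) (\<beta> r)))
        (at (\<alpha> r, \<beta> r) within UNIV \<times> UNIV)"
      unfolding UNIV_Times_UNIV by (intro tendsto_intros)
    then show "continuous (at (\<alpha> r, \<beta> r) within UNIV \<times> UNIV) (\<lambda>(x, y). blinfun_scaleR_left (Fb x y) :: real \<Rightarrow>\<^sub>L real)"
      by (simp add: continuous_within case_prod_unfold)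
  qed auto
  then have F: "((\<lambda>(x, y). F x y) has_derivative (\<lambda>(h, k). h * Fa + k * Fb (\<alpha> r) (\<beta> r))) (at (\<alpha> r, \<beta> r))"
    by simp
  have "((\<lambda>r. (\<alpha> r, \<beta> r)) has_derivative (\<lambda>h. (h * \<alpha>', h * \<beta>'))) (at r)"
    using \<alpha> \<beta> by (intro has_derivative_Pair) (simp_all add: has_field_derivative_def mult_commute_abs)
  from has_derivative_compose[OF this F] show ?thesis
    unfolding has_field_derivative_def split by (rule has_derivative_eq_rhs) (simp add: fun_eq_iff algebra_simps)
qed

section \<open>Directional derivatives and the classes Ck\<close>

text \<open>General directions, so that partial and normal derivatives come from one
  computation.\<close>

definition ddir :: "((nat \<Rightarrow> real) \<Rightarrow> real) \<Rightarrow> (nat \<Rightarrow> real) \<Rightarrow> (nat \<Rightarrow> real) \<Rightarrow> real \<Rightarrow> bool" where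
  "ddir f p \<xi> D \<longleftrightarrow> ((\<lambda>r. f (\<lambda>i. p i + r * \<xi> i)) has_real_derivative D) (at 0)"

definition evec :: "nat \<Rightarrow> nat \<Rightarrow> real" where
  "evec j = (\<lambda>i. if i = j then 1 else 0)"

lemma ddir_evec:
  assumes "ddir f p (evec i) D"
  shows "((\<lambda>r. f (p(i := r))) has_real_derivative D) (at (p i))"
proof -
  have "(\<lambda>j. p j + r * evec i j) = p(i := p i + r)" for r
    by (auto simp: evec_def)
  then have "((\<lambda>r. f (p(i := r + p i))) has_real_derivative D) (at 0)"
    using assms by (simp add: ddir_def add.commute)
  then show ?thesis using DERIV_shift[of "\<lambda>r. f (p(i := r))" D 0 "p i"] by simp
qed

lemma pd_ddir: "ddir f p (evec i) D \<Longrightarrow> pd i f p = D"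
  unfolding pd_def by (intro DERIV_imp_deriv ddir_evec)

lemma differentiable_ddir: "ddir f p (evec i) D \<Longrightarrow> (\<lambda>r. f (p(i := r))) differentiable (at (p i))"
  by (drule ddir_evec) (auto simp: real_differentiable_def)

text \<open>\<open>Euclidean_space m\<close> is a subspace of the product topology, so continuity on
  the whole sequence space restricts to it.\<close>

lemma cont_on_UNIV: "continuous_on UNIV f \<Longrightarrow> cont_on m S f"
proof -
  assume "continuous_on UNIV f"
  then have "continuous_map (powertop_real UNIV) euclideanreal f"
    by (simp add: euclidean_product_topology)
  then show ?thesis
    unfolding cont_on_def Euclidean_space_def by (intro continuous_map_from_subtopology)
qed

lemma cont_on_cong:
  assumes "cont_on m S f" "\<And>x. x \<in> S \<Longrightarrow> f x = g x"
  shows "cont_on m S g"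
  using assms(1) unfolding cont_on_def by (rule continuous_map_eq) (use assms(2) in auto)

lemma Ck_1_UNIV:
  assumes c: "continuous_on UNIV f" and d: "\<And>i p. i < N \<Longrightarrow> ddir f p (evec i) (f1 i p)"
    and c1: "\<And>i. i < N \<Longrightarrow> continuous_on UNIV (f1 i)"
  shows "Ck N 1 S f" "\<And>i. i < N \<Longrightarrow> pd i f = f1 i"
proof -
  show pd: "pd i f = f1 i" if "i < N" for i
    by (rule ext) (rule pd_ddir[OF d[OF that]])
  show "Ck N 1 S f"
    using cont_on_UNIV[OF c] cont_on_UNIV[OF c1] differentiable_ddir[OF d]
    by (auto simp: pd)
qed

text \<open>Fitted to the solution, whose first derivatives exist everywhere thanks to the
  continuation, but whose second derivatives are claimed on \<open>S\<close> only; their formulas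
  \<open>f2\<close> are nevertheless continuous everywhere.\<close>

lemma Ck_2_UNIV:
  assumes c: "continuous_on UNIV f" and d: "\<And>i p. i < N \<Longrightarrow> ddir f p (evec i) (f1 i p)"
    and c1: "\<And>i. i < N \<Longrightarrow> continuous_on UNIV (f1 i)"
    and d2: "\<And>i j p. i < N \<Longrightarrow> j < N \<Longrightarrow> p \<in> S \<Longrightarrow> ddir (f1 i) p (evec j) (f2 i j p)"
    and c2: "\<And>i j. i < N \<Longrightarrow> j < N \<Longrightarrow> continuous_on UNIV (f2 i j)"
  shows "Ck N 2 S f" "\<And>i j p. i < N \<Longrightarrow> j < N \<Longrightarrow> p \<in> S \<Longrightarrow> pd j (pd i f) p = f2 i j p"
proof -
  have pd: "pd i f = f1 i" if "i < N" for i
    by (rule Ck_1_UNIV(2)[OF c d c1 that])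
  show pd2: "pd j (pd i f) p = f2 i j p" if "i < N" "j < N" "p \<in> S" for i j p
    unfolding pd[OF that(1)] by (rule pd_ddir[OF d2[OF that]])
  have "cont_on N S (pd j (f1 i))" if "i < N" "j < N" for i j
    by (rule cont_on_cong[OF cont_on_UNIV[OF c2[OF that]]]) (use pd2 pd that in auto)
  then show "Ck N 2 S f"
    using cont_on_UNIV[OF c] cont_on_UNIV[OF c1] differentiable_ddir[OF d] differentiable_ddir[OF d2]
    by (auto simp: pd numeral_2_eq_2)
qed

lemma ddir_add: "ddir f p \<xi> D \<Longrightarrow> ddir g p \<xi> E \<Longrightarrow> ddir (\<lambda>p. f p + g p) p \<xi> (D + E)"
  unfolding ddir_def by (rule DERIV_add)

lemma ddir_mult: "ddir f p \<xi> D \<Longrightarrow> ddir g p \<xi> E \<Longrightarrow> ddir (\<lambda>p. f p * g p) p \<xi> (D * g p + E * f p)"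
  unfolding ddir_def by (drule (1) DERIV_mult) simp

lemma ddir_cmult: "ddir f p \<xi> D \<Longrightarrow> ddir (\<lambda>p. c * f p) p \<xi> (c * D)"
  unfolding ddir_def by (rule DERIV_cmult)

lemma ddir_coord: "ddir (\<lambda>p. p i) p \<xi> (\<xi> i)"
  unfolding ddir_def by (auto intro!: derivative_eq_intros)

lemma ddir_const: "ddir (\<lambda>p. c) p \<xi> 0"
  unfolding ddir_def by simp

section \<open>The solution in the original coordinates\<close>

text \<open>Equation \<open>A\<close> times \<open>s\<close>, added to the equation of
  \<open>v\<^sub>n\<close>, which enters as \<open>l * il = 1\<close>, regroups into powers of
  \<open>1 + s * ec\<close>. Each summand is expanded on its own before they are added.\<close>

lemma pde_scalar:
  fixes T M l il Y Y1 Y2 EY ec Ee v0 v1 s SS SR kc K :: real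
  assumes kc: "kc = ec + ec + s * (ec * ec)" and l: "l * il = 1"
    and K: "K = M * M * ((kc + kc + s * (kc * kc)) * (l * Y2)) - kc * EY + M * M * (kc * Y)
      - M * M * ((ec * ec + kc * kc) * v0) - T * (Ee * (Y1 + ec * v1 + s * (ec * Y1)))
      - T * (- ((2 + 2 * s * ec) * SR)) - T * T * ((- SS) * (s * Y2 - il * v0))"
    and A: "M * M * (l * Y2) - EY + M * M * Y - M * M * (ec + ec) * v0 - T * v1 * Ee + s * K = 0"
  shows "l * (M * M) * ((1 + s * ec) ^ 2) ^ 2 * (s * Y2 - il * v0) + (1 + s * ec) ^ 2 * (- s * EY)
     + 2 * T * (1 + s * ec) * (s ^ 2 * SR) + T * (1 + s * ec) * (- s * Ee) * (v1 + s * Y1)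
     + T ^ 2 * (s ^ 2 * SS) * (s * Y2 - il * v0) + M * M * (1 + s * ec) ^ 2 * (v0 + s * Y) = 0" (is "?L = 0")
proof -
  have q: "(1 + s * ec) ^ 2 = 1 + s * kc"
    unfolding kc by (simp add: algebra_simps power2_eq_square)
  have e1: "l * (M * M) * (1 + s * kc) ^ 2 * (s * Y2 - il * v0) = s * (M * M * (l * Y2))
      + s * (s * (M * M * ((kc + kc + s * (kc * kc)) * (l * Y2)))) - (l * il) * (M * M * ((1 + s * kc) ^ 2 * v0))"
    by (simp add: algebra_simps power2_eq_square)
  have e2: "(1 + s * kc) * (- s * EY) = s * (- EY) + s * (s * (- (kc * EY)))"
    by (simp add: algebra_simps)
  have e3: "M * M * (1 + s * kc) * (v0 + s * Y) = M * M * ((1 + s * kc) * v0) + s * (M * M * Y) + s * (s * (M * M * (kc * Y)))"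
    by (simp add: algebra_simps)
  have skc: "s * kc = s * (ec + ec) + s * (s * (ec * ec))" unfolding kc by (simp add: algebra_simps)
  have "(1 + s * kc) - (1 + s * kc) ^ 2 = - (s * kc) - s * (s * (kc * kc))"
    by (simp add: algebra_simps power2_eq_square)
  then have "(1 + s * kc) - (1 + s * kc) ^ 2 = - (s * (ec + ec)) - s * (s * (ec * ec)) - s * (s * (kc * kc))"
    using skc by linarith
  then have "M * M * (((1 + s * kc) - (1 + s * kc) ^ 2) * v0) = M * M * ((- (s * (ec + ec)) - s * (s * (ec * ec)) - s * (s * (kc * kc))) * v0)"
    by (simp only:)
  then have e4: "M * M * ((1 + s * kc) * v0) = M * M * ((1 + s * kc) ^ 2 * v0)
      + s * (- (M * M * (ec + ec) * v0)) + s * (s * (- (M * M * ((ec * ec + kc * kc) * v0))))"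
    by (simp add: algebra_simps)
  have e5: "T * (1 + s * ec) * (- s * Ee) * (v1 + s * Y1) = s * (- (T * v1 * Ee)) + s * (s * (- (T * (Ee * (Y1 + ec * v1 + s * (ec * Y1))))))"
    by (simp add: algebra_simps)
  have e6: "2 * T * (1 + s * ec) * (s ^ 2 * SR) = s * (s * (T * ((2 + 2 * s * ec) * SR)))"
    by (simp add: algebra_simps power2_eq_square)
  have e7: "T ^ 2 * (s ^ 2 * SS) * (s * Y2 - il * v0) = s * (s * (T * T * (SS * (s * Y2 - il * v0))))"
    by (simp add: algebra_simps power2_eq_square)
  have sA: "s * (M * M * (l * Y2)) + s * (- EY) + s * (M * M * Y) + s * (- (M * M * (ec + ec) * v0)) + s * (- (T * v1 * Ee)) + s * (s * K) = 0"
    unfolding distrib_left[symmetric] using A by simp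
  have sK: "s * (s * K) = s * (s * (M * M * ((kc + kc + s * (kc * kc)) * (l * Y2)))) + s * (s * (- (kc * EY)))
      + s * (s * (M * M * (kc * Y))) + s * (s * (- (M * M * ((ec * ec + kc * kc) * v0))))
      + s * (s * (- (T * (Ee * (Y1 + ec * v1 + s * (ec * Y1)))))) + s * (s * (T * ((2 + 2 * s * ec) * SR)))
      + s * (s * (T * T * (SS * (s * Y2 - il * v0))))"
    unfolding distrib_left[symmetric] K by simp
  \<comment> \<open>What remains is linear in the summands; naming them keeps the polynomial
    expansion away.\<close>
  have lin: "x1 + x2 + x6 + x5 + x7 + x3 = 0"
    if "x1 = a + b1 - c" "x2 = d + b2" "x3 = c' + f + b3" "c' = c + g + b4" "x5 = h + b5" "x6 = b6" "x7 = b7"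
      "a + d + f + g + h + k = 0" "k = b1 + b2 + b3 + b4 + b5 + b6 + b7"
    for x1 x2 x3 x5 x6 x7 a b1 c d b2 c' f b3 g b4 h b5 b6 b7 k :: real
    unfolding that(1-3,5-7) using that(8) unfolding that(4,9) by (simp add: algebra_simps)
  show ?thesis
    unfolding q by (rule lin[OF e1[unfolded l mult_1] e2 e3 e4 e5 e6 e7 sA sK])
qed

definition tail :: "(nat \<Rightarrow> real) \<Rightarrow> nat \<Rightarrow> real" where
  "tail p = (\<lambda>i. p (Suc i))"

lemma tail_line: "tail (\<lambda>i. p i + r * \<xi> i) = (\<lambda>i. tail p i + r * tail \<xi> i)"
  by (simp add: tail_def)

lemma continuous_on_tail [continuous_intros]: "continuous_on S f \<Longrightarrow> continuous_on S (\<lambda>y. tail (f y))"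
  unfolding tail_def
  by (rule continuous_on_coordinatewise_then_product) (erule continuous_on_product_then_coordinatewise)

lemma ddir_comp:
  assumes a: "((\<lambda>t. \<Phi> t (tail p)) has_real_derivative \<Phi>t) (at (\<alpha> p))"
    and line: "\<And>t x r. ((\<lambda>r. \<Phi> t (\<lambda>i. x i + r * tail \<xi> i)) has_real_derivative \<Phi>x t (\<lambda>i. x i + r * tail \<xi> i)) (at r)"
    and c: "continuous_on UNIV (\<lambda>(t, x). \<Phi>x t x)"
    and \<alpha>: "ddir \<alpha> p \<xi> \<alpha>'"
  shows "ddir (\<lambda>p. \<Phi> (\<alpha> p) (tail p)) p \<xi> (\<Phi>t * \<alpha>' + \<Phi>x (\<alpha> p) (tail p))"
proof -
  have "continuous_on UNIV (\<lambda>(t, r). \<Phi>x t (\<lambda>i. tail p i + r * tail \<xi> i))"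
  proof -
    have "continuous_on UNIV (\<lambda>q::real \<times> real. (fst q, \<lambda>i. tail p i + snd q * tail \<xi> i))"
      by (intro continuous_intros)
    from continuous_on_compose2[OF c this] show ?thesis by (simp add: case_prod_unfold)
  qed
  then have "((\<lambda>r. \<Phi> (\<alpha> (\<lambda>i. p i + r * \<xi> i)) (\<lambda>i. tail p i + r * tail \<xi> i)) has_real_derivative
      (\<Phi>t * \<alpha>' + \<Phi>x (\<alpha> (\<lambda>i. p i + 0 * \<xi> i)) (\<lambda>i. tail p i + 0 * tail \<xi> i) * 1)) (at 0)"
    by (intro chain_two_variables[where \<beta> = "\<lambda>r. r" and \<alpha> = "\<lambda>r. \<alpha> (\<lambda>i. p i + r * \<xi> i)"])
      (use a line \<alpha> in \<open>auto simp: ddir_def intro!: derivative_eq_intros\<close>)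
  then show ?thesis by (simp add: ddir_def tail_line)
qed

declare continuous_on_coordinatewise_then_product [continuous_intros del]

lemma continuous_on_ser_eval_comp:
  assumes "\<And>r. \<bar>g r\<bar> \<le> 1" "continuous_on UNIV g" "conv_at m p s F" "continuous_on S f" "continuous_on S y"
  shows "continuous_on S (\<lambda>q. ser_eval g m F s (f q) (y q))"
proof -
  have "continuous_on S (\<lambda>q. (f q, y q))" using assms by (intro continuous_on_Pair)
  from continuous_on_compose2[OF continuous_on_ser_eval[OF assms(1-3)] this] show ?thesis by simp
qed

lemma continuous_on_clamp1_comp [continuous_intros]: "continuous_on S f \<Longrightarrow> continuous_on S (\<lambda>q. clamp1 (f q))"
  unfolding clamp1_def by (intro continuous_intros)

text \<open>Continues \<open>F\<close>, with \<open>t\<close>-derivative \<open>G\<close>, linearly in \<open>t\<close> beyond \<open>[-1, 1]\<close>. This makes the solution \<open>C\<^sup>1\<close> on the whole space,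
  so that nothing special happens at the boundary of the domain.\<close>

definition eX :: "(real \<Rightarrow> real) \<Rightarrow> nat \<Rightarrow> tser \<Rightarrow> tser \<Rightarrow> real \<Rightarrow> real \<Rightarrow> (nat \<Rightarrow> real) \<Rightarrow> real" where
  "eX g m F G s t x = ser_eval g m F s (clamp1 t) x + (t - clamp1 t) * ser_eval g m G s (clamp1 t) x"

lemma continuous_on_eX_comp:
  assumes "\<And>r. \<bar>g r\<bar> \<le> 1" "continuous_on UNIV g" "conv_at m p s F" "conv_at m q s G" "continuous_on S f" "continuous_on S y"
  shows "continuous_on S (\<lambda>q. eX g m F G s (f q) (y q))"
  unfolding eX_def using assms
  by (intro continuous_intros continuous_on_ser_eval_comp[OF assms(1,2,3)] continuous_on_ser_eval_comp[OF assms(1,2,4)]) auto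

lemma eX_deriv_t:
  assumes "\<And>r. \<bar>g r\<bar> \<le> 1" "conv_at m 0 s F" "conv_at m 0 s G" "t_deriv F G"
  shows "((\<lambda>t. eX g m F G s t x) has_real_derivative ser_eval g m G s (clamp1 t) x) (at t)"
  unfolding eX_def by (rule clamp_extension_deriv) (rule ser_eval_deriv_t[OF assms])

lemma eX_deriv_line:
  assumes "conv_at m 1 s F" "conv_at m 1 s G"
  shows "((\<lambda>r. eX cos m F G s t (\<lambda>i. x i + r * \<xi> i)) has_real_derivative
      - (\<Sum>i<m. \<xi> i * eX sin m (fmap (Dop i) F) (fmap (Dop i) G) s t (\<lambda>i. x i + r * \<xi> i))) (at r)" (is ?A)
    and "((\<lambda>r. eX sin m F G s t (\<lambda>i. x i + r * \<xi> i)) has_real_derivative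
      (\<Sum>i<m. \<xi> i * eX cos m (fmap (Dop i) F) (fmap (Dop i) G) s t (\<lambda>i. x i + r * \<xi> i))) (at r)" (is ?B)
proof -
  have *: "(\<Sum>i<m. \<xi> i * eX g m (fmap (Dop i) F) (fmap (Dop i) G) s t y)
    = (\<Sum>i<m. \<xi> i * ser_eval g m (fmap (Dop i) F) s (clamp1 t) y) + (t - clamp1 t) * (\<Sum>i<m. \<xi> i * ser_eval g m (fmap (Dop i) G) s (clamp1 t) y)" for g y
    by (simp add: eX_def distrib_left sum.distrib sum_distrib_left mult_ac)
  show ?A
    unfolding * unfolding eX_def
    by (rule DERIV_cong[OF DERIV_add[OF cos_ser_deriv_line[OF assms(1)] DERIV_cmult[OF cos_ser_deriv_line[OF assms(2)]]]]) simp
  show ?B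
    unfolding * unfolding eX_def
    by (rule DERIV_cong[OF DERIV_add[OF sin_ser_deriv_line[OF assms(1)] DERIV_cmult[OF sin_ser_deriv_line[OF assms(2)]]]]) simp
qed

lemma at_interior_deriv:
  assumes "(f has_real_derivative D) (at t within {-1..1})" "\<bar>t\<bar> < 1"
  shows "((\<lambda>t. f (clamp1 t)) has_real_derivative D) (at t)"
proof -
  have "(f has_real_derivative D) (at t within {-1<..<1})" by (rule DERIV_subset[OF assms(1)]) auto
  then have "(f has_real_derivative D) (at t)" using assms(2) by (simp add: at_within_open[of t "{-1<..<1}"] abs_less_iff)
  then show ?thesis
    by (rule has_field_derivative_transform_within_open[where S = "{-1<..<1}"]) (use assms(2) in \<open>auto simp: clamp1_id\<close>)
qed

lemma t_deriv_D: "t_deriv F G \<Longrightarrow> t_deriv (fmap (Dop i) F) (fmap (Dop i) G)"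
  unfolding t_deriv_def by (auto intro!: DERIV_cmult)

lemma trig_eval_const_t:
  assumes "\<And>k. \<exists>r. cf f k = of_real r"
  shows "trig_eval g m f t x = trig_eval g m f 0 x"
proof -
  have "apply_bcontfun (cf f k) t = apply_bcontfun (cf f k) 0" for k
    using assms[of k] by auto
  then show ?thesis by (simp add: trig_eval_def)
qed

lemma ser_eval_const_t:
  assumes "\<And>j k. \<exists>r. cf (F $ j) k = of_real r"
  shows "ser_eval g m F s t x = ser_eval g m F s 0 x"
  unfolding ser_eval_def by (subst trig_eval_const_t[OF assms]) simp

lemma const_D: "(\<And>j k. \<exists>r. cf (F $ j) k = of_real r) \<Longrightarrow> \<exists>r. cf (fmap (Dop i) F $ j) k = of_real r"
  by (simp add: of_real_def) (metis scaleR_scaleR)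

section \<open>Derivatives of the straightened and of the original solution\<close>

text \<open>Everything at one fixed \<open>s\<close> where the series converge absolutely;
  \<open>eqA\<close> and \<open>eqB\<close> are the equations divided by \<open>s\<close>.
  Positivity of the profile and of \<open>M\<close> is added in \<open>sol_pos\<close>.\<close>

locale sol_at =
  fixes n m :: nat and H :: "comp \<Rightarrow> tser" and s :: real
  assumes n: "n \<ge> 1" and m: "m \<ge> 1"
    and eqA: "H Mu * H Mu * (rc (lam n) * H CY2) - fmap (Eop m) (H CY) + H Mu * H Mu * H CY
       - H Mu * H Mu * (H Eta + H Eta) * cst (Tv n) - cst Tid * cst (Tv1 n) * fmap (Eop m) (H Eta)
       + fps_X * Kop n m H = 0"
    and eqB: "fmap aop (rc (lam n) * (H Mu * H Mu) * ((H CY1 + H Eta) + (H CY1 + H Eta)) + fps_X * Kbop n m H) = 0"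
    and eqC: "fmap aop (H CY) = 0"
    and psymH: "\<And>c j. psym m (cpar c) (H c $ j)"
    and smH: "\<And>c. conv_at m (cord c) s (H c)"
    and Tsp1: "t_deriv (H CY) (H CY1)" and Tsp2: "t_deriv (H CY1) (H CY2)"
    and Mu_const: "\<And>j. \<exists>r. H Mu $ j = sng 0 (of_real r)"
    and Eta_const: "\<And>j k. \<exists>r. cf (H Eta $ j) k = of_real r"
begin

lemma fevH [simp]: "par_ser 1 (H c)"
  using psymH psym_par_poly unfolding par_ser_def by blast

lemma smY: "p \<le> 3 \<Longrightarrow> conv_at m p s (H CY)" and smY1: "p \<le> 2 \<Longrightarrow> conv_at m p s (H CY1)"
  and smY2: "p \<le> 1 \<Longrightarrow> conv_at m p s (H CY2)" and smE: "p \<le> 3 \<Longrightarrow> conv_at m p s (H Eta)" and smM: "p \<le> 3 \<Longrightarrow> conv_at m p s (H Mu)"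
  using conv_at_le[OF smH[of CY]] conv_at_le[OF smH[of CY1]] conv_at_le[OF smH[of CY2]] conv_at_le[OF smH[of Eta]] conv_at_le[OF smH[of Mu]]
  by simp_all

definition Ms :: real where "Ms = cos_ser m (H Mu) s 0 (\<lambda>_. 0)"

lemma cos_ser_Mu [simp]: "cos_ser m (H Mu) s t x = Ms"
proof -
  have "cos_poly m (H Mu $ j) t x = cos_poly m (H Mu $ j) 0 (\<lambda>_. 0)" for j
    using Mu_const[of j] by (auto simp: trig_eval_sng)
  then show ?thesis unfolding Ms_def ser_eval_def by simp
qed

definition ec :: "(nat \<Rightarrow> real) \<Rightarrow> real" where "ec x = cos_ser m (H Eta) s 0 x"
definition eD :: "nat \<Rightarrow> (nat \<Rightarrow> real) \<Rightarrow> real" where "eD i x = - sin_ser m (fmap (Dop i) (H Eta)) s 0 x"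
definition eDD :: "nat \<Rightarrow> nat \<Rightarrow> (nat \<Rightarrow> real) \<Rightarrow> real" where
  "eDD i l x = - cos_ser m (fmap (Dop l) (fmap (Dop i) (H Eta))) s 0 x"

text \<open>This constant has two roles: it is the scale of the profile, and it equals the
  prescribed normal derivative \<open>1 / sqrt (\<gamma> s)\<close>.\<close>

definition hc :: real where "hc = sqrt (lam n) * Ms"
definition hh :: "(nat \<Rightarrow> real) \<Rightarrow> real" where "hh x = hc * (1 + s * ec x)"
definition hD :: "nat \<Rightarrow> (nat \<Rightarrow> real) \<Rightarrow> real" where "hD i x = hc * (s * eD i x)"
definition hDD :: "nat \<Rightarrow> nat \<Rightarrow> (nat \<Rightarrow> real) \<Rightarrow> real" where "hDD i l x = hc * (s * eDD i l x)"

definition v1 :: "real \<Rightarrow> real" where "v1 t = (-1) ^ n * cos (real n * pi * t)"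

definition W :: "real \<Rightarrow> (nat \<Rightarrow> real) \<Rightarrow> real" where "W t x = v n t + s * eX cos m (H CY) (H CY1) s t x"
definition Wt :: "real \<Rightarrow> (nat \<Rightarrow> real) \<Rightarrow> real" where "Wt t x = v1 t + s * cos_ser m (H CY1) s (clamp1 t) x"
definition Wtt :: "real \<Rightarrow> (nat \<Rightarrow> real) \<Rightarrow> real" where "Wtt t x = - v n t / lam n + s * cos_ser m (H CY2) s (clamp1 t) x"
definition Wx :: "nat \<Rightarrow> real \<Rightarrow> (nat \<Rightarrow> real) \<Rightarrow> real" where
  "Wx i t x = - s * eX sin m (fmap (Dop i) (H CY)) (fmap (Dop i) (H CY1)) s t x"
definition Wtx :: "nat \<Rightarrow> real \<Rightarrow> (nat \<Rightarrow> real) \<Rightarrow> real" where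
  "Wtx i t x = - s * sin_ser m (fmap (Dop i) (H CY1)) s (clamp1 t) x"
definition Wxx :: "nat \<Rightarrow> nat \<Rightarrow> real \<Rightarrow> (nat \<Rightarrow> real) \<Rightarrow> real" where
  "Wxx i l t x = - s * eX cos m (fmap (Dop l) (fmap (Dop i) (H CY))) (fmap (Dop l) (fmap (Dop i) (H CY1))) s t x"

lemma v_deriv: "(v n has_real_derivative v1 t) (at t)" and v1_deriv: "(v1 has_real_derivative - v n t / lam n) (at t)"
  unfolding v_def [abs_def] v1_def [abs_def] lam_def using n
  by (auto intro!: derivative_eq_intros simp: power2_eq_square field_simps)

lemma v_cont [continuous_intros]: "continuous_on S f \<Longrightarrow> continuous_on S (\<lambda>q. v n (f q))"
  and v1_cont [continuous_intros]: "continuous_on S f \<Longrightarrow> continuous_on S (\<lambda>q. v1 (f q))"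
proof -
  have "continuous_on UNIV (v n)" "continuous_on UNIV v1"
    by (rule DERIV_continuous_on, rule v_deriv) (rule DERIV_continuous_on, rule v1_deriv)
  then show "continuous_on S f \<Longrightarrow> continuous_on S (\<lambda>q. v n (f q))" "continuous_on S f \<Longrightarrow> continuous_on S (\<lambda>q. v1 (f q))"
    by (auto intro: continuous_on_compose2)
qed

lemma smD:
  "i < m \<Longrightarrow> p \<le> 2 \<Longrightarrow> conv_at m p s (fmap (Dop i) (H CY))" "i < m \<Longrightarrow> p \<le> 1 \<Longrightarrow> conv_at m p s (fmap (Dop i) (H CY1))"
  "i < m \<Longrightarrow> p \<le> 2 \<Longrightarrow> conv_at m p s (fmap (Dop i) (H Eta))"
  "i < m \<Longrightarrow> l < m \<Longrightarrow> p \<le> 1 \<Longrightarrow> conv_at m p s (fmap (Dop l) (fmap (Dop i) (H CY)))"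
  "i < m \<Longrightarrow> l < m \<Longrightarrow> conv_at m 0 s (fmap (Dop l) (fmap (Dop i) (H CY1)))"
  "i < m \<Longrightarrow> l < m \<Longrightarrow> p \<le> 1 \<Longrightarrow> conv_at m p s (fmap (Dop l) (fmap (Dop i) (H Eta)))"
  by (auto intro!: conv_at_D smY smY1 smE)

lemma W_deriv_t: "((\<lambda>t. W t x) has_real_derivative Wt t x) (at t)"
  unfolding W_def Wt_def
  by (intro DERIV_add DERIV_cmult v_deriv eX_deriv_t cs_le_1 smY smY1 Tsp1) auto

lemma Wt_deriv_t: "\<bar>t\<bar> < 1 \<Longrightarrow> ((\<lambda>t. Wt t x) has_real_derivative Wtt t x) (at t)"
proof -
  assume t: "\<bar>t\<bar> < 1"
  then have t': "t \<in> {-1..1}" by auto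
  show ?thesis
    unfolding Wt_def Wtt_def clamp1_id[OF t']
    by (intro DERIV_add DERIV_cmult v1_deriv at_interior_deriv t ser_eval_deriv_t cs_le_1 smY1 smY2 Tsp2 t') auto
qed

lemma Wx_deriv_t: "i < m \<Longrightarrow> ((\<lambda>t. Wx i t x) has_real_derivative Wtx i t x) (at t)"
  unfolding Wx_def Wtx_def
  by (intro DERIV_cmult eX_deriv_t cs_le_1 smD t_deriv_D Tsp1) auto

lemma W_deriv_line:
  "((\<lambda>r. W t (\<lambda>i. x i + r * \<xi> i)) has_real_derivative (\<Sum>i<m. \<xi> i * Wx i t (\<lambda>i. x i + r * \<xi> i))) (at r)"
  unfolding W_def Wx_def
  by (rule DERIV_cong[OF DERIV_add[OF DERIV_const DERIV_cmult[OF eX_deriv_line(1)]]])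
    (auto simp: smY smY1 sum_distrib_left mult_ac sum_negf)

lemma Wt_deriv_line:
  "((\<lambda>r. Wt t (\<lambda>i. x i + r * \<xi> i)) has_real_derivative (\<Sum>i<m. \<xi> i * Wtx i t (\<lambda>i. x i + r * \<xi> i))) (at r)"
  unfolding Wt_def Wtx_def
  by (rule DERIV_cong[OF DERIV_add[OF DERIV_const DERIV_cmult[OF cos_ser_deriv_line]]])
    (auto simp: smY1 sum_distrib_left mult_ac sum_negf)

lemma Wx_deriv_line:
  "i < m \<Longrightarrow> ((\<lambda>r. Wx i t (\<lambda>i. x i + r * \<xi> i)) has_real_derivative (\<Sum>l<m. \<xi> l * Wxx i l t (\<lambda>i. x i + r * \<xi> i))) (at r)"
  unfolding Wx_def Wxx_def
  by (rule DERIV_cong[OF DERIV_cmult[OF eX_deriv_line(2)]])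
    (auto simp: smD sum_distrib_left mult_ac sum_negf)

lemma W_conts:
  assumes "continuous_on S f" "continuous_on S y"
  shows "continuous_on S (\<lambda>q. W (f q) (y q))" "continuous_on S (\<lambda>q. Wt (f q) (y q))"
    "continuous_on S (\<lambda>q. Wtt (f q) (y q))"
    "i < m \<Longrightarrow> continuous_on S (\<lambda>q. Wx i (f q) (y q))" "i < m \<Longrightarrow> continuous_on S (\<lambda>q. Wtx i (f q) (y q))"
    "i < m \<Longrightarrow> l < m \<Longrightarrow> continuous_on S (\<lambda>q. Wxx i l (f q) (y q))"
proof -
  have cc: "continuous_on UNIV (cos :: real \<Rightarrow> real)" "continuous_on UNIV (sin :: real \<Rightarrow> real)"
    by (intro continuous_intros)+
  show "continuous_on S (\<lambda>q. W (f q) (y q))" "continuous_on S (\<lambda>q. Wt (f q) (y q))"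
    "continuous_on S (\<lambda>q. Wtt (f q) (y q))"
    "i < m \<Longrightarrow> continuous_on S (\<lambda>q. Wx i (f q) (y q))" "i < m \<Longrightarrow> continuous_on S (\<lambda>q. Wtx i (f q) (y q))"
    "i < m \<Longrightarrow> l < m \<Longrightarrow> continuous_on S (\<lambda>q. Wxx i l (f q) (y q))"
    unfolding W_def Wt_def Wtt_def Wx_def Wtx_def Wxx_def using assms lam_pos[OF n]
    by (auto intro!: continuous_intros continuous_on_eX_comp[where p = 0 and q = 0] continuous_on_ser_eval_comp[where p = 0]
        smY smY1 smY2 smD cc)
qed

lemma ec_cont: "continuous_on S y \<Longrightarrow> continuous_on S (\<lambda>q. ec (y q))"
  and eD_cont: "continuous_on S y \<Longrightarrow> i < m \<Longrightarrow> continuous_on S (\<lambda>q. eD i (y q))"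
  and eDD_cont: "continuous_on S y \<Longrightarrow> i < m \<Longrightarrow> l < m \<Longrightarrow> continuous_on S (\<lambda>q. eDD i l (y q))"
proof -
  have cc: "continuous_on UNIV (cos :: real \<Rightarrow> real)" "continuous_on UNIV (sin :: real \<Rightarrow> real)"
    by (intro continuous_intros)+
  show "continuous_on S y \<Longrightarrow> continuous_on S (\<lambda>q. ec (y q))"
    "continuous_on S y \<Longrightarrow> i < m \<Longrightarrow> continuous_on S (\<lambda>q. eD i (y q))"
    "continuous_on S y \<Longrightarrow> i < m \<Longrightarrow> l < m \<Longrightarrow> continuous_on S (\<lambda>q. eDD i l (y q))"
    unfolding ec_def eD_def eDD_def
    by (auto intro!: continuous_intros continuous_on_ser_eval_comp[where p = 0] smE smD cc)
qed

lemma h_conts: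
  assumes "continuous_on S y"
  shows "continuous_on S (\<lambda>q. hh (y q))" "i < m \<Longrightarrow> continuous_on S (\<lambda>q. hD i (y q))"
    "i < m \<Longrightarrow> l < m \<Longrightarrow> continuous_on S (\<lambda>q. hDD i l (y q))"
  unfolding hh_def hD_def hDD_def using assms by (auto intro!: continuous_intros ec_cont eD_cont eDD_cont)

lemma hh_line: "((\<lambda>r. hh (\<lambda>i. x i + r * \<xi> i)) has_real_derivative (\<Sum>i<m. \<xi> i * hD i (\<lambda>i. x i + r * \<xi> i))) (at r)"
  unfolding hh_def hD_def ec_def eD_def
  by (rule DERIV_cong[OF DERIV_cmult[OF DERIV_add[OF DERIV_const DERIV_cmult[OF cos_ser_deriv_line]]]])
    (auto simp: smE sum_distrib_left mult_ac sum_negf)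

lemma hD_line: "i < m \<Longrightarrow> ((\<lambda>r. hD i (\<lambda>i. x i + r * \<xi> i)) has_real_derivative (\<Sum>l<m. \<xi> l * hDD i l (\<lambda>i. x i + r * \<xi> i))) (at r)"
  unfolding hD_def hDD_def eD_def eDD_def
  by (rule DERIV_cong[OF DERIV_cmult[OF DERIV_cmult[OF DERIV_minus[OF sin_ser_deriv_line]]]])
    (auto simp: smD sum_distrib_left mult_ac sum_negf)

lemma ddir_hh: "ddir hh x \<xi> (\<Sum>i<m. \<xi> i * hD i x)"
  unfolding ddir_def using hh_line[of x \<xi> 0] by simp

lemma ddir_hD: "i < m \<Longrightarrow> ddir (hD i) x \<xi> (\<Sum>l<m. \<xi> l * hDD i l x)"
  unfolding ddir_def using hD_line[of i x \<xi> 0] by simp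

lemma ddir_tail: "ddir f (tail p) (tail \<xi>) D \<Longrightarrow> ddir (\<lambda>p. f (tail p)) p \<xi> D"
  unfolding ddir_def tail_line .

text \<open>\<open>TT\<close> is the straightened first coordinate, and \<open>TD \<xi>\<close> its derivative in the direction \<open>\<xi>\<close>.\<close>

definition TT :: "(nat \<Rightarrow> real) \<Rightarrow> real" where "TT p = p 0 * hh (tail p)"
definition TD :: "(nat \<Rightarrow> real) \<Rightarrow> (nat \<Rightarrow> real) \<Rightarrow> real" where
  "TD \<xi> p = \<xi> 0 * hh (tail p) + (\<Sum>i<m. \<xi> (Suc i) * hD i (tail p)) * p 0"

lemma ddir_TT: "ddir TT p \<xi> (TD \<xi> p)"
  unfolding TT_def [abs_def] TD_def
  using ddir_mult[OF ddir_coord[of 0 p \<xi>] ddir_tail[OF ddir_hh[of "tail p" "tail \<xi>"]]] by (simp add: tail_def)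

lemma coord_cont [continuous_intros]: "continuous_on S (\<lambda>p::nat \<Rightarrow> real. p i)"
  by (rule continuous_on_product_then_coordinatewise[OF continuous_on_id])

lemma TT_cont: "continuous_on S TT"
  unfolding TT_def [abs_def]
  by (intro continuous_intros h_conts continuous_on_id)

definition w :: "(nat \<Rightarrow> real) \<Rightarrow> real" where "w p = W (TT p) (tail p)"

definition wD :: "nat \<Rightarrow> (nat \<Rightarrow> real) \<Rightarrow> real" where
  "wD j p = (case j of 0 \<Rightarrow> hh (tail p) * Wt (TT p) (tail p)
     | Suc i \<Rightarrow> Wx i (TT p) (tail p) + p 0 * hD i (tail p) * Wt (TT p) (tail p))"

lemma ddir_w: "ddir w p \<xi> (Wt (TT p) (tail p) * TD \<xi> p + (\<Sum>i<m. \<xi> (Suc i) * Wx i (TT p) (tail p)))"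
proof -
  have "continuous_on UNIV (\<lambda>(t, x). \<Sum>i<m. tail \<xi> i * Wx i t x)"
    unfolding case_prod_unfold by (intro continuous_intros W_conts) auto
  from ddir_comp[OF W_deriv_t W_deriv_line this ddir_TT] show ?thesis
    unfolding w_def [abs_def] by (simp add: tail_def)
qed

lemma sum_evec_0: "(\<Sum>i<m. evec 0 (Suc i) * f i) = 0" and sum_evec_Suc: "l < m \<Longrightarrow> (\<Sum>i<m. evec (Suc l) (Suc i) * f i) = f l"
  by (simp_all add: evec_def if_distrib[of "\<lambda>x. x * _"] cong: if_cong)

lemma ddir_w_evec: "j < Suc m \<Longrightarrow> ddir w p (evec j) (wD j p)"
  using ddir_w[of p "evec j"]
  by (cases j) (simp_all add: TD_def sum_evec_0 sum_evec_Suc wD_def, simp_all add: evec_def mult_ac add_ac)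

definition wDD :: "nat \<Rightarrow> nat \<Rightarrow> (nat \<Rightarrow> real) \<Rightarrow> real" where
  "wDD j k p = (let \<xi> = evec k; t = TT p; x = tail p;
      Wt' = Wtt t x * TD \<xi> p + (\<Sum>i<m. \<xi> (Suc i) * Wtx i t x);
      h' = (\<lambda>i. \<Sum>l<m. \<xi> (Suc l) * hDD i l x) in
    case j of 0 \<Rightarrow> (\<Sum>i<m. \<xi> (Suc i) * hD i x) * Wt t x + Wt' * hh x
     | Suc i \<Rightarrow> (Wtx i t x * TD \<xi> p + (\<Sum>l<m. \<xi> (Suc l) * Wxx i l t x))
         + ((\<xi> 0 * hD i x + h' i * p 0) * Wt t x + Wt' * (p 0 * hD i x)))"

lemma ddir_wD:
  assumes p: "\<bar>TT p\<bar> < 1" and j: "j < Suc m" and k: "k < Suc m"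
  shows "ddir (wD j) p (evec k) (wDD j k p)"
proof -
  let ?\<xi> = "evec k"
  have c: "continuous_on UNIV (\<lambda>(t, x). \<Sum>i<m. tail ?\<xi> i * Wtx i t x)"
    unfolding case_prod_unfold by (intro continuous_intros W_conts) auto
  have Wt: "ddir (\<lambda>p. Wt (TT p) (tail p)) p ?\<xi> (Wtt (TT p) (tail p) * TD ?\<xi> p + (\<Sum>i<m. ?\<xi> (Suc i) * Wtx i (TT p) (tail p)))"
    using ddir_comp[OF Wt_deriv_t[OF p] Wt_deriv_line c ddir_TT] by (simp add: tail_def)
  have h: "ddir (\<lambda>p. hh (tail p)) p ?\<xi> (\<Sum>i<m. ?\<xi> (Suc i) * hD i (tail p))"
    using ddir_tail[OF ddir_hh[of "tail p" "tail ?\<xi>"]] by (simp add: tail_def)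
  show ?thesis
  proof (cases j)
    case 0
    then show ?thesis unfolding wD_def wDD_def Let_def using ddir_mult[OF h Wt] by simp
  next
    case (Suc i)
    then have i: "i < m" using j by simp
    have hD: "ddir (\<lambda>p. hD i (tail p)) p ?\<xi> (\<Sum>l<m. ?\<xi> (Suc l) * hDD i l (tail p))"
      using ddir_tail[OF ddir_hD[OF i, of "tail p" "tail ?\<xi>"]] by (simp add: tail_def)
    have c: "continuous_on UNIV (\<lambda>(t, x). \<Sum>l<m. tail ?\<xi> l * Wxx i l t x)"
      unfolding case_prod_unfold using i by (intro continuous_intros W_conts) auto
    have Wx: "ddir (\<lambda>p. Wx i (TT p) (tail p)) p ?\<xi> (Wtx i (TT p) (tail p) * TD ?\<xi> p + (\<Sum>l<m. ?\<xi> (Suc l) * Wxx i l (TT p) (tail p)))"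
      using ddir_comp[OF Wx_deriv_t[OF i] Wx_deriv_line[OF i] c ddir_TT] by (simp add: tail_def)
    show ?thesis
      unfolding wD_def wDD_def Let_def
      using ddir_add[OF Wx ddir_mult[OF ddir_mult[OF ddir_coord[of 0] hD] Wt]] Suc by simp
  qed
qed

lemma TD_cont: "continuous_on S (TD \<xi>)"
  unfolding TD_def [abs_def] by (intro continuous_intros h_conts continuous_on_id) auto

lemma w_conts:
  shows "continuous_on S w" "j < Suc m \<Longrightarrow> continuous_on S (wD j)"
    "j < Suc m \<Longrightarrow> k < Suc m \<Longrightarrow> continuous_on S (wDD j k)"
proof -
  show "continuous_on S w" unfolding w_def [abs_def]
    by (intro W_conts TT_cont continuous_intros continuous_on_id)
  show "j < Suc m \<Longrightarrow> continuous_on S (wD j)"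
    unfolding wD_def [abs_def]
    by (cases j) (auto intro!: continuous_intros W_conts h_conts TT_cont continuous_on_id)
  show "j < Suc m \<Longrightarrow> k < Suc m \<Longrightarrow> continuous_on S (wDD j k)"
    unfolding wDD_def [abs_def] Let_def
    by (cases j) (auto intro!: continuous_intros W_conts h_conts TT_cont TD_cont continuous_on_id)
qed

lemma w_Ck:
  assumes S: "\<And>p. p \<in> S \<Longrightarrow> \<bar>TT p\<bar> < 1"
  shows "Ck (Suc m) 2 S w" "Ck (Suc m) 1 S w" "\<And>j. j < Suc m \<Longrightarrow> pd j w = wD j"
    "\<And>j k p. j < Suc m \<Longrightarrow> k < Suc m \<Longrightarrow> p \<in> S \<Longrightarrow> pd k (pd j w) p = wDD j k p"
  using Ck_2_UNIV[where f = w and N = "Suc m" and S = S, OF w_conts(1) ddir_w_evec w_conts(2) ddir_wD w_conts(3)]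
    Ck_1_UNIV(1)[where f = w and N = "Suc m" and S = S, OF w_conts(1) ddir_w_evec w_conts(2)]
    Ck_1_UNIV(2)[where f = w and N = "Suc m", OF w_conts(1) ddir_w_evec w_conts(2)] S by auto

lemma w_C1_closure:
  assumes S: "\<And>p. p \<in> S \<Longrightarrow> \<bar>TT p\<bar> < 1"
  shows "C1_closure (Suc m) S w"
  unfolding C1_closure_def using w_Ck(2)[OF S] w_Ck(3)[OF S]
  by (auto intro!: cont_on_UNIV w_conts exI[of _ "wD _"])

end

section \<open>Parity of products and multiplicativity of the evaluation\<close>

lemma par_poly_times:
  assumes f: "par_poly \<sigma> f" and g: "par_poly \<tau> g" and \<sigma>: "\<sigma> \<noteq> 0" and \<tau>: "\<tau> \<noteq> 0"
  shows "par_poly (\<sigma> * \<tau>) (f * g)"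
proof -
  have img: "uminus ` supp h = supp h" if h: "par_poly \<rho> h" "\<rho> \<noteq> 0" for \<rho> h
  proof -
    have "uminus ` supp h \<subseteq> supp h" using h by (auto simp: par_poly_def in_keys_iff)
    moreover from this have "uminus ` uminus ` supp h \<subseteq> uminus ` supp h" by (rule image_mono)
    ultimately show ?thesis by (simp add: image_image)
  qed
  have "cf (f * g) (- k) = (\<sigma> * \<tau>) *\<^sub>R cf (f * g) k" for k
  proof -
    have inj: "inj_on uminus A" for A :: "freq set" by simp
    have eq: "- a + - b = - k \<longleftrightarrow> a + b = k" for a b :: freq
      by (metis add_uminus_conv_diff minus_add_distrib minus_equation_iff diff_conv_add_uminus)
    then have eq': "- a - b = - k \<longleftrightarrow> a + b = k" for a b :: freq
      by simp
    have "cf (f * g) (- k) = (\<Sum>a\<in>uminus ` supp f. \<Sum>b\<in>uminus ` supp g. if a + b = - k then 1 *\<^sub>R (cf f a * cf g b) else 0)"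
      unfolding cf_times wconv_def img[OF f \<sigma>] img[OF g \<tau>] ..
    also have "\<dots> = (\<Sum>a\<in>supp f. \<Sum>b\<in>supp g. if a + b = k then (\<sigma> * \<tau>) *\<^sub>R (cf f a * cf g b) else 0)"
      using f g by (simp add: sum.reindex inj eq eq' par_poly_def mult_ac cong: if_cong)
    also have "\<dots> = (\<sigma> * \<tau>) *\<^sub>R cf (f * g) k"
      unfolding cf_times wconv_def scaleR_sum_right by (intro sum.cong refl) auto
    finally show ?thesis .
  qed
  then show ?thesis by (simp add: par_poly_def)
qed

lemma par_poly_sum: "(\<And>i. i \<in> A \<Longrightarrow> par_poly \<sigma> (f i)) \<Longrightarrow> par_poly \<sigma> (\<Sum>i\<in>A. f i)"
proof (induction A rule: infinite_finite_induct)
  case (insert i A)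
  then show ?case by (simp add: par_poly_add)
qed (simp_all add: par_poly_def)

lemma par_ser_times: "par_ser \<sigma> F \<Longrightarrow> par_ser \<tau> G \<Longrightarrow> \<sigma> \<noteq> 0 \<Longrightarrow> \<tau> \<noteq> 0 \<Longrightarrow> par_ser (\<sigma> * \<tau>) (F * G)"
  unfolding par_ser_def fps_mult_nth by (auto intro!: par_poly_sum par_poly_times)

lemma par_ser_add: "par_ser \<sigma> F \<Longrightarrow> par_ser \<sigma> G \<Longrightarrow> par_ser \<sigma> (F + G)"
  by (simp add: par_ser_def par_poly_add)

lemma par_ser_diff: "par_ser \<sigma> F \<Longrightarrow> par_ser \<sigma> G \<Longrightarrow> par_ser \<sigma> (F - G)"
  by (simp add: par_ser_def par_poly_def lookup_minus scaleR_diff_right)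

lemma par_ser_cst: "par_ser 1 (cst c)"
  by (auto simp: par_ser_def par_poly_def cst_def lookup_single when_def)

lemma par_ser_X: "par_ser 1 fps_X"
proof -
  have "par_poly 1 (1 :: tpoly)" by (auto simp: par_poly_def lookup_one when_def)
  moreover have "par_poly 1 (0 :: tpoly)" by (simp add: par_poly_def)
  ultimately show ?thesis by (simp add: par_ser_def)
qed

lemma sqn_uminus [simp]: "sqn m (- k) = sqn m k"
  by (simp add: sqn_def)

lemma par_ser_E: "par_ser 1 F \<Longrightarrow> par_ser 1 (fmap (Eop m) F)"
  by (simp add: par_ser_def par_poly_def)

lemma par_ser_sum: "(\<And>i. i \<in> A \<Longrightarrow> par_ser \<sigma> (F i)) \<Longrightarrow> par_ser \<sigma> (\<Sum>i\<in>A. F i)"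
  by (simp add: par_ser_def fps_sum_nth par_poly_sum)

lemma par_ser_GS: "par_ser 1 F \<Longrightarrow> par_ser 1 G \<Longrightarrow> par_ser 1 (GS m F G)"
  unfolding GS_def using par_ser_times[of "-1" _ "-1"] by (intro par_ser_sum) (auto simp: par_ser_D)

text \<open>Order 1 is shared by all five components, and evenness removes the sine part; on such
  series evaluation is a ring homomorphism.\<close>

definition good :: "nat \<Rightarrow> real \<Rightarrow> tser \<Rightarrow> bool" where
  "good m s F \<longleftrightarrow> conv_at m 1 s F \<and> par_ser 1 F"

lemma good_times [intro]: "good m s F \<Longrightarrow> good m s G \<Longrightarrow> good m s (F * G)"
  using par_ser_times[of 1 F 1 G] by (auto simp: good_def conv_at_times)

lemma good_add [intro]: "good m s F \<Longrightarrow> good m s G \<Longrightarrow> good m s (F + G)"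
  and good_diff [intro]: "good m s F \<Longrightarrow> good m s G \<Longrightarrow> good m s (F - G)"
  by (auto simp: good_def conv_at_add conv_at_diff par_ser_add par_ser_diff)

lemma good_cst [intro]: "good m s (cst c)" and good_X [intro]: "good m s fps_X"
  by (auto simp: good_def par_ser_cst par_ser_X)

lemma good_1 [intro]: "good m s 1"
  using good_cst[of m s 1] by simp

lemma cos_ser_good_times: "good m s F \<Longrightarrow> good m s G \<Longrightarrow> cos_ser m (F * G) s t x = cos_ser m F s t x * cos_ser m G s t x"
  by (simp add: good_def cos_ser_times[where p = 1 and q = 1])

lemma cos_ser_good_add: "good m s F \<Longrightarrow> good m s G \<Longrightarrow> cos_ser m (F + G) s t x = cos_ser m F s t x + cos_ser m G s t x"
  and cos_ser_good_diff: "good m s F \<Longrightarrow> good m s G \<Longrightarrow> cos_ser m (F - G) s t x = cos_ser m F s t x - cos_ser m G s t x"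
  by (simp_all add: good_def ser_eval_add[where p = 1 and q = 1] ser_eval_diff[where p = 1 and q = 1])

lemma ser_eval_0 [simp]: "ser_eval g m 0 s t x = 0"
  by (simp add: ser_eval_def)

lemma fmap_D_X: "fmap (Dop i) fps_X = 0"
proof (rule fps_ext)
  fix j
  have "Dop i 1 = 0" by (rule poly_mapping_eqI) (simp add: lookup_one when_def)
  moreover have "Dop i 0 = 0" by (rule poly_mapping_eqI) simp
  ultimately show "fmap (Dop i) fps_X $ j = 0 $ j" by simp
qed

section \<open>The formal equations as identities between functions\<close>

context sol_at
begin

lemma good_H [intro]: "good m s (H c)"
proof -
  have "1 \<le> cord c" by (cases c) auto
  then show ?thesis using conv_at_le[OF smH] by (auto simp: good_def)
qed

lemma good_EY [intro]: "good m s (fmap (Eop m) (H CY))" and good_EE [intro]: "good m s (fmap (Eop m) (H Eta))"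
  by (auto simp: good_def par_ser_E intro!: conv_at_E smY smE)

lemma good_kap [intro]: "good m s (kap (H Eta))"
  unfolding kap_def by (intro good_add good_times good_X good_H)

lemma conv_at_kap: "p \<le> 3 \<Longrightarrow> conv_at m p s (kap (H Eta))"
  unfolding kap_def by (intro conv_at_add conv_at_times conv_at_X smE)

lemma good_GS1 [intro]: "good m s (GS m (kap (H Eta)) (H CY1))" and good_GS2 [intro]: "good m s (GS m (H Eta) (H Eta))"
  using good_kap by (auto simp: good_def intro!: par_ser_GS conv_at_GS conv_at_kap smY1 smE)

lemma good_K [intro]: "good m s (Kop n m H)" and good_Kb [intro]: "good m s (Kbop n m H)"
  unfolding Kop_def Kbop_def by (intro good_add good_diff good_times good_cst good_X good_1 good_H good_EY good_EE good_kap good_GS1 good_GS2)+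

lemmas ev_simps = cos_ser_good_add cos_ser_good_diff cos_ser_good_times

lemma Eta_const_ec [simp]: "cos_ser m (H Eta) s t x = ec x"
  unfolding ec_def by (rule ser_eval_const_t[OF Eta_const])

lemma ev_kap [simp]: "cos_ser m (kap (H Eta)) s t x = ec x + ec x + s * (ec x * ec x)"
  unfolding kap_def by (simp only: ev_simps good_H good_times good_add good_X cos_ser_X Eta_const_ec)

lemma eD_eq: "sin_ser m (fmap (Dop i) (H Eta)) s t x = - eD i x"
  unfolding eD_def using ser_eval_const_t[OF const_D[OF Eta_const], where m = m and s = s and g = sin and t = t and x = x] by simp

text \<open>The gradient of \<open>2 * \<eta> + s * \<eta>\<^sup>2\<close>; the minus sign arises
  because \<open>sin_ser\<close> of \<open>Dop i F\<close> is minus the \<open>i\<close>-th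
  derivative of an even \<open>F\<close>.\<close>

lemma ev_D_kap:
  assumes "i < m"
  shows "sin_ser m (fmap (Dop i) (kap (H Eta))) s t x = - (2 + 2 * s * ec x) * eD i x"
proof -
  let ?D = "fmap (Dop i) (H Eta)"
  have sD: "conv_at m 0 s ?D" using assms by (auto intro: smD)
  have sE: "conv_at m 0 s (H Eta)" by (auto intro: smE)
  have o: "par_ser (-1) ?D" by (auto intro: par_ser_D)
  have "sin_ser m (?D * H Eta + H Eta * ?D) s t x = - (2 * ec x) * eD i x"
    using ser_eval_add[OF cs_le_1(2) conv_at_times[OF sD sE] conv_at_times[OF sE sD], where t = t and x = x] sin_ser_times[OF sD sE, where t = t and x = x]
      sin_ser_times[OF sE sD, where t = t and x = x]
    by (simp only: cos_ser_par_ser[OF o] sin_ser_par_ser[OF fevH] eD_eq Eta_const_ec) simp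
  moreover have "cos_ser m (?D * H Eta + H Eta * ?D) s t x = 0"
    using par_ser_times[OF o fevH, of Eta] par_ser_times[OF fevH o, of Eta] by (intro cos_ser_par_ser par_ser_add) auto
  moreover have "fmap (Dop i) (kap (H Eta)) = ?D + ?D + fps_X * (?D * H Eta + H Eta * ?D)"
    unfolding kap_def by (simp only: fmap_D_add fmap_D_times fmap_D_X mult_zero_left add_0_left)
  moreover have sP: "conv_at m 0 s (?D * H Eta + H Eta * ?D)" by (intro conv_at_add conv_at_times sD sE)
  moreover have "sin_ser m (fps_X * (?D * H Eta + H Eta * ?D)) s t x = s * sin_ser m (?D * H Eta + H Eta * ?D) s t x"
    by (subst sin_ser_times[OF conv_at_X[of m 0 s] sP]) simp
  moreover have "sin_ser m (?D + ?D + fps_X * (?D * H Eta + H Eta * ?D)) s t x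
      = sin_ser m ?D s t x + sin_ser m ?D s t x + sin_ser m (fps_X * (?D * H Eta + H Eta * ?D)) s t x"
    by (subst ser_eval_add[OF cs_le_1(2) conv_at_add[OF sD sD] conv_at_times[OF conv_at_X sP]], subst ser_eval_add[OF cs_le_1(2) sD sD]) simp
  ultimately show ?thesis
    by (simp only: eD_eq) (simp add: algebra_simps)
qed

text \<open>\<open>SS\<close> is the squared gradient of \<open>\<eta>\<close>, and
  \<open>SR\<close> below is the scalar product of the gradients of \<open>\<eta>\<close> and of
  \<open>Y'\<close>.\<close>

definition SS :: "(nat \<Rightarrow> real) \<Rightarrow> real" where "SS x = (\<Sum>i<m. eD i x ^ 2)"
definition SR :: "real \<Rightarrow> (nat \<Rightarrow> real) \<Rightarrow> real" where "SR t x = - (\<Sum>i<m. eD i x * sin_ser m (fmap (Dop i) (H CY1)) s t x)"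

lemma ev_GS2 [simp]: "cos_ser m (GS m (H Eta) (H Eta)) s t x = - SS x"
  by (subst cos_ser_GS[where p = 0]) (auto intro: smE simp: eD_eq SS_def power2_eq_square)

lemma ev_GS1 [simp]: "cos_ser m (GS m (kap (H Eta)) (H CY1)) s t x = - ((2 + 2 * s * ec x) * SR t x)"
proof -
  have "cos_ser m (GS m (kap (H Eta)) (H CY1)) s t x = - (\<Sum>i<m. (- (2 + 2 * s * ec x) * eD i x) * sin_ser m (fmap (Dop i) (H CY1)) s t x)"
    using good_kap by (subst cos_ser_GS[where p = 0]) (auto intro: conv_at_kap smY1 simp: ev_D_kap good_def)
  also have "\<dots> = (2 + 2 * s * ec x) * (\<Sum>i<m. eD i x * sin_ser m (fmap (Dop i) (H CY1)) s t x)"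
    unfolding sum_distrib_left sum_negf[symmetric] by (intro sum.cong refl) (simp add: algebra_simps)
  finally show ?thesis by (simp add: SR_def)
qed

definition EY :: "real \<Rightarrow> (nat \<Rightarrow> real) \<Rightarrow> real" where "EY t x = cos_ser m (fmap (Eop m) (H CY)) s t x"
definition EE :: "(nat \<Rightarrow> real) \<Rightarrow> real" where "EE x = - (\<Sum>i<m. eDD i i x)"

lemma ev_EE [simp]: "cos_ser m (fmap (Eop m) (H Eta)) s t x = EE x"
proof -
  have "cos_ser m (fmap (Dop i) (fmap (Dop i) (H Eta))) s t x = - eDD i i x" for i
    unfolding eDD_def by (simp add: ser_eval_const_t[OF const_D[OF const_D[OF Eta_const]], where t = t])
  then show ?thesis
    by (subst ser_eval_E[OF cs_le_1(1), where p = 0]) (auto simp: EE_def sum_negf intro: smE)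
qed

text \<open>The straightened equation multiplied by \<open>(1 + s * ec x)\<^sup>2\<close>, which
  clears the denominators stemming from the first coordinate being \<open>t / hh x\<close>.\<close>

lemma equationA:
  assumes "\<bar>t\<bar> < 1"
  shows "lam n * (Ms * Ms) * ((1 + s * ec x) ^ 2) ^ 2 * Wtt t x + (1 + s * ec x) ^ 2 * (- s * EY t x)
     + 2 * t * (1 + s * ec x) * (s ^ 2 * SR t x) + t * (1 + s * ec x) * (- s * EE x) * Wt t x
     + t ^ 2 * (s ^ 2 * SS x) * Wtt t x + Ms * Ms * (1 + s * ec x) ^ 2 * W t x = 0"
proof -
  have t: "clamp1 t = t" using assms by (intro clamp1_id) auto
  have T: "apply_bcontfun Tid t = t" "apply_bcontfun (Tv n) t = v n t" "apply_bcontfun (Tv1 n) t = v1 t"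
    using t by (simp_all add: apply_T v1_def)
  define K where "K = cos_ser m (Kop n m H) s t x"
  have K: "K = Ms * Ms * (((ec x + ec x + s * (ec x * ec x)) + (ec x + ec x + s * (ec x * ec x)) + s * ((ec x + ec x + s * (ec x * ec x)) * (ec x + ec x + s * (ec x * ec x)))) * (lam n * cos_ser m (H CY2) s t x))
      - (ec x + ec x + s * (ec x * ec x)) * EY t x + Ms * Ms * ((ec x + ec x + s * (ec x * ec x)) * cos_ser m (H CY) s t x)
      - Ms * Ms * ((ec x * ec x + (ec x + ec x + s * (ec x * ec x)) * (ec x + ec x + s * (ec x * ec x))) * v n t)
      - t * (EE x * (cos_ser m (H CY1) s t x + ec x * v1 t + s * (ec x * cos_ser m (H CY1) s t x)))
      - t * (- ((2 + 2 * s * ec x) * SR t x)) - t * t * ((- SS x) * (s * cos_ser m (H CY2) s t x - 1 / lam n * v n t))"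
    unfolding K_def Kop_def
    by (simp only: ev_simps good_add good_diff good_times good_cst good_X good_1 good_H good_EY good_EE good_kap good_GS1 good_GS2
        cos_ser_cst cos_ser_X cos_ser_Mu ev_kap ev_EE ev_GS1 ev_GS2 Eta_const_ec EY_def[symmetric] T apply_bcontfun_of_real)
  have A: "Ms * Ms * (lam n * cos_ser m (H CY2) s t x) - EY t x + Ms * Ms * cos_ser m (H CY) s t x
      - Ms * Ms * (ec x + ec x) * v n t - t * v1 t * EE x + s * K = 0"
    using arg_cong[OF eqA, of "\<lambda>F. cos_ser m F s t x"] unfolding K_def
    by (simp only: ev_simps good_add good_diff good_times good_cst good_X good_1 good_H good_EY good_EE good_kap good_GS1 good_GS2 good_K
        cos_ser_cst cos_ser_X cos_ser_Mu ev_kap ev_EE ev_GS1 ev_GS2 Eta_const_ec EY_def[symmetric] T apply_bcontfun_of_real ser_eval_0)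
  have "lam n * (1 / lam n) = 1" using lam_pos[OF n] by simp
  from pde_scalar[OF refl this K A]
  show ?thesis
    by (simp add: Wtt_def Wt_def W_def eX_def t)
qed

lemma Wxx_sum: "\<bar>t\<bar> < 1 \<Longrightarrow> (\<Sum>i<m. Wxx i i t x) = - s * EY t x"
proof -
  assume "\<bar>t\<bar> < 1"
  then have "clamp1 t = t" by (intro clamp1_id) auto
  then show ?thesis
    unfolding EY_def by (subst ser_eval_E[OF cs_le_1(1), where p = 0]) (auto simp: Wxx_def eX_def sum_distrib_left sum_negf intro: smY)
qed

lemma hc_sq: "hc\<^sup>2 = lam n * (Ms * Ms)"
  using lam_pos[OF n] by (simp add: hc_def power_mult_distrib power2_eq_square)

text \<open>The chain rule gives the Laplacian in terms of \<open>p 0\<close>; substituting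
  \<open>t = p 0 * hc * g\<close> and multiplying by \<open>g\<^sup>2\<close> produces the left side
  of \<open>equationA\<close>, and \<open>g\<close> is nonzero.\<close>

lemma w_pde:
  assumes p: "\<bar>TT p\<bar> < 1" and S: "\<And>p. p \<in> S \<Longrightarrow> \<bar>TT p\<bar> < 1" "p \<in> S" and pos: "1 + s * ec (tail p) \<noteq> 0"
  shows "laplacian (Suc m) w p + Ms\<^sup>2 * w p = 0"
proof -
  define x where "x = tail p"
  define t where "t = TT p"
  define g where "g = 1 + s * ec x"
  have g0: "g \<noteq> 0" using pos by (simp add: g_def x_def)
  have t: "\<bar>t\<bar> < 1" using p by (simp add: t_def)
  then have ct: "clamp1 t = t" by (intro clamp1_id) auto
  have tg: "t = p 0 * hc * g" by (simp add: t_def TT_def hh_def g_def x_def)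
  have TD0: "TD (evec 0) p = hh x" by (simp add: TD_def x_def sum_evec_0) (simp add: evec_def)
  have TDS: "TD (evec (Suc i)) p = hD i x * p 0" if "i < m" for i
    using that by (simp add: TD_def x_def sum_evec_Suc) (simp add: evec_def)
  have e: "evec (Suc i) 0 = 0" for i by (simp add: evec_def)
  have d0: "wDD 0 0 p = Wtt t x * hh x ^ 2"
    by (simp add: wDD_def Let_def TD0 sum_evec_0 t_def[symmetric] x_def[symmetric] power2_eq_square)
  have dS: "wDD (Suc i) (Suc i) p = 2 * p 0 * (hD i x * Wtx i t x) + Wxx i i t x + p 0 * hDD i i x * Wt t x + (p 0)\<^sup>2 * hD i x ^ 2 * Wtt t x"
    if "i < m" for i
    using that by (simp add: wDD_def Let_def TDS sum_evec_Suc e t_def[symmetric] x_def[symmetric] power2_eq_square algebra_simps)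
  have "laplacian (Suc m) w p = (\<Sum>i<Suc m. wDD i i p)"
    unfolding laplacian_def by (intro sum.cong refl w_Ck(4)[OF S(1) _ _ S(2)]) auto
  also have "\<dots> = wDD 0 0 p + (\<Sum>i<m. wDD (Suc i) (Suc i) p)" by (rule sum.lessThan_Suc_shift)
  also have "(\<Sum>i<m. wDD (Suc i) (Suc i) p) = 2 * p 0 * (\<Sum>i<m. hD i x * Wtx i t x) + (\<Sum>i<m. Wxx i i t x)
      + p 0 * (\<Sum>i<m. hDD i i x) * Wt t x + (p 0)\<^sup>2 * (\<Sum>i<m. hD i x ^ 2) * Wtt t x"
    by (simp add: dS sum.distrib sum_distrib_left sum_distrib_right)
  also have "(\<Sum>i<m. hD i x * Wtx i t x) = hc * (s ^ 2 * SR t x)"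
    by (simp add: hD_def Wtx_def SR_def ct sum_distrib_left sum_negf power2_eq_square mult_ac)
  also have "(\<Sum>i<m. hDD i i x) = hc * (- s * EE x)"
    by (simp add: hDD_def EE_def sum_distrib_left sum_negf mult_ac)
  also have "(\<Sum>i<m. hD i x ^ 2) = hc\<^sup>2 * (s ^ 2 * SS x)"
    by (simp add: hD_def SS_def sum_distrib_left power_mult_distrib mult_ac)
  also have "(\<Sum>i<m. Wxx i i t x) = - s * EY t x" by (rule Wxx_sum[OF t])
  finally have L: "laplacian (Suc m) w p = Wtt t x * (hc * g)\<^sup>2 + (2 * (p 0 * hc) * (s ^ 2 * SR t x) + - s * EY t x
      + (p 0 * hc) * (- s * EE x) * Wt t x + (p 0 * hc)\<^sup>2 * (s ^ 2 * SS x) * Wtt t x)"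
    by (simp add: d0 hh_def g_def power_mult_distrib mult_ac)
  have "(laplacian (Suc m) w p + Ms\<^sup>2 * w p) * g\<^sup>2 =
     hc\<^sup>2 * (g ^ 2) ^ 2 * Wtt t x + g ^ 2 * (- s * EY t x)
     + 2 * t * g * (s ^ 2 * SR t x) + t * g * (- s * EE x) * Wt t x
     + t ^ 2 * (s ^ 2 * SS x) * Wtt t x + Ms * Ms * g ^ 2 * W t x"
    unfolding L tg w_def t_def[symmetric] x_def[symmetric]
    by (simp add: algebra_simps power2_eq_square)
  also have "\<dots> = 0" using equationA[OF t, of x] unfolding hc_sq g_def .
  finally show ?thesis using g0 by simp
qed

lemma cf_Y_1: "apply_bcontfun (cf (H CY $ j) k) 1 = 0" and cf_Y_m1: "apply_bcontfun (cf (H CY $ j) k) (-1) = 0"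
proof -
  have "cf (fmap aop (H CY) $ j) k = 0" using eqC by simp
  then have "apply_bcontfun (cf (fmap aop (H CY) $ j) k) 0 = 0" by (simp only: zero_bcontfun.rep_eq)
  then show 1: "apply_bcontfun (cf (H CY $ j) k) 1 = 0" by simp
  have "apply_bcontfun (cf (H CY $ j) k) (- 1) = -1 * apply_bcontfun (cf (H CY $ j) k) 1"
    using psymH[of CY j] unfolding psym_def by simp
  then show "apply_bcontfun (cf (H CY $ j) k) (-1) = 0" using 1 by simp
qed

lemma clamp1_m1 [simp]: "clamp1 (-1) = -1"
  by (simp add: clamp1_def)

lemma v_1: "v n 1 = 0" "v n (-1) = 0" "v1 1 = 1" "v1 (-1) = 1"
  by (simp_all add: v_def v1_def cos_npi flip: power_add)

lemma W_1: "W 1 x = 0" "W (-1) x = 0"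
  by (simp_all add: W_def eX_def ser_eval_def trig_eval_def cf_Y_1 cf_Y_m1 v_1)

lemma Wx_1: "i < m \<Longrightarrow> Wx i 1 x = 0" "i < m \<Longrightarrow> Wx i (-1) x = 0"
  by (simp_all add: Wx_def eX_def ser_eval_def trig_eval_def cf_Y_1 cf_Y_m1)

lemma Wt_m1: "Wt (-1) x = Wt 1 x"
  using cos_ser_parity[of m 1 "H CY1" cos 2 s 1 x] psymH[of CY1] smY1[of 2] by (simp add: Wt_def v_1)

text \<open>The Neumann condition squared and cleared of denominators: \<open>s\<close> times
  \<open>eqB\<close>, evaluated at \<open>t = 1\<close> and regrouped.\<close>

lemma equationB:
  "(Wt 1 x)\<^sup>2 * (lam n * (Ms * Ms) * ((1 + s * ec x)\<^sup>2)\<^sup>2 + s\<^sup>2 * SS x) = lam n * (Ms * Ms) * (1 + s * ec x)\<^sup>2"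
proof -
  define a where "a = cos_ser m (H CY1) s 1 x"
  define e where "e = ec x"
  define kc where "kc = e + e + s * (e * e)"
  define L where "L = lam n * (Ms * Ms)"
  have "cos_ser m (fmap aop (rc (lam n) * (H Mu * H Mu) * ((H CY1 + H Eta) + (H CY1 + H Eta)) + fps_X * Kbop n m H)) s 1 x = 0"
    unfolding eqB by simp
  then have B: "L * ((a + e) + (a + e)) + s * (L * (a * a + (a + a + s * (a * a)) * (kc + kc + s * (kc * kc)) + e * e + kc * kc)
      - (1 + s * a) * (1 + s * a) * (- SS x)) = 0"
    unfolding ser_eval_aop Kbop_def L_def a_def kc_def e_def
    by (simp only: ev_simps good_add good_diff good_times good_cst good_X good_1 good_H good_kap good_GS2
        cos_ser_cst cos_ser_X cos_ser_1 cos_ser_Mu ev_kap ev_GS2 Eta_const_ec apply_bcontfun_of_real)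
  have q: "(1 + s * e)\<^sup>2 = 1 + s * kc" by (simp add: kc_def algebra_simps power2_eq_square)
  have skc: "s * kc = s * (e + e) + s * (s * (e * e))" by (simp add: kc_def algebra_simps)
  have "(1 + s * a)\<^sup>2 * (L * (1 + s * kc)\<^sup>2 + s\<^sup>2 * SS x) - L * (1 + s * kc)
     = s * (L * (a + a) + s * (L * (a * a + (a + a + s * (a * a)) * (kc + kc + s * (kc * kc)) + kc * kc)
      - (1 + s * a) * (1 + s * a) * (- SS x))) + L * (s * kc)"
    by (simp add: algebra_simps power2_eq_square)
  also have "\<dots> = s * (L * ((a + e) + (a + e)) + s * (L * (a * a + (a + a + s * (a * a)) * (kc + kc + s * (kc * kc)) + e * e + kc * kc)
      - (1 + s * a) * (1 + s * a) * (- SS x)))"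
    unfolding skc by (simp add: algebra_simps)
  also have "\<dots> = 0" unfolding B by simp
  finally show ?thesis
    by (simp add: Wt_def v_1 a_def[symmetric] e_def[symmetric] L_def[symmetric] q)
qed

end

section \<open>Boundary conditions\<close>

lemma tail_case_nat [simp]: "tail (case_nat t x) = x"
  by (simp add: tail_def)

lemma case_nat_tail: "case_nat (p 0) (tail p) = p"
  by (auto simp: tail_def split: nat.split)

lemma Rn_Suc_iff: "p \<in> Rn (Suc m) \<longleftrightarrow> tail p \<in> Rn m"
  unfolding topspace_Euclidean_space tail_def mem_Collect_eq by (auto, metis Suc_le_D Suc_le_mono)

lemma openin_pos_Euclidean:
  fixes f :: "(nat \<Rightarrow> real) \<Rightarrow> real"
  assumes "continuous_on UNIV f"
  shows "openin (Euclidean_space N) {q \<in> Rn N. 0 < f q}"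
proof -
  have "continuous_map (Euclidean_space N) euclideanreal f"
    using cont_on_UNIV[OF assms, of N "Rn N"] by (simp add: cont_on_def)
  from openin_continuous_map_preimage[OF this, of "{0<..}"] show ?thesis by simp
qed

context sol_at
begin

lemma W_odd: "W (- t) x = - W t x"
proof -
  have c: "clamp1 (- t) = - clamp1 t" by (simp add: clamp1_def min_def max_def)
  have "cos_ser m (H CY) s (- clamp1 t) x = -1 * cos_ser m (H CY) s (clamp1 t) x"
    by (rule cos_ser_parity[OF _ cs_le_1(1) smY[of 0]]) (use psymH[of CY] in auto)
  moreover have "cos_ser m (H CY1) s (- clamp1 t) x = 1 * cos_ser m (H CY1) s (clamp1 t) x"
    by (rule cos_ser_parity[OF _ cs_le_1(1) smY1[of 0]]) (use psymH[of CY1] in auto)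
  ultimately show ?thesis by (simp add: W_def eX_def c v_def algebra_simps)
qed

lemma W_hh_sym:
  shows "i < m \<Longrightarrow> W t (x(i := - x i)) = W t x" "i < m \<Longrightarrow> hh (x(i := - x i)) = hh x"
    "i < m \<Longrightarrow> W t (x(i := x i + 2 * pi)) = W t x" "i < m \<Longrightarrow> hh (x(i := x i + 2 * pi)) = hh x"
    "\<pi> permutes {..<m} \<Longrightarrow> W t (x \<circ> \<pi>) = W t x" "\<pi> permutes {..<m} \<Longrightarrow> hh (x \<circ> \<pi>) = hh x"
  unfolding W_def eX_def hh_def ec_def
  by (simp_all add: cos_ser_shift cos_ser_flip[OF psymH] cos_ser_perm[OF psymH] del: Eta_const_ec)

lemma TT_case_nat [simp]: "TT (case_nat t x) = t * hh x"
  by (simp add: TT_def)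

lemma w_case_nat: "w (case_nat t x) = W (t * hh x) x"
  by (simp add: w_def)

lemma w_symmetries: "solution_symmetries m S w"
  unfolding solution_symmetries_def by (simp add: w_case_nat W_hh_sym W_odd)

end

text \<open>The first two conditions make the profile positive; the third recovers the sign of the
  normal derivative, which squaring has lost.\<close>

locale sol_pos = sol_at +
  assumes pos: "\<And>x. 1 + s * ec x > 0" and Ms_pos: "Ms > 0" and Wt_pos: "\<And>x. Wt 1 x > 0"
begin

lemma hc_pos: "hc > 0"
  using lam_pos[OF n] Ms_pos by (simp add: hc_def)

lemma hh_pos: "hh x > 0"
  using hc_pos pos by (simp add: hh_def)

lemma Omega_eq: "Omega m hh = {q \<in> Rn (Suc m). \<bar>TT q\<bar> < 1}"
proof -
  have *: "\<bar>t\<bar> < 1 / hh x \<longleftrightarrow> \<bar>t * hh x\<bar> < 1" for t x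
    using hh_pos[of x] by (simp add: abs_mult pos_less_divide_eq)
  show ?thesis
  proof (intro equalityI subsetI)
    fix q assume "q \<in> Omega m hh"
    then show "q \<in> {q \<in> Rn (Suc m). \<bar>TT q\<bar> < 1}"
      unfolding Omega_def using * by (auto simp: Rn_Suc_iff)
  next
    fix q assume q: "q \<in> {q \<in> Rn (Suc m). \<bar>TT q\<bar> < 1}"
    have "q = case_nat (q 0) (tail q)" by (simp add: case_nat_tail)
    moreover have "tail q \<in> Rn m" "\<bar>q 0\<bar> < 1 / hh (tail q)"
      using q * by (auto simp: Rn_Suc_iff TT_def)
    ultimately show "q \<in> Omega m hh" unfolding Omega_def by blast
  qed
qed

text \<open>The length of the gradient of \<open>TT\<close>; the boundary components are the level
  sets \<open>TT = 1\<close> and \<open>TT = -1\<close>, so this gradient is normal to them.\<close>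

definition grad_norm :: "(nat \<Rightarrow> real) \<Rightarrow> real" where "grad_norm p = sqrt (\<Sum>j<Suc m. (TD (evec j) p)\<^sup>2)"
definition normal_at :: "real \<Rightarrow> (nat \<Rightarrow> real) \<Rightarrow> nat \<Rightarrow> real" where
  "normal_at \<sigma> p = (\<lambda>i. if i < Suc m then \<sigma> * TD (evec i) p / grad_norm p else 0)"

lemma TD_evec:
  "TD (evec 0) p = hh (tail p)" "i < m \<Longrightarrow> TD (evec (Suc i)) p = hD i (tail p) * p 0"
proof -
  have e: "evec 0 0 = 1" "evec (Suc i) 0 = 0" by (simp_all add: evec_def)
  show "TD (evec 0) p = hh (tail p)" by (simp add: TD_def sum_evec_0 e)
  show "i < m \<Longrightarrow> TD (evec (Suc i)) p = hD i (tail p) * p 0" by (simp add: TD_def sum_evec_Suc e)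
qed

lemma grad_norm_sq: "(grad_norm p)\<^sup>2 = (\<Sum>j<Suc m. (TD (evec j) p)\<^sup>2)"
  unfolding grad_norm_def by (intro real_sqrt_pow2 sum_nonneg) auto

lemma grad_norm_pos: "grad_norm p > 0"
proof -
  have "(TD (evec 0) p)\<^sup>2 \<le> (\<Sum>j<Suc m. (TD (evec j) p)\<^sup>2)"
    by (rule member_le_sum) auto
  moreover have "(TD (evec 0) p)\<^sup>2 > 0" using hh_pos[of "tail p"] by (simp add: TD_evec)
  ultimately have "0 < (\<Sum>j<Suc m. (TD (evec j) p)\<^sup>2)" by (rule less_le_trans[rotated])
  then show ?thesis unfolding grad_norm_def by (simp only: real_sqrt_gt_0_iff)
qed

lemma TD_normal_at: "TD (normal_at \<sigma> p) p = \<sigma> * grad_norm p"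
proof -
  have "TD (normal_at \<sigma> p) p = (\<sigma> / grad_norm p) * ((TD (evec 0) p)\<^sup>2 + (\<Sum>i<m. (TD (evec (Suc i)) p)\<^sup>2))"
    by (simp add: TD_def[of "normal_at \<sigma> p"], simp add: normal_at_def TD_evec sum_distrib_right sum_distrib_left distrib_left add_divide_distrib sum_divide_distrib power2_eq_square mult_ac)
  also have "(TD (evec 0) p)\<^sup>2 + (\<Sum>i<m. (TD (evec (Suc i)) p)\<^sup>2) = (grad_norm p)\<^sup>2"
    unfolding grad_norm_sq by (rule sum.lessThan_Suc_shift[symmetric])
  finally show ?thesis using grad_norm_pos[of p] by (simp add: power2_eq_square)
qed

lemma normal:
  assumes \<sigma>: "\<sigma> \<in> {1, -1}" and p: "p \<in> Rn (Suc m)" "TT p = \<sigma>"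
  shows "unit_outer_normal (Suc m) (Omega m hh) p (normal_at \<sigma> p)"
proof -
  have \<sigma>2: "\<sigma>\<^sup>2 = 1" and a\<sigma>: "\<bar>\<sigma> * r\<bar> = \<bar>r\<bar>" for r using \<sigma> by (auto simp: abs_mult)
  have \<sigma>\<sigma>: "\<sigma> * \<sigma> = 1" using \<sigma> by auto
  \<comment> \<open>In this half space \<open>\<sigma> * TT\<close> is positive, so the two-sided
    condition \<open>\<bar>TT\<bar> < 1\<close> becomes the single inequality
    \<open>\<sigma> * TT < 1\<close>.\<close>
  define U where "U = {q \<in> Rn (Suc m). 0 < \<sigma> * q 0}"
  define \<phi> where "\<phi> = (\<lambda>q. \<sigma> * TT q + (- 1))"
  have d: "ddir \<phi> q \<xi> (\<sigma> * TD \<xi> q)" for q \<xi>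
    unfolding \<phi>_def using ddir_add[OF ddir_cmult[OF ddir_TT, of \<sigma> q \<xi>] ddir_const, of "-1"] by simp
  have c: "continuous_on UNIV \<phi>" unfolding \<phi>_def by (intro continuous_intros TT_cont)
  have c1: "continuous_on UNIV (\<lambda>q. \<sigma> * TD \<xi> q)" for \<xi> by (intro continuous_intros TD_cont)
  have "sum (\<lambda>i. (normal_at \<sigma> p i)\<^sup>2) {..<Suc m} = (\<Sum>j<Suc m. (TD (evec j) p)\<^sup>2) / (grad_norm p)\<^sup>2"
    unfolding sum_divide_distrib by (intro sum.cong refl) (simp add: normal_at_def power_divide power_mult_distrib \<sigma>2)
  also have "\<dots> = 1" using grad_norm_pos[of p] by (simp only: grad_norm_sq[symmetric]) simp
  finally have e: "enorm (Suc m) (normal_at \<sigma> p) = 1"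
    by (simp only: enorm_def L2_set_def real_sqrt_one)
  have op: "openin (Euclidean_space (Suc m)) U"
    unfolding U_def by (intro openin_pos_Euclidean continuous_intros)
  have "\<sigma> * p 0 * hh (tail p) = 1" using p(2) \<sigma>\<sigma> by (simp add: TT_def mult.assoc)
  then have "0 < \<sigma> * p 0 * hh (tail p)" by simp
  then have "0 < \<sigma> * p 0" using hh_pos[of "tail p"] by (simp add: zero_less_mult_iff)
  then have pU: "p \<in> U" using p by (simp add: U_def)
  have "\<bar>TT q\<bar> < 1 \<longleftrightarrow> \<phi> q < 0" if "q \<in> U" for q
  proof -
    have "0 < (\<sigma> * q 0) * hh (tail q)" using that hh_pos by (auto simp: U_def intro!: mult_pos_pos)
    then have "0 < \<sigma> * TT q" by (simp add: TT_def mult.assoc)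
    then show ?thesis using a\<sigma>[of "TT q"] by (simp add: \<phi>_def)
  qed
  then have D: "Omega m hh \<inter> U = {q \<in> U. \<phi> q < 0}" unfolding Omega_eq by (auto simp: U_def)
  have "\<phi> p = 0" using p(2) \<sigma>\<sigma> by (simp add: \<phi>_def)
  moreover have "pd i \<phi> p = grad_norm p * normal_at \<sigma> p i" if "i < Suc m" for i
    using pd_ddir[OF d[of p "evec i"]] that grad_norm_pos[of p] by (simp add: normal_at_def)
  moreover have "normal_at \<sigma> p \<in> Rn (Suc m)" by (simp add: topspace_Euclidean_space normal_at_def)
  moreover have "Ck (Suc m) 1 U \<phi>" by (rule Ck_1_UNIV(1)[OF c d c1])
  ultimately show ?thesis
    unfolding unit_outer_normal_def using e op pU D grad_norm_pos[of p] by blast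
qed

text \<open>On the boundary \<open>(p 0)\<^sup>2 * (hh x)\<^sup>2 = 1\<close>. This turns
  \<open>(grad_norm p)\<^sup>2 * g\<^sup>2\<close> into the bracket of \<open>equationB\<close>; the
  square root is then taken with both sides nonnegative.\<close>

lemma normal_deriv_value:
  assumes \<sigma>: "\<sigma> \<in> {1, -1}" and p: "TT p = \<sigma>"
  shows "Wt \<sigma> (tail p) * grad_norm p = hc"
proof -
  define x where "x = tail p"
  define g where "g = 1 + s * ec x"
  have g: "g > 0" using pos by (simp add: g_def)
  have Wt: "Wt \<sigma> x = Wt 1 x" using \<sigma> Wt_m1 by auto
  have "(p 0 * hh x)\<^sup>2 = 1" using p \<sigma> by (auto simp: TT_def x_def)
  then have p0: "(p 0)\<^sup>2 * (hc\<^sup>2 * g\<^sup>2) = 1" by (simp add: hh_def g_def power_mult_distrib mult_ac)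
  have "(grad_norm p)\<^sup>2 = (hh x)\<^sup>2 + (p 0)\<^sup>2 * (\<Sum>i<m. (hD i x)\<^sup>2)"
    unfolding grad_norm_sq sum.lessThan_Suc_shift by (simp add: TD_evec x_def power_mult_distrib sum_distrib_left mult_ac)
  also have "(\<Sum>i<m. (hD i x)\<^sup>2) = hc\<^sup>2 * (s\<^sup>2 * SS x)"
    by (simp add: hD_def SS_def sum_distrib_left power_mult_distrib mult_ac)
  finally have N': "(grad_norm p)\<^sup>2 = (hh x)\<^sup>2 + (p 0)\<^sup>2 * (hc\<^sup>2 * (s\<^sup>2 * SS x))" .
  have h2: "(hh x)\<^sup>2 = hc\<^sup>2 * g\<^sup>2" by (simp only: hh_def g_def power_mult_distrib)
  have "(grad_norm p)\<^sup>2 * g\<^sup>2 = hc\<^sup>2 * (g\<^sup>2)\<^sup>2 + ((p 0)\<^sup>2 * (hc\<^sup>2 * g\<^sup>2)) * (s\<^sup>2 * SS x)"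
    unfolding N' h2 distrib_right power2_eq_square[of "g\<^sup>2"] by (simp only: mult_ac)
  then have N: "(grad_norm p)\<^sup>2 * g\<^sup>2 = hc\<^sup>2 * (g\<^sup>2)\<^sup>2 + s\<^sup>2 * SS x" unfolding p0 by simp
  have "(Wt 1 x * grad_norm p)\<^sup>2 * g\<^sup>2 = (Wt 1 x)\<^sup>2 * ((grad_norm p)\<^sup>2 * g\<^sup>2)" by (simp add: power_mult_distrib mult_ac)
  also have "\<dots> = hc\<^sup>2 * g\<^sup>2" unfolding N unfolding hc_sq g_def by (rule equationB)
  finally have "(Wt 1 x * grad_norm p)\<^sup>2 = hc\<^sup>2" using g by simp
  moreover have "0 \<le> Wt 1 x * grad_norm p" using Wt_pos grad_norm_pos by (simp add: less_imp_le)
  ultimately have "Wt 1 x * grad_norm p = hc" using hc_pos by (auto intro: power2_eq_imp_eq)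
  then show ?thesis using Wt by (simp add: x_def)
qed

text \<open>As \<open>W\<close> vanishes at both ends of the \<open>t\<close>-interval, so do the
  \<open>Wx\<close>, and only the \<open>t\<close>-derivative contributes. Since the continued
  \<open>w\<close> is differentiable across the boundary, the one-sided derivative is a
  restriction.\<close>

lemma normal_deriv:
  assumes \<sigma>: "\<sigma> \<in> {1, -1}" and p: "TT p = \<sigma>"
  shows "has_normal_deriv w p (normal_at \<sigma> p) (\<sigma> * hc)"
proof -
  have "Wx i \<sigma> (tail p) = 0" if "i < m" for i
    using \<sigma> Wx_1[OF that] by auto
  then have "Wt (TT p) (tail p) * TD (normal_at \<sigma> p) p + (\<Sum>i<m. normal_at \<sigma> p (Suc i) * Wx i (TT p) (tail p)) = \<sigma> * hc"
    using normal_deriv_value[OF assms] by (simp add: p TD_normal_at mult_ac)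
  then have "ddir w p (normal_at \<sigma> p) (\<sigma> * hc)" using ddir_w[of p "normal_at \<sigma> p"] by simp
  then show ?thesis
    unfolding has_normal_deriv_def ddir_def by (rule has_field_derivative_at_within)
qed

lemma classical: "classical_solution m hh (Ms\<^sup>2) hc w"
proof -
  have S: "\<bar>TT p\<bar> < 1" if "p \<in> Omega m hh" for p using that by (simp add: Omega_eq)
  have "hh x \<noteq> 0" for x using hh_pos[of x] by simp
  then have bp: "p \<in> Rn (Suc m) \<and> TT p = 1" if "p \<in> bdry_plus m hh" for p
    using that by (auto simp: bdry_plus_def Rn_Suc_iff)
  have bm: "p \<in> Rn (Suc m) \<and> TT p = -1" if "p \<in> bdry_minus m hh" for p
    using that \<open>\<And>x. hh x \<noteq> 0\<close> by (auto simp: bdry_minus_def Rn_Suc_iff)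
  show ?thesis
    unfolding classical_solution_def
  proof (intro conjI ballI exI[of _ "\<lambda>p. normal_at (TT p) p"])
    show "Ck (Suc m) 2 (Omega m hh) w" by (rule w_Ck(1)[OF S])
    show "C1_closure (Suc m) (Omega m hh) w" by (rule w_C1_closure[OF S])
    show "laplacian (Suc m) w p + Ms\<^sup>2 * w p = 0" if "p \<in> Omega m hh" for p
      using pos[of "tail p"] by (intro w_pde[OF S[OF that] S that]) auto
    show "w p = 0" if "p \<in> bdry_plus m hh \<union> bdry_minus m hh" for p
      using that bp[of p] bm[of p] by (auto simp: w_def W_1)
    show "unit_outer_normal (Suc m) (Omega m hh) p (normal_at (TT p) p)" if "p \<in> bdry_plus m hh \<union> bdry_minus m hh" for p
      using that bp[of p] bm[of p] by (auto intro!: normal)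
    show "has_normal_deriv w p (normal_at (TT p) p) hc" if "p \<in> bdry_plus m hh" for p
      using normal_deriv[of 1 p] bp[OF that] by simp
    show "has_normal_deriv w p (normal_at (TT p) p) (- hc)" if "p \<in> bdry_minus m hh" for p
      using normal_deriv[of "-1" p] bm[OF that] by simp
  qed
qed

end

section \<open>Smooth dependence on the parameter\<close>

definition mass :: "nat \<Rightarrow> real \<Rightarrow> tser \<Rightarrow> real" where
  "mass m s F = (\<Sum>j. \<bar>s\<bar> ^ j * wnorm m 3 (F $ j))"

lemma mass_nonneg: "conv_at m 3 s F \<Longrightarrow> 0 \<le> mass m s F"
  unfolding mass_def conv_at_def by (rule suminf_nonneg) auto

lemma mass_bound:
  assumes "conv_at m 3 s F" "\<And>r. \<bar>g r\<bar> \<le> 1" "\<And>j. wnorm m 0 (G $ j) \<le> wnorm m 3 (F $ j)"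
  shows "\<bar>ser_eval g m G s t x\<bar> \<le> mass m s F"
proof -
  have le: "\<bar>s\<bar> ^ j * wnorm m 0 (G $ j) \<le> \<bar>s\<bar> ^ j * wnorm m 3 (F $ j)" for j
    using assms(3) by (intro mult_left_mono) auto
  have "conv_at m 0 s G"
    unfolding conv_at_def
    by (rule summable_comparison_test'[OF assms(1)[unfolded conv_at_def], of 0]) (use le in \<open>auto simp: abs_mult\<close>)
  from ser_eval_bound[OF assms(2) this] have "\<bar>ser_eval g m G s t x\<bar> \<le> (\<Sum>j. \<bar>s\<bar> ^ j * wnorm m 0 (G $ j))" .
  also have "\<dots> \<le> mass m s F"
    unfolding mass_def using \<open>conv_at m 0 s G\<close> assms(1) by (intro suminf_le le) (auto simp: conv_at_def)
  finally show ?thesis .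
qed

lemma enorm_nonneg: "0 \<le> enorm m x"
  by (simp add: enorm_def L2_set_nonneg)

lemma abs_le_enorm: "i < m \<Longrightarrow> \<bar>x i\<bar> \<le> enorm m x"
proof -
  assume "i < m"
  then have "(x i)\<^sup>2 \<le> (\<Sum>i<m. (x i)\<^sup>2)" by (intro member_le_sum) auto
  then show ?thesis unfolding enorm_def L2_set_def by (intro real_le_rsqrt) simp
qed

lemma enorm_pos:
  assumes "x \<in> Rn m" "y \<in> Rn m" "x \<noteq> y"
  shows "0 < enorm m (\<lambda>i. x i - y i)"
proof -
  obtain i where i: "x i \<noteq> y i" using assms(3) by auto
  then have "i < m" using assms(1,2) by (auto simp: topspace_Euclidean_space) (metis linorder_not_le)
  from abs_le_enorm[OF this, of "\<lambda>i. x i - y i"] i show ?thesis by auto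
qed

section \<open>Hoelder bounds for a convergent cosine series\<close>

text \<open>Order 3 lets \<open>mass\<close> dominate all derivatives up to the third, so the second
  ones are Lipschitz.\<close>

locale coeff_series =
  fixes m :: nat and s :: real and F :: tser and \<sigma> :: real
  assumes m: "m \<ge> 1" and sm3: "conv_at m 3 s F" and psymF: "\<And>j. psym m \<sigma> (F $ j)"
begin

abbreviation f :: "(nat \<Rightarrow> real) \<Rightarrow> real" where "f x \<equiv> cos_ser m F s 0 x"
abbreviation f1 :: "nat \<Rightarrow> (nat \<Rightarrow> real) \<Rightarrow> real" where "f1 i x \<equiv> - sin_ser m (fmap (Dop i) F) s 0 x"
abbreviation f2 :: "nat \<Rightarrow> nat \<Rightarrow> (nat \<Rightarrow> real) \<Rightarrow> real" where "f2 i j x \<equiv> - cos_ser m (fmap (Dop j) (fmap (Dop i) F)) s 0 x"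
abbreviation f3 :: "nat \<Rightarrow> nat \<Rightarrow> nat \<Rightarrow> (nat \<Rightarrow> real) \<Rightarrow> real" where
  "f3 i j l x \<equiv> sin_ser m (fmap (Dop l) (fmap (Dop j) (fmap (Dop i) F))) s 0 x"

lemma smF: "p \<le> 3 \<Longrightarrow> conv_at m p s F" "i < m \<Longrightarrow> p \<le> 2 \<Longrightarrow> conv_at m p s (fmap (Dop i) F)"
  "i < m \<Longrightarrow> j < m \<Longrightarrow> p \<le> 1 \<Longrightarrow> conv_at m p s (fmap (Dop j) (fmap (Dop i) F))"
  by (auto intro!: conv_at_D intro: conv_at_le[OF sm3])

lemma wnorm_Dop_le: "i < m \<Longrightarrow> Suc p \<le> q \<Longrightarrow> wnorm m p (Dop i h) \<le> wnorm m q h"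
  by (rule order_trans[OF wnorm_Dop wnorm_mono])

lemma bounds:
  "\<bar>f x\<bar> \<le> mass m s F" "i < m \<Longrightarrow> \<bar>f1 i x\<bar> \<le> mass m s F"
  "i < m \<Longrightarrow> j < m \<Longrightarrow> \<bar>f2 i j x\<bar> \<le> mass m s F" "i < m \<Longrightarrow> j < m \<Longrightarrow> l < m \<Longrightarrow> \<bar>f3 i j l x\<bar> \<le> mass m s F"
proof -
  have a: "wnorm m p (fmap (Dop i) G $ j) \<le> wnorm m q (G $ j)" if "i < m" "Suc p \<le> q" for p q G i j
    using wnorm_Dop_le[OF that] by simp
  show "\<bar>f x\<bar> \<le> mass m s F" by (rule mass_bound[OF sm3]) (auto intro: wnorm_mono)
  show "i < m \<Longrightarrow> \<bar>f1 i x\<bar> \<le> mass m s F"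
    unfolding abs_minus_cancel by (rule mass_bound[OF sm3]) (auto intro: wnorm_Dop_le)
  show "i < m \<Longrightarrow> j < m \<Longrightarrow> \<bar>f2 i j x\<bar> \<le> mass m s F"
    unfolding abs_minus_cancel
    by (rule mass_bound[OF sm3]) (auto intro!: order_trans[OF a a[of _ 1 3], simplified])
  show "i < m \<Longrightarrow> j < m \<Longrightarrow> l < m \<Longrightarrow> \<bar>f3 i j l x\<bar> \<le> mass m s F"
    by (rule mass_bound[OF sm3]) (auto intro!: order_trans[OF a[of _ 0 1] order_trans[OF a[of _ 1 2] a[of _ 2 3]], simplified])
qed

lemma conts:
  "continuous_on UNIV f" "i < m \<Longrightarrow> continuous_on UNIV (f1 i)" "i < m \<Longrightarrow> j < m \<Longrightarrow> continuous_on UNIV (f2 i j)"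
proof -
  have cc: "continuous_on UNIV (cos :: real \<Rightarrow> real)" "continuous_on UNIV (sin :: real \<Rightarrow> real)"
    by (intro continuous_intros)+
  show "continuous_on UNIV f" "i < m \<Longrightarrow> continuous_on UNIV (f1 i)" "i < m \<Longrightarrow> j < m \<Longrightarrow> continuous_on UNIV (f2 i j)"
    by (auto intro!: continuous_on_minus continuous_on_ser_eval_comp[where p = 0] smF cc continuous_on_const continuous_on_id)
qed

lemma lines:
  "((\<lambda>r. f (\<lambda>i. x i + r * \<xi> i)) has_real_derivative (\<Sum>i<m. \<xi> i * f1 i (\<lambda>i. x i + r * \<xi> i))) (at r)"
  "i < m \<Longrightarrow> ((\<lambda>r. f1 i (\<lambda>i. x i + r * \<xi> i)) has_real_derivative (\<Sum>j<m. \<xi> j * f2 i j (\<lambda>i. x i + r * \<xi> i))) (at r)"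
  "i < m \<Longrightarrow> j < m \<Longrightarrow> ((\<lambda>r. f2 i j (\<lambda>i. x i + r * \<xi> i)) has_real_derivative (\<Sum>l<m. \<xi> l * f3 i j l (\<lambda>i. x i + r * \<xi> i))) (at r)"
  using cos_ser_deriv_line[OF smF(1), where x = x and \<xi> = \<xi> and r = r and t = 0]
    DERIV_minus[OF sin_ser_deriv_line[OF smF(2), where x = x and \<xi> = \<xi> and r = r and t = 0]]
    DERIV_minus[OF cos_ser_deriv_line[OF smF(3), where x = x and \<xi> = \<xi> and r = r and t = 0]]
  by (simp_all add: sum_negf)

lemma sum_evec: "i < m \<Longrightarrow> (\<Sum>l<m. evec i l * g l) = g i"
  by (simp add: evec_def if_distrib[of "\<lambda>x. x * _"] cong: if_cong)

lemma ddirs: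
  "i < m \<Longrightarrow> ddir f x (evec i) (f1 i x)" "i < m \<Longrightarrow> j < m \<Longrightarrow> ddir (f1 i) x (evec j) (f2 i j x)"
  using lines(1)[of x "evec i" 0] lines(2)[of i x "evec j" 0] unfolding ddir_def by (simp_all only: sum_evec) simp_all

lemma pds: "i < m \<Longrightarrow> pd i f = f1 i" "i < m \<Longrightarrow> j < m \<Longrightarrow> pd j (pd i f) = f2 i j"
proof -
  show 1: "i < m \<Longrightarrow> pd i f = f1 i" for i by (rule ext) (rule pd_ddir[OF ddirs(1)])
  show "i < m \<Longrightarrow> j < m \<Longrightarrow> pd j (pd i f) = f2 i j"
    unfolding 1 by (rule ext) (rule pd_ddir[OF ddirs(2)])
qed

lemma pds': "i < m \<Longrightarrow> j < m \<Longrightarrow> pd j (f1 i) = f2 i j"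
proof -
  assume "i < m" "j < m"
  from pds(2)[OF this] show ?thesis unfolding pds(1)[OF \<open>i < m\<close>] .
qed

lemma Ck2: "Ck m 2 S f"
  by (rule Ck_2_UNIV(1)[where ?f1.0 = f1 and ?f2.0 = f2]) (auto intro: conts ddirs)

lemma f2_Lipschitz:
  assumes i: "i < m" and j: "j < m"
  shows "\<bar>f2 i j x - f2 i j y\<bar> \<le> real m * mass m s F * enorm m (\<lambda>i. x i - y i)"
proof -
  define \<xi> where "\<xi> = (\<lambda>i. x i - y i)"
  let ?d = "\<lambda>r. \<Sum>l<m. \<xi> l * f3 i j l (\<lambda>i. y i + r * \<xi> i)"
  have "\<exists>r. 0 < r \<and> r < (1::real) \<and> f2 i j (\<lambda>i. y i + 1 * \<xi> i) - f2 i j (\<lambda>i. y i + 0 * \<xi> i) = (1 - 0) * ?d r"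
    by (rule MVT2) (auto intro!: lines(3)[OF i j])
  then obtain r where r: "f2 i j x - f2 i j y = ?d r" by (auto simp: \<xi>_def)
  have "\<bar>?d r\<bar> \<le> (\<Sum>l<m. \<bar>\<xi> l * f3 i j l (\<lambda>i. y i + r * \<xi> i)\<bar>)" by (rule sum_abs)
  also have "\<dots> \<le> (\<Sum>l<m. enorm m \<xi> * mass m s F)"
    unfolding abs_mult by (intro sum_mono mult_mono abs_le_enorm bounds i j) (auto simp: enorm_nonneg)
  finally show ?thesis unfolding r \<xi>_def by (simp add: mult_ac)
qed

text \<open>For distances up to 1 the Lipschitz bound suffices since
  \<open>d \<le> d powr \<alpha>\<close>; beyond that the supremum bound does, since
  \<open>1 \<le> d powr \<alpha>\<close>. The constant covers both cases because
  \<open>m \<ge> 1\<close>.\<close>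

lemma f2_Hoelder:
  assumes i: "i < m" and j: "j < m" and \<alpha>: "0 < \<alpha>" "\<alpha> < 1" and q: "q \<in> holder_quotients m \<alpha> (f2 i j)"
  shows "0 \<le> q" "q \<le> 2 * real m * mass m s F"
proof -
  obtain x y where xy: "x \<in> Rn m" "y \<in> Rn m" "x \<noteq> y" "q = \<bar>f2 i j x - f2 i j y\<bar> / enorm m (\<lambda>i. x i - y i) powr \<alpha>"
    using q unfolding holder_quotients_def by blast
  define d where "d = enorm m (\<lambda>i. x i - y i)"
  have d: "d > 0" unfolding d_def by (rule enorm_pos[OF xy(1-3)])
  define N where "N = mass m s F"
  have N: "N \<ge> 0" unfolding N_def by (rule mass_nonneg[OF sm3])
  have "\<bar>f2 i j x - f2 i j y\<bar> \<le> 2 * real m * N * d powr \<alpha>"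
  proof (cases "d \<le> 1")
    case True
    have "d powr 1 \<le> d powr \<alpha>" using True d \<alpha> by (intro powr_mono') auto
    then have "real m * N * d \<le> real m * N * d powr \<alpha>" using d N by (intro mult_left_mono) auto
    moreover have "0 \<le> real m * N * d powr \<alpha>" using N by simp
    ultimately show ?thesis using f2_Lipschitz[OF i j, of x y] unfolding d_def[symmetric] N_def[symmetric] by linarith
  next
    case False
    have "\<bar>f2 i j x - f2 i j y\<bar> \<le> \<bar>f2 i j x\<bar> + \<bar>f2 i j y\<bar>" by (rule abs_triangle_ineq4)
    also have "\<dots> \<le> 2 * N" using bounds(3)[OF i j, of x] bounds(3)[OF i j, of y] by (simp add: N_def)
    also have "\<dots> \<le> (2 * real m * N) * 1" using m N mult_right_mono[of 1 "real m" N] by simp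
    also have "\<dots> \<le> 2 * real m * N * d powr \<alpha>" using False \<alpha> N by (intro mult_left_mono ge_one_powr_ge_zero) auto
    finally show ?thesis .
  qed
  then show "q \<le> 2 * real m * mass m s F"
    unfolding xy(4) d_def[symmetric] N_def[symmetric] using d by (simp add: pos_divide_le_eq)
  show "0 \<le> q" unfolding xy(4) by simp
qed

text \<open>Needed to estimate the supremum of the quotients; two distinct points exist as
  \<open>m \<ge> 1\<close>.\<close>

lemma f2_Hoelder_ne: "holder_quotients m \<alpha> g \<noteq> {}"
proof -
  have "(\<lambda>_. 0) \<in> Rn m" "evec 0 \<in> Rn m" "(\<lambda>_. 0) \<noteq> evec 0"
    using m by (auto simp: topspace_Euclidean_space evec_def fun_eq_iff)
  then show ?thesis unfolding holder_quotients_def by blast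
qed

lemma in_C2a: "0 < \<alpha> \<Longrightarrow> \<alpha> < 1 \<Longrightarrow> f \<in> C2a_pe m \<alpha>"
  unfolding C2a_pe_def periodic_even_def using f2_Hoelder(2)
  by (auto simp: Ck2 pds pds' cos_ser_shift cos_ser_flip[OF psymF] intro!: bdd_aboveI[of _ "2 * real m * mass m s F"])

lemma perm_inv: "perm_invariant m f"
  unfolding perm_invariant_def by (simp add: cos_ser_perm[OF psymF])

lemma sup_norm_bounds:
  assumes "\<And>x. \<bar>g x\<bar> \<le> N"
  shows "0 \<le> sup_norm m g" "sup_norm m g \<le> N"
proof -
  have z: "(\<lambda>_. 0) \<in> Rn m" by (simp add: topspace_Euclidean_space)
  have "\<bar>g (\<lambda>_. 0)\<bar> \<le> sup_norm m g"
    unfolding sup_norm_def using assms by (intro cSUP_upper z bdd_aboveI[of _ N]) auto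
  then show "0 \<le> sup_norm m g" by linarith
  show "sup_norm m g \<le> N" unfolding sup_norm_def using z assms by (intro cSUP_least) auto
qed

text \<open>The lower bound lets the absolute value be dropped when the norm of a difference
  quotient is shown to tend to 0.\<close>

lemma C2a_norm_bounds:
  assumes \<alpha>: "0 < \<alpha>" "\<alpha> < 1"
  shows "0 \<le> C2a_norm m \<alpha> f" "C2a_norm m \<alpha> f \<le> (1 + real m + real m * (real m * (1 + 2 * real m))) * mass m s F"
proof -
  define N where "N = mass m s F"
  have a: "0 \<le> Sup (holder_quotients m \<alpha> (f2 i j))" "Sup (holder_quotients m \<alpha> (f2 i j)) \<le> 2 * real m * N" if "i < m" "j < m" for i j
  proof -
    obtain q where q: "q \<in> holder_quotients m \<alpha> (f2 i j)" using f2_Hoelder_ne by blast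
    have "q \<le> Sup (holder_quotients m \<alpha> (f2 i j))"
      using f2_Hoelder(2)[OF that \<alpha>] by (intro cSup_upper q bdd_aboveI)
    then show "0 \<le> Sup (holder_quotients m \<alpha> (f2 i j))" using f2_Hoelder(1)[OF that \<alpha> q] by linarith
    show "Sup (holder_quotients m \<alpha> (f2 i j)) \<le> 2 * real m * N"
      unfolding N_def by (intro cSup_least f2_Hoelder_ne f2_Hoelder(2)[OF that \<alpha>])
  qed
  have e: "C2a_norm m \<alpha> f = sup_norm m f + (\<Sum>i<m. sup_norm m (f1 i)) +
     (\<Sum>i<m. \<Sum>j<m. sup_norm m (f2 j i) + Sup (holder_quotients m \<alpha> (f2 j i)))"
    unfolding C2a_norm_def by (intro arg_cong2[where f = "(+)"] sum.cong refl) (simp_all add: pds pds')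
  show "0 \<le> C2a_norm m \<alpha> f"
    unfolding e by (intro add_nonneg_nonneg sum_nonneg a(1) sup_norm_bounds(1)[OF bounds(1)] sup_norm_bounds(1)[OF bounds(2)]
        sup_norm_bounds(1)[OF bounds(3)]) auto
  have "C2a_norm m \<alpha> f \<le> N + (\<Sum>i<m. N) + (\<Sum>i<m. \<Sum>j<m. N + 2 * real m * N)"
    unfolding e N_def by (intro add_mono sum_mono a(2)[unfolded N_def] sup_norm_bounds(2)[OF bounds(1)] sup_norm_bounds(2)[OF bounds(2)]
        sup_norm_bounds(2)[OF bounds(3)]) auto
  then show "C2a_norm m \<alpha> f \<le> (1 + real m + real m * (real m * (1 + 2 * real m))) * mass m s F"
    by (simp add: N_def algebra_simps)
qed

end

section \<open>Termwise differentiation in s\<close>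

lemma summable_weighted:
  fixes a :: "nat \<Rightarrow> real"
  assumes "\<And>s. \<bar>s\<bar> < \<rho> \<Longrightarrow> summable (\<lambda>j. s ^ j * a j)" "\<bar>s\<bar> < \<rho>"
  shows "summable (\<lambda>j. s ^ j * (real (Suc j) * a (Suc j)))"
proof -
  have "summable (\<lambda>j. diffs a j * s ^ j)"
    using assms by (intro termdiff_converges[where K = \<rho>]) (auto simp: mult.commute)
  then show ?thesis by (simp add: diffs_def mult_ac)
qed

lemma psym_of_nat: "psym m \<sigma> f \<Longrightarrow> psym m \<sigma> (of_nat k * f)"
  by (induction k) (auto simp: distrib_right intro: psym_add)

lemma wnorm_of_nat: "wnorm m p (of_nat k * f) \<le> real k * wnorm m p (f :: tpoly)"
proof (induction k)
  case (Suc k)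
  then show ?case using wnorm_add[of m p f "of_nat k * f"] by (simp add: distrib_right)
qed simp

lemma conv_at_fps_deriv:
  assumes "\<And>s. \<bar>s\<bar> < \<rho> \<Longrightarrow> conv_at m p s F" "\<bar>s\<bar> < \<rho>"
  shows "conv_at m p s (fps_deriv F)"
  unfolding conv_at_def
proof (rule summable_comparison_test')
  show "summable (\<lambda>j. \<bar>s\<bar> ^ j * (real (Suc j) * wnorm m p (F $ Suc j)))"
  proof (rule summable_weighted[where \<rho> = \<rho>])
    fix r :: real assume "\<bar>r\<bar> < \<rho>"
    from assms(1)[OF this] show "summable (\<lambda>j. r ^ j * wnorm m p (F $ j))"
      unfolding conv_at_def by (rule summable_norm_cancel[OF summable_comparison_test']) (auto simp: abs_mult power_abs)
  qed (use assms(2) in auto)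
  show "norm (\<bar>s\<bar> ^ j * wnorm m p (fps_deriv F $ j)) \<le> \<bar>s\<bar> ^ j * (real (Suc j) * wnorm m p (F $ Suc j))" for j
    using wnorm_of_nat[of m p "Suc j" "F $ Suc j"] by (simp add: abs_mult mult_left_mono del: of_nat_Suc)
qed

text \<open>The difference quotients of the curve are again series of this kind, evaluated at \<open>s = 1\<close>. Thus one bound of the
  Hoelder norm serves for the curve and for its difference quotients.\<close>

definition scaled_ser :: "(nat \<Rightarrow> real) \<Rightarrow> tser \<Rightarrow> tser" where
  "scaled_ser q F = Abs_fps (\<lambda>j. sng 0 (of_real (q j)) * F $ j)"

lemma psym_scaled_ser: "psym m \<sigma> (F $ j) \<Longrightarrow> psym m \<sigma> (scaled_ser q F $ j)"
  using psym_mult[OF psym_sng_0[of "of_real (q j)" 1], of m \<sigma> "F $ j"] by (simp add: scaled_ser_def)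

lemma wnorm_scaled_ser: "wnorm m p (scaled_ser q F $ j) \<le> \<bar>q j\<bar> * wnorm m p (F $ j)"
  using wnorm_mult[of m p "sng 0 (of_real (q j))" "F $ j"] by (simp add: scaled_ser_def wnorm_sng)

lemma cos_ser_scaled_ser: "cos_ser m (scaled_ser q F) 1 t x = (\<Sum>j. q j * cos_poly m (F $ j) t x)"
  by (simp add: ser_eval_def scaled_ser_def cos_poly_times trig_eval_sng)

lemma mass_scaled_ser:
  assumes "summable (\<lambda>j. \<bar>q j\<bar> * wnorm m 3 (F $ j))"
  shows "conv_at m 3 1 (scaled_ser q F)" "mass m 1 (scaled_ser q F) \<le> (\<Sum>j. \<bar>q j\<bar> * wnorm m 3 (F $ j))"
proof -
  show 1: "conv_at m 3 1 (scaled_ser q F)"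
    unfolding conv_at_def by (rule summable_comparison_test'[OF assms, of 0]) (simp add: wnorm_scaled_ser)
  show "mass m 1 (scaled_ser q F) \<le> (\<Sum>j. \<bar>q j\<bar> * wnorm m 3 (F $ j))"
    unfolding mass_def using 1 assms by (intro suminf_le) (auto simp: wnorm_scaled_ser conv_at_def)
qed

definition diff_coeff :: "real \<Rightarrow> real \<Rightarrow> nat \<Rightarrow> real" where
  "diff_coeff r s j = (r ^ j - s ^ j) / (r - s) - real j * s ^ (j - 1)"

lemma cos_ser_difference_quotient:
  assumes conv_at: "\<And>s. \<bar>s\<bar> < \<rho> \<Longrightarrow> conv_at m 3 s F" and s: "\<bar>s\<bar> < \<rho>" and r: "\<bar>r\<bar> < \<rho>"
  shows "(cos_ser m F r t x - cos_ser m F s t x) / (r - s) - cos_ser m (fps_deriv F) s t x = cos_ser m (scaled_ser (diff_coeff r s) F) 1 t x"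
proof -
  have S: "(\<lambda>j. s ^ j * cos_poly m (F $ j) t x) sums cos_ser m F s t x" if "\<bar>s\<bar> < \<rho>" for s
    unfolding ser_eval_def by (intro summable_sums ser_eval_summable[OF cs_le_1(1) conv_at[OF that]])
  have D: "cos_poly m (of_nat k * f) t x = real k * cos_poly m f t x" for k and f :: tpoly
    by (induction k) (simp_all add: distrib_right trig_eval_add)
  have "(\<lambda>j. s ^ j * cos_poly m (fps_deriv F $ j) t x) sums cos_ser m (fps_deriv F) s t x"
    unfolding ser_eval_def by (intro summable_sums ser_eval_summable[OF cs_le_1(1) conv_at_fps_deriv[OF conv_at s]])
  then have "(\<lambda>j. real (Suc j) * s ^ (Suc j - 1) * cos_poly m (F $ Suc j) t x) sums cos_ser m (fps_deriv F) s t x"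
    using D[of "Suc _"] by (simp add: mult_ac del: of_nat_Suc)
  from sums_Suc[OF this] have S': "(\<lambda>j. real j * s ^ (j - 1) * cos_poly m (F $ j) t x) sums cos_ser m (fps_deriv F) s t x" by simp
  have "(\<lambda>j. (r ^ j * cos_poly m (F $ j) t x - s ^ j * cos_poly m (F $ j) t x) / (r - s) - real j * s ^ (j - 1) * cos_poly m (F $ j) t x) sums
      ((cos_ser m F r t x - cos_ser m F s t x) / (r - s) - cos_ser m (fps_deriv F) s t x)"
    by (intro sums_diff sums_divide S S' s r)
  then show ?thesis
    unfolding cos_ser_scaled_ser diff_coeff_def by (simp add: sums_iff algebra_simps diff_divide_distrib)
qed

lemma diff_coeff_bound:
  assumes "\<bar>s\<bar> \<le> K" "\<bar>r\<bar> \<le> K" "r \<noteq> s"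
  shows "\<bar>diff_coeff r s j\<bar> \<le> real j * real (j - 1) * K ^ (j - 2) * \<bar>r - s\<bar>"
  using lemma_termdiff3[of "r - s" s K j] assms by (simp add: diff_coeff_def)

text \<open>A radius \<open>K\<close> strictly between \<open>\<bar>s\<bar>\<close> and
  \<open>\<rho>\<close> makes the twice differentiated majorant converge at \<open>K\<close>; the
  second-order Taylor bound for monomials then gives a remainder linear in
  \<open>r - s\<close>.\<close>

lemma diff_coeff_mass_tendsto:
  assumes conv_at: "\<And>s. \<bar>s\<bar> < \<rho> \<Longrightarrow> conv_at m 3 s F" and s: "\<bar>s\<bar> < \<rho>"
  shows "\<exists>C. \<forall>\<^sub>F r in at s. \<bar>r\<bar> < \<rho> \<and> conv_at m 3 1 (scaled_ser (diff_coeff r s) F) \<and> mass m 1 (scaled_ser (diff_coeff r s) F) \<le> C * \<bar>r - s\<bar>"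
proof -
  obtain K where K: "\<bar>s\<bar> < K" "K < \<rho>" using dense[OF s] by blast
  define b where "b = (\<lambda>j. real j * real (j - 1) * K ^ (j - 2) * wnorm m 3 (F $ j))"
  have 0: "summable (\<lambda>j. r ^ j * wnorm m 3 (F $ j))" if "\<bar>r\<bar> < \<rho>" for r
    using conv_at[OF that] unfolding conv_at_def by (rule summable_norm_cancel[OF summable_comparison_test']) (auto simp: abs_mult power_abs)
  have "summable (\<lambda>j. K ^ j * (real (Suc j) * (real (Suc (Suc j)) * wnorm m 3 (F $ Suc (Suc j)))))"
    using K by (intro summable_weighted[where \<rho> = \<rho> and a = "\<lambda>j. real (Suc j) * wnorm m 3 (F $ Suc j)"] summable_weighted[where \<rho> = \<rho>] 0) auto
  then have "summable (\<lambda>j. b (j + 2))" by (simp add: b_def mult_ac)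
  then have b: "summable b" unfolding summable_iff_shift .
  have "\<forall>\<^sub>F r in at s. \<bar>r\<bar> < K"
    using K(1) by (intro order_tendstoD(2)[OF tendsto_rabs[OF tendsto_ident_at]])
  moreover have "\<forall>\<^sub>F r in at s. r \<noteq> s" by (simp add: eventually_at_filter)
  ultimately have "\<forall>\<^sub>F r in at s. \<bar>r\<bar> < \<rho> \<and> conv_at m 3 1 (scaled_ser (diff_coeff r s) F) \<and> mass m 1 (scaled_ser (diff_coeff r s) F) \<le> (\<Sum>j. b j) * \<bar>r - s\<bar>"
  proof eventually_elim
    case (elim r)
    have le: "\<bar>diff_coeff r s j\<bar> * wnorm m 3 (F $ j) \<le> b j * \<bar>r - s\<bar>" for j
      using mult_right_mono[OF diff_coeff_bound[of s K r j], of "wnorm m 3 (F $ j)"] elim K by (simp add: b_def mult_ac)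
    have S: "summable (\<lambda>j. \<bar>diff_coeff r s j\<bar> * wnorm m 3 (F $ j))"
      by (rule summable_comparison_test'[OF summable_mult2[OF b], of 0]) (use le in \<open>auto simp: abs_mult\<close>)
    have "mass m 1 (scaled_ser (diff_coeff r s) F) \<le> (\<Sum>j. \<bar>diff_coeff r s j\<bar> * wnorm m 3 (F $ j))" by (rule mass_scaled_ser[OF S])
    also have "\<dots> \<le> (\<Sum>j. b j * \<bar>r - s\<bar>)" by (rule suminf_le[OF le S summable_mult2[OF b]])
    also have "\<dots> = (\<Sum>j. b j) * \<bar>r - s\<bar>" by (rule suminf_mult2[OF b, symmetric])
    finally show ?case using elim K mass_scaled_ser(1)[OF S] by auto
  qed
  then show ?thesis by blast
qed

lemma conv_at_fps_deriv_pow: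
  "(\<And>s. \<bar>s\<bar> < \<rho> \<Longrightarrow> conv_at m p s F) \<Longrightarrow> \<bar>s\<bar> < \<rho> \<Longrightarrow> conv_at m p s ((fps_deriv ^^ k) F)"
  by (induction k arbitrary: s) (auto intro: conv_at_fps_deriv)

lemma psym_fps_deriv_pow: "(\<And>j. psym m \<sigma> (F $ j)) \<Longrightarrow> psym m \<sigma> ((fps_deriv ^^ k) F $ j)"
  by (induction k arbitrary: j) (auto intro: psym_of_nat simp del: of_nat_Suc of_nat_add)

text \<open>The \<open>k\<close>-th derivative is the \<open>k\<close>-th formal derivative,
  evaluated; all of them converge on the same open interval, so one differentiation step serves
  every \<open>k\<close>.\<close>

lemma smooth_curve_series:
  assumes m: "m \<ge> 1" and \<alpha>: "0 < \<alpha>" "\<alpha> < 1"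
    and F: "\<And>s. \<bar>s\<bar> < \<rho> \<Longrightarrow> conv_at m 3 s F" and G: "\<And>s. \<bar>s\<bar> < \<rho> \<Longrightarrow> conv_at m 3 s G"
    and ps: "\<And>j. psym m \<sigma> (F $ j)"
  shows "smooth_curve m \<alpha> {-\<rho><..<\<rho>} (\<lambda>s. cos_ser m G s 0 (\<lambda>_. 0)) (\<lambda>s x. cos_ser m F s 0 x)"
  unfolding smooth_curve_def
proof (intro exI conjI allI ballI)
  fix k s assume "s \<in> {-\<rho><..<\<rho>}"
  then have s: "\<bar>s\<bar> < \<rho>" by auto
  let ?F = "(fps_deriv ^^ k) F" and ?G = "(fps_deriv ^^ k) G"
  have Fk: "conv_at m 3 s ?F" and Gk: "conv_at m 3 s ?G" if "\<bar>s\<bar> < \<rho>" for s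
    using conv_at_fps_deriv_pow[OF F that] conv_at_fps_deriv_pow[OF G that] by auto
  interpret coeff_series m s ?F \<sigma>
    by unfold_locales (rule m, rule Fk[OF s], intro psym_fps_deriv_pow ps)
  show "f \<in> C2a_pe m \<alpha>" by (rule in_C2a[OF \<alpha>])
  show "perm_invariant m f" by (rule perm_inv)
  show "((\<lambda>s. cos_ser m ?G s 0 (\<lambda>_. 0)) has_real_derivative cos_ser m ((fps_deriv ^^ Suc k) G) s 0 (\<lambda>_. 0)) (at s)"
  proof -
    obtain C where C: "\<forall>\<^sub>F r in at s. \<bar>r\<bar> < \<rho> \<and> conv_at m 3 1 (scaled_ser (diff_coeff r s) ?G) \<and> mass m 1 (scaled_ser (diff_coeff r s) ?G) \<le> C * \<bar>r - s\<bar>"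
      using diff_coeff_mass_tendsto[OF Gk s] by blast
    have "((\<lambda>r. (cos_ser m ?G r 0 (\<lambda>_. 0) - cos_ser m ?G s 0 (\<lambda>_. 0)) / (r - s) - cos_ser m (fps_deriv ?G) s 0 (\<lambda>_. 0)) \<longlongrightarrow> 0) (at s)"
    proof (rule Lim_null_comparison)
      show "\<forall>\<^sub>F r in at s. norm ((cos_ser m ?G r 0 (\<lambda>_. 0) - cos_ser m ?G s 0 (\<lambda>_. 0)) / (r - s) - cos_ser m (fps_deriv ?G) s 0 (\<lambda>_. 0)) \<le> C * \<bar>r - s\<bar>"
        using C
      proof eventually_elim
        case (elim r)
        then have r: "\<bar>r\<bar> < \<rho>" by simp
        have "\<bar>cos_ser m (scaled_ser (diff_coeff r s) ?G) 1 0 (\<lambda>_. 0)\<bar> \<le> mass m 1 (scaled_ser (diff_coeff r s) ?G)"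
          using elim by (intro mass_bound) (auto intro: wnorm_mono)
        then show ?case using elim cos_ser_difference_quotient[OF Gk s r, of 0 "\<lambda>_. 0"] by simp
      qed
      show "((\<lambda>r. C * \<bar>r - s\<bar>) \<longlongrightarrow> 0) (at s)" by (rule tendsto_eq_intros refl | simp)+
    qed
    then show ?thesis unfolding has_field_derivative_iff by (simp add: LIM_zero_iff)
  qed
  show "((\<lambda>r. C2a_norm m \<alpha> (\<lambda>x. (cos_ser m ?F r 0 x - cos_ser m ?F s 0 x) / (r - s) - cos_ser m ((fps_deriv ^^ Suc k) F) s 0 x)) \<longlongrightarrow> 0) (at s)"
  proof -
    let ?c = "1 + real m + real m * (real m * (1 + 2 * real m))"
    obtain C where C: "\<forall>\<^sub>F r in at s. \<bar>r\<bar> < \<rho> \<and> conv_at m 3 1 (scaled_ser (diff_coeff r s) ?F) \<and> mass m 1 (scaled_ser (diff_coeff r s) ?F) \<le> C * \<bar>r - s\<bar>"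
      using diff_coeff_mass_tendsto[OF Fk s] by blast
    show ?thesis
    proof (rule Lim_null_comparison)
      show "\<forall>\<^sub>F r in at s. norm (C2a_norm m \<alpha> (\<lambda>x. (cos_ser m ?F r 0 x - cos_ser m ?F s 0 x) / (r - s) - cos_ser m ((fps_deriv ^^ Suc k) F) s 0 x)) \<le> ?c * (C * \<bar>r - s\<bar>)"
        using C
      proof eventually_elim
        case (elim r)
        then have r: "\<bar>r\<bar> < \<rho>" by simp
        interpret Q: coeff_series m 1 "scaled_ser (diff_coeff r s) ?F" \<sigma>
          by unfold_locales (rule m, use elim in simp, intro psym_scaled_ser psym_fps_deriv_pow ps)
        have "?c * mass m 1 (scaled_ser (diff_coeff r s) ?F) \<le> ?c * (C * \<bar>r - s\<bar>)"
          using elim by (intro mult_left_mono) auto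
        then show ?case
          using Q.C2a_norm_bounds[OF \<alpha>] by (simp add: cos_ser_difference_quotient[OF Fk s r])
      qed
      show "((\<lambda>r. ?c * (C * \<bar>r - s\<bar>)) \<longlongrightarrow> 0) (at s)" by (rule tendsto_eq_intros refl | simp)+
    qed
  qed
qed simp_all

section \<open>The bifurcating family\<close>

lemma ser_eval_bounded:
  assumes g: "\<And>r. \<bar>g r\<bar> \<le> 1" and R: "\<And>J. jet_norm m p \<rho> J F \<le> R" and s: "\<bar>s\<bar> \<le> \<rho>"
  shows "\<bar>ser_eval g m F s t x\<bar> \<le> R"
proof -
  have conv_at: "conv_at m p s F" by (rule conv_at_jet_norm[OF R s])
  have "\<bar>ser_eval g m F s t x\<bar> \<le> (\<Sum>j. \<bar>s\<bar> ^ j * wnorm m p (F $ j))" by (rule ser_eval_bound[OF g conv_at])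
  also have "\<dots> \<le> R"
    using conv_at by (intro suminf_le_const order_trans[OF sum_power_wnorm_le_jet_norm[OF s] R]) (simp add: conv_at_def)
  finally show ?thesis .
qed

lemma ser_eval_at_0: "ser_eval g m F 0 t x = trig_eval g m (F $ 0) t x"
proof -
  have "(\<lambda>j. 0 ^ j * trig_eval g m (F $ j) t x) sums (\<Sum>j\<in>{0}. 0 ^ j * trig_eval g m (F $ j) t x)"
    by (rule sums_finite) auto
  then show ?thesis by (simp add: ser_eval_def sums_iff)
qed

lemma cos_poly_theta_poly: "cos_poly m (theta_poly m) t x = theta m x" and sin_poly_theta_poly: "sin_poly m (theta_poly m) t x = 0"
proof -
  have d: "dotp m (unit i) x = x i" "dotp m (- unit i) x = - x i" if "i < m" for i
    using that by (simp_all add: dotp_def unit_def if_distrib[of of_int] if_distrib[of "\<lambda>r. r * _"] sum_negf cong: if_cong)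
  show "cos_poly m (theta_poly m) t x = theta m x" "sin_poly m (theta_poly m) t x = 0"
    unfolding theta_poly_def theta_def trig_eval_sum trig_eval_add trig_eval_sng by (simp_all add: d)
qed

lemma cos_poly_base_CY:
  assumes "\<bar>t\<bar> \<le> 1"
  shows "cos_poly m (base n m CY $ 0) t x = (sin (pi * t / 2) - (-1) ^ n * t * cos (real n * pi * t)) * theta m x"
proof -
  have t: "clamp1 t = t" using assms by (intro clamp1_id) auto
  have TH: "cos_ser m (TH m) 0 t x = theta m x" "sin_ser m (TH m) 0 t x = 0"
    by (simp_all add: TH_def ser_eval_fps_const cos_poly_theta_poly sin_poly_theta_poly)
  have s: "conv_at m 0 0 (cst Tid * cst (Tv1 n))" "conv_at m 0 0 (cst Tphi - cst Tid * cst (Tv1 n))" "conv_at m 0 0 (TH m)"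
    unfolding TH_def by (intro conv_at_diff conv_at_times conv_at_cst conv_at_const)+
  have "cos_poly m (base n m CY $ 0) t x = cos_ser m ((cst Tphi - cst Tid * cst (Tv1 n)) * TH m) 0 t x"
    by (simp add: ser_eval_at_0)
  also have "\<dots> = (apply_bcontfun Tphi t - apply_bcontfun Tid t * apply_bcontfun (Tv1 n) t) * theta m x"
    unfolding cos_ser_times[OF s(2,3)] TH ser_eval_diff[OF cs_le_1(1) conv_at_cst[of m 0 0] s(1)]
      cos_ser_times[OF conv_at_cst[of m 0 0] conv_at_cst[of m 0 0]] by simp
  also have "\<dots> = (sin (pi * t / 2) - (-1) ^ n * t * cos (real n * pi * t)) * theta m x"
    by (simp add: apply_T t mult_ac)
  finally show ?thesis .
qed

lemma psym_fps_times:
  assumes "\<And>j. psym m \<sigma> (F $ j)" "\<And>j. psym m \<tau> (G $ j)"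
  shows "psym m (\<sigma> * \<tau>) ((F * G) $ j)"
  unfolding fps_mult_nth by (intro psym_sum psym_mult assms)

lemma psym_1: "psym m 1 1"
  using psym_sng_0[of 1 1 m] by simp

lemma unif_little_oI:
  assumes "\<delta> > 0" "\<And>s p. \<bar>s\<bar> < \<delta> \<Longrightarrow> p \<in> S \<Longrightarrow> \<bar>r s p\<bar> \<le> \<bar>s\<bar> * (\<bar>s\<bar> * C)"
  shows "unif_little_o S r"
  unfolding unif_little_o_def
proof (intro allI impI)
  fix \<epsilon> :: real assume \<epsilon>: "\<epsilon> > 0"
  define \<delta>' where "\<delta>' = min \<delta> (\<epsilon> / (\<bar>C\<bar> + 1))"
  have "\<delta>' > 0" using assms(1) \<epsilon> by (simp add: \<delta>'_def)
  then have "\<forall>\<^sub>F s in nhds 0. \<bar>s\<bar> < \<delta>'"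
    unfolding eventually_nhds_metric by (auto simp: dist_real_def)
  then show "\<forall>\<^sub>F s in nhds 0. \<forall>p\<in>S. \<bar>r s p\<bar> \<le> \<epsilon> * \<bar>s\<bar>"
  proof eventually_elim
    case (elim s)
    have "\<bar>s\<bar> * (\<bar>C\<bar> + 1) \<le> \<epsilon>" using elim by (simp add: \<delta>'_def pos_less_divide_eq less_imp_le)
    moreover have "\<bar>s\<bar> * C \<le> \<bar>s\<bar> * (\<bar>C\<bar> + 1)" by (intro mult_left_mono) auto
    ultimately have "\<bar>s\<bar> * (\<bar>s\<bar> * C) \<le> \<bar>s\<bar> * \<epsilon>" by (intro mult_left_mono) auto
    then show ?case using assms(2)[of s] elim by (auto simp: \<delta>'_def mult.commute intro: order_trans)
  qed
qed

locale sol_family =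
  fixes n m :: nat and H :: "comp \<Rightarrow> tser" and \<rho> R :: real
  assumes n: "n \<ge> 1" and m: "m \<ge> 1" and \<rho>: "\<rho> > 0"
    and eqA: "H Mu * H Mu * (rc (lam n) * H CY2) - fmap (Eop m) (H CY) + H Mu * H Mu * H CY
       - H Mu * H Mu * (H Eta + H Eta) * cst (Tv n) - cst Tid * cst (Tv1 n) * fmap (Eop m) (H Eta)
       + fps_X * Kop n m H = 0"
    and eqB: "fmap aop (rc (lam n) * (H Mu * H Mu) * ((H CY1 + H Eta) + (H CY1 + H Eta)) + fps_X * Kbop n m H) = 0"
    and eqC: "fmap aop (H CY) = 0"
    and psymH: "\<And>c j. psym m (cpar c) (H c $ j)"
    and inbH: "\<And>J. jets_bounded m \<rho> J R H"
    and baseH: "\<And>c. H c $ 0 = base n m c $ 0"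
    and Tsp1: "t_deriv (H CY) (H CY1)" and Tsp2: "t_deriv (H CY1) (H CY2)"
    and Mu_const: "\<And>j. \<exists>r. H Mu $ j = sng 0 (of_real r)"
    and Eta_const: "\<And>j k. \<exists>r. cf (H Eta $ j) k = of_real r"
begin

lemma NJH: "jet_norm m (cord c) \<rho> J (H c) \<le> R"
  using inbH by (auto simp: jets_bounded_def)

lemma R_nonneg: "0 \<le> R"
  using order_trans[OF jet_norm_nonneg[of \<rho> m "cord Mu" 0 "H Mu"] NJH[of Mu 0]] \<rho> by simp

lemma sol_at: "\<bar>s\<bar> \<le> \<rho> \<Longrightarrow> sol_at n m H s"
proof -
  assume s: "\<bar>s\<bar> \<le> \<rho>"
  show ?thesis
    by unfold_locales (fact n m eqA eqB eqC psymH Tsp1 Tsp2 Mu_const Eta_const conv_at_jet_norm[OF NJH s])+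
qed

lemma H_bound: "\<bar>s\<bar> \<le> \<rho> \<Longrightarrow> \<bar>cos_ser m (H c) s t x\<bar> \<le> R"
  by (rule ser_eval_bounded[OF _ NJH]) simp_all

lemma H_tail: "\<bar>s\<bar> \<le> \<rho> \<Longrightarrow> \<bar>cos_ser m (H c) s t x - cos_poly m (base n m c $ 0) t x\<bar> \<le> \<bar>s\<bar> * (R / \<rho>)"
  unfolding baseH[symmetric] by (rule ser_eval_tail[OF _ NJH]) (simp_all add: \<rho>)

section \<open>Parameter and profile as series, and the length of the interval\<close>

definition sMu :: tser where "sMu = H Mu * H Mu"
text \<open>The profile \<open>a M (1 + s \<eta>)\<close> formed at the level of series, so that the
  smoothness result for convergent series applies to it directly.\<close>

definition sh :: tser where "sh = rc (sqrt (lam n)) * (H Mu * (1 + fps_X * H Eta))"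

definition mu :: "real \<Rightarrow> real" where "mu s = cos_ser m sMu s 0 (\<lambda>_. 0)"
definition hs :: "real \<Rightarrow> (nat \<Rightarrow> real) \<Rightarrow> real" where "hs s x = cos_ser m sh s 0 x"

lemma sms: "\<bar>s\<bar> \<le> \<rho> \<Longrightarrow> conv_at m 3 s sMu" "\<bar>s\<bar> \<le> \<rho> \<Longrightarrow> conv_at m 3 s sh"
  using conv_at_jet_norm[OF NJH[of Mu]] conv_at_jet_norm[OF NJH[of Eta]] unfolding sMu_def sh_def
  by (auto intro!: conv_at_times conv_at_add)

lemma psym_sh: "psym m 1 (sh $ j)"
proof -
  have c: "psym m 1 (rc r $ j)" for r j
    by (simp add: cst_def psym_sng_0)
  have X: "psym m 1 (fps_X $ j)" and 1: "psym m 1 ((1 :: tser) $ j)" for j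
    by (simp_all add: psym_1)
  have "psym m 1 ((fps_X * H Eta) $ j)" for j
    using psym_fps_times[of m 1 fps_X 1 "H Eta" j] X psymH[of Eta] by simp
  then have "psym m 1 ((1 + fps_X * H Eta) $ j)" for j
    using psym_add[OF 1, of "(fps_X * H Eta) $ j" j] by simp
  then have "psym m 1 ((H Mu * (1 + fps_X * H Eta)) $ j)" for j
    using psym_fps_times[of m 1 "H Mu" 1 "1 + fps_X * H Eta" j] psymH[of Mu] by simp
  then show ?thesis
    using psym_fps_times[of m 1 "rc (sqrt (lam n))" 1 "H Mu * (1 + fps_X * H Eta)" j] c unfolding sh_def by simp
qed

lemma mu_eq: "\<bar>s\<bar> \<le> \<rho> \<Longrightarrow> mu s = (sol_at.Ms m H s)\<^sup>2"
  and hs_eq: "\<bar>s\<bar> \<le> \<rho> \<Longrightarrow> hs s = sol_at.hh n m H s"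
proof -
  assume s: "\<bar>s\<bar> \<le> \<rho>"
  interpret S: sol_at n m H s by (rule sol_at[OF s])
  show "mu s = S.Ms\<^sup>2"
    by (simp add: mu_def sMu_def cos_ser_good_times S.good_H power2_eq_square)
  have "good m s (1 + fps_X * H Eta)" by (intro good_add good_times good_X good_1 S.good_H)
  then have "hs s x = S.hh x" for x
    unfolding hs_def sh_def S.hh_def S.hc_def
    by (simp add: cos_ser_good_times good_times good_cst S.good_H cos_ser_good_add good_1 good_X)
  then show "hs s = S.hh" by (rule ext)
qed

text \<open>The second bound gives \<open>\<bar>s\<bar> * R < 1\<close>, hence positivity of
  \<open>1 + s * \<eta>\<close> and of the derivative \<open>1 + s * Y'\<close> at
  \<open>t = 1\<close>; the third keeps \<open>M\<close> within \<open>M0 n\<close> of its initial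
  value, hence positive.\<close>

definition \<delta> :: real where "\<delta> = min \<rho> (min (1 / (R + 1)) (M0 n * \<rho> / (R + 1)))"

lemma M0_pos: "M0 n > 0"
  using mu0_pos[OF n] by (simp add: M0_def)

lemma \<delta>_pos: "\<delta> > 0"
  using \<rho> R_nonneg M0_pos by (auto simp: \<delta>_def)

lemma \<delta>_le: "\<bar>s\<bar> < \<delta> \<Longrightarrow> \<bar>s\<bar> \<le> \<rho>"
  by (simp add: \<delta>_def)

lemma small: "\<bar>s\<bar> < \<delta> \<Longrightarrow> \<bar>s\<bar> * R < 1" "\<bar>s\<bar> < \<delta> \<Longrightarrow> \<bar>s\<bar> * (R / \<rho>) < M0 n"
proof -
  assume s: "\<bar>s\<bar> < \<delta>"
  have "\<bar>s\<bar> * (R + 1) < 1" "\<bar>s\<bar> * (R + 1) < M0 n * \<rho>"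
    using s R_nonneg by (simp_all add: \<delta>_def pos_less_divide_eq)
  moreover have "\<bar>s\<bar> * R \<le> \<bar>s\<bar> * (R + 1)" by (intro mult_left_mono) auto
  ultimately show "\<bar>s\<bar> * R < 1" "\<bar>s\<bar> * (R / \<rho>) < M0 n"
    using \<rho> by (auto simp: pos_divide_less_eq)
qed

lemma Ms_close: "\<bar>s\<bar> \<le> \<rho> \<Longrightarrow> \<bar>sol_at.Ms m H s - M0 n\<bar> \<le> \<bar>s\<bar> * (R / \<rho>)"
  using H_tail[of s Mu 0 "\<lambda>_. 0"] by (simp add: sol_at.Ms_def[OF sol_at] cst_def trig_eval_sng)

lemma ec_close: "\<bar>s\<bar> \<le> \<rho> \<Longrightarrow> \<bar>sol_at.ec m H s x - theta m x\<bar> \<le> \<bar>s\<bar> * (R / \<rho>)"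
  using H_tail[of s Eta 0 x] by (simp add: sol_at.ec_def[OF sol_at] TH_def cos_poly_theta_poly)

lemma sol_pos: "\<bar>s\<bar> < \<delta> \<Longrightarrow> sol_pos n m H s"
proof -
  assume s: "\<bar>s\<bar> < \<delta>"
  note s' = \<delta>_le[OF s]
  interpret S: sol_at n m H s by (rule sol_at[OF s'])
  have *: "\<bar>s * cos_ser m (H c) s t x\<bar> < 1" for c t x
    using small(1)[OF s] mult_left_mono[OF H_bound[OF s', of c t x], of "\<bar>s\<bar>"] by (simp add: abs_mult)
  show ?thesis
  proof unfold_locales
    show "1 + s * S.ec x > 0" for x using *[of Eta 0 x] by (simp add: abs_less_iff)
    show "S.Ms > 0" using Ms_close[OF s'] small(2)[OF s] by linarith
    show "S.Wt 1 x > 0" for x using *[of CY1 1 x] by (simp add: S.Wt_def S.v_1)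
  qed
qed

lemma mu_0: "mu 0 = mu0 n"
proof -
  have "sol_at.Ms m H 0 = M0 n" using Ms_close[of 0] \<rho> by simp
  then show ?thesis using mu_eq[of 0] \<rho> mu0_pos[OF n] by (simp add: M0_def)
qed

lemma sqrt_lam: "sqrt (lam n) = 1 / (real n * pi)"
  using n by (simp add: lam_def real_sqrt_divide)

text \<open>The leading term contains the actual \<open>mu s\<close>, so after it is removed a
  factor \<open>s\<close> is left in front of differences that are themselves of order
  \<open>s\<close>: those of \<open>\<eta>\<close> from theta and of \<open>M\<close> from
  \<open>M0 n\<close>.\<close>

lemma hs_expansion:
  "unif_little_o S (\<lambda>s x. hs s x - (sqrt (lam n) * sqrt (mu s) + s * (sqrt (lam n) * M0 n) * theta m x))"
proof (rule unif_little_oI[OF \<delta>_pos])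
  fix s x assume s: "\<bar>s\<bar> < \<delta>"
  note s' = \<delta>_le[OF s]
  interpret S: sol_pos n m H s by (rule sol_pos[OF s])
  have mu: "sqrt (mu s) = S.Ms" using mu_eq[OF s'] S.Ms_pos by simp
  have e: "hs s x - (sqrt (lam n) * sqrt (mu s) + s * (sqrt (lam n) * M0 n) * theta m x)
      = s * (sqrt (lam n) * (S.Ms * (S.ec x - theta m x) + (S.Ms - M0 n) * theta m x))"
    unfolding hs_eq[OF s'] mu S.hh_def S.hc_def by (simp add: algebra_simps)
  have t: "\<bar>theta m x\<bar> \<le> real m"
    unfolding theta_def
    by (rule order_trans[OF sum_abs], rule order_trans[OF sum_mono[where g = "\<lambda>_. 1"]]) simp_all
  have "\<bar>S.Ms * (S.ec x - theta m x) + (S.Ms - M0 n) * theta m x\<bar> \<le> R * (\<bar>s\<bar> * (R / \<rho>)) + (\<bar>s\<bar> * (R / \<rho>)) * real m"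
  proof (rule order_trans[OF abs_triangle_ineq], unfold abs_mult, intro add_mono mult_mono)
    show "\<bar>S.Ms\<bar> \<le> R" unfolding S.Ms_def by (rule H_bound[OF s'])
  qed (use ec_close[OF s'] Ms_close[OF s'] t R_nonneg \<rho> in auto)
  then have "sqrt (lam n) * \<bar>S.Ms * (S.ec x - theta m x) + (S.Ms - M0 n) * theta m x\<bar>
      \<le> sqrt (lam n) * (R * (\<bar>s\<bar> * (R / \<rho>)) + (\<bar>s\<bar> * (R / \<rho>)) * real m)"
    using lam_pos[OF n] by (intro mult_left_mono) auto
  also have "\<dots> = \<bar>s\<bar> * (sqrt (lam n) * (R / \<rho> * (R + real m)))" by (simp add: algebra_simps)
  finally have "\<bar>s\<bar> * (sqrt (lam n) * \<bar>S.Ms * (S.ec x - theta m x) + (S.Ms - M0 n) * theta m x\<bar>)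
      \<le> \<bar>s\<bar> * (\<bar>s\<bar> * (sqrt (lam n) * (R / \<rho> * (R + real m))))"
    by (intro mult_left_mono) auto
  then show "\<bar>hs s x - (sqrt (lam n) * sqrt (mu s) + s * (sqrt (lam n) * M0 n) * theta m x)\<bar>
      \<le> \<bar>s\<bar> * (\<bar>s\<bar> * (sqrt (lam n) * (R / \<rho> * (R + real m))))"
    unfolding e abs_mult[of s] abs_mult[of "sqrt (lam n)"] using lam_pos[OF n] by simp
qed

text \<open>At the point \<open>t / hs s x\<close> the straightened coordinate is \<open>t\<close>
  itself, so the remainder is exactly \<open>s\<close> times the difference of \<open>Y\<close> and
  its zeroth coefficient.\<close>

lemma w_expansion:
  "unif_little_o ({-1<..<1} \<times> S) (\<lambda>s (t, x). sol_at.w n m H s (case_nat (t / hs s x) x) -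
     (v n t + s * (sin (pi * t / 2) - (-1) ^ n * t * cos (real n * pi * t)) * theta m x))"
proof (rule unif_little_oI[OF \<delta>_pos], clarify)
  fix s t :: real and x assume s: "\<bar>s\<bar> < \<delta>" and t: "t \<in> {-1<..<1}"
  note s' = \<delta>_le[OF s]
  interpret S: sol_pos n m H s by (rule sol_pos[OF s])
  have t': "clamp1 t = t" "\<bar>t\<bar> \<le> 1" using t by (auto intro: clamp1_id)
  have "S.w (case_nat (t / hs s x) x) = S.W t x"
    unfolding hs_eq[OF s'] S.w_case_nat using S.hh_pos[of x] by simp
  then have "S.w (case_nat (t / hs s x) x) - (v n t + s * (sin (pi * t / 2) - (-1) ^ n * t * cos (real n * pi * t)) * theta m x)
      = s * (cos_ser m (H CY) s t x - cos_poly m (base n m CY $ 0) t x)"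
    unfolding cos_poly_base_CY[OF t'(2)] by (simp add: S.W_def eX_def t' algebra_simps)
  then show "\<bar>S.w (case_nat (t / hs s x) x) - (v n t + s * (sin (pi * t / 2) - (-1) ^ n * t * cos (real n * pi * t)) * theta m x)\<bar>
      \<le> \<bar>s\<bar> * (\<bar>s\<bar> * (R / \<rho>))"
    using H_tail[OF s', of CY t x] by (simp only: abs_mult[of s]) (intro mult_left_mono, auto)
qed

lemma solves:
  assumes s: "\<bar>s\<bar> < \<delta>" and \<alpha>: "0 < \<alpha>" "\<alpha> < 1"
  shows "mu s > 0" "hs s \<in> P2a_pe m \<alpha>"
    "classical_solution m (hs s) (mu s) (1 / sqrt ((real n)\<^sup>2 * pi\<^sup>2 / mu s)) (sol_at.w n m H s)"
    "solution_symmetries m S (sol_at.w n m H s)"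
proof -
  note s' = \<delta>_le[OF s]
  interpret S: sol_pos n m H s by (rule sol_pos[OF s])
  interpret C: coeff_series m s sh 1
    by unfold_locales (fact m sms(2)[OF s'] psym_sh)+
  show "mu s > 0" using mu_eq[OF s'] S.Ms_pos by simp
  have h: "hs s = C.f" by (rule ext) (simp add: hs_def)
  have "\<forall>x\<in>Rn m. hs s x > 0" unfolding hs_eq[OF s'] using S.hh_pos by blast
  then show "hs s \<in> P2a_pe m \<alpha>"
    using C.in_C2a[OF \<alpha>] C.perm_inv unfolding P2a_pe_def h by simp
  have "1 / sqrt ((real n)\<^sup>2 * pi\<^sup>2 / mu s) = S.hc"
    unfolding S.hc_def sqrt_lam mu_eq[OF s'] using S.Ms_pos n
    by (simp add: real_sqrt_divide real_sqrt_mult)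
  then show "classical_solution m (hs s) (mu s) (1 / sqrt ((real n)\<^sup>2 * pi\<^sup>2 / mu s)) S.w"
    using S.classical by (simp add: hs_eq[OF s'] mu_eq[OF s'])
  show "solution_symmetries m S S.w" by (rule S.w_symmetries)
qed

lemma smooth: "0 < \<alpha> \<Longrightarrow> \<alpha> < 1 \<Longrightarrow> smooth_curve m \<alpha> {-\<delta><..<\<delta>} mu hs"
  unfolding mu_def [abs_def] hs_def [abs_def]
  by (rule smooth_curve_series[OF m]) (auto intro: sms \<delta>_le psym_sh)

end

theorem theorem1p3:
  shows "\<exists>a b d :: nat \<Rightarrow> real. \<forall>n\<ge>1. a n > 0 \<and> b n > 0 \<and> d n > 0 \<and>
    (\<forall>m\<ge>1. \<forall>\<alpha>\<in>{0<..<1::real}.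
      \<exists>\<rho>>0. \<exists>(\<mu> :: real \<Rightarrow> real) (h :: real \<Rightarrow> (nat \<Rightarrow> real) \<Rightarrow> real) (w :: real \<Rightarrow> (nat \<Rightarrow> real) \<Rightarrow> real).
        let \<gamma> = (\<lambda>s. (real n)\<^sup>2 * pi\<^sup>2 / \<mu> s) in
        (\<forall>s\<in>{-\<rho><..<\<rho>}. \<mu> s > 0 \<and> h s \<in> P2a_pe m \<alpha>) \<and>
        smooth_curve m \<alpha> {-\<rho><..<\<rho>} \<mu> h \<and>
        \<mu> 0 = d n \<and>
        unif_little_o (Rn m) (\<lambda>s x. h s x - (a n * sqrt (\<mu> s) + s * b n * theta m x)) \<and>
        (\<forall>s\<in>{-\<rho><..<\<rho>}.
           classical_solution m (h s) (\<mu> s) (1 / sqrt (\<gamma> s)) (w s) \<and>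
           solution_symmetries m (Euclidean_space (Suc m) closure_of Omega m (h s)) (w s)) \<and>
        unif_little_o ({-1<..<1} \<times> Rn m)
          (\<lambda>s (t, x). w s (case_nat (t / h s x) x) -
             (v n t + s * (sin (pi * t / 2) - (-1) ^ n * t * cos (real n * pi * t)) * theta m x)))"
proof (rule exI[of _ "\<lambda>n. sqrt (lam n)"], rule exI[of _ "\<lambda>n. sqrt (lam n) * M0 n"], rule exI[of _ mu0],
    intro allI impI conjI ballI)
  \<comment> \<open>The constants come from the trivial branch at the bifurcation point:
    \<open>a = 1 / (n * \<pi>)\<close>, \<open>b = a * sqrt d\<close> and \<open>d = mu0 n\<close>;
    since \<open>mu0\<close> is fixed by \<open>|k| = 1\<close>, they are the same in every
    dimension.\<close>
  fix n :: nat assume n: "n \<ge> 1"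
  show "sqrt (lam n) > 0" "sqrt (lam n) * M0 n > 0" "mu0 n > 0"
    using lam_pos[OF n] mu0_pos[OF n] by (simp_all add: M0_def)
  fix m :: nat and \<alpha> :: real assume m: "m \<ge> 1" and "\<alpha> \<in> {0<..<1}"
  then have \<alpha>: "0 < \<alpha>" "\<alpha> < 1" by auto
  \<comment> \<open>One solution series for given \<open>n\<close> and \<open>m\<close> serves every
    \<open>\<alpha>\<close>, as three derivatives are controlled.\<close>
  obtain H \<rho> R where "sol_family n m H \<rho> R"
    using formal_solution[OF n m] n m unfolding sol_family_def by (metis (no_types, lifting))
  then interpret sol_family n m H \<rho> R .
  have i: "\<bar>s\<bar> < \<delta>" if "s \<in> {-\<delta><..<\<delta>}" for s using that by auto
  show "\<exists>\<rho>>0. \<exists>(\<mu> :: real \<Rightarrow> real) (h :: real \<Rightarrow> (nat \<Rightarrow> real) \<Rightarrow> real) (w :: real \<Rightarrow> (nat \<Rightarrow> real) \<Rightarrow> real).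
        let \<gamma> = (\<lambda>s. (real n)\<^sup>2 * pi\<^sup>2 / \<mu> s) in
        (\<forall>s\<in>{-\<rho><..<\<rho>}. \<mu> s > 0 \<and> h s \<in> P2a_pe m \<alpha>) \<and>
        smooth_curve m \<alpha> {-\<rho><..<\<rho>} \<mu> h \<and>
        \<mu> 0 = mu0 n \<and>
        unif_little_o (Rn m) (\<lambda>s x. h s x - (sqrt (lam n) * sqrt (\<mu> s) + s * (sqrt (lam n) * M0 n) * theta m x)) \<and>
        (\<forall>s\<in>{-\<rho><..<\<rho>}.
           classical_solution m (h s) (\<mu> s) (1 / sqrt (\<gamma> s)) (w s) \<and>
           solution_symmetries m (Euclidean_space (Suc m) closure_of Omega m (h s)) (w s)) \<and>
        unif_little_o ({-1<..<1} \<times> Rn m)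
          (\<lambda>s (t, x). w s (case_nat (t / h s x) x) -
             (v n t + s * (sin (pi * t / 2) - (-1) ^ n * t * cos (real n * pi * t)) * theta m x))"
    unfolding Let_def
    by (rule exI[of _ \<delta>], rule conjI[OF \<delta>_pos], rule exI[of _ mu], rule exI[of _ hs], rule exI[of _ "\<lambda>s. sol_at.w n m H s"],
        intro conjI ballI solves[OF i \<alpha>] smooth[OF \<alpha>] mu_0 hs_expansion w_expansion)
qed

end
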